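(* There exists a rank one Riemannian symmetric space of noncompact type $X=G/K$ such that for all $c,\varepsilon\in\mathbb R$ satisfying either ($c<1$ and $\varepsilon\le0$) or ($c\le1$ and $\varepsilon<0$), there are a nonnegative integer $d$ and infinitely many linearly independent functions $f\in L^1(X)\cap L^2(X)$ satisfying $$\int_X\int_{\mathfrak a^*}\frac{|f(x)|\,\|\widehat f(\lambda)\|_2\,e^{c\,\sigma(x)|\lambda|}\,\Xi(x)^{1-\varepsilon}}{(1+\sigma(x)+|\lambda|)^d}\,dx\,d\mu(\lambda)<\infty,$$ none of which is of the form $f=\sum_{\delta\in F}h_\delta$ with $F\subset\widehat K_0$ finite and $h_\delta$ of type $\delta$ with Fourier coefficients $\widehat h_{\delta,j}(\lambda)=P'_{\delta,j}(\lambda^2)Q_\delta(-\lambda)e^{-\alpha\lambda^2}$ ($1\le j\le d(\delta)$), where $\alpha>0$ is a constant and the $P'_{\delta,j}$ are polynomials.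
   Context: **Symmetric space.** $G$ is a noncompact connected semisimple Lie group of real rank $1$ with finite centre, $K\subset G$ a maximal compact subgroup, $X=G/K$. Functions on $X$ are identified with right $K$-invariant functions on $G$. $\mathfrak g=\mathfrak k\oplus\mathfrak p$ is the Cartan decomposition, $G=KAN$ a fixed Iwasawa decomposition, $\mathfrak a=\mathrm{Lie}(A)$ (one-dimensional), $M$ the centraliser of $A$ in $K$. $\gamma$ is the simple positive restricted root and $m_\gamma,m_{2\gamma}$ are the multiplicities of $\gamma,2\gamma$ ($m_{2\gamma}=0$ if $2\gamma$ is not a root). $H_\gamma\in\mathfrak a$ satisfies $\gamma(H_\gamma)=1$. Identify $\mathfrak a$ with $\mathbb R$ via $tH_\gamma\leftrightarrow t$, and $\mathfrak a^*$ (resp. $\mathfrak a^*_{\mathbb C}$) with $\mathbb R$ (resp. $\mathbb C$) via $\lambda\gamma\leftrightarrow\lambda$; $|\lambda|$ is the usual absolute value. Put $a_t=\exp(tH_\gamma)$, $\rho=\frac12(m_\gamma+2m_{2\gamma})$. $dk$ is normalised Haar measure on $K$, $dx$ is a $G$-invariant measure on $X$. $\sigma(x)=d(xK,eK)$ is the Riemannian distance for the $G$-invariant metric on $X$ coming from the Killing form on $\mathfrak p$, normalised so that $\sigma(a_t)=|t|$. $H:G\to\mathfrak a$ is the Iwasawa projection, $H(k\exp(Y)n)=Y$; $\kappa(g)\in K$ is the $K$-part of $g\in G=KAN$. $A(x,k)=-H(x^{-1}k)$. The elementary spherical functions are $\phi_\lambda(x)=\int_K e^{(i\lambda+\rho)A(x,k)}dk$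 and $\Xi=\phi_0$. The Plancherel measure is $d\mu(\lambda)=|c(\lambda)|^{-2}d\lambda$ on $\mathfrak a^*\equiv\mathbb R$, where $c(\cdot)$ is Harish-Chandra's $c$-function (not to be confused with the constant $c$) and $d\lambda$ is Lebesgue measure. **Fourier transform.** The spherical principal series acts on $L^2(K/M)$ by $(\pi_\lambda(x)g)(k)=e^{(i\lambda+\rho)A(x,k)}g(\kappa(x^{-1}k))$. The operator Fourier transform is $\widehat f(\lambda)=\int_G f(x)\pi_{-\lambda}(x)\,dx$ and $\|\cdot\|_2$ is the Hilbert–Schmidt norm. Equivalently $\|\widehat f(\lambda)\|_2=\big(\int_K|\widetilde f(\lambda,k)|^2dk\big)^{1/2}$, where $\widetilde f(\lambda,k)=\int_X f(x)e^{(-i\lambda+\rho)A(x,k)}dx$. **$K$-types.** $\widehat K_0$ is the set of equivalence classes of irreducible unitary representations of $K$ having a nonzero $M$-fixed vector (which is then unique up to scalar). For $\delta\in\widehat K_0$ acting on $V_\delta$, $d(\delta)$ is its degree, $\chi_\delta$ its character, $v_1,\dots,v_{d(\delta)}$ an orthonormal basis of $V_\delta$ with $v_1$ $M$-fixed, and $Y_{\delta,j}(k)=\langle v_j,\delta(k)v_1\rangle$ (inner product linear in the first variable). A function $h$ on $X$ is of type $\delta$ if $h(x)=d(\delta)\int_K h(kx)\overline{\chi_\delta(k)}\,dk$. Put $\Phi^j_{\lambda,\delta}(x)=\int_{K}e^{(i\lambda+\rho)A(x,k)}Y_{\delta,j}(k)\,dk$ and $\widehat h_{\delta,j}(\lambda)=\int_X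 h(x)\Phi^j_{-\lambda,\delta}(x)\,dx$. The elements $\delta\in\widehat K_0$ are parametrised (Kostant, Johnson–Wallach) by pairs of integers $(p_\delta,q_\delta)$ with $p_\delta\ge0$ and $p_\delta\pm q_\delta$ nonnegative even integers, the trivial representation corresponding to $(0,0)$. The Kostant polynomial is $$Q_\delta(\lambda)=\Big(\tfrac12(a+b+1+i\lambda)\Big)_{\frac{p_\delta+q_\delta}2}\Big(\tfrac12(a-b+1+i\lambda)\Big)_{\frac{p_\delta-q_\delta}2},\quad a=\tfrac{m_\gamma+m_{2\gamma}-1}2,\ b=\tfrac{m_{2\gamma}-1}2,\ (z)_m=\tfrac{\Gamma(z+m)}{\Gamma(z)};$$ it satisfies $\Phi^j_{\lambda,\delta}=\frac{Q_\delta(\lambda)}{Q_\delta(-\lambda)}\Phi^j_{-\lambda,\delta}$, which determines it up to a nonzero scalar since all its zeros lie in the open upper half plane. *)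

theory Defs
  imports
    "HOL-Analysis.Analysis"
    "HOL-Library.Function_Algebras"
    "HOL-Algebra.Group"
    "HOL-Computational_Algebra.Polynomial"
    "Jordan_Normal_Form.Schur_Decomposition"
begin

section \<open>Smooth functions on open subsets of Euclidean space\<close>

text \<open>Following \<^const>\<open>Euclidean_space\<close>, a point of $n$-space is a function \<open>nat \<Rightarrow> real\<close>
  vanishing at all indices \<open>i \<ge> n\<close>; vector addition is the pointwise one of
  \<^theory>\<open>HOL-Library.Function_Algebras\<close>.\<close>

type_synonym coords = "nat \<Rightarrow> real"

definition smul :: "real \<Rightarrow> coords \<Rightarrow> coords" where
  "smul c X = (\<lambda>i. c * X i)"

interpretation coords: vector_space smul
  by unfold_locales (auto simp: smul_def algebra_simps fun_eq_iff)

definition unit_coord :: "nat \<Rightarrow> coords" where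
  "unit_coord i = (\<lambda>j. if j = i then 1 else 0)"

primrec C_diff :: "nat \<Rightarrow> nat \<Rightarrow> coords set \<Rightarrow> (coords \<Rightarrow> real) \<Rightarrow> bool" where
  "C_diff 0 n U f \<longleftrightarrow> continuous_on U f"
| "C_diff (Suc k) n U f \<longleftrightarrow> continuous_on U f \<and>
     (\<forall>i<n. \<exists>g. (\<forall>x\<in>U. ((\<lambda>t. f (x(i := t))) has_real_derivative g x) (at (x i))) \<and> C_diff k n U g)"

definition smooth_on :: "nat \<Rightarrow> coords set \<Rightarrow> (coords \<Rightarrow> real) \<Rightarrow> bool" where
  "smooth_on n U f \<longleftrightarrow> (\<forall>k. C_diff k n U f)"

section \<open>Lie groups\<close>

text \<open>The underlying set of a Lie group is a subset, with the subspace topology, of a second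
  countable Hausdorff space \<open>'g\<close>. With \<open>'g = (nat \<Rightarrow> real)\<close> this is no restriction: by Whitney's
  theorem every second countable manifold is homeomorphic to a subset of some Euclidean space.

  \<open>chart1\<close> is a chosen chart around the identity; it identifies the Lie algebra (the tangent
  space at the identity) with $n$-space.\<close>

type_synonym 'g chart = "'g set \<times> ('g \<Rightarrow> coords)"

record 'g lie_data = "'g monoid" +
  gdim :: nat
  atlas :: "'g chart set"
  chart1 :: "'g chart"

definition is_chart :: "('g::topological_space, 'b) lie_data_scheme \<Rightarrow> 'g chart \<Rightarrow> bool" where
  "is_chart G c \<longleftrightarrow> (case c of (U, \<phi>) \<Rightarrow>
     openin (top_of_set (carrier G)) U \<and>
     openin (Euclidean_space (gdim G)) (\<phi> ` U) \<and>
     homeomorphism U (\<phi> ` U) \<phi> (the_inv_into U \<phi>))"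

definition compatible_charts :: "nat \<Rightarrow> 'g chart \<Rightarrow> 'g chart \<Rightarrow> bool" where
  "compatible_charts n c c' \<longleftrightarrow> (case (c, c') of ((U, \<phi>), (V, \<psi>)) \<Rightarrow>
     \<forall>i<n. smooth_on n (\<phi> ` (U \<inter> V)) (\<lambda>x. \<psi> (the_inv_into U \<phi> x) i))"

definition smooth_manifold :: "('g::topological_space, 'b) lie_data_scheme \<Rightarrow> bool" where
  "smooth_manifold G \<longleftrightarrow>
     (\<forall>c\<in>atlas G. is_chart G c) \<and> (\<Union>c\<in>atlas G. fst c) = carrier G \<and>
     (\<forall>c\<in>atlas G. \<forall>c'\<in>atlas G. compatible_charts (gdim G) c c')"

text \<open>Pairs of points of $n$-space are points of $2n$-space.\<close>

definition fst_half :: "nat \<Rightarrow> coords \<Rightarrow> coords" where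
  "fst_half n z = (\<lambda>i. if i < n then z i else 0)"

definition snd_half :: "nat \<Rightarrow> coords \<Rightarrow> coords" where
  "snd_half n z = (\<lambda>i. if i < n then z (n + i) else 0)"

definition smooth_mult :: "('g, 'b) lie_data_scheme \<Rightarrow> bool" where
  "smooth_mult G \<longleftrightarrow> (let n = gdim G in
     \<forall>(U, \<phi>)\<in>atlas G. \<forall>(V, \<psi>)\<in>atlas G. \<forall>(W, \<theta>)\<in>atlas G.
       let m = (\<lambda>z. the_inv_into U \<phi> (fst_half n z) \<otimes>\<^bsub>G\<^esub> the_inv_into V \<psi> (snd_half n z)) in
       \<forall>i<n. smooth_on (2 * n)
         {z \<in> topspace (Euclidean_space (2 * n)).
            fst_half n z \<in> \<phi> ` U \<and> snd_half n z \<in> \<psi> ` V \<and> m z \<in> W}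
         (\<lambda>z. \<theta> (m z) i))"

definition smooth_inverse :: "('g, 'b) lie_data_scheme \<Rightarrow> bool" where
  "smooth_inverse G \<longleftrightarrow> (\<forall>(U, \<phi>)\<in>atlas G. \<forall>(V, \<psi>)\<in>atlas G. \<forall>i<gdim G.
     smooth_on (gdim G) {x \<in> \<phi> ` U. inv\<^bsub>G\<^esub> (the_inv_into U \<phi> x) \<in> V}
       (\<lambda>x. \<psi> (inv\<^bsub>G\<^esub> (the_inv_into U \<phi> x)) i))"

definition lie_group ::
  "('g::{t2_space, second_countable_topology}, 'b) lie_data_scheme \<Rightarrow> bool" where
  "lie_group G \<longleftrightarrow> group G \<and> smooth_manifold G \<and>
     continuous_on (carrier G \<times> carrier G) (\<lambda>(x, y). x \<otimes>\<^bsub>G\<^esub> y) \<and>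
     continuous_on (carrier G) (\<lambda>x. inv\<^bsub>G\<^esub> x) \<and>
     smooth_mult G \<and> smooth_inverse G \<and>
     chart1 G \<in> atlas G \<and> \<one>\<^bsub>G\<^esub> \<in> fst (chart1 G)"

definition lie_algebra :: "('g, 'b) lie_data_scheme \<Rightarrow> coords set" where
  "lie_algebra G = topspace (Euclidean_space (gdim G))"

definition one_param_subgroup ::
  "('g::topological_space, 'b) lie_data_scheme \<Rightarrow> coords \<Rightarrow> (real \<Rightarrow> 'g) \<Rightarrow> bool" where
  "one_param_subgroup G X u \<longleftrightarrow>
     range u \<subseteq> carrier G \<and> continuous_on UNIV u \<and> (\<forall>s t. u (s + t) = u s \<otimes>\<^bsub>G\<^esub> u t) \<and>
     (\<forall>i<gdim G. ((\<lambda>t. snd (chart1 G) (u t) i) has_real_derivative X i) (at 0))"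

definition lie_exp :: "('g::topological_space, 'b) lie_data_scheme \<Rightarrow> coords \<Rightarrow> 'g" where
  "lie_exp G X = (THE g. \<exists>u. one_param_subgroup G X u \<and> g = u 1)"

definition Ad :: "('g::topological_space, 'b) lie_data_scheme \<Rightarrow> 'g \<Rightarrow> coords \<Rightarrow> coords" where
  "Ad G g Y = (\<lambda>i. if i < gdim G
     then deriv (\<lambda>s. snd (chart1 G) (g \<otimes>\<^bsub>G\<^esub> lie_exp G (smul s Y) \<otimes>\<^bsub>G\<^esub> inv\<^bsub>G\<^esub> g) i) 0 else 0)"

definition bracket ::
  "('g::topological_space, 'b) lie_data_scheme \<Rightarrow> coords \<Rightarrow> coords \<Rightarrow> coords" where
  "bracket G X Y = (\<lambda>i. if i < gdim G
     then deriv (\<lambda>s. Ad G (lie_exp G (smul s X)) Y i) 0 else 0)"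

text \<open>The Killing form, i.e. the trace of $\mathrm{ad}(X)\,\mathrm{ad}(Y)$.\<close>

definition killing :: "('g::topological_space, 'b) lie_data_scheme \<Rightarrow> coords \<Rightarrow> coords \<Rightarrow> real" where
  "killing G X Y = (\<Sum>i<gdim G. bracket G X (bracket G Y (unit_coord i)) i)"

definition semisimple :: "('g::topological_space, 'b) lie_data_scheme \<Rightarrow> bool" where
  "semisimple G \<longleftrightarrow> (\<forall>X\<in>lie_algebra G. (\<forall>Y\<in>lie_algebra G. killing G X Y = 0) \<longrightarrow> X = 0)"

definition group_centre :: "('g, 'b) monoid_scheme \<Rightarrow> 'g set" where
  "group_centre G = {z \<in> carrier G. \<forall>g\<in>carrier G. z \<otimes>\<^bsub>G\<^esub> g = g \<otimes>\<^bsub>G\<^esub> z}"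

definition maximal_compact_subgroup ::
  "'g::topological_space set \<Rightarrow> ('g, 'b) monoid_scheme \<Rightarrow> bool" where
  "maximal_compact_subgroup K G \<longleftrightarrow> subgroup K G \<and> compact K \<and>
     (\<forall>L. subgroup L G \<and> compact L \<and> K \<subseteq> L \<longrightarrow> L = K)"

section \<open>Rank one symmetric spaces\<close>

text \<open>\<open>Kgp\<close> is $K$ and \<open>Hg\<close> is $H_\gamma$. \<open>dk\<close> is the Haar measure of $K$ and \<open>dx\<close> a Haar
  measure of $G$. Functions on $X = G/K$ are right $K$-invariant functions on $G$; as \<open>dk\<close> has
  total mass one, the integral of such a function over $X$ is its integral against \<open>dx\<close>.\<close>

record 'g symmetric_data = "'g lie_data" +
  Kgp :: "'g set"
  Hg :: coords
  dk :: "'g measure"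
  dx :: "'g measure"

definition k_alg :: "('g::topological_space, 'b) symmetric_data_scheme \<Rightarrow> coords set" where
  "k_alg S = {X \<in> lie_algebra S. \<forall>t. lie_exp S (smul t X) \<in> Kgp S}"

definition p_alg :: "('g::topological_space, 'b) symmetric_data_scheme \<Rightarrow> coords set" where
  "p_alg S = {X \<in> lie_algebra S. \<forall>Y\<in>k_alg S. killing S X Y = 0}"

definition a_alg :: "('g, 'b) symmetric_data_scheme \<Rightarrow> coords set" where
  "a_alg S = coords.span {Hg S}"

definition abelian_subspace_of_p ::
  "('g::topological_space, 'b) symmetric_data_scheme \<Rightarrow> coords set \<Rightarrow> bool" where
  "abelian_subspace_of_p S V \<longleftrightarrow> coords.subspace V \<and> V \<subseteq> p_alg S \<and>
     (\<forall>X\<in>V. \<forall>Y\<in>V. bracket S X Y = 0)"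

definition maximal_abelian_subspace_of_p ::
  "('g::topological_space, 'b) symmetric_data_scheme \<Rightarrow> coords set \<Rightarrow> bool" where
  "maximal_abelian_subspace_of_p S V \<longleftrightarrow> abelian_subspace_of_p S V \<and>
     (\<forall>W. abelian_subspace_of_p S W \<and> V \<subseteq> W \<longrightarrow> W = V)"

text \<open>A linear functional on $\mathfrak a$ is identified with its value at \<open>Hg\<close>; so $\gamma$
  becomes \<open>1\<close>, and a root is positive if this value is positive.\<close>

definition root_space :: "('g::topological_space, 'b) symmetric_data_scheme \<Rightarrow> real \<Rightarrow> coords set" where
  "root_space S r = {Y \<in> lie_algebra S. bracket S (Hg S) Y = smul r Y}"

definition positive_root :: "('g::topological_space, 'b) symmetric_data_scheme \<Rightarrow> real \<Rightarrow> bool" where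
  "positive_root S r \<longleftrightarrow> r > 0 \<and> root_space S r \<noteq> {0}"

definition simple_root :: "('g::topological_space, 'b) symmetric_data_scheme \<Rightarrow> real \<Rightarrow> bool" where
  "simple_root S r \<longleftrightarrow> positive_root S r \<and>
     \<not> (\<exists>r1 r2. positive_root S r1 \<and> positive_root S r2 \<and> r = r1 + r2)"

definition haar_prob_on_K :: "('g::topological_space, 'b) symmetric_data_scheme \<Rightarrow> bool" where
  "haar_prob_on_K S \<longleftrightarrow> sets (dk S) = sets (restrict_space borel (Kgp S)) \<and>
     emeasure (dk S) (Kgp S) = 1 \<and>
     (\<forall>k\<in>Kgp S. distr (dk S) (dk S) (\<lambda>l. k \<otimes>\<^bsub>S\<^esub> l) = dk S)"

definition haar_on_G :: "('g::topological_space, 'b) symmetric_data_scheme \<Rightarrow> bool" where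
  "haar_on_G S \<longleftrightarrow> sets (dx S) = sets (restrict_space borel (carrier S)) \<and>
     emeasure (dx S) (carrier S) \<noteq> 0 \<and>
     (\<forall>C\<subseteq>carrier S. compact C \<longrightarrow> emeasure (dx S) C < \<infinity>) \<and>
     (\<forall>g\<in>carrier S. distr (dx S) (dx S) (\<lambda>x. g \<otimes>\<^bsub>S\<^esub> x) = dx S)"

text \<open>Since $\mathfrak a = \mathbb{R} H_\gamma$, the maximality of $\mathfrak a$ says that the real
  rank is one.\<close>

definition rank_one_symmetric_space ::
  "('g::{t2_space, second_countable_topology}, 'b) symmetric_data_scheme \<Rightarrow> bool" where
  "rank_one_symmetric_space S \<longleftrightarrow>
     lie_group S \<and> connected (carrier S) \<and> \<not> compact (carrier S) \<and>
     semisimple S \<and> finite (group_centre S) \<and>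
     maximal_compact_subgroup (Kgp S) S \<and>
     Hg S \<noteq> 0 \<and> maximal_abelian_subspace_of_p S (a_alg S) \<and> simple_root S 1 \<and>
     haar_prob_on_K S \<and> haar_on_G S"

definition m1 :: "('g::topological_space, 'b) symmetric_data_scheme \<Rightarrow> nat" where
  "m1 S = coords.dim (root_space S 1)"

definition m2 :: "('g::topological_space, 'b) symmetric_data_scheme \<Rightarrow> nat" where
  "m2 S = coords.dim (root_space S 2)"

definition rho :: "('g::topological_space, 'b) symmetric_data_scheme \<Rightarrow> real" where
  "rho S = (real (m1 S) + 2 * real (m2 S)) / 2"

definition a_elt :: "('g::topological_space, 'b) symmetric_data_scheme \<Rightarrow> real \<Rightarrow> 'g" where
  "a_elt S t = lie_exp S (smul t (Hg S))"

definition Mgp :: "('g::topological_space, 'b) symmetric_data_scheme \<Rightarrow> 'g set" where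
  "Mgp S = {k \<in> Kgp S. \<forall>t. k \<otimes>\<^bsub>S\<^esub> a_elt S t = a_elt S t \<otimes>\<^bsub>S\<^esub> k}"

definition Ngp :: "('g::topological_space, 'b) symmetric_data_scheme \<Rightarrow> 'g set" where
  "Ngp S = lie_exp S ` coords.span (\<Union>r\<in>{0<..}. root_space S r)"

definition iwasawa_H :: "('g::topological_space, 'b) symmetric_data_scheme \<Rightarrow> 'g \<Rightarrow> real" where
  "iwasawa_H S g = (THE t. \<exists>k\<in>Kgp S. \<exists>n\<in>Ngp S. g = k \<otimes>\<^bsub>S\<^esub> a_elt S t \<otimes>\<^bsub>S\<^esub> n)"

definition iwasawa_K :: "('g::topological_space, 'b) symmetric_data_scheme \<Rightarrow> 'g \<Rightarrow> 'g" where
  "iwasawa_K S g = (THE k. k \<in> Kgp S \<and> (\<exists>t. \<exists>n\<in>Ngp S. g = k \<otimes>\<^bsub>S\<^esub> a_elt S t \<otimes>\<^bsub>S\<^esub> n))"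

definition Afun :: "('g::topological_space, 'b) symmetric_data_scheme \<Rightarrow> 'g \<Rightarrow> 'g \<Rightarrow> real" where
  "Afun S x k = - iwasawa_H S (inv\<^bsub>S\<^esub> x \<otimes>\<^bsub>S\<^esub> k)"

subsection \<open>The Riemannian distance\<close>

text \<open>A curve in $X$ is given by a lift $u$ to $G$. Translating the tangent vector of $uK$ back to
  the base point gives the $\mathfrak p$-component of $u(t)^{-1}u'(t)$. As \<open>\<parallel>Hg\<parallel> = 1\<close>, the metric is
  the multiple of the Killing form for which $\sigma(a_t) = |t|$. A piecewise $C^1$ curve becomes
  $C^1$ after a reparametrisation that stops at the corners, hence $C^1$ curves suffice.\<close>

definition p_part :: "('g::topological_space, 'b) symmetric_data_scheme \<Rightarrow> coords \<Rightarrow> coords" where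
  "p_part S X = (THE Z. Z \<in> p_alg S \<and> X - Z \<in> k_alg S)"

definition p_norm :: "('g::topological_space, 'b) symmetric_data_scheme \<Rightarrow> coords \<Rightarrow> real" where
  "p_norm S Z = sqrt (killing S Z Z / killing S (Hg S) (Hg S))"

definition C1_curve ::
  "('g::topological_space, 'b) symmetric_data_scheme \<Rightarrow> (real \<Rightarrow> 'g) \<Rightarrow> (real \<Rightarrow> coords) \<Rightarrow> bool" where
  "C1_curve S u w \<longleftrightarrow> u ` {0..1} \<subseteq> carrier S \<and> continuous_on {0..1} u \<and>
     w ` {0..1} \<subseteq> lie_algebra S \<and> continuous_on {0..1} w \<and>
     (\<forall>t\<in>{0..1}. \<forall>i<gdim S.
        ((\<lambda>s. snd (chart1 S) (inv\<^bsub>S\<^esub> (u t) \<otimes>\<^bsub>S\<^esub> u s) i) has_real_derivative w t i)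
          (at t within {0..1}))"

definition sigma :: "('g::topological_space, 'b) symmetric_data_scheme \<Rightarrow> 'g \<Rightarrow> real" where
  "sigma S x = Inf {integral {0..1} (\<lambda>t. p_norm S (p_part S (w t))) | u w.
     C1_curve S u w \<and> u 0 \<in> Kgp S \<and> inv\<^bsub>S\<^esub> x \<otimes>\<^bsub>S\<^esub> u 1 \<in> Kgp S}"

section \<open>Harmonic analysis\<close>

definition spherical ::
  "('g::topological_space, 'b) symmetric_data_scheme \<Rightarrow> complex \<Rightarrow> 'g \<Rightarrow> complex" where
  "spherical S l x = (LINT k|dk S. exp ((\<i> * l + of_real (rho S)) * of_real (Afun S x k)))"

definition Xi :: "('g::topological_space, 'b) symmetric_data_scheme \<Rightarrow> 'g \<Rightarrow> real" where
  "Xi S x = Re (spherical S 0 x)"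

text \<open>The $c$-function is $\lim_{t\to\infty} e^{(\rho-i\lambda)t}\phi_\lambda(a_t)$ for
  $\mathrm{Im}\,\lambda<0$. It continues meromorphically to the plane, and its only pole on the
  real line is at $0$; the continuation to real $\lambda\ne0$ is the boundary value from below.\<close>

definition c_lower :: "('g::topological_space, 'b) symmetric_data_scheme \<Rightarrow> complex \<Rightarrow> complex" where
  "c_lower S l = Lim at_top
     (\<lambda>t::real. exp ((of_real (rho S) - \<i> * l) * of_real t) * spherical S l (a_elt S t))"

definition c_fun :: "('g::topological_space, 'b) symmetric_data_scheme \<Rightarrow> real \<Rightarrow> complex" where
  "c_fun S l = Lim (at_right 0) (\<lambda>\<eta>::real. c_lower S (of_real l - \<i> * of_real \<eta>))"

definition plancherel :: "('g::topological_space, 'b) symmetric_data_scheme \<Rightarrow> real measure" where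
  "plancherel S = density lborel (\<lambda>l. ennreal (1 / (cmod (c_fun S l))\<^sup>2))"

definition fun_on_X :: "('g, 'b) symmetric_data_scheme \<Rightarrow> ('g \<Rightarrow> complex) \<Rightarrow> bool" where
  "fun_on_X S f \<longleftrightarrow> f \<in> borel_measurable (dx S) \<and>
     (\<forall>x\<in>carrier S. \<forall>k\<in>Kgp S. f (x \<otimes>\<^bsub>S\<^esub> k) = f x)"

definition L1_X :: "('g, 'b) symmetric_data_scheme \<Rightarrow> ('g \<Rightarrow> complex) set" where
  "L1_X S = {f. fun_on_X S f \<and> integrable (dx S) f}"

definition L2_X :: "('g, 'b) symmetric_data_scheme \<Rightarrow> ('g \<Rightarrow> complex) set" where
  "L2_X S = {f. fun_on_X S f \<and> integrable (dx S) (\<lambda>x. (cmod (f x))\<^sup>2)}"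

definition L2_KM :: "('g::topological_space, 'b) symmetric_data_scheme \<Rightarrow> ('g \<Rightarrow> complex) set" where
  "L2_KM S = {g. g \<in> borel_measurable (dk S) \<and>
     (\<forall>k\<in>Kgp S. \<forall>m\<in>Mgp S. g (k \<otimes>\<^bsub>S\<^esub> m) = g k) \<and> integrable (dk S) (\<lambda>k. (cmod (g k))\<^sup>2)}"

definition principal_series ::
  "('g::topological_space, 'b) symmetric_data_scheme \<Rightarrow> real \<Rightarrow> 'g \<Rightarrow> ('g \<Rightarrow> complex) \<Rightarrow> 'g \<Rightarrow> complex"
  where
  "principal_series S l x g k =
     exp ((\<i> * of_real l + of_real (rho S)) * of_real (Afun S x k)) *
     g (iwasawa_K S (inv\<^bsub>S\<^esub> x \<otimes>\<^bsub>S\<^esub> k))"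

text \<open>The operator-valued integral defining the Fourier transform, evaluated at a function on $K$
  and a point of $K$.\<close>

definition fourier ::
  "('g::topological_space, 'b) symmetric_data_scheme \<Rightarrow> ('g \<Rightarrow> complex) \<Rightarrow> real \<Rightarrow>
   ('g \<Rightarrow> complex) \<Rightarrow> 'g \<Rightarrow> complex" where
  "fourier S f l g k = (LINT x|dx S. f x * principal_series S (- l) x g k)"

definition orthonormal_family ::
  "('g::topological_space, 'b) symmetric_data_scheme \<Rightarrow> nat \<Rightarrow> (nat \<Rightarrow> 'g \<Rightarrow> complex) \<Rightarrow> bool" where
  "orthonormal_family S n e \<longleftrightarrow> (\<forall>i<n. e i \<in> L2_KM S) \<and>
     (\<forall>i<n. \<forall>j<n. (LINT k|dk S. e i k * cnj (e j k)) = (if i = j then 1 else 0))"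

text \<open>The square of the Hilbert-Schmidt norm of an operator $T$ on $L^2(K/M)$ is the supremum of
  $\sum_i \|Te_i\|^2$ over finite orthonormal families; the infimum below is its square root
  in the extended nonnegative reals.\<close>

definition HS_norm ::
  "('g::topological_space, 'b) symmetric_data_scheme \<Rightarrow> (('g \<Rightarrow> complex) \<Rightarrow> 'g \<Rightarrow> complex) \<Rightarrow> ennreal"
  where
  "HS_norm S T = Inf {r. \<forall>n e. orthonormal_family S n e \<longrightarrow>
     (\<Sum>i<n. \<integral>\<^sup>+ k. ennreal ((cmod (T (e i) k))\<^sup>2) \<partial>dk S) \<le> r\<^sup>2}"

section \<open>\<open>K\<close>-types\<close>

text \<open>A representation of $K$ together with an orthonormal basis $v_1,\dots,v_d$ of $V_\delta$ is
  given by unitary matrices. Matrix indices start at \<open>0\<close>, so $v_j$ is \<open>unit_vec d (j - 1)\<close>. The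
  values of \<open>\<delta>\<close> outside $K$ are irrelevant.\<close>

type_synonym 'g rep = "'g \<Rightarrow> complex mat"

definition rep_deg :: "('g, 'b) symmetric_data_scheme \<Rightarrow> 'g rep \<Rightarrow> nat" where
  "rep_deg S \<delta> = dim_row (\<delta> \<one>\<^bsub>S\<^esub>)"

definition unitary_rep :: "('g::topological_space, 'b) symmetric_data_scheme \<Rightarrow> 'g rep \<Rightarrow> bool" where
  "unitary_rep S \<delta> \<longleftrightarrow> (let d = rep_deg S \<delta> in
     (\<forall>k\<in>Kgp S. \<delta> k \<in> carrier_mat d d \<and> mat_adjoint (\<delta> k) * \<delta> k = 1\<^sub>m d) \<and>
     (\<forall>k\<in>Kgp S. \<forall>l\<in>Kgp S. \<delta> (k \<otimes>\<^bsub>S\<^esub> l) = \<delta> k * \<delta> l) \<and>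
     (\<forall>i<d. \<forall>j<d. continuous_on (Kgp S) (\<lambda>k. \<delta> k $$ (i, j))))"

definition vec_subspace :: "nat \<Rightarrow> complex Matrix.vec set \<Rightarrow> bool" where
  "vec_subspace d W \<longleftrightarrow> W \<subseteq> carrier_vec d \<and> 0\<^sub>v d \<in> W \<and>
     (\<forall>v\<in>W. \<forall>w\<in>W. v + w \<in> W) \<and> (\<forall>a. \<forall>v\<in>W. a \<cdot>\<^sub>v v \<in> W)"

definition irreducible_rep :: "('g, 'b) symmetric_data_scheme \<Rightarrow> 'g rep \<Rightarrow> bool" where
  "irreducible_rep S \<delta> \<longleftrightarrow> (let d = rep_deg S \<delta> in d > 0 \<and>
     (\<forall>W. vec_subspace d W \<and> (\<forall>k\<in>Kgp S. \<forall>w\<in>W. \<delta> k *\<^sub>v w \<in> W) \<longrightarrow>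
        W = {0\<^sub>v d} \<or> W = carrier_vec d))"

definition equivalent_reps :: "('g, 'b) symmetric_data_scheme \<Rightarrow> 'g rep \<Rightarrow> 'g rep \<Rightarrow> bool" where
  "equivalent_reps S \<delta> \<delta>' \<longleftrightarrow> rep_deg S \<delta> = rep_deg S \<delta>' \<and>
     (\<exists>T\<in>carrier_mat (rep_deg S \<delta>) (rep_deg S \<delta>). invertible_mat T \<and>
        (\<forall>k\<in>Kgp S. T * \<delta> k = \<delta>' k * T))"

text \<open>Representatives of the classes with an $M$-fixed vector, in a basis with $v_1$ $M$-fixed.\<close>

definition K_type :: "('g::topological_space, 'b) symmetric_data_scheme \<Rightarrow> 'g rep \<Rightarrow> bool" where
  "K_type S \<delta> \<longleftrightarrow> unitary_rep S \<delta> \<and> irreducible_rep S \<delta> \<and>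
     (\<forall>m\<in>Mgp S. \<delta> m *\<^sub>v unit_vec (rep_deg S \<delta>) 0 = unit_vec (rep_deg S \<delta>) 0)"

definition rep_char :: "('g, 'b) symmetric_data_scheme \<Rightarrow> 'g rep \<Rightarrow> 'g \<Rightarrow> complex" where
  "rep_char S \<delta> k = (\<Sum>i<rep_deg S \<delta>. \<delta> k $$ (i, i))"

text \<open>For an inner product linear in the first variable, $\langle v_j,\delta(k)v_1\rangle$ is the
  conjugate of a matrix entry of $\delta(k)$.\<close>

definition Yfun :: "'g rep \<Rightarrow> nat \<Rightarrow> 'g \<Rightarrow> complex" where
  "Yfun \<delta> j k = cnj (\<delta> k $$ (j, 0))"

definition of_type :: "('g, 'b) symmetric_data_scheme \<Rightarrow> 'g rep \<Rightarrow> ('g \<Rightarrow> complex) \<Rightarrow> bool" where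
  "of_type S \<delta> h \<longleftrightarrow> (AE x in dx S.
     h x = of_nat (rep_deg S \<delta>) * (LINT k|dk S. h (k \<otimes>\<^bsub>S\<^esub> x) * cnj (rep_char S \<delta> k)))"

definition gen_spherical ::
  "('g::topological_space, 'b) symmetric_data_scheme \<Rightarrow> 'g rep \<Rightarrow> nat \<Rightarrow> complex \<Rightarrow> 'g \<Rightarrow> complex" where
  "gen_spherical S \<delta> j l x =
     (LINT k|dk S. exp ((\<i> * l + of_real (rho S)) * of_real (Afun S x k)) * Yfun \<delta> j k)"

definition fourier_coeff ::
  "('g::topological_space, 'b) symmetric_data_scheme \<Rightarrow> 'g rep \<Rightarrow> nat \<Rightarrow> ('g \<Rightarrow> complex) \<Rightarrow> real \<Rightarrow> complex"
  where
  "fourier_coeff S \<delta> j h l = (LINT x|dx S. h x * gen_spherical S \<delta> j (- of_real l) x)"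

definition kostant_poly ::
  "('g::topological_space, 'b) symmetric_data_scheme \<Rightarrow> int \<Rightarrow> int \<Rightarrow> complex \<Rightarrow> complex" where
  "kostant_poly S p q l =
     (let a = (of_nat (m1 S) + of_nat (m2 S) - 1) / 2; b = (of_nat (m2 S) - 1) / 2 in
      pochhammer ((a + b + 1 + \<i> * l) / 2) (nat ((p + q) div 2)) *
      pochhammer ((a - b + 1 + \<i> * l) / 2) (nat ((p - q) div 2)))"

text \<open>$Q_\delta$ is the polynomial of the above form that satisfies the functional equation of
  $\Phi^j_{\lambda,\delta}$. As all its zeros lie in the open upper half plane and its leading
  coefficient is $(i/2)^p$, it is unique (whereas the sign of $q$ is not determined by it).\<close>

definition is_kostant_poly ::
  "('g::topological_space, 'b) symmetric_data_scheme \<Rightarrow> 'g rep \<Rightarrow> (complex \<Rightarrow> complex) \<Rightarrow> bool" where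
  "is_kostant_poly S \<delta> Q \<longleftrightarrow>
     (\<exists>p q. p \<ge> 0 \<and> p + q \<ge> 0 \<and> p - q \<ge> 0 \<and> even (p + q) \<and> even (p - q) \<and> Q = kostant_poly S p q) \<and>
     (\<forall>j<rep_deg S \<delta>. \<forall>l. \<forall>x\<in>carrier S.
        Q (- l) * gen_spherical S \<delta> j l x = Q l * gen_spherical S \<delta> j (- l) x)"

text \<open>Elements of $L^1(X)$ are classes of functions, so \<open>f = \<Sum>\<delta>\<in>F. h \<delta>\<close> means equality almost everywhere.\<close>

definition gaussian_form :: "('g::topological_space, 'b) symmetric_data_scheme \<Rightarrow> ('g \<Rightarrow> complex) \<Rightarrow> bool"
  where
  "gaussian_form S f \<longleftrightarrow>
     (\<exists>(F :: 'g rep set) (h :: 'g rep \<Rightarrow> 'g \<Rightarrow> complex) (\<alpha> :: real) (P :: 'g rep \<Rightarrow> nat \<Rightarrow> complex poly).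
        finite F \<and> (\<forall>\<delta>\<in>F. K_type S \<delta>) \<and>
        (\<forall>\<delta>\<in>F. \<forall>\<delta>'\<in>F. equivalent_reps S \<delta> \<delta>' \<longrightarrow> \<delta> = \<delta>') \<and>
        \<alpha> > 0 \<and>
        (\<forall>\<delta>\<in>F. h \<delta> \<in> L1_X S \<and> of_type S \<delta> (h \<delta>) \<and>
           (\<exists>Q. is_kostant_poly S \<delta> Q \<and>
              (\<forall>j<rep_deg S \<delta>. \<forall>l::real. fourier_coeff S \<delta> j (h \<delta>) l =
                 poly (P \<delta> j) ((of_real l)\<^sup>2) * Q (- of_real l) * of_real (exp (- \<alpha> * l\<^sup>2))))) \<and>
        (AE x in dx S. f x = (\<Sum>\<delta>\<in>F. h \<delta> x)))"

definition lin_indep_seq :: "('g, 'b) symmetric_data_scheme \<Rightarrow> (nat \<Rightarrow> 'g \<Rightarrow> complex) \<Rightarrow> bool" where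
  "lin_indep_seq S f \<longleftrightarrow> (\<forall>n (a :: nat \<Rightarrow> complex).
     (AE x in dx S. (\<Sum>i<n. a i * f i x) = 0) \<longrightarrow> (\<forall>i<n. a i = 0))"

definition beurling_integral ::
  "('g::topological_space, 'b) symmetric_data_scheme \<Rightarrow> real \<Rightarrow> real \<Rightarrow> nat \<Rightarrow> ('g \<Rightarrow> complex) \<Rightarrow> ennreal"
  where
  "beurling_integral S c \<epsilon> d f =
     (\<integral>\<^sup>+ x. \<integral>\<^sup>+ l.
        HS_norm S (fourier S f l) *
        ennreal (cmod (f x) * exp (c * sigma S x * \<bar>l\<bar>) * Xi S x powr (1 - \<epsilon>) /
          (1 + sigma S x + \<bar>l\<bar>) ^ d) \<partial>plancherel S \<partial>dx S)"

end

theory Submission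
  imports Defs "HOL-Probability.Probability" "HOL-Real_Asymp.Real_Asymp"
begin

text \<open>Take $G = SL(2,\mathbb{C})$ and $K = SU(2)$, so that $X$ is hyperbolic 3-space, $\rho = 1$,
  $c(\lambda) = 1 / (i\lambda)$ and $\phi_\lambda$ is elementary. For small $s > 0$ let $f_s$ be the
  $K$-biinvariant function with spherical transform $e^{-\lambda^2/2}\cos(s\lambda)$, up to a constant.
  Its Abel transform is $E_s(t) = e^{-(t-s)^2/2} + e^{-(t+s)^2/2}$, and inverting it gives
  $|f_s(a_r)| \le (1 + 2r) e^{-r} e^{sr - r^2/2}$. Hence for $c = 1$ the Gaussians in $r$, in $\lambda$ and
  the factor $e^{r|\lambda|}$ combine to $e^{-(|\lambda|-r)^2/2}$; the loss $e^{sr}$ is absorbed by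
  $\Xi^{-\varepsilon}$ if $s \le -\varepsilon/2$, and what remains of $\Xi^{2-\varepsilon}$ beats the volume growth
  $e^{2r}$. For $c < 1$ Gaussian decay is left over and every $s \le 1$ will do. As $\sigma(a_r) \le r$ and the
  polynomial weight is not needed, $d = 0$.

  Paired with $\phi_{-\lambda}$, a function of the excluded form yields a polynomial times $e^{-\alpha\lambda^2}$,
  since only the trivial $K$-type contributes. This has finitely many zeros, whereas $\cos(s\lambda)$ has
  infinitely many. The functions $f_{s/3^n}$ are linearly independent because at suitable $\lambda$
  all cosines but the last one vanish.\<close>

section \<open>Smooth functions\<close>

text \<open>The group is complex, so inverting the Abel transform takes a single differentiation,
  and every spherical function is an integral over [0, 1] of a power of an affine function. Haar
  measure on G is built in the coordinates (first column v, unipotent parameter z), which makes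
  every integral over G an Iwasawa integral by construction.

  For 0 <= s <= 1 the function f_s is nonnegative. So f_s dx is itself a measure, and its image
  under x -> (A, kappa) is a product measure; all transforms of f_s are read off from this product.
  Because f_s is K-biinvariant, its operator Fourier transform is a scalar times the projection to
  the constants, and its Hilbert-Schmidt norm is bounded by the modulus of the scalar transform.

  The factor cos(s lambda) does not weaken the decay in lambda. It is paid for on X only, by a
  factor that is exponential and not Gaussian, so the pair of Gaussians that is critical for c = 1
  can be kept.\<close>

lemma C_diff_continuous_on: "C_diff k n U f \<Longrightarrow> continuous_on U f"
  by (cases k) auto

lemma C_diff_lower: "C_diff (Suc k) n U f \<Longrightarrow> C_diff k n U f"
proof (induction k arbitrary: f)
  case 0
  then show ?case by simp
next
  case (Suc k)
  have "\<exists>g. (\<forall>x\<in>U. ((\<lambda>t. f (x(i := t))) has_real_derivative g x) (at (x i))) \<and> C_diff k n U g"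
    if "i < n" for i
    using Suc.prems Suc.IH that by (subst (asm) C_diff.simps(2)) blast
  then show ?case
    using Suc.prems by simp
qed

definition partial_deriv :: "coords set \<Rightarrow> nat \<Rightarrow> (coords \<Rightarrow> real) \<Rightarrow> (coords \<Rightarrow> real) \<Rightarrow> bool" where
  "partial_deriv U i f g \<longleftrightarrow>
     (\<forall>x\<in>U. ((\<lambda>t. f (x(i := t))) has_real_derivative g x) (at (x i)))"

lemma C_diff_Suc_iff:
  "C_diff (Suc k) n U f \<longleftrightarrow>
     continuous_on U f \<and> (\<exists>g. \<forall>i<n. partial_deriv U i f (g i) \<and> C_diff k n U (g i))"
  unfolding C_diff.simps partial_deriv_def choice_iff' ..

lemma C_diff_SucD:
  "C_diff (Suc k) n U f \<Longrightarrow> \<exists>g. \<forall>i<n. partial_deriv U i f (g i) \<and> C_diff k n U (g i)"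
  unfolding C_diff_Suc_iff by (rule conjunct2)

lemma C_diff_SucI:
  assumes "continuous_on U f" "\<And>i. i < n \<Longrightarrow> partial_deriv U i f (g i)"
    "\<And>i. i < n \<Longrightarrow> C_diff k n U (g i)"
  shows "C_diff (Suc k) n U f"
  unfolding C_diff_Suc_iff using assms by (intro conjI exI[of _ g]) auto

lemma C_diff_const: "C_diff k n U (\<lambda>x. c)"
proof (induction k arbitrary: c)
  case (Suc k)
  show ?case
    by (auto intro!: exI[of _ "\<lambda>x. 0"] Suc)
qed auto

lemma C_diff_coord: "C_diff k n U (\<lambda>x. x j)"
proof (cases k)
  case 0
  show ?thesis unfolding 0 by (auto intro: continuous_on_product_then_coordinatewise continuous_intros)
next
  case (Suc m)
  have *: "((\<lambda>t. (x(i := t)) j) has_real_derivative (if i = j then 1 else 0)) (at (x i))"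
    for x :: coords and i
    by auto
  show ?thesis
    unfolding Suc C_diff.simps
  proof (intro conjI allI impI)
    show "continuous_on U (\<lambda>x. x j)"
      by (rule continuous_on_product_then_coordinatewise[OF continuous_on_id])
    show "\<exists>g. (\<forall>x\<in>U. ((\<lambda>t. (x(i := t)) j) has_real_derivative g x) (at (x i))) \<and> C_diff m n U g" for i
      by (rule exI[of _ "\<lambda>x. if i = j then 1 else 0"]) (use * C_diff_const in blast)
  qed
qed

lemma C_diff_add:
  "C_diff k n U f \<Longrightarrow> C_diff k n U g \<Longrightarrow> C_diff k n U (\<lambda>x. f x + g x)"
proof (induction k arbitrary: f g)
  case 0
  then show ?case by (auto intro: continuous_on_add)
next
  case (Suc k)
  obtain f' where "\<forall>i<n. partial_deriv U i f (f' i) \<and> C_diff k n U (f' i)"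
    using C_diff_SucD[OF Suc.prems(1)] ..
  then have f': "\<And>i. i < n \<Longrightarrow> partial_deriv U i f (f' i)" "\<And>i. i < n \<Longrightarrow> C_diff k n U (f' i)"
    by simp_all
  obtain g' where "\<forall>i<n. partial_deriv U i g (g' i) \<and> C_diff k n U (g' i)"
    using C_diff_SucD[OF Suc.prems(2)] ..
  then have g': "\<And>i. i < n \<Longrightarrow> partial_deriv U i g (g' i)" "\<And>i. i < n \<Longrightarrow> C_diff k n U (g' i)"
    by simp_all
  show ?case
  proof (rule C_diff_SucI)
    show "continuous_on U (\<lambda>x. f x + g x)"
      using Suc.prems by (intro continuous_on_add C_diff_continuous_on)
    show "partial_deriv U i (\<lambda>x. f x + g x) (\<lambda>x. f' i x + g' i x)" if "i < n" for i
      using f'(1)[OF that] g'(1)[OF that] unfolding partial_deriv_def by (simp add: DERIV_add)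
    show "C_diff k n U (\<lambda>x. f' i x + g' i x)" if "i < n" for i
      using f'(2)[OF that] g'(2)[OF that] by (rule Suc.IH)
  qed
qed

lemma C_diff_mult:
  "C_diff k n U f \<Longrightarrow> C_diff k n U g \<Longrightarrow> C_diff k n U (\<lambda>x. f x * g x)"
proof (induction k arbitrary: f g)
  case 0
  then show ?case by (auto intro: continuous_on_mult)
next
  case (Suc k)
  obtain f' where "\<forall>i<n. partial_deriv U i f (f' i) \<and> C_diff k n U (f' i)"
    using C_diff_SucD[OF Suc.prems(1)] ..
  then have f': "\<And>i. i < n \<Longrightarrow> partial_deriv U i f (f' i)" "\<And>i. i < n \<Longrightarrow> C_diff k n U (f' i)"
    by simp_all
  obtain g' where "\<forall>i<n. partial_deriv U i g (g' i) \<and> C_diff k n U (g' i)"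
    using C_diff_SucD[OF Suc.prems(2)] ..
  then have g': "\<And>i. i < n \<Longrightarrow> partial_deriv U i g (g' i)" "\<And>i. i < n \<Longrightarrow> C_diff k n U (g' i)"
    by simp_all
  show ?case
  proof (rule C_diff_SucI)
    show "continuous_on U (\<lambda>x. f x * g x)"
      using Suc.prems by (intro continuous_on_mult C_diff_continuous_on)
    show "partial_deriv U i (\<lambda>x. f x * g x) (\<lambda>x. f' i x * g x + g' i x * f x)" if "i < n" for i
      unfolding partial_deriv_def
    proof
      fix x assume "x \<in> U"
      then have "((\<lambda>t. f (x(i := t))) has_real_derivative f' i x) (at (x i))"
        "((\<lambda>t. g (x(i := t))) has_real_derivative g' i x) (at (x i))"
        using f'(1)[OF that] g'(1)[OF that] unfolding partial_deriv_def by simp_all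
      from DERIV_mult[OF this]
      show "((\<lambda>t. f (x(i := t)) * g (x(i := t))) has_real_derivative f' i x * g x + g' i x * f x) (at (x i))"
        by simp
    qed
    show "C_diff k n U (\<lambda>x. f' i x * g x + g' i x * f x)" if "i < n" for i
      by (intro C_diff_add Suc.IH f'(2)[OF that] g'(2)[OF that] Suc.prems[THEN C_diff_lower])
  qed
qed

text \<open>The derivative of 1/f is minus f' times two copies of 1/f. Written as a product it is as
  smooth as its factors, and 1/f has order k by induction.\<close>

lemma C_diff_inverse:
  assumes "\<forall>x\<in>U. f x \<noteq> 0"
  shows "C_diff k n U f \<Longrightarrow> C_diff k n U (\<lambda>x. inverse (f x))"
proof (induction k)
  case 0
  then show ?case using assms by (auto intro!: continuous_on_inverse)
next
  case (Suc k)
  obtain f' where "\<forall>i<n. partial_deriv U i f (f' i) \<and> C_diff k n U (f' i)"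
    using C_diff_SucD[OF Suc.prems] ..
  then have f': "\<And>i. i < n \<Longrightarrow> partial_deriv U i f (f' i)" "\<And>i. i < n \<Longrightarrow> C_diff k n U (f' i)"
    by simp_all
  have IH: "C_diff k n U (\<lambda>x. inverse (f x))"
    by (rule Suc.IH[OF Suc.prems[THEN C_diff_lower]])
  show ?case
  proof (rule C_diff_SucI)
    show "continuous_on U (\<lambda>x. inverse (f x))"
      using C_diff_continuous_on[OF Suc.prems] assms by (intro continuous_on_inverse)
    show "partial_deriv U i (\<lambda>x. inverse (f x)) (\<lambda>x. (-1) * (inverse (f x) * f' i x * inverse (f x)))"
      if "i < n" for i
      unfolding partial_deriv_def
    proof
      fix x assume x: "x \<in> U"
      then have "((\<lambda>t. f (x(i := t))) has_real_derivative f' i x) (at (x i))"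
        using f'(1)[OF that] unfolding partial_deriv_def by simp
      from DERIV_inverse'[OF this]
      show "((\<lambda>t. inverse (f (x(i := t)))) has_real_derivative
          (-1) * (inverse (f x) * f' i x * inverse (f x))) (at (x i))"
        using assms x by simp
    qed
    show "C_diff k n U (\<lambda>x. (-1) * (inverse (f x) * f' i x * inverse (f x)))" if "i < n" for i
      by (intro C_diff_mult C_diff_const IH f'(2)[OF that])
  qed
qed

text \<open>The image of a chart lies in the subspace where the coordinates from \<open>n\<close> on
  vanish, so it is not open in the space of all sequences. But \<open>C_diff\<close> only looks
  along lines in the first \<open>n\<close> directions; openness along these lines suffices for
  replacing a function by one that agrees with it on \<open>U\<close>.\<close>

definition coord_open :: "nat \<Rightarrow> coords set \<Rightarrow> bool" where
  "coord_open n U \<longleftrightarrow> (\<forall>x\<in>U. \<forall>i<n. \<forall>\<^sub>F t in nhds (x i). x(i := t) \<in> U)"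

lemma C_diff_cong_on:
  assumes U: "coord_open n U" and eq: "\<And>x. x \<in> U \<Longrightarrow> f x = g x" and g: "C_diff k n U g"
  shows "C_diff k n U f"
proof (cases k)
  case 0
  then show ?thesis using g eq by (simp cong: continuous_on_cong)
next
  case (Suc m)
  obtain g' where "\<forall>i<n. partial_deriv U i g (g' i) \<and> C_diff m n U (g' i)"
    using C_diff_SucD[OF g[unfolded Suc]] ..
  then have g': "\<And>i. i < n \<Longrightarrow> partial_deriv U i g (g' i)" "\<And>i. i < n \<Longrightarrow> C_diff m n U (g' i)"
    by simp_all
  show ?thesis
    unfolding Suc
  proof (rule C_diff_SucI)
    show "continuous_on U f"
      using C_diff_continuous_on[OF g] eq by (simp cong: continuous_on_cong)
    show "partial_deriv U i f (g' i)" if i: "i < n" for i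
      unfolding partial_deriv_def
    proof
      fix x assume x: "x \<in> U"
      have ev: "\<forall>\<^sub>F t in nhds (x i). f (x(i := t)) = g (x(i := t))"
        using U[unfolded coord_open_def, rule_format, OF x i]
        by (rule eventually_mono) (rule eq)
      show "((\<lambda>t. f (x(i := t))) has_real_derivative g' i x) (at (x i))"
        unfolding DERIV_cong_ev[OF refl ev refl]
        using g'(1)[OF i] x unfolding partial_deriv_def by simp
    qed
    show "C_diff m n U (g' i)" if "i < n" for i
      using g'(2)[OF that] .
  qed
qed

lemma smooth_on_cong_on:
  "coord_open n U \<Longrightarrow> (\<And>x. x \<in> U \<Longrightarrow> f x = g x) \<Longrightarrow> smooth_on n U g \<Longrightarrow> smooth_on n U f"
  unfolding smooth_on_def using C_diff_cong_on by blast

lemma smooth_on_intros: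
  "smooth_on n U (\<lambda>x. c)"
  "smooth_on n U (\<lambda>x. x j)"
  "smooth_on n U f \<Longrightarrow> smooth_on n U g \<Longrightarrow> smooth_on n U (\<lambda>x. f x + g x)"
  "smooth_on n U f \<Longrightarrow> smooth_on n U g \<Longrightarrow> smooth_on n U (\<lambda>x. f x * g x)"
  "(\<forall>x\<in>U. f x \<noteq> 0) \<Longrightarrow> smooth_on n U f \<Longrightarrow> smooth_on n U (\<lambda>x. inverse (f x))"
  unfolding smooth_on_def
  by (auto intro: C_diff_const C_diff_coord C_diff_add C_diff_mult C_diff_inverse)

lemma smooth_on_minus: "smooth_on n U f \<Longrightarrow> smooth_on n U (\<lambda>x. - f x)"
  using smooth_on_intros(4)[OF smooth_on_intros(1)[of n U "-1"]] by simp

section \<open>Complex-valued smooth functions\<close>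

definition csmooth_on :: "nat \<Rightarrow> coords set \<Rightarrow> (coords \<Rightarrow> complex) \<Rightarrow> bool" where
  "csmooth_on n U f \<longleftrightarrow> smooth_on n U (\<lambda>x. Re (f x)) \<and> smooth_on n U (\<lambda>x. Im (f x))"

lemma csmooth_on_const: "csmooth_on n U (\<lambda>x. c)"
  unfolding csmooth_on_def by (auto intro: smooth_on_intros)

lemma csmooth_on_Complex:
  "smooth_on n U f \<Longrightarrow> smooth_on n U g \<Longrightarrow> csmooth_on n U (\<lambda>x. Complex (f x) (g x))"
  unfolding csmooth_on_def by simp

lemma csmooth_on_add:
  "csmooth_on n U f \<Longrightarrow> csmooth_on n U g \<Longrightarrow> csmooth_on n U (\<lambda>x. f x + g x)"
  unfolding csmooth_on_def by (auto intro: smooth_on_intros)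

lemma csmooth_on_minus: "csmooth_on n U f \<Longrightarrow> csmooth_on n U (\<lambda>x. - f x)"
  unfolding csmooth_on_def by (auto intro: smooth_on_minus)

lemma csmooth_on_diff:
  "csmooth_on n U f \<Longrightarrow> csmooth_on n U g \<Longrightarrow> csmooth_on n U (\<lambda>x. f x - g x)"
  using csmooth_on_add[OF _ csmooth_on_minus] by fastforce

lemma csmooth_on_mult:
  assumes "csmooth_on n U f" "csmooth_on n U g"
  shows "csmooth_on n U (\<lambda>x. f x * g x)"
  using assms unfolding csmooth_on_def
  by (auto simp: diff_conv_add_uminus simp del: add_uminus_conv_diff
      intro!: smooth_on_intros smooth_on_minus)

lemma csmooth_on_inverse:
  assumes "\<And>x. x \<in> U \<Longrightarrow> f x \<noteq> 0" "csmooth_on n U f"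
  shows "csmooth_on n U (\<lambda>x. inverse (f x))"
proof -
  have "(Re (f x))\<^sup>2 + (Im (f x))\<^sup>2 \<noteq> 0" if "x \<in> U" for x
    using assms(1)[OF that] by (simp add: complex_eq_iff sum_power2_eq_zero_iff)
  then have "smooth_on n U (\<lambda>x. inverse (Re (f x) * Re (f x) + Im (f x) * Im (f x)))"
    using assms(2) unfolding csmooth_on_def power2_eq_square by (auto intro!: smooth_on_intros)
  then show ?thesis
    using assms(2) unfolding csmooth_on_def
    by (auto simp: divide_inverse power2_eq_square intro!: smooth_on_intros smooth_on_minus)
qed

lemma csmooth_on_divide:
  assumes "\<And>x. x \<in> U \<Longrightarrow> g x \<noteq> 0" "csmooth_on n U f" "csmooth_on n U g"
  shows "csmooth_on n U (\<lambda>x. f x / g x)"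
  unfolding divide_inverse using assms by (intro csmooth_on_mult csmooth_on_inverse)

lemmas csmooth_on_intros =
  csmooth_on_const csmooth_on_add csmooth_on_minus csmooth_on_diff csmooth_on_mult
  csmooth_on_Complex smooth_on_intros(1,2)

lemma coord_openI:
  assumes "\<And>x. x \<in> U \<Longrightarrow> \<exists>V. open V \<and> x \<in> V \<and> (\<forall>y\<in>V. (\<forall>i\<ge>n. y i = x i) \<longrightarrow> y \<in> U)"
  shows "coord_open n U"
  unfolding coord_open_def
proof (intro ballI allI impI)
  fix x i assume x: "x \<in> U" and i: "i < n"
  obtain V where V: "open V" "x \<in> V" "\<forall>y\<in>V. (\<forall>i\<ge>n. y i = x i) \<longrightarrow> y \<in> U"
    using assms[OF x] by blast
  have "continuous_on UNIV (\<lambda>t. x(i := t))"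
  proof (rule continuous_on_coordinatewise_then_product)
    show "continuous_on UNIV (\<lambda>t. (x(i := t)) j)" for j
      by (cases "j = i") (simp_all add: continuous_on_id)
  qed
  then have "open ((\<lambda>t. x(i := t)) -` V)"
    using V(1) by (auto intro: open_vimage)
  moreover have "x i \<in> (\<lambda>t. x(i := t)) -` V" using V(2) by simp
  ultimately have "\<forall>\<^sub>F t in nhds (x i). t \<in> (\<lambda>t. x(i := t)) -` V"
    by (rule eventually_nhds_in_open)
  then show "\<forall>\<^sub>F t in nhds (x i). x(i := t) \<in> U"
    by (rule eventually_mono) (use V(3) i in auto)
qed

section \<open>The group $SL(2,\mathbb{C})$\<close>

text \<open>The matrix with rows $(a, b)$ and $(c, d)$ is a point of $\mathbb{R}^8$. With \<open>d = 0\<close>,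
  \<open>mk\<close> also encodes points of $\mathbb{R}^6$, in particular traceless matrices.\<close>

definition mk :: "complex \<Rightarrow> complex \<Rightarrow> complex \<Rightarrow> complex \<Rightarrow> coords" where
  "mk a b c d = (\<lambda>i. if i = 0 then Re a else if i = 1 then Im a else if i = 2 then Re b
     else if i = 3 then Im b else if i = 4 then Re c else if i = 5 then Im c
     else if i = 6 then Re d else if i = 7 then Im d else 0)"

definition "ea x = Complex (x 0) (x 1)" for x :: coords
definition "eb x = Complex (x 2) (x 3)" for x :: coords
definition "ec x = Complex (x 4) (x 5)" for x :: coords
definition "ed x = Complex (x 6) (x 7)" for x :: coords

lemma mk_sel [simp]:
  "ea (mk a b c d) = a" "eb (mk a b c d) = b" "ec (mk a b c d) = c" "ed (mk a b c d) = d"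
  by (simp_all add: mk_def ea_def eb_def ec_def ed_def)

lemma mk_tail [simp]: "i \<ge> 8 \<Longrightarrow> mk a b c d i = 0"
  by (simp add: mk_def)

lemma mk_tail6 [simp]: "i \<ge> 6 \<Longrightarrow> mk a b c 0 i = 0"
  by (simp add: mk_def)

lemma less_8_cases: "(i::nat) < 8 \<Longrightarrow> i \<in> {0,1,2,3,4,5,6,7}"
  by auto

lemma mk_eta:
  assumes "\<forall>i\<ge>8. x i = 0" shows "mk (ea x) (eb x) (ec x) (ed x) = x"
proof
  fix i :: nat
  show "mk (ea x) (eb x) (ec x) (ed x) i = x i"
  proof (cases "i < 8")
    case True
    then show ?thesis
      using less_8_cases[of i] by (auto simp: mk_def ea_def eb_def ec_def ed_def)
  qed (use assms in auto)
qed

lemma mk_eta6: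
  assumes "\<forall>i\<ge>6. x i = 0" shows "mk (ea x) (eb x) (ec x) 0 = x"
proof -
  have "ed x = 0" using assms by (simp add: ed_def complex_eq_iff)
  then show ?thesis using mk_eta[of x] assms by simp
qed

lemma mk_inject [simp]:
  "mk a b c d = mk a' b' c' d' \<longleftrightarrow> a = a' \<and> b = b' \<and> c = c' \<and> d = d'"
  by (metis mk_sel)

lemma continuous_on_entries [continuous_intros]:
  assumes "continuous_on U f"
  shows "continuous_on U (\<lambda>x. ea (f x))" "continuous_on U (\<lambda>x. eb (f x))"
    "continuous_on U (\<lambda>x. ec (f x))" "continuous_on U (\<lambda>x. ed (f x))"
  using continuous_on_product_then_coordinatewise[OF assms]
  by (auto simp: ea_def eb_def ec_def ed_def Complex_eq intro!: continuous_intros)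

lemma continuous_on_mk [continuous_intros]:
  assumes "continuous_on U a" "continuous_on U b" "continuous_on U c" "continuous_on U d"
  shows "continuous_on U (\<lambda>x. mk (a x) (b x) (c x) (d x))"
proof (rule continuous_on_coordinatewise_then_product)
  fix i :: nat
  show "continuous_on U (\<lambda>x. mk (a x) (b x) (c x) (d x) i)"
    using less_8_cases[of i] assms
    by (cases "i < 8") (auto simp: mk_def intro!: continuous_intros)
qed

definition "mdet x = ea x * ed x - eb x * ec x"

definition "mmult x y = mk (ea x * ea y + eb x * ec y) (ea x * eb y + eb x * ed y)
   (ec x * ea y + ed x * ec y) (ec x * eb y + ed x * ed y)"

definition "madj x = mk (ed x) (- eb x) (- ec x) (ea x)"

definition "m1mat = mk 1 0 0 1"

definition SL2 :: "coords set" where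
  "SL2 = {x. (\<forall>i\<ge>8. x i = 0) \<and> mdet x = 1}"

lemma mk_in_SL2 [simp]: "mk a b c d \<in> SL2 \<longleftrightarrow> a * d - b * c = 1"
  by (simp add: SL2_def mdet_def)

lemma SL2_eta: "x \<in> SL2 \<Longrightarrow> mk (ea x) (eb x) (ec x) (ed x) = x"
  by (rule mk_eta) (simp add: SL2_def)

lemma SL2_eqI:
  assumes "x \<in> SL2" "y \<in> SL2" "ea x = ea y" "eb x = eb y" "ec x = ec y" "ed x = ed y"
  shows "x = y"
  using SL2_eta[OF assms(1)] SL2_eta[OF assms(2)] unfolding assms(3-) by (rule trans[OF sym])

lemma SL2_cases:
  assumes "x \<in> SL2"
  obtains a b c d where "x = mk a b c d" "a * d - b * c = 1"
proof
  show "x = mk (ea x) (eb x) (ec x) (ed x)"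
    using SL2_eta[OF assms] by (rule sym)
  show "ea x * ed x - eb x * ec x = 1"
    using assms by (simp add: SL2_def mdet_def)
qed

lemma mmult_mk [simp]:
  "mmult (mk a b c d) (mk a' b' c' d') = mk (a*a' + b*c') (a*b' + b*d') (c*a' + d*c') (c*b' + d*d')"
  by (simp add: mmult_def)

lemma madj_mk [simp]: "madj (mk a b c d) = mk d (-b) (-c) a"
  by (simp add: madj_def)

lemma mmult_in_SL2: assumes "x \<in> SL2" "y \<in> SL2" shows "mmult x y \<in> SL2"
proof -
  obtain a b c d where x: "x = mk a b c d" "a * d - b * c = 1" using assms(1) by (rule SL2_cases)
  obtain a' b' c' d' where y: "y = mk a' b' c' d'" "a' * d' - b' * c' = 1" using assms(2) by (rule SL2_cases)
  have "(a*a' + b*c') * (c*b' + d*d') - (a*b' + b*d') * (c*a' + d*c') = (a * d - b * c) * (a' * d' - b' * c')"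
    by (simp add: algebra_simps)
  then show ?thesis by (simp add: x y)
qed

lemma madj_in_SL2: "x \<in> SL2 \<Longrightarrow> madj x \<in> SL2"
  by (auto simp: SL2_def mdet_def madj_def algebra_simps)

lemma m1mat_in_SL2: "m1mat \<in> SL2"
  by (simp add: m1mat_def)

lemma mmult_assoc: "mmult (mmult x y) z = mmult x (mmult y z)"
  by (simp add: mmult_def algebra_simps)

lemma mmult_1: "x \<in> SL2 \<Longrightarrow> mmult m1mat x = x" "x \<in> SL2 \<Longrightarrow> mmult x m1mat = x"
  by (simp_all add: m1mat_def mmult_def mk_eta SL2_def)

lemma mmult_madj: "x \<in> SL2 \<Longrightarrow> mmult (madj x) x = m1mat" "x \<in> SL2 \<Longrightarrow> mmult x (madj x) = m1mat"
  by (simp_all add: m1mat_def mmult_def madj_def SL2_def mdet_def algebra_simps)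

text \<open>The forgotten entry is recovered from the determinant, as (1 + bc)/a or (ad - 1)/b. The
  first row of an invertible matrix is nonzero, so the two charts cover the group.\<close>

definition "chart_a = ({x \<in> SL2. ea x \<noteq> 0}, \<lambda>x. mk (ea x) (eb x) (ec x) 0)"
definition "chart_b = ({x \<in> SL2. eb x \<noteq> 0}, \<lambda>x. mk (ea x) (eb x) (ed x) 0)"

definition SU2 :: "coords set" where
  "SU2 = {x \<in> SL2. ed x = cnj (ea x) \<and> ec x = - cnj (eb x)}"

text \<open>The first column of an element of $SU(2)$ is an arbitrary unit vector $(v_1, v_2)$, which
  determines the second one.\<close>

definition ku :: "complex \<times> complex \<Rightarrow> coords" where
  "ku v = (if v = 0 then m1mat else
     mk (fst v /\<^sub>R norm v) (- cnj (snd v) /\<^sub>R norm v) (snd v /\<^sub>R norm v) (cnj (fst v) /\<^sub>R norm v))"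

text \<open>Iwasawa coordinates: the first column is \<open>v\<close>; the second is
  \<open>z\<close> times \<open>v\<close> plus the vector orthogonal to \<open>v\<close> that makes
  the determinant one. The points with \<open>v = 0\<close> form a null set, and the value there
  only keeps \<open>psi\<close> inside \<open>SL2\<close>.\<close>

definition psi :: "(complex \<times> complex) \<times> complex \<Rightarrow> coords" where
  "psi = (\<lambda>(v, z). if v = 0 then m1mat else
     mk (fst v) (- cnj (snd v) /\<^sub>R (norm v)\<^sup>2 + z * fst v)
        (snd v) (cnj (fst v) /\<^sub>R (norm v)\<^sup>2 + z * snd v))"

text \<open>Normalised Lebesgue measure of the unit ball in C^2, projected radially to the sphere
  and carried over to SU(2). Left multiplication becomes a linear isometry of the ball, so
  invariance is inherited.\<close>

definition haarK :: "coords measure" where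
  "haarK = distr (uniform_measure lborel (ball 0 1)) (restrict_space borel SU2) ku"

text \<open>Left multiplication acts on \<open>v\<close> linearly with determinant one and
  translates \<open>z\<close> by an amount that depends on \<open>v\<close> only. Both operations
  preserve Lebesgue measure.\<close>

definition haarG :: "coords measure" where
  "haarG = distr lborel (restrict_space borel SL2) psi"

text \<open>\<open>Hg\<close> stands for diag(1/2, -1/2), for which ad has eigenvalue 1 on strictly
  upper triangular matrices. In the coordinates of \<open>chart_a\<close> an element of the Lie
  algebra is the triple (a, b, c) of its entries; the fourth entry -a is left out.\<close>

definition S0 :: "coords symmetric_data" where
  "S0 = \<lparr> carrier = SL2, monoid.mult = mmult, one = m1mat, gdim = 6,
     atlas = {chart_a, chart_b}, chart1 = chart_a, Kgp = SU2, Hg = mk (1/2) 0 0 0,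
     dk = haarK, dx = haarG \<rparr>"

lemma S0_sel [simp]:
  "carrier S0 = SL2" "monoid.mult S0 = mmult" "one S0 = m1mat" "gdim S0 = 6"
  "atlas S0 = {chart_a, chart_b}" "chart1 S0 = chart_a" "Kgp S0 = SU2" "Hg S0 = mk (1/2) 0 0 0"
  "dk S0 = haarK" "dx S0 = haarG"
  by (simp_all add: S0_def)

lemma group_S0: "Group.group S0"
proof (rule groupI)
  show "\<exists>y\<in>carrier S0. y \<otimes>\<^bsub>S0\<^esub> x = \<one>\<^bsub>S0\<^esub>" if "x \<in> carrier S0" for x
    by (rule bexI[of _ "madj x"]) (use that in \<open>simp_all add: mmult_madj madj_in_SL2\<close>)
qed (simp_all add: mmult_in_SL2 m1mat_in_SL2 mmult_assoc mmult_1)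

lemma inv_S0 [simp]: "x \<in> SL2 \<Longrightarrow> inv\<^bsub>S0\<^esub> x = madj x"
  using Group.group.inv_equality[OF group_S0, of "madj x" x] by (simp add: mmult_madj madj_in_SL2)

subsection \<open>The smooth structure\<close>

abbreviation (input) "phi_a \<equiv> snd chart_a"
abbreviation (input) "phi_b \<equiv> snd chart_b"

definition inv_a :: "coords \<Rightarrow> coords" where
  "inv_a x = mk (ea x) (eb x) (ec x) ((1 + eb x * ec x) / ea x)"

definition inv_b :: "coords \<Rightarrow> coords" where
  "inv_b x = mk (ea x) (eb x) ((ea x * ec x - 1) / eb x) (ec x)"

lemma inj_on_chart_a: "inj_on (snd chart_a) (fst chart_a)"
proof (rule inj_onI)
  fix x y assume x: "x \<in> fst chart_a" and y: "y \<in> fst chart_a" and eq: "snd chart_a x = snd chart_a y"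
  have "ea x * ed x = ea y * ed y"
    using x y eq by (auto simp: chart_a_def SL2_def mdet_def algebra_simps)
  then show "x = y"
    using x y eq by (auto simp: chart_a_def intro: SL2_eqI)
qed

lemma inv_a: assumes "ea x \<noteq> 0" "\<forall>i\<ge>6. x i = 0"
  shows "inv_a x \<in> fst chart_a" "snd chart_a (inv_a x) = x"
  using assms by (simp_all add: chart_a_def inv_a_def mk_eta6)

lemma image_chart_a: "snd chart_a ` fst chart_a = {x. (\<forall>i\<ge>6. x i = 0) \<and> ea x \<noteq> 0}"
proof safe
  fix x :: coords assume "\<forall>i\<ge>6. x i = 0" "ea x \<noteq> 0"
  then show "x \<in> snd chart_a ` fst chart_a"
    using inv_a[of x] by (metis image_eqI)
qed (auto simp: chart_a_def)

lemma the_inv_a: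
  assumes "y \<in> snd chart_a ` fst chart_a"
  shows "the_inv_into (fst chart_a) (snd chart_a) y = inv_a y"
  using assms unfolding image_chart_a by (intro the_inv_into_f_eq inj_on_chart_a inv_a) auto

lemma inj_on_chart_b: "inj_on (snd chart_b) (fst chart_b)"
proof (rule inj_onI)
  fix x y assume x: "x \<in> fst chart_b" and y: "y \<in> fst chart_b" and eq: "snd chart_b x = snd chart_b y"
  have "eb x * ec x = eb y * ec y"
    using x y eq by (auto simp: chart_b_def SL2_def mdet_def algebra_simps)
  then show "x = y"
    using x y eq by (auto simp: chart_b_def intro: SL2_eqI)
qed

lemma inv_b: assumes "eb x \<noteq> 0" "\<forall>i\<ge>6. x i = 0"
  shows "inv_b x \<in> fst chart_b" "snd chart_b (inv_b x) = x"
  using assms by (simp_all add: chart_b_def inv_b_def mk_eta6)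

lemma image_chart_b: "snd chart_b ` fst chart_b = {x. (\<forall>i\<ge>6. x i = 0) \<and> eb x \<noteq> 0}"
proof safe
  fix x :: coords assume "\<forall>i\<ge>6. x i = 0" "eb x \<noteq> 0"
  then show "x \<in> snd chart_b ` fst chart_b"
    using inv_b[of x] by (metis image_eqI)
qed (auto simp: chart_b_def)

lemma the_inv_b:
  assumes "y \<in> snd chart_b ` fst chart_b"
  shows "the_inv_into (fst chart_b) (snd chart_b) y = inv_b y"
  using assms unfolding image_chart_b by (intro the_inv_into_f_eq inj_on_chart_b inv_b) auto

lemma openin_Euclidean_space_Collect:
  assumes "\<And>x. x \<in> U \<longleftrightarrow> (\<forall>i\<ge>n. x i = 0) \<and> x \<in> V" "open V"
  shows "openin (Euclidean_space n) U"
  unfolding Euclidean_space_def openin_subtopology euclidean_product_topology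
  by (rule exI[of _ V]) (use assms in auto)

lemma open_entries: "open {x. ea x \<noteq> 0}" "open {x. eb x \<noteq> 0}"
  by (intro open_Collect_neq continuous_intros)+

lemma the_inv_into_image: "inj_on f A \<Longrightarrow> the_inv_into A f ` f ` A = A"
  by (force simp: the_inv_into_f_f image_iff)

lemma continuous_on_inv_a: "continuous_on {x. ea x \<noteq> 0} inv_a"
  unfolding inv_a_def by (intro continuous_intros) auto

lemma continuous_on_inv_b: "continuous_on {x. eb x \<noteq> 0} inv_b"
  unfolding inv_b_def by (intro continuous_intros) auto

lemma is_chart_a: "is_chart S0 chart_a"
proof -
  have "openin (top_of_set SL2) (SL2 \<inter> {x. ea x \<noteq> 0})"
    using open_entries(1) by (rule openin_open_Int)
  then have 1: "openin (top_of_set SL2) (fst chart_a)"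
    by (simp add: chart_a_def Int_def)
  have 2: "openin (Euclidean_space 6) (snd chart_a ` fst chart_a)"
    unfolding image_chart_a by (rule openin_Euclidean_space_Collect[OF _ open_entries(1)]) auto
  have "homeomorphism (fst chart_a) (snd chart_a ` fst chart_a) (snd chart_a) (the_inv_into (fst chart_a) (snd chart_a))"
  proof (rule homeomorphismI)
    show "continuous_on (fst chart_a) (snd chart_a)"
      unfolding chart_a_def snd_conv by (intro continuous_intros)
    show "continuous_on (snd chart_a ` fst chart_a) (the_inv_into (fst chart_a) (snd chart_a))"
    proof (rule continuous_on_eq)
      show "continuous_on (snd chart_a ` fst chart_a) inv_a"
        unfolding image_chart_a by (rule continuous_on_subset[OF continuous_on_inv_a]) auto
    qed (rule the_inv_a[symmetric], assumption)
  qed (simp_all add: the_inv_into_f_f[OF inj_on_chart_a] f_the_inv_into_f[OF inj_on_chart_a] the_inv_into_image[OF inj_on_chart_a])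
  with 1 2 show ?thesis by (simp add: is_chart_def split_beta)
qed

lemma is_chart_b: "is_chart S0 chart_b"
proof -
  have "openin (top_of_set SL2) (SL2 \<inter> {x. eb x \<noteq> 0})"
    using open_entries(2) by (rule openin_open_Int)
  then have 1: "openin (top_of_set SL2) (fst chart_b)"
    by (simp add: chart_b_def Int_def)
  have 2: "openin (Euclidean_space 6) (snd chart_b ` fst chart_b)"
    unfolding image_chart_b by (rule openin_Euclidean_space_Collect[OF _ open_entries(2)]) auto
  have "homeomorphism (fst chart_b) (snd chart_b ` fst chart_b) (snd chart_b) (the_inv_into (fst chart_b) (snd chart_b))"
  proof (rule homeomorphismI)
    show "continuous_on (fst chart_b) (snd chart_b)"
      unfolding chart_b_def snd_conv by (intro continuous_intros)
    show "continuous_on (snd chart_b ` fst chart_b) (the_inv_into (fst chart_b) (snd chart_b))"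
    proof (rule continuous_on_eq)
      show "continuous_on (snd chart_b ` fst chart_b) inv_b"
        unfolding image_chart_b by (rule continuous_on_subset[OF continuous_on_inv_b]) auto
    qed (rule the_inv_b[symmetric], assumption)
  qed (simp_all add: the_inv_into_f_f[OF inj_on_chart_b] f_the_inv_into_f[OF inj_on_chart_b] the_inv_into_image[OF inj_on_chart_b])
  with 1 2 show ?thesis by (simp add: is_chart_def split_beta)
qed

text \<open>On the domain of a chart the inverse chart is a rational function, and the charts only
  forget an entry; so all smoothness claims reduce to that of the entries of a matrix.\<close>

lemma smooth_on_phi:
  assumes "c \<in> {chart_a, chart_b}" "csmooth_on n U (\<lambda>x. ea (f x))" "csmooth_on n U (\<lambda>x. eb (f x))"
    "csmooth_on n U (\<lambda>x. ec (f x))" "csmooth_on n U (\<lambda>x. ed (f x))" "i < 6"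
  shows "smooth_on n U (\<lambda>x. snd c (f x) i)"
proof -
  have "i \<in> {0,1,2,3,4,5}" using assms(6) by auto
  then show ?thesis
    using assms(1-5) by (auto simp: chart_a_def chart_b_def mk_def csmooth_on_def)
qed

definition inv_chart :: "coords chart \<Rightarrow> coords \<Rightarrow> coords" where
  "inv_chart c = (if c = chart_a then inv_a else inv_b)"

lemma chart_a_neq_b: "chart_a \<noteq> chart_b"
proof -
  have "m1mat \<in> fst chart_a" "m1mat \<notin> fst chart_b"
    by (auto simp: chart_a_def chart_b_def m1mat_def)
  then show ?thesis by metis
qed

lemma the_inv_chart:
  assumes "c \<in> {chart_a, chart_b}" "y \<in> snd c ` fst c"
  shows "the_inv_into (fst c) (snd c) y = inv_chart c y"
  using assms chart_a_neq_b by (auto simp: inv_chart_def the_inv_a the_inv_b)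

lemma csmooth_on_inv_chart:
  assumes "c \<in> {chart_a, chart_b}" "\<And>x. x \<in> U \<Longrightarrow> f x \<in> snd c ` fst c"
    "csmooth_on n U (\<lambda>x. ea (f x))" "csmooth_on n U (\<lambda>x. eb (f x))" "csmooth_on n U (\<lambda>x. ec (f x))"
  shows "csmooth_on n U (\<lambda>x. ea (inv_chart c (f x)))" "csmooth_on n U (\<lambda>x. eb (inv_chart c (f x)))"
    "csmooth_on n U (\<lambda>x. ec (inv_chart c (f x)))" "csmooth_on n U (\<lambda>x. ed (inv_chart c (f x)))"
proof -
  have "ea (f x) \<noteq> 0" if "c = chart_a" "x \<in> U" for x
    using assms(2)[OF that(2)] that(1) by (auto simp: chart_a_def)
  moreover have "eb (f x) \<noteq> 0" if "c = chart_b" "x \<in> U" for x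
    using assms(2)[OF that(2)] that(1) by (auto simp: chart_b_def)
  ultimately show "csmooth_on n U (\<lambda>x. ea (inv_chart c (f x)))" "csmooth_on n U (\<lambda>x. eb (inv_chart c (f x)))"
    "csmooth_on n U (\<lambda>x. ec (inv_chart c (f x)))" "csmooth_on n U (\<lambda>x. ed (inv_chart c (f x)))"
    using assms(1,3-5) chart_a_neq_b
    by (cases "c = chart_a"; simp add: inv_chart_def inv_a_def inv_b_def csmooth_on_add csmooth_on_diff
        csmooth_on_mult csmooth_on_const csmooth_on_divide)+
qed

lemma chart_fst_vimage:
  assumes "c \<in> {chart_a, chart_b}"
  obtains W where "open W" "fst c = SL2 \<inter> W"
proof (cases "c = chart_a")
  case True
  then show ?thesis by (intro that[OF open_entries(1)]) (auto simp: chart_a_def)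
next
  case False
  then show ?thesis using assms by (intro that[OF open_entries(2)]) (auto simp: chart_b_def)
qed

lemma chart_image_vimage:
  assumes "c \<in> {chart_a, chart_b}"
  obtains W where "open W" "snd c ` fst c = {x. \<forall>i\<ge>6. x i = 0} \<inter> W" "continuous_on W (inv_chart c)"
proof (cases "c = chart_a")
  case True
  show ?thesis
    by (rule that[OF open_entries(1)])
      (use True continuous_on_inv_a in \<open>auto simp: image_chart_a inv_chart_def\<close>)
next
  case False
  then have "c = chart_b" using assms by simp
  then show ?thesis
    by (intro that[OF open_entries(2)])
      (use False continuous_on_inv_b in \<open>auto simp: image_chart_b inv_chart_def\<close>)
qed

lemma inv_chart_in_SL2:
  assumes "c \<in> {chart_a, chart_b}" "y \<in> snd c ` fst c"
  shows "inv_chart c y \<in> SL2"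
proof (cases "c = chart_a")
  case True
  then have "inv_a y \<in> fst chart_a"
    using assms(2) by (intro inv_a) (auto simp: image_chart_a)
  then show ?thesis using True by (simp add: inv_chart_def chart_a_def)
next
  case False
  then have "inv_b y \<in> fst chart_b"
    using assms by (intro inv_b) (auto simp: image_chart_b)
  then show ?thesis using False by (simp add: inv_chart_def chart_b_def)
qed

text \<open>The domains of the coordinate changes, of multiplication and of inversion all have this
  form: a coordinate subspace cut down by an open set and by the preimage of an open set.\<close>

lemma coord_open_vimage:
  assumes "\<And>x. x \<in> U \<longleftrightarrow> (\<forall>i\<ge>n. x i = 0) \<and> x \<in> V \<and> f x \<in> W"
    and "open V" "open W" "continuous_on V f"
  shows "coord_open n U"
proof (rule coord_openI)
  fix x assume "x \<in> U"
  then have x: "\<forall>i\<ge>n. x i = 0" "x \<in> V" "f x \<in> W" using assms(1) by auto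
  have "open (V \<inter> f -` W)"
    using assms(2-4) by (simp add: continuous_open_preimage Int_commute)
  then show "\<exists>V. open V \<and> x \<in> V \<and> (\<forall>y\<in>V. (\<forall>i\<ge>n. y i = x i) \<longrightarrow> y \<in> U)"
    by (intro exI[of _ "V \<inter> f -` W"]) (use x assms(1) in auto)
qed

lemma compatible_charts_S0:
  assumes c: "c \<in> {chart_a, chart_b}" and c': "c' \<in> {chart_a, chart_b}"
  shows "compatible_charts 6 c c'"
proof -
  obtain U \<phi> V \<psi> where [simp]: "c = (U, \<phi>)" "c' = (V, \<psi>)" by (cases c, cases c')
  obtain W where W: "open W" "\<phi> ` U = {x. \<forall>i\<ge>6. x i = 0} \<inter> W" "continuous_on W (inv_chart c)"
    using chart_image_vimage[OF c] by auto
  obtain T where T: "open T" "V = SL2 \<inter> T"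
    using chart_fst_vimage[OF c'] by auto
  have inj: "inj_on \<phi> U" using c inj_on_chart_a inj_on_chart_b by (metis \<open>c = (U, \<phi>)\<close> fst_conv snd_conv insertE singletonD)
  have inv: "the_inv_into U \<phi> y = inv_chart c y" if "y \<in> \<phi> ` U" for y
    using the_inv_chart[OF c] that by simp
  have D: "\<phi> ` (U \<inter> V) = {y. (\<forall>i\<ge>6. y i = 0) \<and> y \<in> W \<and> inv_chart c y \<in> T}"
  proof -
    have "\<phi> ` (U \<inter> V) = {y \<in> \<phi> ` U. the_inv_into U \<phi> y \<in> V}"
      using inj by (auto simp: the_inv_into_f_f)
    also have "\<dots> = {y \<in> \<phi> ` U. inv_chart c y \<in> T}"
      using inv inv_chart_in_SL2[OF c] T(2) by auto
    finally show ?thesis unfolding W(2) by auto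
  qed
  have co: "coord_open 6 (\<phi> ` (U \<inter> V))"
    unfolding D by (rule coord_open_vimage[OF _ W(1) T(1) W(3)]) auto
  have "smooth_on 6 (\<phi> ` (U \<inter> V)) (\<lambda>x. \<psi> (the_inv_into U \<phi> x) i)" if i: "i < 6" for i
  proof (rule smooth_on_cong_on[OF co])
    show "\<psi> (the_inv_into U \<phi> x) i = snd c' (inv_chart c x) i" if "x \<in> \<phi> ` (U \<inter> V)" for x
      using inv that by auto
    have "csmooth_on 6 (\<phi> ` (U \<inter> V)) (\<lambda>x. ea x)" "csmooth_on 6 (\<phi> ` (U \<inter> V)) (\<lambda>x. eb x)"
      "csmooth_on 6 (\<phi> ` (U \<inter> V)) (\<lambda>x. ec x)"
      unfolding ea_def eb_def ec_def by (intro csmooth_on_intros)+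
    then show "smooth_on 6 (\<phi> ` (U \<inter> V)) (\<lambda>x. snd c' (inv_chart c x) i)"
      by (intro smooth_on_phi[OF c' _ _ _ _ i] csmooth_on_inv_chart[OF c]) auto
  qed
  then show ?thesis by (simp add: compatible_charts_def)
qed

lemma fst_half_in: "(\<forall>i\<ge>6. fst_half 6 z i = 0)" "(\<forall>i\<ge>6. snd_half 6 z i = 0)"
  by (auto simp: fst_half_def snd_half_def)

lemma csmooth_on_halves:
  "csmooth_on n U (\<lambda>x. ea (fst_half 6 x))" "csmooth_on n U (\<lambda>x. eb (fst_half 6 x))"
  "csmooth_on n U (\<lambda>x. ec (fst_half 6 x))" "csmooth_on n U (\<lambda>x. ea (snd_half 6 x))"
  "csmooth_on n U (\<lambda>x. eb (snd_half 6 x))" "csmooth_on n U (\<lambda>x. ec (snd_half 6 x))"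
  unfolding ea_def eb_def ec_def fst_half_def snd_half_def by (auto intro!: csmooth_on_intros)

lemma continuous_on_halves:
  "continuous_on U (fst_half 6)" "continuous_on U (snd_half 6)"
proof -
  have "continuous_on U (\<lambda>x. fst_half 6 x i)" "continuous_on U (\<lambda>x. snd_half 6 x i)" for i
    unfolding fst_half_def snd_half_def
    by (cases "i < 6"; simp add: continuous_on_product_then_coordinatewise[OF continuous_on_id])+
  then show "continuous_on U (fst_half 6)" "continuous_on U (snd_half 6)"
    by (auto intro: continuous_on_coordinatewise_then_product)
qed

lemma continuous_on_mmult [continuous_intros]:
  "continuous_on U f \<Longrightarrow> continuous_on U g \<Longrightarrow> continuous_on U (\<lambda>x. mmult (f x) (g x))"
  unfolding mmult_def
  by (intro continuous_on_mk continuous_on_add continuous_on_mult continuous_on_entries)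

lemma continuous_on_madj [continuous_intros]:
  "continuous_on U f \<Longrightarrow> continuous_on U (\<lambda>x. madj (f x))"
  unfolding madj_def
  by (intro continuous_on_mk continuous_on_minus continuous_on_entries)

lemma smooth_mult_S0:
  assumes c: "c1 \<in> {chart_a, chart_b}" "c2 \<in> {chart_a, chart_b}" "c3 \<in> {chart_a, chart_b}" and i: "i < 6"
  defines "m \<equiv> (\<lambda>z. mmult (the_inv_into (fst c1) (snd c1) (fst_half 6 z))
                        (the_inv_into (fst c2) (snd c2) (snd_half 6 z)))"
  shows "smooth_on 12 {z \<in> topspace (Euclidean_space 12). fst_half 6 z \<in> snd c1 ` fst c1 \<and>
           snd_half 6 z \<in> snd c2 ` fst c2 \<and> m z \<in> fst c3} (\<lambda>z. snd c3 (m z) i)"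
    (is "smooth_on 12 ?D _")
proof (rule smooth_on_cong_on)
  let ?m = "\<lambda>z. mmult (inv_chart c1 (fst_half 6 z)) (inv_chart c2 (snd_half 6 z))"
  have m: "m z = ?m z" if "fst_half 6 z \<in> snd c1 ` fst c1" "snd_half 6 z \<in> snd c2 ` fst c2" for z
    using the_inv_chart[OF c(1) that(1)] the_inv_chart[OF c(2) that(2)] unfolding m_def by simp
  obtain W1 where W1: "open W1" "snd c1 ` fst c1 = {x. \<forall>i\<ge>6. x i = 0} \<inter> W1" "continuous_on W1 (inv_chart c1)"
    using chart_image_vimage[OF c(1)] by auto
  obtain W2 where W2: "open W2" "snd c2 ` fst c2 = {x. \<forall>i\<ge>6. x i = 0} \<inter> W2" "continuous_on W2 (inv_chart c2)"
    using chart_image_vimage[OF c(2)] by auto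
  obtain T where T: "open T" "fst c3 = SL2 \<inter> T"
    using chart_fst_vimage[OF c(3)] by auto
  let ?V = "fst_half 6 -` W1 \<inter> snd_half 6 -` W2"
  have V: "open ?V"
    using W1(1) W2(1) by (intro open_Int open_vimage continuous_on_halves)
  have contm: "continuous_on ?V ?m"
    by (intro continuous_intros continuous_on_compose2[OF W1(3) continuous_on_halves(1)]
        continuous_on_compose2[OF W2(3) continuous_on_halves(2)]) auto
  have D: "z \<in> ?D \<longleftrightarrow> (\<forall>i\<ge>12. z i = 0) \<and> z \<in> ?V \<and> ?m z \<in> T" for z
  proof (cases "fst_half 6 z \<in> snd c1 ` fst c1 \<and> snd_half 6 z \<in> snd c2 ` fst c2")
    case True
    then have "?m z \<in> SL2"
      by (intro mmult_in_SL2 inv_chart_in_SL2[OF c(1)] inv_chart_in_SL2[OF c(2)]) auto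
    then show ?thesis
      using True m[of z] T(2) W1(2) W2(2) by (auto simp: topspace_Euclidean_space)
  next
    case False
    then show ?thesis using fst_half_in unfolding W1(2) W2(2) by auto
  qed
  show "coord_open 12 ?D"
    by (rule coord_open_vimage[OF D V T(1) contm])
  show "snd c3 (m z) i = snd c3 (?m z) i" if "z \<in> ?D" for z
    using m that by auto
  have "csmooth_on 12 ?D (\<lambda>x. ea (inv_chart c1 (fst_half 6 x)))" "csmooth_on 12 ?D (\<lambda>x. eb (inv_chart c1 (fst_half 6 x)))"
      "csmooth_on 12 ?D (\<lambda>x. ec (inv_chart c1 (fst_half 6 x)))" "csmooth_on 12 ?D (\<lambda>x. ed (inv_chart c1 (fst_half 6 x)))"
    by (rule csmooth_on_inv_chart[OF c(1)]; use csmooth_on_halves in auto)+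
  moreover have "csmooth_on 12 ?D (\<lambda>x. ea (inv_chart c2 (snd_half 6 x)))" "csmooth_on 12 ?D (\<lambda>x. eb (inv_chart c2 (snd_half 6 x)))"
      "csmooth_on 12 ?D (\<lambda>x. ec (inv_chart c2 (snd_half 6 x)))" "csmooth_on 12 ?D (\<lambda>x. ed (inv_chart c2 (snd_half 6 x)))"
    by (rule csmooth_on_inv_chart[OF c(2)]; use csmooth_on_halves in auto)+
  ultimately show "smooth_on 12 ?D (\<lambda>z. snd c3 (?m z) i)"
    by (intro smooth_on_phi[OF c(3) _ _ _ _ i]) (simp_all add: mmult_def csmooth_on_intros)
qed

lemma smooth_inverse_S0:
  assumes c: "c1 \<in> {chart_a, chart_b}" "c2 \<in> {chart_a, chart_b}" and i: "i < 6"
  shows "smooth_on 6 {x \<in> snd c1 ` fst c1. inv\<^bsub>S0\<^esub> (the_inv_into (fst c1) (snd c1) x) \<in> fst c2}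
           (\<lambda>x. snd c2 (inv\<^bsub>S0\<^esub> (the_inv_into (fst c1) (snd c1) x)) i)"
    (is "smooth_on 6 ?D _")
proof (rule smooth_on_cong_on)
  let ?m = "\<lambda>z. madj (inv_chart c1 z)"
  have m: "inv\<^bsub>S0\<^esub> (the_inv_into (fst c1) (snd c1) x) = ?m x" "?m x \<in> SL2" if "x \<in> snd c1 ` fst c1" for x
    using the_inv_chart[OF c(1) that] inv_chart_in_SL2[OF c(1) that] by (auto simp: madj_in_SL2)
  obtain W1 where W1: "open W1" "snd c1 ` fst c1 = {x. \<forall>i\<ge>6. x i = 0} \<inter> W1" "continuous_on W1 (inv_chart c1)"
    using chart_image_vimage[OF c(1)] by auto
  obtain T where T: "open T" "fst c2 = SL2 \<inter> T"
    using chart_fst_vimage[OF c(2)] by auto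
  have D: "z \<in> ?D \<longleftrightarrow> (\<forall>i\<ge>6. z i = 0) \<and> z \<in> W1 \<and> ?m z \<in> T" for z
    using m[of z] T(2) W1(2) by auto
  show "coord_open 6 ?D"
    by (rule coord_open_vimage[OF D W1(1) T(1) continuous_on_madj[OF W1(3)]])
  show "snd c2 (inv\<^bsub>S0\<^esub> (the_inv_into (fst c1) (snd c1) x)) i = snd c2 (?m x) i" if "x \<in> ?D" for x
    using m that by auto
  have "csmooth_on 6 ?D (\<lambda>x. ea x)" "csmooth_on 6 ?D (\<lambda>x. eb x)" "csmooth_on 6 ?D (\<lambda>x. ec x)"
    unfolding ea_def eb_def ec_def by (intro csmooth_on_intros)+
  then have "csmooth_on 6 ?D (\<lambda>x. ea (inv_chart c1 x))" "csmooth_on 6 ?D (\<lambda>x. eb (inv_chart c1 x))"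
      "csmooth_on 6 ?D (\<lambda>x. ec (inv_chart c1 x))" "csmooth_on 6 ?D (\<lambda>x. ed (inv_chart c1 x))"
    by (auto intro!: csmooth_on_inv_chart[OF c(1)])
  then show "smooth_on 6 ?D (\<lambda>z. snd c2 (?m z) i)"
    by (intro smooth_on_phi[OF c(2) _ _ _ _ i]) (simp_all add: madj_def csmooth_on_intros)
qed

lemma lie_group_S0: "lie_group S0"
proof -
  have man: "smooth_manifold S0"
    unfolding smooth_manifold_def using is_chart_a is_chart_b compatible_charts_S0
    by (auto simp: chart_a_def chart_b_def SL2_def mdet_def)
  have sm: "smooth_mult S0"
    unfolding smooth_mult_def Let_def split_beta S0_sel
  proof (intro ballI allI impI)
    fix c1 c2 c3 and i :: nat
    assume "c1 \<in> {chart_a, chart_b}" "c2 \<in> {chart_a, chart_b}" "c3 \<in> {chart_a, chart_b}" "i < 6"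
    note * = smooth_mult_S0[OF this]
    have e: "2 * 6 = (12::nat)" by simp
    show "smooth_on (2 * 6) {z \<in> topspace (Euclidean_space (2 * 6)).
         fst_half 6 z \<in> snd c1 ` fst c1 \<and> snd_half 6 z \<in> snd c2 ` fst c2 \<and>
         mmult (the_inv_into (fst c1) (snd c1) (fst_half 6 z)) (the_inv_into (fst c2) (snd c2) (snd_half 6 z)) \<in> fst c3}
        (\<lambda>z. snd c3 (mmult (the_inv_into (fst c1) (snd c1) (fst_half 6 z))
                          (the_inv_into (fst c2) (snd c2) (snd_half 6 z))) i)"
      unfolding e by (rule *)
  qed
  have si: "smooth_inverse S0"
    unfolding smooth_inverse_def split_beta S0_sel
  proof (intro ballI allI impI)
    fix c1 c2 and i :: nat
    assume "c1 \<in> {chart_a, chart_b}" "c2 \<in> {chart_a, chart_b}" "i < 6"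
    then show "smooth_on 6 {x \<in> snd c1 ` fst c1. inv\<^bsub>S0\<^esub> (the_inv_into (fst c1) (snd c1) x) \<in> fst c2}
        (\<lambda>x. snd c2 (inv\<^bsub>S0\<^esub> (the_inv_into (fst c1) (snd c1) x)) i)"
      by (rule smooth_inverse_S0)
  qed
  have cm: "continuous_on (carrier S0 \<times> carrier S0) (\<lambda>(x, y). x \<otimes>\<^bsub>S0\<^esub> y)"
    unfolding split_beta S0_sel
    by (rule continuous_on_mmult[OF continuous_on_fst[OF continuous_on_id] continuous_on_snd[OF continuous_on_id]])
  have ci: "continuous_on (carrier S0) (\<lambda>x. inv\<^bsub>S0\<^esub> x)"
  proof (rule continuous_on_eq)
    show "continuous_on (carrier S0) (\<lambda>x. madj x)"
      by (rule continuous_on_madj[OF continuous_on_id])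
  qed simp
  have one: "\<one>\<^bsub>S0\<^esub> \<in> fst (chart1 S0)"
    by (simp add: chart_a_def m1mat_def)
  have at: "chart1 S0 \<in> atlas S0"
    by simp
  show ?thesis
    unfolding lie_group_def
    by (rule conjI[OF group_S0 conjI[OF man conjI[OF cm conjI[OF ci conjI[OF sm conjI[OF si conjI[OF at one]]]]]]])
qed

subsection \<open>Exponential map and Lie bracket\<close>

text \<open>A traceless $2 \times 2$ matrix satisfies $X^2 = \omega^2 I$, so that
  $\exp(tX) = \cosh(t\omega) I + \frac{\sinh(t\omega)}{\omega} X$.\<close>

definition momega :: "coords \<Rightarrow> complex" where
  "momega X = csqrt ((ea X)\<^sup>2 + eb X * ec X)"

definition mS :: "coords \<Rightarrow> real \<Rightarrow> complex" where
  "mS X t = (if momega X = 0 then of_real t else sinh (of_real t * momega X) / momega X)"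

definition mC :: "coords \<Rightarrow> real \<Rightarrow> complex" where
  "mC X t = cosh (of_real t * momega X)"

definition mexp :: "coords \<Rightarrow> real \<Rightarrow> coords" where
  "mexp X t = mk (mC X t + mS X t * ea X) (mS X t * eb X) (mS X t * ec X) (mC X t - mS X t * ea X)"

lemma momega_sq: "momega X * momega X = ea X * ea X + eb X * ec X"
  by (simp add: momega_def flip: power2_eq_square)

lemma mCS_0 [simp]: "mC X 0 = 1" "mS X 0 = 0"
  by (simp_all add: mC_def mS_def)

lemma mC_add: "mC X (s + t) = mC X s * mC X t + momega X * momega X * (mS X s * mS X t)"
  by (simp add: mC_def mS_def cosh_add distrib_right)

lemma mS_add: "mS X (s + t) = mS X s * mC X t + mC X s * mS X t"
  by (simp add: mC_def mS_def sinh_add distrib_right add_divide_distrib)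

lemma mC_sq: "mC X t * mC X t - momega X * momega X * (mS X t * mS X t) = 1"
proof (cases "momega X = 0")
  case False
  then show ?thesis
    using cosh_square_eq[of "of_real t * momega X"] by (simp add: mC_def mS_def power2_eq_square)
qed (simp add: mC_def mS_def)

lemma mexp_in_SL2: "mexp X t \<in> SL2"
proof -
  have "(mC X t + mS X t * ea X) * (mC X t - mS X t * ea X) - mS X t * eb X * (mS X t * ec X)
      = mC X t * mC X t - (ea X * ea X + eb X * ec X) * (mS X t * mS X t)"
    by (simp add: algebra_simps)
  then show ?thesis
    using mC_sq[of X t] by (simp add: mexp_def momega_sq)
qed

lemma mexp_add: "mexp X (s + t) = mmult (mexp X s) (mexp X t)"
  by (simp add: mexp_def mC_add mS_add momega_sq algebra_simps)

lemma mexp_0 [simp]: "mexp X 0 = m1mat"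
  by (simp add: mexp_def m1mat_def)

lemma madj_mexp: "madj (mexp X t) = mexp X (- t)"
  by (simp add: mexp_def mC_def mS_def)

lemma cosh_sinh_deriv:
  "((\<lambda>t. cosh (of_real t * w)) has_vector_derivative w * sinh (of_real t * w)) (at t)"
  "((\<lambda>t. sinh (of_real t * w)) has_vector_derivative w * cosh (of_real t * w)) (at t)" for w :: complex
proof -
  have "((\<lambda>z. cosh (z * w)) has_field_derivative sinh (of_real t * w) * w) (at (of_real t))"
    "((\<lambda>z. sinh (z * w)) has_field_derivative cosh (of_real t * w) * w) (at (of_real t))"
    by (auto intro!: derivative_eq_intros)
  from this[THEN has_vector_derivative_real_field]
  show "((\<lambda>t. cosh (of_real t * w)) has_vector_derivative w * sinh (of_real t * w)) (at t)"
    "((\<lambda>t. sinh (of_real t * w)) has_vector_derivative w * cosh (of_real t * w)) (at t)"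
    by (simp_all add: mult.commute)
qed

lemma mC_deriv: "(mC X has_vector_derivative momega X * momega X * mS X t) (at t)"
  using cosh_sinh_deriv(1)[of "momega X" t] unfolding mC_def[abs_def] mS_def by auto

lemma mS_deriv: "(mS X has_vector_derivative mC X t) (at t)"
proof (cases "momega X = 0")
  case True
  have "((\<lambda>t. complex_of_real t) has_vector_derivative 1) (at t)"
    using has_vector_derivative_of_real[OF DERIV_ident] by simp
  then show ?thesis using True unfolding mC_def mS_def[abs_def] by simp
next
  case False
  have "((\<lambda>t. sinh (of_real t * momega X) / momega X) has_vector_derivative
      momega X * cosh (of_real t * momega X) / momega X) (at t)"
    by (rule has_vector_derivative_divide[OF cosh_sinh_deriv(2)])
  then show ?thesis using False unfolding mC_def mS_def[abs_def] by simp
qed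

text \<open>Differentiating all four complex entries, rather than the six real chart coordinates,
  turns the product rule into matrix multiplication.\<close>

definition has_mderiv :: "(real \<Rightarrow> coords) \<Rightarrow> coords \<Rightarrow> real filter \<Rightarrow> bool" where
  "has_mderiv u D F \<longleftrightarrow> ((\<lambda>t. ea (u t)) has_vector_derivative ea D) F \<and>
     ((\<lambda>t. eb (u t)) has_vector_derivative eb D) F \<and>
     ((\<lambda>t. ec (u t)) has_vector_derivative ec D) F \<and>
     ((\<lambda>t. ed (u t)) has_vector_derivative ed D) F"

definition madd :: "coords \<Rightarrow> coords \<Rightarrow> coords" where
  "madd x y = mk (ea x + ea y) (eb x + eb y) (ec x + ec y) (ed x + ed y)"

lemma has_mderiv_mult:
  assumes "has_mderiv u D (at t within T)" "has_mderiv v E (at t within T)"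
  shows "has_mderiv (\<lambda>t. mmult (u t) (v t)) (madd (mmult (u t) E) (mmult D (v t))) (at t within T)"
  using assms unfolding has_mderiv_def mmult_def madd_def mk_sel
  by (auto intro!: derivative_eq_intros has_vector_derivative_mult simp: algebra_simps)

lemma has_mderiv_const: "has_mderiv (\<lambda>t. c) (mk 0 0 0 0) F"
  unfolding has_mderiv_def by simp

lemma has_mderiv_madj: "has_mderiv u D F \<Longrightarrow> has_mderiv (\<lambda>t. madj (u t)) (madj D) F"
  unfolding has_mderiv_def madj_def by (auto intro!: has_vector_derivative_minus)

text \<open>Rebuilds the matrix from its chart coordinates, in which the fourth entry is 0.\<close>

definition traceless :: "coords \<Rightarrow> coords" where
  "traceless X = mk (ea X) (eb X) (ec X) (- ea X)"

lemma traceless_sel [simp]: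
  "ea (traceless X) = ea X" "eb (traceless X) = eb X" "ec (traceless X) = ec X" "ed (traceless X) = - ea X"
  by (simp_all add: traceless_def)

lemma mexp_deriv: "has_mderiv (mexp X) (mmult (traceless X) (mexp X t)) (at t)"
proof -
  have S: "((\<lambda>t. mS X t * z) has_vector_derivative mC X t * z) (at t)" for z
    by (rule has_vector_derivative_mult_left[OF mS_deriv])
  have "((\<lambda>t. mC X t + mS X t * ea X) has_vector_derivative
      momega X * momega X * mS X t + mC X t * ea X) (at t)"
    "((\<lambda>t. mC X t - mS X t * ea X) has_vector_derivative
      momega X * momega X * mS X t - mC X t * ea X) (at t)"
    by (rule has_vector_derivative_add[OF mC_deriv S] has_vector_derivative_diff[OF mC_deriv S])+
  with S[of "eb X"] S[of "ec X"] show ?thesis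
    unfolding has_mderiv_def mexp_def[abs_def] mmult_def mk_sel traceless_sel momega_sq
    by (simp add: algebra_simps)
qed

lemma mexp_deriv_0: "has_mderiv (mexp X) (traceless X) (at 0)"
  using mexp_deriv[of X 0] by (simp add: has_mderiv_def mmult_def m1mat_def)

lemma chart_a_coord: "snd chart_a x = mk (ea x) (eb x) (ec x) 0"
  by (simp add: chart_a_def)

lemma less_6_cases: "(i::nat) < 6 \<Longrightarrow> i \<in> {0,1,2,3,4,5}"
  by auto

lemma has_vector_derivative_Re_Im:
  assumes "(f has_vector_derivative D) F"
  shows "((\<lambda>t. Re (f t)) has_real_derivative Re D) F" "((\<lambda>t. Im (f t)) has_real_derivative Im D) F"
  using bounded_linear.has_vector_derivative[OF bounded_linear_Re assms]
    bounded_linear.has_vector_derivative[OF bounded_linear_Im assms]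
  by (simp_all add: has_real_derivative_iff_has_vector_derivative)

lemma has_mderiv_chart:
  assumes "has_mderiv u D F" "i < 6"
  shows "((\<lambda>t. snd chart_a (u t) i) has_real_derivative mk (ea D) (eb D) (ec D) 0 i) F"
  using assms less_6_cases[OF assms(2)] unfolding has_mderiv_def chart_a_coord
  by (auto simp: mk_def intro: has_vector_derivative_Re_Im)

lemma has_vector_derivative_ReIm_I:
  assumes "((\<lambda>t. Re (f t)) has_real_derivative Re D) F" "((\<lambda>t. Im (f t)) has_real_derivative Im D) F"
  shows "(f has_vector_derivative D) F"
proof -
  have "((\<lambda>t. of_real (Re (f t)) + \<i> * of_real (Im (f t))) has_vector_derivative
      of_real (Re D) + \<i> * of_real (Im D)) F"
    by (intro has_vector_derivative_add has_vector_derivative_mult_right has_vector_derivative_of_real)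
      (use assms in auto)
  then show ?thesis by (simp add: complex_eq[symmetric])
qed

lemma continuous_on_mexp: "continuous_on U (mexp X)"
proof -
  have "continuous_on U (mC X)" "continuous_on U (mS X)"
    by (auto intro!: continuous_at_imp_continuous_on has_vector_derivative_continuous mC_deriv mS_deriv)
  then show ?thesis
    unfolding mexp_def[abs_def]
    by (intro continuous_on_mk continuous_on_add continuous_on_diff continuous_on_mult continuous_on_const)
qed

lemma one_param_mexp:
  assumes "\<And>i. i < 6 \<Longrightarrow> X i = Y i"
  shows "one_param_subgroup S0 X (mexp Y)"
proof -
  have "mk (ea Y) (eb Y) (ec Y) 0 i = X i" if "i < 6" for i
    using less_6_cases[OF that] assms by (auto simp: mk_def ea_def eb_def ec_def)
  then show ?thesis
    unfolding one_param_subgroup_def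
    using mexp_in_SL2 mexp_add continuous_on_mexp has_mderiv_chart[OF mexp_deriv_0[of Y]] by auto
qed

lemma has_vector_derivative_shift:
  assumes "(f has_vector_derivative D) (at 0)"
  shows "((\<lambda>s. f (s - t)) has_vector_derivative D) (at t)"
proof -
  have "((\<lambda>s. s - t) has_vector_derivative 1) (at t)"
    by (auto intro!: derivative_eq_intros)
  from vector_diff_chain_at[OF this, of f D] assms show ?thesis
    by (simp add: o_def)
qed

lemma zero_vector_derivative_const:
  fixes f :: "real \<Rightarrow> complex"
  assumes "\<And>t. (f has_vector_derivative 0) (at t)"
  shows "f t = f 0"
proof -
  obtain c where "\<And>x. x \<in> UNIV \<Longrightarrow> f x = c"
    using has_vector_derivative_zero_constant[of UNIV f] assms by (metis convex_UNIV)
  then show ?thesis by simp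
qed

text \<open>The definition of a one-parameter subgroup only gives the derivatives of the entries a,
  b, c. Near the identity the fourth entry is (1 + bc)/a; as b and c vanish at time 0, the numerator
  has derivative 0 there, and the quotient has derivative -a'.\<close>

lemma one_param_deriv_0:
  assumes u: "one_param_subgroup S0 X u"
  shows "has_mderiv u (traceless X) (at 0)"
proof -
  have SL: "u t \<in> SL2" for t
    using u by (auto simp: one_param_subgroup_def)
  have "\<forall>s t. u (s + t) = mmult (u s) (u t)"
    using u by (simp add: one_param_subgroup_def)
  from this[rule_format, of 0 0] have "u 0 = mmult (u 0) (u 0)"
    by simp
  then have "mmult (madj (u 0)) (u 0) = mmult (mmult (madj (u 0)) (u 0)) (u 0)"
    by (simp add: mmult_assoc)
  then have u0: "u 0 = m1mat"
    by (simp add: mmult_madj SL mmult_1)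
  have der: "((\<lambda>t. mk (ea (u t)) (eb (u t)) (ec (u t)) 0 i) has_real_derivative X i) (at 0)" if "i < 6" for i
    using u that by (auto simp: one_param_subgroup_def chart_a_coord)
  have D: "((\<lambda>t. ea (u t)) has_vector_derivative ea X) (at 0)"
    "((\<lambda>t. eb (u t)) has_vector_derivative eb X) (at 0)"
    "((\<lambda>t. ec (u t)) has_vector_derivative ec X) (at 0)"
    using der[of 0] der[of 1] der[of 2] der[of 3] der[of 4] der[of 5]
    by (auto intro!: has_vector_derivative_ReIm_I simp: mk_def ea_def[of X] eb_def[of X] ec_def[of X])
  have contu: "continuous_on UNIV u"
    using u by (simp add: one_param_subgroup_def)
  let ?U = "{t. ea (u t) \<noteq> 0}"
  have U: "open ?U" "0 \<in> ?U"
    using u0 by (auto intro!: open_Collect_neq continuous_on_entries contu continuous_on_const simp: m1mat_def)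
  have "((\<lambda>t. 1 + eb (u t) * ec (u t)) has_derivative (\<lambda>h. 0)) (at 0)"
    using has_vector_derivative_add[OF has_vector_derivative_const has_vector_derivative_mult[OF D(2,3)], of 1] u0
    by (simp add: has_vector_derivative_def m1mat_def)
  moreover have "((\<lambda>t. ea (u t)) has_derivative (\<lambda>h. h *\<^sub>R ea X)) (at 0)"
    using D(1) by (simp add: has_vector_derivative_def)
  ultimately have "((\<lambda>t. (1 + eb (u t) * ec (u t)) / ea (u t)) has_vector_derivative - ea X) (at 0)"
    using has_derivative_divide'[of "\<lambda>t. 1 + eb (u t) * ec (u t)" "\<lambda>h. 0" 0 UNIV "\<lambda>t. ea (u t)" "\<lambda>h. h *\<^sub>R ea X"] u0
    by (simp add: has_vector_derivative_def m1mat_def)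
  moreover have "(1 + eb (u t) * ec (u t)) / ea (u t) = ed (u t)" if "t \<in> ?U" for t
    using SL[of t] that by (simp add: SL2_def mdet_def field_simps)
  ultimately have "((\<lambda>t. ed (u t)) has_vector_derivative - ea X) (at 0)"
    by (rule has_vector_derivative_transform_within_open[OF _ U])
  with D show ?thesis by (simp add: has_mderiv_def)
qed

lemma has_mderiv_cong: "has_mderiv u D F \<Longrightarrow> ea D = ea E \<Longrightarrow> eb D = eb E \<Longrightarrow> ec D = ec E \<Longrightarrow> ed D = ed E \<Longrightarrow> has_mderiv u E F"
  by (simp add: has_mderiv_def)

text \<open>The homomorphism property carries the derivative at 0 to every time, so u' = uX. Then
  u(t) exp(-tX) has derivative zero and is constantly the identity.\<close>

lemma one_param_unique:
  assumes u: "one_param_subgroup S0 X u"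
  shows "u t = mexp X t"
proof -
  have SL: "u t \<in> SL2" for t
    using u by (auto simp: one_param_subgroup_def)
  have add: "u (s + t) = mmult (u s) (u t)" for s t
    using u by (simp add: one_param_subgroup_def)
  have du: "has_mderiv u (mmult (u t) (traceless X)) (at t)" for t
  proof -
    have "has_mderiv (\<lambda>s. u (s - t)) (traceless X) (at t)"
      using one_param_deriv_0[OF u] unfolding has_mderiv_def
      by (auto intro!: has_vector_derivative_shift[where f = "\<lambda>t. ea (u t)"] has_vector_derivative_shift[where f = "\<lambda>t. eb (u t)"]
        has_vector_derivative_shift[where f = "\<lambda>t. ec (u t)"] has_vector_derivative_shift[where f = "\<lambda>t. ed (u t)"])
    from has_mderiv_mult[OF has_mderiv_const this, of "u t"]
    have "has_mderiv (\<lambda>s. mmult (u t) (u (s - t))) (mmult (u t) (traceless X)) (at t)"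
      by (rule has_mderiv_cong) (simp_all add: madd_def mmult_def)
    moreover have "mmult (u t) (u (s - t)) = u s" for s
      using add[of t "s - t"] by simp
    ultimately show ?thesis by simp
  qed
  define v where "v = (\<lambda>t. mmult (u t) (madj (mexp X t)))"
  have "has_mderiv v (mk 0 0 0 0) (at t)" for t
    unfolding v_def
    by (rule has_mderiv_cong[OF has_mderiv_mult[OF du has_mderiv_madj[OF mexp_deriv]]])
      (simp_all add: madd_def mmult_def madj_def traceless_def mexp_def algebra_simps)
  then have "ea (v t) = ea (v 0)" "eb (v t) = eb (v 0)" "ec (v t) = ec (v 0)" "ed (v t) = ed (v 0)"
    unfolding has_mderiv_def mk_sel by (auto intro: zero_vector_derivative_const)
  moreover have vSL: "v t \<in> SL2" for t
    unfolding v_def by (intro mmult_in_SL2 madj_in_SL2 mexp_in_SL2 SL)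
  ultimately have "v t = v 0"
    by (intro SL2_eqI)
  also have "v 0 = m1mat"
  proof -
    have "u 0 = mmult (u 0) (u 0)" using add[of 0 0] by simp
    then have "mmult (madj (u 0)) (u 0) = mmult (mmult (madj (u 0)) (u 0)) (u 0)"
      by (simp add: mmult_assoc)
    then have "u 0 = m1mat"
      by (simp add: mmult_madj SL mmult_1)
    then show ?thesis by (simp add: v_def m1mat_def)
  qed
  finally have "mmult (v t) (mexp X t) = mexp X t"
    by (simp add: mmult_1 mexp_in_SL2)
  then show ?thesis
    by (simp add: v_def mmult_assoc mmult_madj mexp_in_SL2 mmult_1 SL)
qed

lemma lie_exp_S0: "lie_exp S0 X = mexp X 1"
  unfolding lie_exp_def
proof (rule the_equality)
  show "\<exists>u. one_param_subgroup S0 X u \<and> mexp X 1 = u 1"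
    using one_param_mexp by blast
  show "g = mexp X 1" if "\<exists>u. one_param_subgroup S0 X u \<and> g = u 1" for g
    using that one_param_unique by blast
qed

text \<open>Because of the branch of \<open>csqrt\<close>, \<open>momega (smul t X)\<close> can be t
  or -t times \<open>momega X\<close>. Uniqueness of one-parameter subgroups avoids this: s ->
  \<open>mexp X (s * t)\<close> is the one with tangent vector tX.\<close>

lemma mexp_smul: "mexp (smul t X) 1 = mexp X t"
proof -
  have "((\<lambda>s. snd chart_a (mexp X (s * t)) i) has_real_derivative smul t X i) (at 0)" if i: "i < 6" for i
  proof -
    have "((\<lambda>s. s * t) has_real_derivative t) (at 0)"
      by (auto intro!: derivative_eq_intros)
    from DERIV_chain2[OF _ this, of "\<lambda>s. snd chart_a (mexp X s) i"] has_mderiv_chart[OF mexp_deriv_0[of X] i]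
    have "((\<lambda>s. snd chart_a (mexp X (s * t)) i) has_real_derivative
        mk (ea (traceless X)) (eb (traceless X)) (ec (traceless X)) 0 i * t) (at 0)"
      by simp
    also have "mk (ea (traceless X)) (eb (traceless X)) (ec (traceless X)) 0 i * t = smul t X i"
      using less_6_cases[OF i] unfolding traceless_sel by (auto simp: mk_def smul_def ea_def eb_def ec_def)
    finally show ?thesis .
  qed
  moreover have "continuous_on UNIV (\<lambda>s. mexp X (s * t))"
    by (rule continuous_on_compose2[OF continuous_on_mexp[of UNIV X]]) (auto intro!: continuous_intros)
  ultimately have "one_param_subgroup S0 (smul t X) (\<lambda>s. mexp X (s * t))"
    unfolding one_param_subgroup_def using mexp_in_SL2 mexp_add by (auto simp: distrib_right)
  from one_param_unique[OF this, of 1] show ?thesis by simp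
qed

lemma deriv_chart:
  assumes "has_mderiv u D (at t)" "ea D = a" "eb D = b" "ec D = c"
  shows "(\<lambda>i. if i < gdim S0 then deriv (\<lambda>t. snd (chart1 S0) (u t) i) t else 0) = mk a b c 0"
proof
  fix i
  show "(if i < gdim S0 then deriv (\<lambda>t. snd (chart1 S0) (u t) i) t else 0) = mk a b c 0 i"
    using DERIV_imp_deriv[OF has_mderiv_chart[OF assms(1), of i]] assms(2-) by simp
qed

definition mconj :: "coords \<Rightarrow> coords \<Rightarrow> coords" where
  "mconj g Y = mmult (mmult g (traceless Y)) (madj g)"

lemma Ad_S0:
  assumes "g \<in> SL2"
  shows "Ad S0 g Y = mk (ea (mconj g Y)) (eb (mconj g Y)) (ec (mconj g Y)) 0"
proof -
  have "has_mderiv (\<lambda>s. mmult (mmult g (mexp Y s)) (madj g)) (mconj g Y) (at 0)"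
    by (rule has_mderiv_cong[OF has_mderiv_mult[OF has_mderiv_mult[OF has_mderiv_const mexp_deriv_0] has_mderiv_const]])
      (simp_all add: madd_def mmult_def mconj_def)
  from deriv_chart[OF this refl refl refl] show ?thesis
    using assms unfolding Ad_def by (simp add: lie_exp_S0 mexp_smul cong: if_cong)
qed

lemma bracket_S0:
  "bracket S0 X Y = mk (eb X * ec Y - ec X * eb Y) (2 * (ea X * eb Y - eb X * ea Y))
     (2 * (ec X * ea Y - ea X * ec Y)) 0"
proof -
  have *: "has_mderiv (\<lambda>s. mconj (mexp X s) Y)
      (madd (mmult (traceless X) (traceless Y)) (mmult (traceless Y) (madj (traceless X)))) (at 0)"
    unfolding mconj_def
    by (rule has_mderiv_cong[OF has_mderiv_mult[OF has_mderiv_mult[OF mexp_deriv_0 has_mderiv_const] has_mderiv_madj[OF mexp_deriv_0]]])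
      (simp_all add: madd_def mmult_def madj_def m1mat_def)
  have "Ad S0 (lie_exp S0 (smul s X)) Y i = snd (chart1 S0) (mconj (mexp X s) Y) i" for s i
    by (simp add: lie_exp_S0 mexp_smul Ad_S0 mexp_in_SL2 chart_a_coord)
  then show ?thesis
    using deriv_chart[OF *, of "eb X * ec Y - ec X * eb Y" "2 * (ea X * eb Y - eb X * ea Y)" "2 * (ec X * ea Y - ea X * ec Y)"]
    unfolding bracket_def by (simp add: madd_def mmult_def madj_def algebra_simps cong: if_cong)
qed

section \<open>Killing form, semisimplicity and centre\<close>

lemma unit_coord_entries:
  "ea (unit_coord i) = (if i = 0 then 1 else if i = 1 then \<i> else 0)"
  "eb (unit_coord i) = (if i = 2 then 1 else if i = 3 then \<i> else 0)"
  "ec (unit_coord i) = (if i = 4 then 1 else if i = 5 then \<i> else 0)"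
  by (auto simp: unit_coord_def ea_def eb_def ec_def complex_eq_iff)

text \<open>The Killing form of sl(2,C) over the complex numbers is 4 tr(XY), and a trace over the
  reals is twice the real part of the complex trace.\<close>

lemma killing_S0: "killing S0 X Y = 8 * Re (2 * ea X * ea Y + eb X * ec Y + ec X * eb Y)"
proof -
  have 6: "{..<6::nat} = {0,1,2,3,4,5}" by auto
  show ?thesis
    unfolding killing_def S0_sel 6 bracket_S0
    by (simp add: unit_coord_entries, simp add: mk_def algebra_simps)
qed

lemma lie_algebra_S0: "lie_algebra S0 = {x. \<forall>i\<ge>6. x i = 0}"
  by (auto simp: lie_algebra_def topspace_Euclidean_space)

lemma zero_entries [simp]: "ea 0 = 0" "eb 0 = 0" "ec 0 = 0" "ed 0 = 0"
  by (simp_all add: ea_def eb_def ec_def ed_def zero_fun_def complex_eq_iff)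

lemma lie_algebra_eqI:
  "x \<in> lie_algebra S0 \<Longrightarrow> y \<in> lie_algebra S0 \<Longrightarrow> ea x = ea y \<Longrightarrow> eb x = eb y \<Longrightarrow> ec x = ec y \<Longrightarrow> x = y"
  using mk_eta6[of x] mk_eta6[of y] unfolding lie_algebra_S0 mem_Collect_eq by metis

lemma mk_in_lie_algebra [simp]: "mk a b c 0 \<in> lie_algebra S0"
  by (simp add: lie_algebra_S0)

lemma zero_in_lie_algebra [simp]: "0 \<in> lie_algebra S0"
  by (simp add: lie_algebra_S0)

lemma semisimple_S0: "semisimple S0"
  unfolding semisimple_def
proof (intro ballI impI)
  fix X assume X: "X \<in> lie_algebra S0" and 0: "\<forall>Y\<in>lie_algebra S0. killing S0 X Y = 0"
  \<comment> \<open>The second argument is the adjoint matrix of \<open>X\<close>, at which the form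
    is 8 times the sum of the squared moduli of the four entries.\<close>
  have "killing S0 X (mk (cnj (ea X)) (cnj (ec X)) (cnj (eb X)) 0) = 0"
    using 0 by simp
  then have "2 * (cmod (ea X))\<^sup>2 + (cmod (eb X))\<^sup>2 + (cmod (ec X))\<^sup>2 = 0"
    unfolding killing_S0 cmod_power2 by (simp add: power2_eq_square algebra_simps)
  moreover have "0 \<le> (cmod (ea X))\<^sup>2" "0 \<le> (cmod (eb X))\<^sup>2" "0 \<le> (cmod (ec X))\<^sup>2"
    by simp_all
  ultimately have "(cmod (ea X))\<^sup>2 = 0" "(cmod (eb X))\<^sup>2 = 0" "(cmod (ec X))\<^sup>2 = 0"
    by linarith+
  then show "X = 0"
    by (intro lie_algebra_eqI X) simp_all
qed

lemma finite_centre_S0: "finite (group_centre S0)"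
proof (rule finite_subset)
  show "group_centre S0 \<subseteq> {mk 1 0 0 1, mk (-1) 0 0 (-1)}"
  proof
    fix z assume "z \<in> group_centre S0"
    then have z: "z \<in> SL2" and comm: "\<And>g. g \<in> SL2 \<Longrightarrow> mmult z g = mmult g z"
      by (auto simp: group_centre_def)
    obtain a b c d where zm: "z = mk a b c d" and det: "a * d - b * c = 1"
      using z by (rule SL2_cases)
    have "c = 0" "a = d"
      using comm[of "mk 1 1 0 1"] by (auto simp: zm)
    moreover have "b = 0"
      using comm[of "mk 1 0 1 1"] by (auto simp: zm)
    ultimately have "a * a = 1" using det by simp
    then have "a = 1 \<or> a = -1" by (simp add: square_eq_1_iff)
    then show "z \<in> {mk 1 0 0 1, mk (-1) 0 0 (-1)}"
      using \<open>c = 0\<close> \<open>a = d\<close> \<open>b = 0\<close> by (auto simp: zm)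
  qed
qed simp

subsection \<open>Cartan and Iwasawa decompositions\<close>

lemma SU2_cases:
  assumes "k \<in> SU2"
  obtains p q where "k = mk p q (- cnj q) (cnj p)" "p * cnj p + q * cnj q = 1"
proof -
  have k: "k \<in> SL2" "ed k = cnj (ea k)" "ec k = - cnj (eb k)" using assms by (auto simp: SU2_def)
  show ?thesis
  proof
    show "k = mk (ea k) (eb k) (- cnj (eb k)) (cnj (ea k))"
      using SL2_eta[OF k(1)] k(2,3) by simp
    show "ea k * cnj (ea k) + eb k * cnj (eb k) = 1"
      using k by (simp add: SL2_def mdet_def mult.commute)
  qed
qed

lemma mk_in_SU2 [simp]: "mk p q (- cnj q) (cnj p) \<in> SU2 \<longleftrightarrow> p * cnj p + q * cnj q = 1"
  by (simp add: SU2_def)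

lemma SU2_subset: "SU2 \<subseteq> SL2"
  by (auto simp: SU2_def)

lemma madj_in_SU2: "k \<in> SU2 \<Longrightarrow> madj k \<in> SU2"
  unfolding SU2_def by (simp add: madj_in_SL2) (simp add: madj_def)

lemma mmult_in_SU2: "k \<in> SU2 \<Longrightarrow> l \<in> SU2 \<Longrightarrow> mmult k l \<in> SU2"
  unfolding SU2_def by (simp add: mmult_in_SL2) (simp add: mmult_def)

lemma m1mat_in_SU2: "m1mat \<in> SU2"
  by (simp add: SU2_def m1mat_def)

lemma subgroup_SU2: "subgroup SU2 S0"
  by (rule group.subgroupI[OF group_S0])
    (use SU2_subset m1mat_in_SU2 in \<open>auto simp: madj_in_SU2 mmult_in_SU2\<close>)

lemma norm_pair_sq: "(norm (v :: complex \<times> complex))\<^sup>2 = (cmod (fst v))\<^sup>2 + (cmod (snd v))\<^sup>2"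
  by (simp add: norm_prod_def)

lemma norm_pair_sq_complex:
  "complex_of_real ((norm (v :: complex \<times> complex))\<^sup>2) = fst v * cnj (fst v) + snd v * cnj (snd v)"
  by (simp add: norm_pair_sq complex_norm_square[symmetric])

lemma ku_in_SU2: "ku v \<in> SU2"
proof (cases "v = 0")
  case False
  let ?n = "complex_of_real (norm v)"
  have n: "?n \<noteq> 0" using False by simp
  have "fst v * cnj (fst v) + snd v * cnj (snd v) = ?n * ?n"
    using norm_pair_sq_complex[of v] by (simp add: power2_eq_square)
  then have "(fst v / ?n) * cnj (fst v / ?n) + (- cnj (snd v) / ?n) * cnj (- cnj (snd v) / ?n) = 1"
    using n by (simp add: field_simps)
  moreover have "ku v = mk (fst v / ?n) (- cnj (snd v) / ?n) (- cnj (- cnj (snd v) / ?n)) (cnj (fst v / ?n))"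
    using False by (simp add: ku_def scaleR_conv_of_real divide_inverse mult.commute)
  ultimately show ?thesis by (simp only: mk_in_SU2)
qed (simp add: ku_def m1mat_in_SU2)

lemma a_elt_S0: "a_elt S0 t = mk (of_real (exp (t/2))) 0 0 (of_real (exp (-t/2)))"
proof -
  have "csqrt ((1/2)\<^sup>2) = 1/2"
    by (rule csqrt_square) simp
  then have w: "momega (mk (1/2) 0 0 0) = 1/2"
    by (simp add: momega_def)
  have "a_elt S0 t = mexp (mk (1/2) 0 0 0) t"
    by (simp add: a_elt_def lie_exp_S0 mexp_smul)
  also have "\<dots> = mk (of_real (exp (t/2))) 0 0 (of_real (exp (-t/2)))"
    unfolding mexp_def mC_def mS_def w
    by (simp add: exp_of_real[symmetric] cosh_def sinh_def field_simps scaleR_conv_of_real)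
  finally show ?thesis .
qed

lemma a_elt_mult: "mmult (a_elt S0 s) (a_elt S0 t) = a_elt S0 (s + t)"
  by (simp add: a_elt_S0 exp_add[symmetric] add_divide_distrib flip: of_real_mult of_real_add)

lemma a_elt_in_SL2 [simp]: "a_elt S0 t \<in> SL2"
  by (simp add: a_elt_S0 exp_add[symmetric] flip: of_real_mult)

lemma madj_a_elt: "madj (a_elt S0 t) = a_elt S0 (- t)"
  by (simp add: a_elt_S0)

text \<open>The coordinate \<open>z\<close> of \<open>psi\<close>: since the second column is z v
  plus a vector orthogonal to v, its inner product with the first column v, divided by the squared
  norm of v, is z.\<close>

definition zc :: "coords \<Rightarrow> complex" where
  "zc g = (cnj (ea g) * eb g + cnj (ec g) * ed g) / of_real ((norm (ea g, ec g))\<^sup>2)"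

lemma SL2_column_nonzero: "g \<in> SL2 \<Longrightarrow> (ea g, ec g) \<noteq> 0"
  by (auto simp: SL2_def mdet_def zero_prod_def)

lemma scaleR_divide: "z /\<^sub>R r = z / of_real r" for z :: complex
  by (simp add: scaleR_conv_of_real divide_inverse)

lemma psi_eq:
  "v \<noteq> 0 \<Longrightarrow> psi (v, z) = mk (fst v) (- cnj (snd v) / of_real ((norm v)\<^sup>2) + z * fst v)
     (snd v) (cnj (fst v) / of_real ((norm v)\<^sup>2) + z * snd v)"
  by (simp add: psi_def scaleR_divide)

lemma ku_eq:
  "v \<noteq> 0 \<Longrightarrow> ku v = mk (fst v / of_real (norm v)) (- cnj (snd v) / of_real (norm v))
     (snd v / of_real (norm v)) (cnj (fst v) / of_real (norm v))"
  by (simp add: ku_def scaleR_divide)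

lemma psi_zc: assumes "g \<in> SL2" shows "psi ((ea g, ec g), zc g) = g"
proof -
  obtain a b c d where g: "g = mk a b c d" and det: "a * d - b * c = 1"
    using assms by (rule SL2_cases)
  let ?n = "complex_of_real ((norm (a, c))\<^sup>2)"
  have nz: "(a, c) \<noteq> 0" using SL2_column_nonzero[OF assms] by (simp add: g)
  then have n: "?n \<noteq> 0" by simp
  have nn: "?n = a * cnj a + c * cnj c" using norm_pair_sq_complex[of "(a,c)"] by simp
  have ad: "a * d = 1 + b * c" using det by (simp add: algebra_simps)
  have "a * (cnj a * b + cnj c * d) = b * (a * cnj a + c * cnj c) + cnj c"
  proof -
    have "a * (cnj a * b + cnj c * d) = a * cnj a * b + cnj c * (a * d)" by (simp add: algebra_simps)
    then show ?thesis by (simp add: ad algebra_simps)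
  qed
  then have "a * (cnj a * b + cnj c * d) - cnj c = b * ?n"
    unfolding nn by simp
  moreover have "- cnj c / ?n + (cnj a * b + cnj c * d) / ?n * a = (a * (cnj a * b + cnj c * d) - cnj c) / ?n"
    by (simp add: diff_divide_distrib mult.commute)
  ultimately have 1: "- cnj c / ?n + (cnj a * b + cnj c * d) / ?n * a = b"
    using n by simp
  have "c * (cnj a * b + cnj c * d) = d * (a * cnj a + c * cnj c) - cnj a"
  proof -
    have "c * (cnj a * b + cnj c * d) = cnj a * (b * c) + c * cnj c * d" by (simp add: algebra_simps)
    also have "b * c = a * d - 1" using ad by simp
    finally show ?thesis by (simp add: algebra_simps)
  qed
  then have "c * (cnj a * b + cnj c * d) + cnj a = d * ?n"
    unfolding nn by simp
  moreover have "cnj a / ?n + (cnj a * b + cnj c * d) / ?n * c = (c * (cnj a * b + cnj c * d) + cnj a) / ?n"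
    by (simp add: add_divide_distrib distrib_left mult_ac)
  ultimately have 2: "cnj a / ?n + (cnj a * b + cnj c * d) / ?n * c = d"
    using n by simp
  show ?thesis
    unfolding g zc_def mk_sel psi_eq[OF nz] fst_conv snd_conv 1 2 ..
qed

lemma psi_entries:
  assumes "v \<noteq> 0"
  shows "ea (psi (v, z)) = fst v" "ec (psi (v, z)) = snd v"
  unfolding psi_eq[OF assms] by simp_all

lemma psi_Iwasawa:
  assumes "v \<noteq> 0"
  shows "psi (v, z) = mmult (mmult (ku v) (a_elt S0 (2 * ln (norm v)))) (mk 1 z 0 1)"
proof -
  have n: "norm v > 0" using assms by simp
  have e: "exp (2 * ln (norm v) / 2) = norm v" "exp (- (2 * ln (norm v)) / 2) = inverse (norm v)"
    using exp_ln[OF n] exp_minus[of "ln (norm v)"] by simp_all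
  have a: "a_elt S0 (2 * ln (norm v)) = mk (of_real (norm v)) 0 0 (1 / of_real (norm v))"
    unfolding a_elt_S0 e by (simp add: divide_inverse)
  show ?thesis
    unfolding psi_eq[OF assms] ku_eq[OF assms] a mmult_mk using n
    by (simp add: power2_eq_square field_simps)
qed

lemma ku_in_SL2: "ku v \<in> SL2"
  using ku_in_SU2 SU2_subset by blast

lemma psi_in_SL2: "psi w \<in> SL2"
proof (cases "fst w = 0")
  case True
  then show ?thesis by (simp add: psi_def split_beta m1mat_in_SL2)
next
  case False
  then show ?thesis
    using psi_Iwasawa[OF False, of "snd w"] by (simp add: mmult_in_SL2 ku_in_SL2)
qed

lemma root_space_S0:
  "root_space S0 r = {mk a b c 0 | a b c. 0 = of_real r * a \<and> b = of_real r * b \<and> - c = of_real r * c}"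
proof -
  have "smul r (mk a b c 0) = mk (of_real r * a) (of_real r * b) (of_real r * c) 0" for a b c
    by (rule ext) (simp add: smul_def mk_def)
  then have *: "bracket S0 (Hg S0) (mk a b c 0) = smul r (mk a b c 0) \<longleftrightarrow>
      0 = of_real r * a \<and> b = of_real r * b \<and> - c = of_real r * c" for a b c
    by (simp add: bracket_S0)
  show ?thesis
  proof safe
    fix Y assume Y: "Y \<in> root_space S0 r"
    then have "Y = mk (ea Y) (eb Y) (ec Y) 0"
      using mk_eta6[of Y] by (simp add: root_space_def lie_algebra_S0)
    with Y * show "\<exists>a b c. Y = mk a b c 0 \<and> 0 = of_real r * a \<and> b = of_real r * b \<and> - c = of_real r * c"
      unfolding root_space_def by (metis (mono_tags, lifting) mem_Collect_eq)
  qed (use * in \<open>auto simp: root_space_def\<close>)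
qed

lemma root_space_pos: "r > 0 \<Longrightarrow> root_space S0 r = (if r = 1 then {mk 0 b 0 0 | b. True} else {0})"
proof -
  assume r: "r > 0"
  have c: "- c = of_real r * c \<longleftrightarrow> c = 0" for c :: complex
  proof -
    have "of_real r + 1 \<noteq> (0::complex)" using r by (simp add: complex_eq_iff)
    moreover have "- c = of_real r * c \<longleftrightarrow> (of_real r + 1) * c = 0" using eq_neg_iff_add_eq_0[of "of_real r * c" c] by (auto simp: distrib_right)
    ultimately show ?thesis by simp
  qed
  have b: "b = of_real r * b \<longleftrightarrow> r = 1 \<or> b = 0" for b :: complex
    by auto
  have "mk 0 0 0 0 = 0"
    by (rule ext) (simp add: mk_def)
  then show ?thesis
    unfolding root_space_S0 c b using r by auto
qed

lemma Ngp_S0: "Ngp S0 = {mk 1 z 0 1 | z. True}"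
proof -
  have sub: "coords.subspace {mk 0 b 0 0 | b. True}"
    unfolding coords.subspace_def
  proof (intro conjI ballI allI)
    show "0 \<in> {mk 0 b 0 0 |b. True}" by (rule CollectI, rule exI[of _ 0]) (auto simp: mk_def)
    show "x + y \<in> {mk 0 b 0 0 |b. True}" if xy: "x \<in> {mk 0 b 0 0 |b. True}" "y \<in> {mk 0 b 0 0 |b. True}" for x y
    proof -
      obtain b b' where "x = mk 0 b 0 0" "y = mk 0 b' 0 0" using xy by blast
      then have "x + y = mk 0 (b + b') 0 0" by (auto simp: mk_def)
      then show ?thesis by blast
    qed
    show "smul c x \<in> {mk 0 b 0 0 |b. True}" if xx: "x \<in> {mk 0 b 0 0 |b. True}" for c x
    proof -
      obtain b where "x = mk 0 b 0 0" using xx by blast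
      then have "smul c x = mk 0 (of_real c * b) 0 0" by (auto simp: mk_def smul_def)
      then show ?thesis by blast
    qed
  qed
  have "(\<Union>r\<in>{0<..}. root_space S0 r) = {mk 0 b 0 0 | b. True}"
  proof
    have "mk 0 0 0 0 = 0" by (rule ext) (simp add: mk_def)
    then show "(\<Union>r\<in>{0<..}. root_space S0 r) \<subseteq> {mk 0 b 0 0 | b. True}"
      by (auto simp: root_space_pos split: if_splits)
    show "{mk 0 b 0 0 | b. True} \<subseteq> (\<Union>r\<in>{0<..}. root_space S0 r)"
      by (rule UN_I[of 1, THEN subsetI]) (auto simp: root_space_pos)
  qed
  then have "coords.span (\<Union>r\<in>{0<..}. root_space S0 r) = {mk 0 b 0 0 | b. True}"
    using sub by (simp add: coords.span_eq_iff)
  moreover have "lie_exp S0 (mk 0 b 0 0) = mk 1 b 0 1" for b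
    by (simp add: lie_exp_S0 mexp_def mC_def mS_def momega_def)
  ultimately show ?thesis
    unfolding Ngp_def by (simp add: full_SetCompr_eq image_image)
qed

text \<open>The unipotent factor does not affect the first column, which is therefore e^{t/2} times
  the first column of \<open>k\<close>, a unit vector. Its norm gives \<open>t\<close>, its
  direction gives \<open>k\<close>.\<close>

lemma Iwasawa_unique:
  assumes "k \<in> SU2" and g: "g = mmult (mmult k (a_elt S0 t)) (mk 1 z 0 1)"
  shows "t = 2 * ln (norm (ea g, ec g))" "k = ku (ea g, ec g)"
proof -
  obtain p q where k: "k = mk p q (- cnj q) (cnj p)" and pq: "p * cnj p + q * cnj q = 1"
    using assms(1) by (rule SU2_cases)
  have "complex_of_real ((cmod p)\<^sup>2 + (cmod q)\<^sup>2) = 1" using pq by (simp only: of_real_add complex_norm_square)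
  then have pq': "(cmod p)\<^sup>2 + (cmod q)\<^sup>2 = 1" by (simp only: of_real_eq_1_iff)
  have v: "ea g = p * of_real (exp (t/2))" "ec g = - cnj q * of_real (exp (t/2))"
    by (simp_all add: g k a_elt_S0)
  have "(norm (ea g, ec g))\<^sup>2 = ((cmod p)\<^sup>2 + (cmod q)\<^sup>2) * (exp (t/2))\<^sup>2"
    by (simp add: norm_pair_sq v norm_mult power_mult_distrib distrib_right)
  then have n: "norm (ea g, ec g) = exp (t/2)"
    using pq' by (simp add: power2_eq_iff_nonneg)
  then show "t = 2 * ln (norm (ea g, ec g))" by simp
  have "(ea g, ec g) \<noteq> 0" using n by (metis exp_not_eq_zero norm_zero)
  then show "k = ku (ea g, ec g)"
    using n unfolding ku_def k by (simp add: v scaleR_conv_of_real)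
qed

lemma Iwasawa_exists:
  assumes "g \<in> SL2"
  shows "g = mmult (mmult (ku (ea g, ec g)) (a_elt S0 (2 * ln (norm (ea g, ec g))))) (mk 1 (zc g) 0 1)"
  using psi_Iwasawa[OF SL2_column_nonzero[OF assms], of "zc g"] psi_zc[OF assms] by simp

lemma iwasawa_H_S0:
  assumes "g \<in> SL2" shows "iwasawa_H S0 g = 2 * ln (norm (ea g, ec g))"
  unfolding iwasawa_H_def
proof (rule the_equality)
  show "\<exists>k\<in>Kgp S0. \<exists>n\<in>Ngp S0. g = k \<otimes>\<^bsub>S0\<^esub> a_elt S0 (2 * ln (norm (ea g, ec g))) \<otimes>\<^bsub>S0\<^esub> n"
    using Iwasawa_exists[OF assms] ku_in_SU2 unfolding Ngp_S0 by auto
qed (use Iwasawa_unique(1) in \<open>auto simp: Ngp_S0\<close>)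

lemma iwasawa_K_S0:
  assumes "g \<in> SL2" shows "iwasawa_K S0 g = ku (ea g, ec g)"
  unfolding iwasawa_K_def
proof (rule the_equality)
  show "ku (ea g, ec g) \<in> Kgp S0 \<and> (\<exists>t. \<exists>n\<in>Ngp S0. g = ku (ea g, ec g) \<otimes>\<^bsub>S0\<^esub> a_elt S0 t \<otimes>\<^bsub>S0\<^esub> n)"
    using Iwasawa_exists[OF assms] ku_in_SU2 unfolding Ngp_S0 by auto
qed (use Iwasawa_unique(2) in \<open>auto simp: Ngp_S0\<close>)

text \<open>The squared Hilbert-Schmidt norm is K-biinvariant and equals 2 cosh r on K a_r K, so it
  serves as a polynomial substitute for the radial coordinate.\<close>

definition hsn :: "coords \<Rightarrow> real" where
  "hsn x = (cmod (ea x))\<^sup>2 + (cmod (eb x))\<^sup>2 + (cmod (ec x))\<^sup>2 + (cmod (ed x))\<^sup>2"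

lemma hsn_complex:
  "complex_of_real (hsn x) = ea x * cnj (ea x) + eb x * cnj (eb x) + ec x * cnj (ec x) + ed x * cnj (ed x)"
  by (simp add: hsn_def complex_norm_square[symmetric])

lemma hsn_mult_left: assumes "k \<in> SU2" shows "hsn (mmult k x) = hsn x"
proof -
  obtain p q where k: "k = mk p q (- cnj q) (cnj p)" and pq: "p * cnj p + q * cnj q = 1"
    using assms by (rule SU2_cases)
  have "complex_of_real (hsn (mmult k x)) = (p * cnj p + q * cnj q) * complex_of_real (hsn x)"
    unfolding hsn_complex by (simp add: k mmult_def algebra_simps)
  then show ?thesis using pq by (simp only: of_real_eq_iff mult_1)
qed

lemma hsn_mult_right: assumes "k \<in> SU2" shows "hsn (mmult x k) = hsn x"
proof -
  obtain p q where k: "k = mk p q (- cnj q) (cnj p)" and pq: "p * cnj p + q * cnj q = 1"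
    using assms by (rule SU2_cases)
  have "complex_of_real (hsn (mmult x k)) = (p * cnj p + q * cnj q) * complex_of_real (hsn x)"
    unfolding hsn_complex by (simp add: k mmult_def algebra_simps)
  then show ?thesis using pq by (simp only: of_real_eq_iff mult_1)
qed

lemma hsn_madj: "hsn (madj x) = hsn x"
  by (simp add: hsn_def madj_def)

text \<open>Expanding the two squares produces \<open>hsn x\<close> minus twice the real part of the
  determinant. Both squares vanish exactly when the matrix is unitary, so the minimum 2 of
  \<open>hsn\<close> characterises \<open>SU2\<close>.\<close>

lemma hsn_defect:
  assumes "x \<in> SL2"
  shows "hsn x = 2 + (cmod (ea x - cnj (ed x)))\<^sup>2 + (cmod (eb x + cnj (ec x)))\<^sup>2"
proof -
  have "Re (ea x * ed x - eb x * ec x) = 1"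
    using assms by (simp add: SL2_def mdet_def)
  then show ?thesis
    unfolding hsn_def cmod_power2 by (simp add: power2_eq_square algebra_simps)
qed

lemma hsn_ge_2: "x \<in> SL2 \<Longrightarrow> hsn x \<ge> 2"
  using hsn_defect[of x] by simp

lemma hsn_eq_2_imp_SU2: assumes "x \<in> SL2" "hsn x = 2" shows "x \<in> SU2"
proof -
  have "(cmod (ea x - cnj (ed x)))\<^sup>2 + (cmod (eb x + cnj (ec x)))\<^sup>2 = 0"
    using hsn_defect[OF assms(1)] assms(2) by simp
  then have "ea x = cnj (ed x)" "eb x + cnj (ec x) = 0"
    by (simp_all add: sum_power2_eq_zero_iff)
  then have "ed x = cnj (ea x)" "ec x = - cnj (eb x)"
    by (simp, metis add_eq_0_iff complex_cnj_cnj complex_cnj_minus)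
  then show ?thesis using assms(1) by (simp add: SU2_def)
qed

definition rad :: "coords \<Rightarrow> real" where
  "rad x = arcosh (hsn x / 2)"

lemma rad_nonneg: "x \<in> SL2 \<Longrightarrow> rad x \<ge> 0"
  using hsn_ge_2[of x] by (simp add: rad_def)

lemma cosh_rad: "x \<in> SL2 \<Longrightarrow> 2 * cosh (rad x) = hsn x"
  using hsn_ge_2[of x] by (simp add: rad_def)

text \<open>Diagonalises the positive matrix x x^*, whose entries are \<open>A\<close>,
  \<open>B\<close>, \<open>cnj B\<close>, \<open>D\<close>. Its determinant is 1 and its trace 2
  cosh r, so \<open>L\<close> = e^r is an eigenvalue. If \<open>k\<close> has the eigenvector as
  first column, the rows of k^{-1}x have squared norms \<open>L\<close> and 1/\<open>L\<close>;
  multiplying by a_{-r} makes both rows unit vectors, so \<open>hsn\<close> becomes 2 and the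
  remaining factor is unitary.\<close>

lemma Cartan:
  assumes "x \<in> SL2"
  obtains k l where "k \<in> SU2" "l \<in> SU2" "x = mmult (mmult k (a_elt S0 (rad x))) l"
proof -
  obtain a b c d where x: "x = mk a b c d" and det: "a * d - b * c = 1"
    using assms by (rule SL2_cases)
  define A where "A = a * cnj a + b * cnj b"
  define D where "D = c * cnj c + d * cnj d"
  define B where "B = a * cnj c + b * cnj d"
  define r where "r = rad x"
  define L where "L = complex_of_real (exp r)"
  have L0: "L \<noteq> 0" by (simp add: L_def)
  have N: "A + D = L + 1 / L"
  proof -
    have "A + D = complex_of_real (hsn x)"
      unfolding hsn_complex by (simp add: x A_def D_def algebra_simps)
    also have "\<dots> = complex_of_real (exp r + exp (- r))"
      unfolding cosh_rad[OF assms, symmetric] r_def by (simp add: cosh_def)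
    finally show ?thesis by (simp add: L_def exp_minus divide_inverse)
  qed
  have AD: "A * D - B * cnj B = 1"
  proof -
    have "A * D - B * cnj B = (a * d - b * c) * cnj (a * d - b * c)"
      by (simp add: A_def B_def D_def algebra_simps)
    then show ?thesis by (simp add: det)
  qed
  have cnjA: "cnj A = A" "cnj D = D" "cnj L = L"
    by (simp_all add: A_def D_def L_def mult.commute)
  \<comment> \<open>The vector (B, L - A) solves the first eigenvalue equation identically and the
    second one by the characteristic equation; if it is zero, the first basis vector is an
    eigenvector.\<close>
  obtain v where v: "v \<noteq> 0" "A * fst v + B * snd v = L * fst v" "cnj B * fst v + D * snd v = L * snd v"
  proof (cases "B = 0 \<and> L = A")
    case True
    then show ?thesis by (intro that[of "(1, 0)"]) (auto simp: zero_prod_def)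
  next
    case False
    have "(L - D) * (L - A) = L * L - (A + D) * L + A * D"
      by (simp add: algebra_simps)
    also have "\<dots> = A * D - 1"
      unfolding N using L0 by (simp add: field_simps)
    finally have "(L - D) * (L - A) = B * cnj B"
      using AD by (simp add: algebra_simps)
    then show ?thesis
      using False by (intro that[of "(B, L - A)"]) (auto simp: zero_prod_def algebra_simps)
  qed
  define k where "k = ku v"
  have k: "k \<in> SU2" by (simp add: k_def ku_in_SU2)
  define y where "y = mmult (madj k) x"
  have y: "y \<in> SL2"
    unfolding y_def using k assms SU2_subset by (auto intro: mmult_in_SL2 madj_in_SL2)
  let ?n = "complex_of_real (norm v)"
  have n0: "?n \<noteq> 0" using v(1) by simp
  have nn: "?n * ?n = fst v * cnj (fst v) + snd v * cnj (snd v)"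
    using norm_pair_sq_complex[of v] by (simp add: power2_eq_square)
  have row1: "ea y * cnj (ea y) + eb y * cnj (eb y) = L"
  proof -
    have ey: "?n * ea y = cnj (fst v) * a + cnj (snd v) * c" "?n * eb y = cnj (fst v) * b + cnj (snd v) * d"
      using v(1) n0 by (simp_all add: y_def k_def ku_def x scaleR_conv_of_real field_simps)
    have "(?n * ?n) * (ea y * cnj (ea y) + eb y * cnj (eb y))
        = (?n * ea y) * cnj (?n * ea y) + (?n * eb y) * cnj (?n * eb y)"
      by (simp add: algebra_simps)
    also have "\<dots> = cnj (fst v) * (A * fst v + B * snd v) + cnj (snd v) * (cnj B * fst v + D * snd v)"
      unfolding ey by (simp add: A_def B_def D_def algebra_simps)
    also have "\<dots> = (?n * ?n) * L"
      unfolding v(2,3) nn by (simp add: algebra_simps)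
    finally show ?thesis using n0 by simp
  qed
  have row2: "ec y * cnj (ec y) + ed y * cnj (ed y) = 1 / L"
  proof -
    have "complex_of_real (hsn y) = A + D"
      unfolding y_def hsn_mult_left[OF madj_in_SU2[OF k]] hsn_complex by (simp add: x A_def D_def algebra_simps)
    then show ?thesis
      using row1 unfolding hsn_complex N by (simp add: algebra_simps)
  qed
  define l where "l = mmult (a_elt S0 (- r)) y"
  have "complex_of_real (hsn l) = of_real (exp (- r)) * (ea y * cnj (ea y) + eb y * cnj (eb y))
      + of_real (exp r) * (ec y * cnj (ec y) + ed y * cnj (ed y))"
  proof -
    have "complex_of_real (exp (- r)) = of_real (exp (- r / 2)) * of_real (exp (- r / 2))"
      "complex_of_real (exp r) = of_real (exp (r / 2)) * of_real (exp (r / 2))"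
      by (simp_all flip: of_real_mult exp_add)
    then show ?thesis
      unfolding hsn_complex by (simp add: l_def mmult_def a_elt_S0 algebra_simps)
  qed
  also have "\<dots> = 2"
    unfolding row1 row2 using L0 by (simp add: L_def exp_minus flip: of_real_mult)
  finally have "hsn l = 2"
    by (metis of_real_eq_iff of_real_numeral)
  then have l: "l \<in> SU2"
    by (rule hsn_eq_2_imp_SU2[rotated]) (simp add: l_def mmult_in_SL2 y)
  have "mmult (mmult k (a_elt S0 r)) l = mmult k (mmult (mmult (a_elt S0 r) (a_elt S0 (- r))) y)"
    by (simp add: l_def mmult_assoc)
  also have "mmult (a_elt S0 r) (a_elt S0 (- r)) = m1mat"
    by (simp add: a_elt_mult) (simp add: a_elt_S0 m1mat_def)
  also have "mmult k (mmult m1mat y) = mmult (mmult k (madj k)) x"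
    by (simp add: mmult_1 y) (simp add: y_def mmult_assoc)
  also have "\<dots> = x"
    using k SU2_subset assms by (auto simp: mmult_madj mmult_1)
  finally show ?thesis
    using that[OF k l] by (simp add: r_def)
qed

subsection \<open>The symmetric pair\<close>

lemma connected_SL2: "connected SL2"
proof -
  let ?U = "(- {0 :: complex \<times> complex}) \<times> (UNIV :: complex set)"
  have "continuous_on ?U (\<lambda>w. mk (fst (fst w)) (- cnj (snd (fst w)) / of_real ((norm (fst w))\<^sup>2) + snd w * fst (fst w))
     (snd (fst w)) (cnj (fst (fst w)) / of_real ((norm (fst w))\<^sup>2) + snd w * snd (fst w)))"
    by (intro continuous_on_mk continuous_on_add continuous_on_divide continuous_on_mult continuous_on_minus
        continuous_on_cnj continuous_on_fst continuous_on_snd continuous_on_id continuous_on_of_real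
        continuous_on_power continuous_on_norm) auto
  then have "continuous_on ?U psi"
    by (rule continuous_on_eq) (auto simp: psi_eq)
  moreover have "connected ?U"
  proof (rule connected_Times)
    show "connected (- {0 :: complex \<times> complex})"
      by (rule connected_punctured_universe) simp
  qed (rule connected_UNIV)
  moreover have "psi ` ?U = SL2"
  proof
    show "psi ` ?U \<subseteq> SL2" using psi_in_SL2 by auto
    show "SL2 \<subseteq> psi ` ?U"
    proof
      fix g assume g: "g \<in> SL2"
      show "g \<in> psi ` ?U"
        by (rule image_eqI[of _ _ "((ea g, ec g), zc g)"]) (use psi_zc[OF g] SL2_column_nonzero[OF g] in auto)
    qed
  qed
  ultimately show ?thesis using connected_continuous_image[of ?U psi] by simp
qed

lemma not_compact_SL2: "\<not> compact SL2"
proof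
  assume "compact SL2"
  then have "compact (ea ` SL2)"
    by (rule compact_continuous_image[OF continuous_on_entries(1)[OF continuous_on_id]])
  from compact_imp_bounded[OF this] obtain B where B: "\<forall>z\<in>ea ` SL2. cmod z \<le> B"
    unfolding bounded_iff ..
  have "mk (of_real (\<bar>B\<bar> + 1)) 0 0 (1 / of_real (\<bar>B\<bar> + 1)) \<in> SL2"
    by (simp add: complex_eq_iff del: of_real_add)
  with B have "cmod (ea (mk (of_real (\<bar>B\<bar> + 1)) 0 0 (1 / of_real (\<bar>B\<bar> + 1)))) \<le> B" by blast
  then show False by (simp del: of_real_add)
qed

lemma compact_SU2: "compact SU2"
proof -
  let ?f = "\<lambda>v. mk (fst v) (- cnj (snd v)) (snd v) (cnj (fst v))"
  have "continuous_on (sphere (0 :: complex \<times> complex) 1) ?f"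
    by (intro continuous_on_mk continuous_on_minus continuous_on_cnj continuous_on_fst continuous_on_snd continuous_on_id)
  then have "compact (?f ` sphere 0 1)"
    by (rule compact_continuous_image) simp
  moreover have "?f ` sphere 0 1 = SU2"
  proof safe
    fix a b :: complex assume "(a, b) \<in> sphere 0 1"
    then have "complex_of_real ((norm (a, b))\<^sup>2) = 1" by simp
    then show "?f (a, b) \<in> SU2"
      unfolding norm_pair_sq_complex by (simp add: SU2_def mult.commute)
  next
    fix k assume "k \<in> SU2"
    then obtain p q where k: "k = mk p q (- cnj q) (cnj p)" and pq: "p * cnj p + q * cnj q = 1"
      by (rule SU2_cases)
    have "complex_of_real ((norm (p, - cnj q))\<^sup>2) = 1"
      unfolding norm_pair_sq_complex using pq by (simp add: mult.commute)
    then have "(norm (p, - cnj q))\<^sup>2 = 1" by (simp only: of_real_eq_1_iff)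
    then have "norm (p, - cnj q) = 1"
      using norm_ge_zero[of "(p, - cnj q)"] unfolding power2_eq_1_iff by linarith
    then show "k \<in> ?f ` sphere 0 1"
      by (intro image_eqI[of _ _ "(p, - cnj q)"]) (auto simp: k)
  qed
  ultimately show ?thesis by simp
qed

section \<open>Maximality of SU(2) among compact subgroups\<close>

definition mpow :: "coords \<Rightarrow> nat \<Rightarrow> coords" where
  "mpow x n = (mmult x ^^ n) m1mat"

lemma mpow_simps [simp]: "mpow x 0 = m1mat" "mpow x (Suc n) = mmult x (mpow x n)"
  by (simp_all add: mpow_def)

lemma mpow_upper: "ea (mpow (mk p z 0 q) n) = p ^ n" "ec (mpow (mk p z 0 q) n) = 0"
  by (induction n) (simp_all add: m1mat_def mmult_def)

lemma mpow_unipotent: "mpow (mk 1 z 0 1) n = mk 1 (of_nat n * z) 0 1"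
  by (induction n) (simp_all add: m1mat_def algebra_simps)

lemma power_bounded_imp_le_1:
  fixes p :: real assumes "p \<ge> 0" "\<And>n. p ^ n \<le> B" shows "p \<le> 1"
proof (rule ccontr)
  assume "\<not> p \<le> 1"
  then obtain n where "B < p ^ n" using real_arch_pow[of p B] by auto
  with assms(2)[of n] show False by simp
qed

text \<open>A larger compact subgroup would also contain the AN-part \<open>b\<close> of each of its
  elements. The powers of \<open>b\<close> and of its inverse have upper left entries e^{nt/2} and
  e^{-nt/2}, and boundedness forces t = 0. Then \<open>b\<close> is unipotent, its powers have upper
  right entries n z, and boundedness forces z = 0.\<close>

lemma maximal_compact_SU2: "maximal_compact_subgroup SU2 S0"
  unfolding maximal_compact_subgroup_def
proof (intro conjI allI impI subgroup_SU2 compact_SU2)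
  fix L assume L: "subgroup L S0 \<and> compact L \<and> SU2 \<subseteq> L"
  then have sub: "subgroup L S0" by simp
  have LS: "L \<subseteq> SL2" and mult: "\<And>x y. x \<in> L \<Longrightarrow> y \<in> L \<Longrightarrow> mmult x y \<in> L" and one: "m1mat \<in> L"
    using subgroup.subset[OF sub] subgroup.m_closed[OF sub] subgroup.one_closed[OF sub] by simp_all
  have inv: "madj x \<in> L" if "x \<in> L" for x
    using subgroup.m_inv_closed[OF sub that] that LS by auto
  have pow: "mpow x n \<in> L" if "x \<in> L" for x n
    using that one mult by (induction n) auto
  have "compact (ea ` L)" "compact (eb ` L)"
    using L by (auto intro!: compact_continuous_image continuous_on_entries continuous_on_id)
  then have "bounded (ea ` L)" "bounded (eb ` L)" by (auto intro: compact_imp_bounded)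
  then obtain B C where "\<forall>z\<in>ea ` L. cmod z \<le> B" "\<forall>z\<in>eb ` L. cmod z \<le> C"
    unfolding bounded_iff by blast
  then have B: "\<And>x. x \<in> L \<Longrightarrow> cmod (ea x) \<le> B" and C: "\<And>x. x \<in> L \<Longrightarrow> cmod (eb x) \<le> C"
    by auto
  have "L \<subseteq> SU2"
  proof
    fix g assume g: "g \<in> L"
    then have gS: "g \<in> SL2" using LS by auto
    define v where "v = (ea g, ec g)"
    define t where "t = 2 * ln (norm v)"
    define b where "b = mmult (a_elt S0 t) (mk 1 (zc g) 0 1)"
    have gk: "g = mmult (ku v) b"
      using Iwasawa_exists[OF gS] by (simp add: b_def v_def t_def mmult_assoc)
    have bS: "b \<in> SL2" unfolding b_def by (intro mmult_in_SL2) simp_all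
    have "b = mmult (madj (ku v)) g"
      unfolding gk by (simp add: mmult_assoc[symmetric] mmult_madj ku_in_SL2 mmult_1 bS)
    then have bL: "b \<in> L"
      using g L ku_in_SU2[of v] inv mult by auto
    have bm: "b = mk (of_real (exp (t/2))) (of_real (exp (t/2)) * zc g) 0 (of_real (exp (-t/2)))"
      by (simp add: b_def a_elt_S0)
    have "exp (t/2) ^ n \<le> B" for n
      using B[OF pow[OF bL, of n]] unfolding bm mpow_upper by (simp add: norm_power)
    then have 1: "exp (t/2) \<le> 1"
      by (intro power_bounded_imp_le_1) auto
    have "madj b = mk (of_real (exp (-t/2))) (- (of_real (exp (t/2)) * zc g)) 0 (of_real (exp (t/2)))"
      by (simp add: bm)
    then have "exp (-t/2) ^ n \<le> B" for n
      using B[OF pow[OF inv[OF bL], of n]] by (simp add: mpow_upper norm_power del: of_real_exp)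
    then have "exp (-t/2) \<le> 1"
      by (intro power_bounded_imp_le_1) auto
    with 1 have t0: "t = 0" by simp
    then have b1: "b = mk 1 (zc g) 0 1" by (simp add: bm)
    have "of_nat n * cmod (zc g) \<le> C" for n
      using C[OF pow[OF bL, of n]] unfolding b1 mpow_unipotent by (simp add: norm_mult)
    then have "\<not> 0 < cmod (zc g)"
      using ex_less_of_nat_mult[of "cmod (zc g)" C] by (auto simp: not_less[symmetric])
    then have "zc g = 0" by simp
    then have "b = m1mat" by (simp add: b1 m1mat_def)
    then show "g \<in> SU2"
      using gk ku_in_SU2[of v] by (simp add: mmult_1 ku_in_SL2)
  qed
  then show "L = SU2" using L by auto
qed

section \<open>The subspaces k, p and a of the Lie algebra\<close>

lemma cnj_has_vector_derivative:
  "(f has_vector_derivative D) F \<Longrightarrow> ((\<lambda>t. cnj (f t)) has_vector_derivative cnj D) F"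
  by (rule bounded_linear.has_vector_derivative[OF bounded_linear_cnj])

lemma k_alg_S0: "k_alg S0 = {mk a b c 0 | a b c. Re a = 0 \<and> c = - cnj b}"
proof safe
  fix X assume X: "X \<in> k_alg S0"
  then have K: "mexp X t \<in> SU2" for t
    by (simp add: k_alg_def lie_exp_S0 mexp_smul)
  have D: "((\<lambda>t. ea (mexp X t)) has_vector_derivative ea X) (at 0)"
    "((\<lambda>t. eb (mexp X t)) has_vector_derivative eb X) (at 0)"
    "((\<lambda>t. ec (mexp X t)) has_vector_derivative ec X) (at 0)"
    "((\<lambda>t. ed (mexp X t)) has_vector_derivative - ea X) (at 0)"
    using mexp_deriv_0[of X] by (simp_all add: has_mderiv_def)
  have "(\<lambda>t. ed (mexp X t)) = (\<lambda>t. cnj (ea (mexp X t)))" "(\<lambda>t. ec (mexp X t)) = (\<lambda>t. - cnj (eb (mexp X t)))"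
    using K by (auto simp: SU2_def)
  then have "- ea X = cnj (ea X)" "ec X = - cnj (eb X)"
    using vector_derivative_unique_at[OF D(4)] vector_derivative_unique_at[OF D(3)]
      cnj_has_vector_derivative[OF D(1)] has_vector_derivative_minus[OF cnj_has_vector_derivative[OF D(2)]] by auto
  moreover have "X = mk (ea X) (eb X) (ec X) 0"
    using X mk_eta6[of X] by (simp add: k_alg_def lie_algebra_S0)
  ultimately show "\<exists>a b c. X = mk a b c 0 \<and> Re a = 0 \<and> c = - cnj b"
    by (intro exI[of _ "ea X"] exI[of _ "eb X"] exI[of _ "ec X"]) (auto simp: complex_eq_iff)
next
  fix a b :: complex assume a: "Re a = 0"
  let ?X = "mk a b (- cnj b) 0"
  have a2: "cnj a = - a" using a by (simp add: complex_eq_iff)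
  have "a\<^sup>2 + b * (- cnj b) = - of_real ((Im a)\<^sup>2 + (cmod b)\<^sup>2)"
    using a by (simp add: complex_norm_square[symmetric]) (simp add: complex_eq_iff power2_eq_square)
  \<comment> \<open>\<open>momega\<close> is the square root of a nonpositive real number, hence
    purely imaginary. As \<open>mC\<close> and \<open>mS\<close> are even in it, both are
    real.\<close>
  then have w: "cnj (momega ?X) = - momega ?X"
    unfolding momega_def by (simp add: csqrt_of_real_nonpos add_nonneg_nonneg)
  have cosh_cnj: "cnj (cosh z) = cosh (cnj z)" and sinh_cnj: "cnj (sinh z) = sinh (cnj z)" for z
    by (simp_all add: cosh_def sinh_def exp_cnj)
  have C: "cnj (mC ?X t) = mC ?X t" for t
    by (simp add: mC_def cosh_cnj w)
  have S: "cnj (mS ?X t) = mS ?X t" for t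
    by (simp add: mS_def sinh_cnj w)
  have "mexp ?X t \<in> SU2" for t
    using mexp_in_SL2[of ?X t] unfolding SU2_def by (simp add: mexp_def C S a2)
  then show "?X \<in> k_alg S0"
    by (simp add: k_alg_def lie_exp_S0 mexp_smul)
qed

lemma p_alg_S0: "p_alg S0 = {mk a b c 0 | a b c. Im a = 0 \<and> c = cnj b}"
proof safe
  fix X assume X: "X \<in> p_alg S0"
  then have 0: "killing S0 X (mk a b (- cnj b) 0) = 0" if "Re a = 0" for a b
    using that unfolding p_alg_def k_alg_S0 by blast
  have "Im (ea X) = 0" "Re (eb X) = Re (ec X)" "Im (eb X) = - Im (ec X)"
    using 0[of \<i> 0] 0[of 0 1] 0[of 0 \<i>] by (simp_all add: killing_S0)
  moreover have "X = mk (ea X) (eb X) (ec X) 0"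
    using X mk_eta6[of X] by (simp add: p_alg_def lie_algebra_S0)
  ultimately show "\<exists>a b c. X = mk a b c 0 \<and> Im a = 0 \<and> c = cnj b"
    by (intro exI[of _ "ea X"] exI[of _ "eb X"] exI[of _ "ec X"]) (auto simp: complex_eq_iff)
next
  fix a b :: complex assume "Im a = 0"
  then show "mk a b (cnj b) 0 \<in> p_alg S0"
    by (auto simp: p_alg_def k_alg_S0 killing_S0 algebra_simps)
qed

lemma k_algI: "Re a = 0 \<Longrightarrow> c = - cnj b \<Longrightarrow> mk a b c 0 \<in> k_alg S0"
  unfolding k_alg_S0 by blast

lemma p_algI: "Im a = 0 \<Longrightarrow> c = cnj b \<Longrightarrow> mk a b c 0 \<in> p_alg S0"
  unfolding p_alg_S0 by blast

lemma smul_mk: "smul r (mk a b c d) = mk (of_real r * a) (of_real r * b) (of_real r * c) (of_real r * d)"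
  by (rule ext) (simp add: smul_def mk_def)

lemma plus_mk: "mk a b c d + mk a' b' c' d' = mk (a + a') (b + b') (c + c') (d + d')"
  by (rule ext) (simp add: mk_def)

lemma madj_mmult: "madj (mmult x y) = mmult (madj y) (madj x)"
  by (simp add: madj_def mmult_def algebra_simps)

lemma mk_0: "mk 0 0 0 0 = 0"
  by (rule ext) (simp add: mk_def)

lemma a_alg_S0: "a_alg S0 = {mk (of_real r) 0 0 0 | r. True}"
proof -
  have "a_alg S0 = range (\<lambda>c. smul c (mk (1/2) 0 0 0))"
    by (simp add: a_alg_def coords.span_singleton)
  also have "\<dots> = {mk (of_real r) 0 0 0 | r. True}"
  proof safe
    fix r show "\<exists>s. smul r (mk (1/2) 0 0 0) = mk (of_real s) 0 0 0 \<and> True"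
      by (rule exI[of _ "r / 2"]) (simp add: smul_mk)
    show "mk (of_real r) 0 0 0 \<in> range (\<lambda>c. smul c (mk (1/2) 0 0 0))"
      by (rule range_eqI[of _ _ "2 * r"]) (simp add: smul_mk)
  qed
  finally show ?thesis .
qed

lemma maximal_abelian_S0: "maximal_abelian_subspace_of_p S0 (a_alg S0)"
  unfolding maximal_abelian_subspace_of_p_def abelian_subspace_of_p_def
proof (intro conjI allI impI ballI)
  show "coords.subspace (a_alg S0)"
    unfolding a_alg_def by (rule coords.subspace_span)
  show "a_alg S0 \<subseteq> p_alg S0"
    unfolding a_alg_S0 p_alg_S0 by fastforce
  show "bracket S0 X Y = 0" if "X \<in> a_alg S0" "Y \<in> a_alg S0" for X Y
    using that unfolding a_alg_S0 by (auto simp: bracket_S0 mk_0)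
  fix W assume W: "(coords.subspace W \<and> W \<subseteq> p_alg S0 \<and> (\<forall>X\<in>W. \<forall>Y\<in>W. bracket S0 X Y = 0)) \<and> a_alg S0 \<subseteq> W"
  have "W \<subseteq> a_alg S0"
  proof
    fix Y assume Y: "Y \<in> W"
    then obtain a b where Ym: "Y = mk a b (cnj b) 0" and a: "Im a = 0"
      using W unfolding p_alg_S0 by blast
    have "mk (of_real 1) 0 0 0 \<in> a_alg S0" unfolding a_alg_S0 by blast
    then have "bracket S0 (mk 1 0 0 0) Y = 0" using W Y by auto
    then have "b = 0" by (simp add: bracket_S0 Ym mk_0[symmetric])
    moreover have "a = of_real (Re a)" using a by (simp add: complex_eq_iff)
    ultimately show "Y \<in> a_alg S0"
      unfolding a_alg_S0 Ym by (intro CollectI exI[of _ "Re a"]) simp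
  qed
  then show "W = a_alg S0" using W by auto
qed

lemma positive_root_S0: "positive_root S0 r \<longleftrightarrow> r = 1"
proof -
  have "mk 0 1 0 0 \<in> root_space S0 1" "mk 0 1 0 0 \<noteq> 0"
    by (auto simp: root_space_pos mk_0[symmetric])
  then have ne: "root_space S0 1 \<noteq> {0}" by auto
  show ?thesis
  proof (cases "r = 1")
    case True
    then show ?thesis using ne by (simp add: positive_root_def)
  next
    case False
    then have "\<not> (r > 0 \<and> root_space S0 r \<noteq> {0})"
      using root_space_pos[of r] by simp
    then show ?thesis using False unfolding positive_root_def by simp
  qed
qed

lemma simple_root_S0: "simple_root S0 1"
  by (simp add: simple_root_def positive_root_S0)

lemma m2_S0: "m2 S0 = 0"
  using coords.dim_unique[of "{}" "{0}" 0] by (simp add: m2_def root_space_pos coords.independent_empty)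

lemma m1_S0: "m1 S0 = 2"
proof -
  let ?B = "{mk 0 1 0 0, mk 0 \<i> 0 0}"
  have ind: "coords.independent ?B"
  proof (rule coords.independent_insertI)
    show "mk 0 1 0 0 \<notin> coords.span {mk 0 \<i> 0 0}"
      by (auto simp: coords.span_singleton smul_mk complex_eq_iff)
    show "coords.independent {mk 0 \<i> 0 0}"
      by (simp add: mk_0[symmetric])
  qed
  have "coords.span ?B = {mk 0 b 0 0 | b. True}"
  proof safe
    fix x assume "x \<in> coords.span ?B"
    then show "\<exists>b. x = mk 0 b 0 0 \<and> True"
    proof (induction rule: coords.span_induct_alt)
      case base
      then show ?case by (metis mk_0)
    next
      case (step c x y)
      then obtain b b' where "x = mk 0 b 0 0" "y = mk 0 b' 0 0" by blast
      then have "smul c x + y = mk 0 (of_real c * b + b') 0 0"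
        by (simp add: smul_mk plus_mk)
      then show ?case by blast
    qed
  next
    fix b
    have "mk 0 b 0 0 = smul (Re b) (mk 0 1 0 0) + smul (Im b) (mk 0 \<i> 0 0)"
      by (simp add: smul_mk plus_mk complex_eq_iff)
    also have "\<dots> \<in> coords.span ?B"
      by (intro coords.span_add coords.span_scale coords.span_base) auto
    finally show "mk 0 b 0 0 \<in> coords.span ?B" .
  qed
  then have "coords.dim {mk 0 b 0 0 | b. True} = card ?B"
    using coords.dim_span_eq_card_independent[OF ind] by simp
  then show ?thesis
    by (simp add: m1_def root_space_pos complex_eq_iff)
qed

lemma rho_S0: "rho S0 = 1"
  by (simp add: rho_def m1_S0 m2_S0)

subsection \<open>The distance from the origin\<close>

text \<open>Here p consists of the Hermitian and k of the anti-Hermitian traceless matrices, so the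
  projection is the Hermitian part.\<close>

lemma p_part_S0:
  assumes "X \<in> lie_algebra S0"
  shows "p_part S0 X = mk (of_real (Re (ea X))) ((eb X + cnj (ec X)) / 2) ((ec X + cnj (eb X)) / 2) 0"
    (is "_ = ?Z")
  unfolding p_part_def
proof (rule the_equality)
  have X: "X = mk (ea X) (eb X) (ec X) 0"
    using assms mk_eta6[of X] by (simp add: lie_algebra_S0)
  have diff: "mk a b c 0 - mk a' b' c' 0 = mk (a - a') (b - b') (c - c') 0" for a b c a' b' c'
    by (rule ext) (simp add: mk_def)
  have "X - ?Z = mk (\<i> * of_real (Im (ea X))) ((eb X - cnj (ec X)) / 2) ((ec X - cnj (eb X)) / 2) 0"
    by (subst (1) X, subst diff) (auto simp: complex_eq_iff field_simps)
  also have "\<dots> \<in> k_alg S0"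
    by (rule k_algI) (simp_all add: complex_eq_iff field_simps)
  finally show "?Z \<in> p_alg S0 \<and> X - ?Z \<in> k_alg S0"
    using p_algI[of "of_real (Re (ea X))" "(ec X + cnj (eb X)) / 2" "(eb X + cnj (ec X)) / 2"] by simp
  fix Z assume Z: "Z \<in> p_alg S0 \<and> X - Z \<in> k_alg S0"
  then obtain a b where Zm: "Z = mk a b (cnj b) 0" and a: "Im a = 0"
    unfolding p_alg_S0 by blast
  have "X - Z = mk (ea X - a) (eb X - b) (ec X - cnj b) 0"
    unfolding Zm by (subst (1) X, subst diff) simp
  then have "Re (ea X - a) = 0" "ec X - cnj b = - cnj (eb X - b)"
    using Z unfolding k_alg_S0 by auto
  then show "Z = ?Z"
    using a by (auto simp: Zm complex_eq_iff)
qed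

lemma p_norm_S0_nonneg:
  assumes "X \<in> lie_algebra S0" shows "p_norm S0 (p_part S0 X) \<ge> 0"
proof -
  have "0 \<le> killing S0 (mk (of_real r) b (cnj b) 0) (mk (of_real r) b (cnj b) 0)" for r b
    by (simp add: killing_S0)
  from this[of "Re (ea X)" "(eb X + cnj (ec X)) / 2"] show ?thesis
    unfolding p_norm_def p_part_S0[OF assms] by (simp add: killing_S0 add.commute)
qed

lemma C1_curve_radial:
  assumes "k \<in> SU2"
  shows "C1_curve S0 (\<lambda>t. mmult k (mexp (Hg S0) (r * t))) (\<lambda>t. smul r (Hg S0))"
proof -
  have SL: "mmult k (mexp (Hg S0) t) \<in> SL2" for t
    using assms SU2_subset by (auto intro: mmult_in_SL2 mexp_in_SL2)
  have "continuous_on {0..1} (\<lambda>t. mexp (Hg S0) (r * t))"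
    by (rule continuous_on_compose2[OF continuous_on_mexp[of UNIV]]) (auto intro!: continuous_intros)
  then have cont: "continuous_on {0..1} (\<lambda>t. mmult k (mexp (Hg S0) (r * t)))"
    by (intro continuous_on_mmult continuous_on_const)
  have "((\<lambda>s. snd chart_a (mmult (madj (mmult k (mexp (Hg S0) (r * t)))) (mmult k (mexp (Hg S0) (r * s)))) i)
      has_real_derivative smul r (Hg S0) i) (at t within {0..1})" if i: "i < 6" for t i
  proof -
    have "mmult (madj (mmult k (mexp (Hg S0) (r * t)))) (mmult k (mexp (Hg S0) (r * s))) = mexp (Hg S0) (r * (s - t))" for s
    proof -
      have "mmult (madj (mmult k (mexp (Hg S0) (r * t)))) (mmult k (mexp (Hg S0) (r * s)))
        = mmult (madj (mexp (Hg S0) (r * t))) (mmult (mmult (madj k) k) (mexp (Hg S0) (r * s)))"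
        by (simp add: madj_mmult mmult_assoc)
      also have "\<dots> = mmult (mexp (Hg S0) (- (r * t))) (mexp (Hg S0) (r * s))"
        using assms SU2_subset by (auto simp: mmult_madj mmult_1 mexp_in_SL2 madj_mexp)
      also have "\<dots> = mexp (Hg S0) (r * (s - t))"
        by (simp add: mexp_add[symmetric] algebra_simps)
      finally show ?thesis .
    qed
    moreover have "((\<lambda>s. snd chart_a (mexp (Hg S0) (r * (s - t))) i) has_real_derivative smul r (Hg S0) i) (at t within {0..1})"
    proof -
      have "((\<lambda>s. r * (s - t)) has_real_derivative r) (at t within {0..1})"
        by (auto intro!: derivative_eq_intros)
      from DERIV_chain2[of "\<lambda>s. snd chart_a (mexp (Hg S0) s) i" _ "\<lambda>s. r * (s - t)", OF _ this]
        has_mderiv_chart[OF mexp_deriv_0[of "Hg S0"] i]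
      have "((\<lambda>s. snd chart_a (mexp (Hg S0) (r * (s - t))) i) has_real_derivative
          mk (ea (traceless (Hg S0))) (eb (traceless (Hg S0))) (ec (traceless (Hg S0))) 0 i * r) (at t within {0..1})"
        by simp
      then show ?thesis
        by (simp add: smul_def mult.commute)
    qed
    ultimately show ?thesis by simp
  qed
  then show ?thesis
    unfolding C1_curve_def using SL cont by (auto simp: smul_mk)
qed

definition sigma_lengths :: "coords \<Rightarrow> real set" where
  "sigma_lengths x = {integral {0..1} (\<lambda>t. p_norm S0 (p_part S0 (w t))) | u w.
     C1_curve S0 u w \<and> u 0 \<in> SU2 \<and> mmult (madj x) (u 1) \<in> SU2}"

lemma sigma_lengths_nonneg: "y \<in> sigma_lengths x \<Longrightarrow> y \<ge> 0"
proof -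
  assume "y \<in> sigma_lengths x"
  then obtain u w where y: "y = integral {0..1} (\<lambda>t. p_norm S0 (p_part S0 (w t)))" and c: "C1_curve S0 u w"
    unfolding sigma_lengths_def by blast
  have "p_norm S0 (p_part S0 (w t)) \<ge> 0" if "t \<in> {0..1}" for t
    by (rule p_norm_S0_nonneg) (use c that in \<open>auto simp: C1_curve_def\<close>)
  \<comment> \<open>A function that is not integrable has integral 0 by convention, so lengths are
    nonnegative in either case.\<close>
  then show ?thesis
    unfolding y
    by (cases "(\<lambda>t. p_norm S0 (p_part S0 (w t))) integrable_on {0..1}")
      (auto intro: Henstock_Kurzweil_Integration.integral_nonneg simp: not_integrable_integral)
qed

text \<open>Write x = k a_r l. The curve t -> k a_{rt} starts in K, and at time 1 it differs from x
  by an element of K; its velocity is constantly r times \<open>Hg\<close>, which has norm one in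
  the normalised metric.\<close>

lemma rad_in_sigma_lengths: assumes "x \<in> SL2" shows "rad x \<in> sigma_lengths x"
proof -
  obtain k l where k: "k \<in> SU2" and l: "l \<in> SU2" and x: "x = mmult (mmult k (a_elt S0 (rad x))) l"
    using Cartan[OF assms] .
  let ?r = "rad x"
  let ?u = "\<lambda>t. mmult k (mexp (Hg S0) (?r * t))" and ?w = "\<lambda>t :: real. smul ?r (Hg S0)"
  have "p_part S0 (smul ?r (Hg S0)) = smul ?r (Hg S0)"
    by (subst p_part_S0) (simp_all add: smul_mk)
  then have n: "p_norm S0 (p_part S0 (smul ?r (Hg S0))) = ?r"
    using rad_nonneg[OF assms] by (simp add: p_norm_def killing_S0 smul_mk power2_eq_square[symmetric])
  have "a_elt S0 ?r = mexp (Hg S0) (?r * 1)"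
    unfolding a_elt_def lie_exp_S0 mexp_smul by simp
  with x have "x = mmult (?u 1) l" by metis
  then have "madj x = madj (mmult (?u 1) l)" by (rule arg_cong)
  then have "madj x = mmult (madj l) (madj (?u 1))"
    unfolding madj_mmult .
  moreover have "?u 1 \<in> SL2" using k SU2_subset by (auto intro: mmult_in_SL2 mexp_in_SL2)
  ultimately have "mmult (madj x) (?u 1) = madj l"
    using l SU2_subset by (auto simp: mmult_assoc mmult_madj mmult_1 madj_in_SL2)
  then have "mmult (madj x) (?u 1) \<in> SU2"
    using l by (simp add: madj_in_SU2)
  moreover have "?u 0 \<in> SU2" using k SU2_subset by (auto simp: mmult_1)
  ultimately have "C1_curve S0 ?u ?w \<and> ?u 0 \<in> SU2 \<and> mmult (madj x) (?u 1) \<in> SU2"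
    using C1_curve_radial[OF k, of ?r] by (intro conjI)
  then have "integral {0..1} (\<lambda>t::real. p_norm S0 (p_part S0 (?w t))) \<in> sigma_lengths x"
    unfolding sigma_lengths_def by (intro CollectI exI[of _ ?u] exI[of _ ?w] conjI[OF refl])
  then show ?thesis unfolding n by simp
qed

lemma sigma_S0: "x \<in> SL2 \<Longrightarrow> sigma S0 x = Inf (sigma_lengths x)"
  by (simp add: sigma_def sigma_lengths_def)

lemma sigma_bounds:
  assumes "x \<in> SL2" shows "0 \<le> sigma S0 x" "sigma S0 x \<le> rad x"
proof -
  show "0 \<le> sigma S0 x"
    unfolding sigma_S0[OF assms]
    using rad_in_sigma_lengths[OF assms] by (intro cInf_greatest sigma_lengths_nonneg) auto
  show "sigma S0 x \<le> rad x"
    unfolding sigma_S0[OF assms]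
    by (rule cInf_lower[OF rad_in_sigma_lengths[OF assms]])
      (auto intro: bdd_belowI[of _ 0] sigma_lengths_nonneg)
qed

section \<open>Haar measures\<close>

subsection \<open>Measurability\<close>

lemma borel_measurable_entries:
  assumes "f \<in> borel_measurable M"
  shows "(\<lambda>x. ea (f x)) \<in> borel_measurable M" "(\<lambda>x. eb (f x)) \<in> borel_measurable M"
    "(\<lambda>x. ec (f x)) \<in> borel_measurable M" "(\<lambda>x. ed (f x)) \<in> borel_measurable M"
  by (rule borel_measurable_continuous_on[OF _ assms], rule continuous_on_entries[OF continuous_on_id])+

lemma borel_measurable_mk:
  fixes a b c d :: "'a \<Rightarrow> complex"
  assumes "a \<in> borel_measurable M" "b \<in> borel_measurable M" "c \<in> borel_measurable M" "d \<in> borel_measurable M"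
  shows "(\<lambda>x. mk (a x) (b x) (c x) (d x)) \<in> borel_measurable M"
proof -
  have "(\<lambda>x. (a x, b x, c x, d x)) \<in> borel_measurable M"
    by (intro borel_measurable_Pair assms)
  moreover have "continuous_on UNIV (\<lambda>q. mk (fst q) (fst (snd q)) (fst (snd (snd q))) (snd (snd (snd q))))"
    by (intro continuous_on_mk continuous_on_fst continuous_on_snd continuous_on_id)
  ultimately show ?thesis
    using borel_measurable_continuous_on[of "\<lambda>q. mk (fst q) (fst (snd q)) (fst (snd (snd q))) (snd (snd (snd q)))"
      "\<lambda>x. (a x, b x, c x, d x)" M] by simp
qed

lemma sets_haar [simp, measurable_cong]:
  "sets haarG = sets (restrict_space borel SL2)" "sets haarK = sets (restrict_space borel SU2)"
  by (simp_all add: haarG_def haarK_def)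

lemma space_haar [simp]: "space haarG = SL2" "space haarK = SU2"
  by (simp_all add: haarG_def haarK_def space_restrict_space)

lemma measurable_into_haar:
  "f \<in> measurable M haarG \<longleftrightarrow> f \<in> borel_measurable M \<and> f \<in> space M \<rightarrow> SL2"
  "f \<in> measurable M haarK \<longleftrightarrow> f \<in> borel_measurable M \<and> f \<in> space M \<rightarrow> SU2"
proof -
  have "measurable M haarG = measurable M (restrict_space borel SL2)"
    by (rule measurable_cong_sets) simp_all
  moreover have "measurable M haarK = measurable M (restrict_space borel SU2)"
    by (rule measurable_cong_sets) simp_all
  ultimately show "f \<in> measurable M haarG \<longleftrightarrow> f \<in> borel_measurable M \<and> f \<in> space M \<rightarrow> SL2"
    "f \<in> measurable M haarK \<longleftrightarrow> f \<in> borel_measurable M \<and> f \<in> space M \<rightarrow> SU2"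
    by (auto simp: measurable_restrict_space2_iff)
qed

lemma borel_measurable_mmult:
  assumes "f \<in> borel_measurable M" "g \<in> borel_measurable M"
  shows "(\<lambda>x. mmult (f x) (g x)) \<in> borel_measurable M"
  unfolding mmult_def
  by (intro borel_measurable_mk borel_measurable_add borel_measurable_times borel_measurable_entries assms)

lemma borel_measurable_madj:
  assumes "f \<in> borel_measurable M" shows "(\<lambda>x. madj (f x)) \<in> borel_measurable M"
  unfolding madj_def
  by (intro borel_measurable_mk borel_measurable_uminus borel_measurable_entries assms)

lemma measurable_haar_group [measurable (raw)]:
  "f \<in> measurable M haarG \<Longrightarrow> g \<in> measurable M haarG \<Longrightarrow> (\<lambda>x. mmult (f x) (g x)) \<in> measurable M haarG"
  "f \<in> measurable M haarG \<Longrightarrow> (\<lambda>x. madj (f x)) \<in> measurable M haarG"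
  "f \<in> measurable M haarK \<Longrightarrow> g \<in> measurable M haarK \<Longrightarrow> (\<lambda>x. mmult (f x) (g x)) \<in> measurable M haarK"
  "f \<in> measurable M haarK \<Longrightarrow> (\<lambda>x. madj (f x)) \<in> measurable M haarK"
  unfolding measurable_into_haar
  by (auto intro: borel_measurable_mmult borel_measurable_madj mmult_in_SL2 mmult_in_SU2 madj_in_SL2 madj_in_SU2)

lemma measurable_haarK_haarG:
  "f \<in> measurable M haarK \<Longrightarrow> f \<in> measurable M haarG"
  unfolding measurable_into_haar using SU2_subset by auto

lemma cts_borel: "continuous_on UNIV f \<Longrightarrow> f \<in> borel_measurable borel"
  by (rule borel_measurable_continuous_onI)

lemma borel_measurable_if_zero:
  fixes p :: "'a :: topological_space \<Rightarrow> complex \<times> complex"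
  assumes p: "continuous_on UNIV p" and f: "f \<in> borel_measurable borel"
  shows "(\<lambda>w. if p w = 0 then c else f w) \<in> borel_measurable borel"
proof (rule measurable_If)
  have "closed {w. p w = 0}"
    by (intro closed_Collect_eq p continuous_on_const)
  then show "{w \<in> space borel. p w = 0} \<in> sets borel"
    by simp
qed (use f in simp_all)

lemma psi_measurable [measurable]: "psi \<in> measurable borel haarG"
proof -
  have d: "(\<lambda>w :: (complex \<times> complex) \<times> complex. g w / of_real ((norm (fst w))\<^sup>2)) \<in> borel_measurable borel"
    if "continuous_on UNIV g" for g :: "_ \<Rightarrow> complex"
    by (rule borel_measurable_divide; rule cts_borel)
      (intro that continuous_on_of_real continuous_on_power continuous_on_norm continuous_on_fst continuous_on_id)+
  have "(\<lambda>w. if fst w = 0 then m1mat else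
      mk (fst (fst w)) (- cnj (snd (fst w)) / of_real ((norm (fst w))\<^sup>2) + snd w * fst (fst w))
     (snd (fst w)) (cnj (fst (fst w)) / of_real ((norm (fst w))\<^sup>2) + snd w * snd (fst w))) \<in> borel_measurable borel"
    by (intro borel_measurable_if_zero borel_measurable_mk borel_measurable_add d cts_borel
        continuous_on_mult continuous_on_minus continuous_on_cnj continuous_on_fst continuous_on_snd continuous_on_id)
  moreover have "psi = (\<lambda>w. if fst w = 0 then m1mat else
      mk (fst (fst w)) (- cnj (snd (fst w)) / of_real ((norm (fst w))\<^sup>2) + snd w * fst (fst w))
     (snd (fst w)) (cnj (fst (fst w)) / of_real ((norm (fst w))\<^sup>2) + snd w * snd (fst w)))"
  proof
    fix w
    show "psi w = (if fst w = 0 then m1mat else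
      mk (fst (fst w)) (- cnj (snd (fst w)) / of_real ((norm (fst w))\<^sup>2) + snd w * fst (fst w))
     (snd (fst w)) (cnj (fst (fst w)) / of_real ((norm (fst w))\<^sup>2) + snd w * snd (fst w)))"
      using psi_eq[of "fst w" "snd w"] by (simp add: psi_def split_beta)
  qed
  ultimately show ?thesis
    unfolding measurable_into_haar using psi_in_SL2 by auto
qed

lemma ku_measurable [measurable]: "ku \<in> measurable borel haarK"
proof -
  have d: "(\<lambda>v :: complex \<times> complex. g v / of_real (norm v)) \<in> borel_measurable borel"
    if "continuous_on UNIV g" for g :: "_ \<Rightarrow> complex"
    by (rule borel_measurable_divide; rule cts_borel)
      (intro that continuous_on_of_real continuous_on_norm continuous_on_id)+
  have "(\<lambda>v. if v = 0 then m1mat else mk (fst v / of_real (norm v)) (- cnj (snd v) / of_real (norm v))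
     (snd v / of_real (norm v)) (cnj (fst v) / of_real (norm v))) \<in> borel_measurable borel"
    by (intro borel_measurable_if_zero borel_measurable_mk d continuous_on_minus continuous_on_cnj
        continuous_on_fst continuous_on_snd continuous_on_id)
  moreover have "ku = (\<lambda>v. if v = 0 then m1mat else mk (fst v / of_real (norm v)) (- cnj (snd v) / of_real (norm v))
     (snd v / of_real (norm v)) (cnj (fst v) / of_real (norm v)))"
    by (rule ext) (metis ku_eq ku_def)
  ultimately show ?thesis
    unfolding measurable_into_haar using ku_in_SU2 by auto
qed

lemma haarG_eq: "haarG = distr lborel haarG psi"
  unfolding haarG_def by (rule distr_cong) simp_all

lemma nn_integral_haarG:
  "f \<in> borel_measurable haarG \<Longrightarrow> (\<integral>\<^sup>+x. f x \<partial>haarG) = (\<integral>\<^sup>+w. f (psi w) \<partial>lborel)"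
  by (subst haarG_eq, rule nn_integral_distr) simp_all

lemma nn_integral_lborel_pair:
  fixes f :: "'a::euclidean_space \<times> 'b::euclidean_space \<Rightarrow> ennreal"
  assumes "f \<in> borel_measurable borel"
  shows "(\<integral>\<^sup>+w. f w \<partial>lborel) = (\<integral>\<^sup>+x. \<integral>\<^sup>+y. f (x, y) \<partial>lborel \<partial>lborel)"
    "(\<integral>\<^sup>+w. f w \<partial>lborel) = (\<integral>\<^sup>+y. \<integral>\<^sup>+x. f (x, y) \<partial>lborel \<partial>lborel)"
proof -
  have f: "f \<in> borel_measurable (lborel \<Otimes>\<^sub>M lborel)"
    using assms unfolding lborel_prod by simp
  show "(\<integral>\<^sup>+w. f w \<partial>lborel) = (\<integral>\<^sup>+x. \<integral>\<^sup>+y. f (x, y) \<partial>lborel \<partial>lborel)"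
    using lborel.nn_integral_fst[OF f] unfolding lborel_prod by simp
  then show "(\<integral>\<^sup>+w. f w \<partial>lborel) = (\<integral>\<^sup>+y. \<integral>\<^sup>+x. f (x, y) \<partial>lborel \<partial>lborel)"
    using lborel_pair.Fubini[OF f] by simp
qed

lemma nn_integral_translate:
  fixes f :: "'a::euclidean_space \<Rightarrow> ennreal"
  assumes "f \<in> borel_measurable borel"
  shows "(\<integral>\<^sup>+x. f (x + c) \<partial>lborel) = (\<integral>\<^sup>+x. f x \<partial>lborel)"
proof -
  have "(\<integral>\<^sup>+x. f x \<partial>distr lborel borel ((+) c)) = (\<integral>\<^sup>+x. f (c + x) \<partial>lborel)"
    by (rule nn_integral_distr) (use assms in simp_all)
  then show ?thesis by (simp add: lborel_distr_plus add.commute)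
qed

lemma nn_integral_scale:
  fixes f :: "'a::euclidean_space \<Rightarrow> ennreal"
  assumes f[measurable]: "f \<in> borel_measurable borel" and c: "c > 0"
  shows "(\<integral>\<^sup>+x. f x \<partial>lborel) = ennreal (c ^ DIM('a)) * (\<integral>\<^sup>+x. f (t + c *\<^sub>R x) \<partial>lborel)"
proof -
  have "(\<integral>\<^sup>+x. f x \<partial>lborel) = (\<integral>\<^sup>+x. f x \<partial>density (distr lborel borel (\<lambda>x. t + c *\<^sub>R x)) (\<lambda>_. \<bar>c\<bar>^DIM('a)))"
    using lborel_affine[of c t] c by simp
  also have "\<dots> = ennreal (c ^ DIM('a)) * (\<integral>\<^sup>+x. f (t + c *\<^sub>R x) \<partial>lborel)"
    using c by (simp add: nn_integral_density nn_integral_distr nn_integral_cmult)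
  finally show ?thesis .
qed

subsection \<open>Left invariance\<close>

text \<open>The matrices act on $\mathbb{C}^2$ preserving Lebesgue measure, because they are products of
  shears.\<close>

definition mact :: "coords \<Rightarrow> complex \<times> complex \<Rightarrow> complex \<times> complex" where
  "mact g v = (ea g * fst v + eb g * snd v, ec g * fst v + ed g * snd v)"

lemma mact_mmult: "mact (mmult g h) v = mact g (mact h v)"
  by (simp add: mact_def mmult_def algebra_simps)

lemma mact_eq_0_iff: "g \<in> SL2 \<Longrightarrow> mact g v = 0 \<longleftrightarrow> v = 0"
proof
  assume g: "g \<in> SL2" and "mact g v = 0"
  then have "mact (mmult (madj g) g) v = mact (madj g) 0" by (simp add: mact_mmult)
  then show "v = 0" using g by (simp add: mmult_madj) (simp add: mact_def m1mat_def zero_prod_def prod_eq_iff)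
qed (simp add: mact_def zero_prod_def)

lemma mact_measurable [measurable]: "mact g \<in> borel_measurable borel"
  unfolding mact_def
  by (intro cts_borel continuous_on_Pair continuous_on_add continuous_on_mult continuous_on_const
      continuous_on_fst continuous_on_snd continuous_on_id)

definition lebesgue_preserving :: "coords \<Rightarrow> bool" where
  "lebesgue_preserving g \<longleftrightarrow>
     (\<forall>f \<in> borel_measurable borel. (\<integral>\<^sup>+v. f (mact g v) \<partial>lborel) = (\<integral>\<^sup>+v. f v \<partial>lborel :: ennreal))"

lemma lebesgue_preserving_mmult:
  assumes "lebesgue_preserving g" "lebesgue_preserving h"
  shows "lebesgue_preserving (mmult g h)"
  unfolding lebesgue_preserving_def mact_mmult
proof
  fix f :: "complex \<times> complex \<Rightarrow> ennreal" assume f: "f \<in> borel_measurable borel"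
  have "(\<lambda>v. f (mact g v)) \<in> borel_measurable borel"
    by (rule measurable_compose[OF mact_measurable f])
  from assms(2)[unfolded lebesgue_preserving_def, rule_format, OF this]
  show "(\<integral>\<^sup>+v. f (mact g (mact h v)) \<partial>lborel) = (\<integral>\<^sup>+v. f v \<partial>lborel)"
    using assms(1)[unfolded lebesgue_preserving_def, rule_format, OF f] by simp
qed

lemma lebesgue_preserving_shear:
  "lebesgue_preserving (mk 1 z 0 1)" "lebesgue_preserving (mk 1 0 z 1)"
proof -
  have 1: "(\<lambda>v. f (mact g v)) \<in> borel_measurable borel" if "f \<in> borel_measurable borel"
    for f :: "complex \<times> complex \<Rightarrow> ennreal" and g
    by (rule measurable_compose[OF mact_measurable that])
  have sec: "(\<lambda>x. f (x, y)) \<in> borel_measurable borel" "(\<lambda>y. f (x, y)) \<in> borel_measurable borel"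
    if "f \<in> borel_measurable borel" for f :: "complex \<times> complex \<Rightarrow> ennreal" and x y
    by (rule measurable_compose[OF cts_borel that],
        intro continuous_on_Pair continuous_on_const continuous_on_id)+
  show "lebesgue_preserving (mk 1 z 0 1)"
    unfolding lebesgue_preserving_def
  proof
    fix f :: "complex \<times> complex \<Rightarrow> ennreal" assume f: "f \<in> borel_measurable borel"
    show "(\<integral>\<^sup>+v. f (mact (mk 1 z 0 1) v) \<partial>lborel) = (\<integral>\<^sup>+v. f v \<partial>lborel)"
      unfolding nn_integral_lborel_pair(2)[OF f] nn_integral_lborel_pair(2)[OF 1[OF f]]
      using nn_integral_translate[OF sec(1)[OF f]] by (simp add: mact_def)
  qed
  show "lebesgue_preserving (mk 1 0 z 1)"
    unfolding lebesgue_preserving_def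
  proof
    fix f :: "complex \<times> complex \<Rightarrow> ennreal" assume f: "f \<in> borel_measurable borel"
    have "(\<integral>\<^sup>+y. f (x, z * x + y) \<partial>lborel) = (\<integral>\<^sup>+y. f (x, y) \<partial>lborel)" for x
      using nn_integral_translate[OF sec(2)[OF f], of x "z * x"] by (simp add: add.commute)
    then show "(\<integral>\<^sup>+v. f (mact (mk 1 0 z 1) v) \<partial>lborel) = (\<integral>\<^sup>+v. f v \<partial>lborel)"
      unfolding nn_integral_lborel_pair(1)[OF f] nn_integral_lborel_pair(1)[OF 1[OF f]]
      by (simp add: mact_def)
  qed
qed

text \<open>If the lower left entry c is nonzero, g is the product of the upper, lower and upper
  shears with parameters (a - 1)/c, c and (d - 1)/c. If c = 0, a lower shear first moves the nonzero
  entry a into this position.\<close>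

lemma lebesgue_preserving_SL2:
  assumes "g \<in> SL2" shows "lebesgue_preserving g"
proof -
  have main: "lebesgue_preserving g" if g: "g \<in> SL2" and c: "ec g \<noteq> 0" for g
  proof -
    let ?p = "(ea g - 1) / ec g" and ?q = "(ed g - 1) / ec g"
    have "mmult (mmult (mk 1 ?p 0 1) (mk 1 0 (ec g) 1)) (mk 1 ?q 0 1) = g"
    proof (rule SL2_eqI[OF _ g])
      have det: "ea g * ed g = 1 + eb g * ec g" using g by (simp add: SL2_def mdet_def algebra_simps)
      show "eb (mmult (mmult (mk 1 ?p 0 1) (mk 1 0 (ec g) 1)) (mk 1 ?q 0 1)) = eb g"
        using c by (simp add: field_simps det)
    qed (use c in \<open>simp_all add: field_simps\<close>)
    then show ?thesis
      by (metis lebesgue_preserving_mmult lebesgue_preserving_shear)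
  qed
  show ?thesis
  proof (cases "ec g = 0")
    case True
    let ?h = "mmult (mk 1 0 1 1) g"
    have "ea g \<noteq> 0" using assms True by (auto simp: SL2_def mdet_def)
    then have "lebesgue_preserving ?h"
      using True assms by (intro main mmult_in_SL2) (simp_all add: mmult_def)
    then have "lebesgue_preserving (mmult (mk 1 0 (-1) 1) ?h)"
      by (rule lebesgue_preserving_mmult[OF lebesgue_preserving_shear(2)])
    moreover have "mmult (mk 1 0 (-1) 1) ?h = g"
    proof -
      have "mmult (mk 1 0 (-1) 1) ?h = mmult m1mat g"
        unfolding mmult_assoc[symmetric] by (simp add: m1mat_def)
      then show ?thesis using assms by (simp add: mmult_1)
    qed
    ultimately show ?thesis by (simp only:)
  qed (rule main[OF assms])
qed

lemma nn_integral_mact: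
  assumes "g \<in> SL2" "f \<in> borel_measurable borel"
  shows "(\<integral>\<^sup>+v. f (mact g v) \<partial>lborel) = (\<integral>\<^sup>+v. f v \<partial>lborel :: ennreal)"
  using lebesgue_preserving_SL2[OF assms(1)] assms(2) unfolding lebesgue_preserving_def by blast

lemma psi_unipotent: assumes "v \<noteq> 0" shows "mmult (psi (v, z)) (mk 1 y 0 1) = psi (v, z + y)"
  unfolding psi_eq[OF assms] by (simp add: algebra_simps)

text \<open>The coordinate z is a right factor in N and commutes with left multiplication. So the
  shift of z can be computed at z = 0 and depends on v alone.\<close>

lemma mmult_psi:
  assumes "g \<in> SL2" "v \<noteq> 0"
  shows "mmult g (psi (v, z)) = psi (mact g v, z + zc (mmult g (psi (v, 0))))"
proof -
  have h: "mmult g (psi (v, 0)) \<in> SL2" by (intro mmult_in_SL2 assms psi_in_SL2)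
  have e: "(ea (mmult g (psi (v, 0))), ec (mmult g (psi (v, 0)))) = mact g v"
    using psi_entries[OF assms(2)] by (simp add: mact_def mmult_def)
  have "mmult g (psi (v, z)) = mmult (mmult g (psi (v, 0))) (mk 1 z 0 1)"
    using psi_unipotent[OF assms(2), of 0 z] by (simp add: mmult_assoc)
  also have "mmult g (psi (v, 0)) = psi (mact g v, zc (mmult g (psi (v, 0))))"
    using psi_zc[OF h] unfolding e by simp
  also have "mmult \<dots> (mk 1 z 0 1) = psi (mact g v, z + zc (mmult g (psi (v, 0))))"
    using mact_eq_0_iff[OF assms(1)] assms(2) by (subst psi_unipotent) (simp_all add: add.commute)
  finally show ?thesis .
qed

lemma AE_nonzero: "AE v in lborel. v \<noteq> (0 :: 'a :: euclidean_space)"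
  by (rule AE_I[of _ _ "{0}"]) auto

lemma measurable_compose_psi:
  assumes "f \<in> borel_measurable haarG" shows "(\<lambda>w. f (psi w)) \<in> borel_measurable borel"
  by (rule measurable_compose[OF psi_measurable assms])

lemma borel_section:
  fixes f :: "'a::euclidean_space \<times> 'b::euclidean_space \<Rightarrow> ennreal"
  assumes "f \<in> borel_measurable borel"
  shows "(\<lambda>y. f (x, y)) \<in> borel_measurable borel"
    "(\<lambda>x. \<integral>\<^sup>+y. f (x, y) \<partial>lborel) \<in> borel_measurable borel"
proof -
  show "(\<lambda>y. f (x, y)) \<in> borel_measurable borel"
    by (rule measurable_compose[OF cts_borel assms])
      (intro continuous_on_Pair continuous_on_const continuous_on_id)
  have "f \<in> borel_measurable (borel \<Otimes>\<^sub>M lborel)"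
    using assms by (subst measurable_cong_sets[OF _ refl, of _ "borel \<Otimes>\<^sub>M borel"])
      (auto simp: borel_prod intro!: sets_pair_measure_cong)
  from lborel.borel_measurable_nn_integral_fst[OF this]
  show "(\<lambda>x. \<integral>\<^sup>+y. f (x, y) \<partial>lborel) \<in> borel_measurable borel" .
qed

lemma nn_integral_haarG_iterated:
  assumes "f \<in> borel_measurable haarG"
  shows "(\<integral>\<^sup>+x. f x \<partial>haarG) = (\<integral>\<^sup>+v. \<integral>\<^sup>+z. f (psi (v, z)) \<partial>lborel \<partial>lborel)"
  unfolding nn_integral_haarG[OF assms] nn_integral_lborel_pair(1)[OF measurable_compose_psi[OF assms]] ..

lemma nn_integral_haarG_left:
  assumes f[measurable]: "f \<in> borel_measurable haarG" and g: "g \<in> SL2"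
  shows "(\<integral>\<^sup>+x. f (mmult g x) \<partial>haarG) = (\<integral>\<^sup>+x. f x \<partial>haarG)"
proof -
  have g': "(\<lambda>x. g) \<in> measurable haarG haarG" using g by simp
  have fg: "(\<lambda>x. f (mmult g x)) \<in> borel_measurable haarG"
    by (rule measurable_compose[OF measurable_haar_group(1)[OF g' measurable_ident_sets[OF refl]] f])
  note fpsi = measurable_compose_psi[OF f]
  have "(\<integral>\<^sup>+x. f (mmult g x) \<partial>haarG) = (\<integral>\<^sup>+v. \<integral>\<^sup>+z. f (mmult g (psi (v, z))) \<partial>lborel \<partial>lborel)"
    by (rule nn_integral_haarG_iterated[OF fg])
  also have "\<dots> = (\<integral>\<^sup>+v. (\<integral>\<^sup>+z. f (psi (mact g v, z)) \<partial>lborel) \<partial>lborel)"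
  proof (rule nn_integral_cong_AE, rule eventually_mono[OF AE_nonzero])
    fix v :: "complex \<times> complex" assume v: "v \<noteq> 0"
    define C where "C = zc (mmult g (psi (v, 0)))"
    have e: "mmult g (psi (v, z)) = psi (mact g v, z + C)" for z
      unfolding C_def by (rule mmult_psi[OF g v])
    show "(\<integral>\<^sup>+z. f (mmult g (psi (v, z))) \<partial>lborel) = (\<integral>\<^sup>+z. f (psi (mact g v, z)) \<partial>lborel)"
      unfolding e by (rule nn_integral_translate[OF borel_section(1)[OF fpsi]])
  qed
  also have "\<dots> = (\<integral>\<^sup>+v. (\<integral>\<^sup>+z. f (psi (v, z)) \<partial>lborel) \<partial>lborel)"
    by (rule nn_integral_mact[OF g borel_section(2)[OF fpsi]])
  also have "\<dots> = (\<integral>\<^sup>+x. f x \<partial>haarG)"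
    by (rule nn_integral_haarG_iterated[OF f, symmetric])
  finally show ?thesis .
qed

lemma measure_eq_distrI:
  assumes T: "T \<in> measurable M M"
    and eq: "\<And>f :: 'a \<Rightarrow> ennreal. f \<in> borel_measurable M \<Longrightarrow> (\<integral>\<^sup>+x. f (T x) \<partial>M) = (\<integral>\<^sup>+x. f x \<partial>M)"
  shows "distr M M T = M"
proof (rule measure_eqI)
  fix A assume "A \<in> sets (distr M M T)"
  then have A: "A \<in> sets M" by simp
  have "emeasure (distr M M T) A = (\<integral>\<^sup>+x. indicator A x \<partial>distr M M T)"
    using A by simp
  also have "\<dots> = (\<integral>\<^sup>+x. indicator A (T x) \<partial>M)"
    using A by (intro nn_integral_distr T) simp
  also have "\<dots> = emeasure M A"
    using A by (subst eq) simp_all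
  finally show "emeasure (distr M M T) A = emeasure M A" .
qed simp

lemma distr_haarG_left:
  assumes "g \<in> SL2" shows "distr haarG haarG (mmult g) = haarG"
  by (rule measure_eq_distrI) (use assms nn_integral_haarG_left in auto)

section \<open>Haar measure on SU(2), and finiteness of the measure on G\<close>

lemma norm_mact_SU2: assumes "k \<in> SU2" shows "norm (mact k v) = norm v"
proof -
  obtain p q where k: "k = mk p q (- cnj q) (cnj p)" and pq: "p * cnj p + q * cnj q = 1"
    using assms by (rule SU2_cases)
  have "complex_of_real ((norm (mact k v))\<^sup>2) = (p * cnj p + q * cnj q) * complex_of_real ((norm v)\<^sup>2)"
    unfolding norm_pair_sq_complex by (simp add: mact_def k algebra_simps)
  then have "(norm (mact k v))\<^sup>2 = (norm v)\<^sup>2"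
    using pq by (simp only: mult_1 of_real_eq_iff)
  then show ?thesis by (simp add: power2_eq_iff_nonneg)
qed

lemma ku_mact:
  assumes "k \<in> SU2" "v \<noteq> 0" shows "ku (mact k v) = mmult k (ku v)"
proof -
  obtain p q where k: "k = mk p q (- cnj q) (cnj p)" and pq: "p * cnj p + q * cnj q = 1"
    using assms(1) by (rule SU2_cases)
  have "mact k v \<noteq> 0" using mact_eq_0_iff[of k v] SU2_subset assms by auto
  then show ?thesis
    unfolding ku_eq[OF assms(2)] ku_eq[OF \<open>mact k v \<noteq> 0\<close>] norm_mact_SU2[OF assms(1)]
    by (simp add: k mact_def add_divide_distrib diff_divide_distrib)
qed

lemma emeasure_unit_ball: "emeasure lborel (ball (0 :: complex \<times> complex) 1) \<noteq> 0"
    "emeasure lborel (ball (0 :: complex \<times> complex) 1) \<noteq> \<infinity>"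
  by (simp_all add: emeasure_ball unit_ball_vol_pos less_imp_neq[THEN not_sym])

lemma haarK_eq: "haarK = distr (uniform_measure lborel (ball 0 1)) haarK ku"
  unfolding haarK_def by (rule distr_cong) simp_all

lemma nn_integral_haarK:
  assumes [measurable]: "f \<in> borel_measurable haarK"
  shows "(\<integral>\<^sup>+k. f k \<partial>haarK) =
    (\<integral>\<^sup>+v. f (ku v) * indicator (ball 0 1) v \<partial>lborel) / emeasure lborel (ball (0 :: complex \<times> complex) 1)"
proof -
  have [measurable]: "(\<lambda>v. f (ku v)) \<in> borel_measurable borel"
    by (rule measurable_compose[OF ku_measurable assms])
  have "(\<integral>\<^sup>+k. f k \<partial>haarK) = (\<integral>\<^sup>+v. f (ku v) \<partial>uniform_measure lborel (ball (0 :: complex \<times> complex) 1))"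
    by (subst haarK_eq, rule nn_integral_distr) simp_all
  then show ?thesis by (simp add: nn_integral_uniform_measure)
qed

lemma prob_space_haarK: "prob_space haarK"
proof -
  interpret prob_space "uniform_measure lborel (ball (0 :: complex \<times> complex) 1)"
    by (rule prob_space_uniform_measure[OF emeasure_unit_ball])
  show ?thesis
    by (subst haarK_eq, rule prob_space_distr) simp
qed

interpretation haarK: prob_space haarK
  by (rule prob_space_haarK)

lemma nn_integral_haarK_left:
  assumes f[measurable]: "f \<in> borel_measurable haarK" and k: "k \<in> SU2"
  shows "(\<integral>\<^sup>+l. f (mmult k l) \<partial>haarK) = (\<integral>\<^sup>+l. f l \<partial>haarK)"
proof -
  have k': "(\<lambda>x. k) \<in> measurable haarK haarK" using k by simp
  have fk: "(\<lambda>x. f (mmult k x)) \<in> borel_measurable haarK"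
    by (rule measurable_compose[OF measurable_haar_group(3)[OF k' measurable_ident_sets[OF refl]] f])
  have fku: "(\<lambda>v. f (ku v)) \<in> borel_measurable borel"
    by (rule measurable_compose[OF ku_measurable f])
  have "(\<integral>\<^sup>+v. f (mmult k (ku v)) * indicator (ball 0 1) v \<partial>lborel)
      = (\<integral>\<^sup>+v. f (ku (mact k v)) * indicator (ball 0 1) (mact k v) \<partial>lborel)"
    by (rule nn_integral_cong_AE, rule eventually_mono[OF AE_nonzero])
      (use ku_mact[OF k] norm_mact_SU2[OF k] in \<open>simp add: indicator_def\<close>)
  also have "\<dots> = (\<integral>\<^sup>+v. f (ku v) * indicator (ball 0 1) v \<partial>lborel)"
  proof (rule nn_integral_mact)
    show "(\<lambda>v. f (ku v) * indicator (ball 0 1) v) \<in> borel_measurable borel"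
      by (intro borel_measurable_times_ennreal fku borel_measurable_indicator) simp
  qed (use k SU2_subset in auto)
  finally show ?thesis
    unfolding nn_integral_haarK[OF f] nn_integral_haarK[OF fk] by simp
qed

lemma distr_haarK_left:
  assumes "k \<in> SU2" shows "distr haarK haarK (mmult k) = haarK"
  by (rule measure_eq_distrI) (use assms nn_integral_haarK_left in auto)

lemma haar_prob_on_K_S0: "haar_prob_on_K S0"
  unfolding haar_prob_on_K_def using haarK.emeasure_space_1 distr_haarK_left by simp

text \<open>Inverse of \<open>psi\<close> away from the null set \<open>v = 0\<close>. In contrast
  to \<open>psi\<close> it is continuous everywhere on its domain \<open>SL2\<close>, so it maps
  compact sets to compact sets.\<close>

definition cmap :: "coords \<Rightarrow> (complex \<times> complex) \<times> complex" where
  "cmap g = ((ea g, ec g), zc g)"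

lemma cmap_psi: assumes "fst w \<noteq> 0" shows "cmap (psi w) = w"
proof -
  obtain v z where w: "w = (v, z)" by (cases w)
  have v: "v \<noteq> 0" using assms w by simp
  have e: "(ea (psi (v, z)), ec (psi (v, z))) = v" using psi_entries[OF v] by simp
  have "psi (v, zc (psi (v, z))) = psi (v, z)"
    using psi_zc[OF psi_in_SL2, of "(v, z)"] unfolding e .
  then have "zc (psi (v, z)) * fst v = z * fst v" "zc (psi (v, z)) * snd v = z * snd v"
    unfolding psi_eq[OF v] by auto
  then have "zc (psi (v, z)) = z"
    using v by (cases v) (auto simp: zero_prod_def)
  then show ?thesis using e by (simp add: cmap_def w)
qed

lemma continuous_on_cmap: "continuous_on SL2 cmap"
  unfolding cmap_def zc_def using SL2_column_nonzero
  by (intro continuous_on_Pair continuous_on_divide continuous_on_add continuous_on_mult continuous_on_cnj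
      continuous_on_entries continuous_on_of_real continuous_on_power continuous_on_norm continuous_on_id) auto

lemma cmap_measurable [measurable]: "cmap \<in> borel_measurable haarG"
proof -
  have "cmap \<in> borel_measurable (restrict_space borel SL2)"
    by (rule borel_measurable_continuous_on_restrict[OF continuous_on_cmap])
  then show ?thesis by (simp cong: measurable_cong_sets)
qed

lemma null_column: "emeasure lborel ({0} \<times> UNIV :: ((complex \<times> complex) \<times> complex) set) = 0"
proof -
  have "emeasure (lborel \<Otimes>\<^sub>M lborel) ({0} \<times> UNIV :: ((complex \<times> complex) \<times> complex) set) = 0"
    by (subst lborel.emeasure_pair_measure_Times) auto
  then show ?thesis by (simp add: lborel_prod)
qed

lemma closed_column: "closed ({0} \<times> UNIV :: ((complex \<times> complex) \<times> complex) set)"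
  by (intro closed_Times) auto

text \<open>Up to the null set \<open>v = 0\<close>, the preimage of \<open>C\<close> under
  \<open>psi\<close> is contained in its image under \<open>cmap\<close>. Measures on G are thus
  bounded by volumes of coordinate regions.\<close>

lemma emeasure_haarG_le:
  assumes C: "C \<in> sets haarG" and B: "B \<in> sets borel" and sub: "cmap ` C \<subseteq> B"
  shows "emeasure haarG C \<le> emeasure lborel B"
proof -
  have "emeasure haarG C = emeasure lborel (psi -` C)"
    using C by (subst haarG_eq, subst emeasure_distr) simp_all
  also have "\<dots> \<le> emeasure lborel (B \<union> {0} \<times> UNIV)"
  proof (rule emeasure_mono)
    show "psi -` C \<subseteq> B \<union> {0} \<times> UNIV"
    proof
      fix w assume w: "w \<in> psi -` C"
      show "w \<in> B \<union> {0} \<times> UNIV"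
      proof (cases "fst w = 0")
        case False
        then have "w = cmap (psi w)" by (simp add: cmap_psi)
        then show ?thesis using w sub by auto
      qed (cases w, auto)
    qed
    show "B \<union> {0} \<times> UNIV \<in> sets lborel" using B closed_column by simp
  qed
  also have "\<dots> \<le> emeasure lborel B + emeasure lborel ({0} \<times> UNIV :: ((complex \<times> complex) \<times> complex) set)"
    using B closed_column by (intro emeasure_subadditive) simp_all
  finally show ?thesis by (simp add: null_column)
qed

lemma haarG_compact_finite:
  assumes "C \<subseteq> SL2" "compact C" shows "emeasure haarG C < \<infinity>"
proof -
  have "C \<inter> SL2 \<in> sets (restrict_space borel SL2)"
    using assms by (auto simp: sets_restrict_space compact_imp_closed Int_commute)
  moreover have "C \<inter> SL2 = C" using assms(1) by auto
  ultimately have "C \<in> sets haarG" by simp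
  moreover have c: "compact (cmap ` C)"
    using assms continuous_on_cmap by (blast intro: compact_continuous_image continuous_on_subset)
  ultimately have "emeasure haarG C \<le> emeasure lborel (cmap ` C)"
    by (intro emeasure_haarG_le) (simp_all add: borel_compact)
  also have "\<dots> < \<infinity>" using c by (rule emeasure_compact_finite)
  finally show ?thesis .
qed

lemma emeasure_haarG_space: "emeasure haarG SL2 = \<infinity>"
proof -
  have "emeasure haarG SL2 = emeasure lborel (psi -` SL2)"
    using sets.top[of haarG] by (subst haarG_eq, subst emeasure_distr) simp_all
  also have "psi -` SL2 = UNIV" using psi_in_SL2 by auto
  finally show ?thesis by simp
qed

lemma haar_on_G_S0: "haar_on_G S0"
  unfolding haar_on_G_def using emeasure_haarG_space haarG_compact_finite distr_haarG_left by simp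

lemma sigma_finite_haarG: "sigma_finite_measure haarG"
proof
  let ?A = "\<lambda>n::nat. {x \<in> SL2. cmap x \<in> cball 0 (real n)}"
  have meas: "?A n \<in> sets haarG" for n
  proof -
    have "cmap -` cball 0 (real n) \<inter> space haarG \<in> sets haarG"
      by (rule measurable_sets[OF cmap_measurable]) simp
    moreover have "cmap -` cball 0 (real n) \<inter> space haarG = ?A n" by auto
    ultimately show ?thesis by simp
  qed
  have "emeasure haarG (?A n) \<noteq> \<infinity>" for n
  proof -
    have "emeasure haarG (?A n) \<le> emeasure lborel (cball (0 :: (complex \<times> complex) \<times> complex) (real n))"
      by (rule emeasure_haarG_le[OF meas]) auto
    also have "\<dots> < \<infinity>" by (rule emeasure_compact_finite) simp
    finally show ?thesis by simp
  qed
  moreover have "(\<Union>n. ?A n) = space haarG"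
    using real_arch_simple by auto
  ultimately show "\<exists>A. countable A \<and> A \<subseteq> sets haarG \<and> \<Union> A = space haarG \<and> (\<forall>a\<in>A. emeasure haarG a \<noteq> \<infinity>)"
    using meas by (intro exI[of _ "range ?A"]) auto
qed

interpretation haarG: sigma_finite_measure haarG
  by (rule sigma_finite_haarG)

interpretation haarGG: pair_sigma_finite haarG haarG ..

interpretation haarKK: pair_sigma_finite haarK haarK ..

interpretation haarKG: pair_sigma_finite haarK haarG ..

theorem rank_one_S0: "rank_one_symmetric_space S0"
  unfolding rank_one_symmetric_space_def
proof (intro conjI)
  show "Hg S0 \<noteq> 0" by (simp add: mk_0[symmetric])
qed (simp_all add: lie_group_S0 connected_SL2 not_compact_SL2 semisimple_S0 finite_centre_S0
    maximal_compact_SU2 maximal_abelian_S0[simplified] simple_root_S0 haar_prob_on_K_S0 haar_on_G_S0)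

subsection \<open>Unimodularity\<close>

text \<open>Both sides equal the double integral of f(y^{-1}x) over K x K: integrating over y first
  gives the left one, over x first the right one, because the total mass is one.\<close>

lemma nn_integral_haarK_inv:
  assumes f[measurable]: "f \<in> borel_measurable haarK"
  shows "(\<integral>\<^sup>+x. f (madj x) \<partial>haarK) = (\<integral>\<^sup>+x. f x \<partial>haarK)"
proof -
  have 1: "(\<integral>\<^sup>+y. f (mmult (madj y) x) \<partial>haarK) = (\<integral>\<^sup>+y. f (madj y) \<partial>haarK)" if x: "x \<in> SU2" for x
  proof -
    have [measurable]: "(\<lambda>y. x) \<in> measurable haarK haarK" using x by simp
    have xS: "x \<in> SL2" using x SU2_subset by auto
    have "(\<integral>\<^sup>+y. f (mmult (madj (mmult x y)) x) \<partial>haarK) = (\<integral>\<^sup>+y. f (mmult (madj y) x) \<partial>haarK)"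
      by (rule nn_integral_haarK_left[OF _ x]) measurable
    moreover have "(\<integral>\<^sup>+y. f (mmult (madj (mmult x y)) x) \<partial>haarK) = (\<integral>\<^sup>+y. f (madj y) \<partial>haarK)"
    proof (rule nn_integral_cong)
      fix y assume "y \<in> space haarK"
      then have "y \<in> SL2" using SU2_subset by auto
      then show "f (mmult (madj (mmult x y)) x) = f (madj y)"
        by (simp add: madj_mmult mmult_assoc mmult_madj xS mmult_1 madj_in_SL2)
    qed
    ultimately show ?thesis by simp
  qed
  have 2: "(\<integral>\<^sup>+x. f (mmult (madj y) x) \<partial>haarK) = (\<integral>\<^sup>+x. f x \<partial>haarK)" if "y \<in> SU2" for y
    by (rule nn_integral_haarK_left[OF f madj_in_SU2[OF that]])
  have "(\<integral>\<^sup>+x. f (madj x) \<partial>haarK) = (\<integral>\<^sup>+x. (\<integral>\<^sup>+y. f (madj y) \<partial>haarK) \<partial>haarK)"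
    by (simp add: haarK.emeasure_space_1[simplified])
  also have "\<dots> = (\<integral>\<^sup>+x. (\<integral>\<^sup>+y. f (mmult (madj y) x) \<partial>haarK) \<partial>haarK)"
    by (rule nn_integral_cong) (simp add: 1)
  also have "\<dots> = (\<integral>\<^sup>+y. (\<integral>\<^sup>+x. f (mmult (madj y) x) \<partial>haarK) \<partial>haarK)"
    by (rule haarKK.Fubini'[symmetric]) measurable
  also have "\<dots> = (\<integral>\<^sup>+y. (\<integral>\<^sup>+x. f x \<partial>haarK) \<partial>haarK)"
    by (rule nn_integral_cong) (simp add: 2)
  also have "\<dots> = (\<integral>\<^sup>+x. f x \<partial>haarK)"
    by (simp add: haarK.emeasure_space_1[simplified])
  finally show ?thesis .
qed

lemma nn_integral_haarK_right:
  assumes f[measurable]: "f \<in> borel_measurable haarK" and l: "l \<in> SU2"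
  shows "(\<integral>\<^sup>+k. f (mmult k l) \<partial>haarK) = (\<integral>\<^sup>+k. f k \<partial>haarK)"
proof -
  have [measurable]: "(\<lambda>y. l) \<in> measurable haarK haarK" using l by simp
  have "(\<integral>\<^sup>+k. f (mmult k l) \<partial>haarK) = (\<integral>\<^sup>+k. f (mmult (madj k) l) \<partial>haarK)"
    by (rule nn_integral_haarK_inv[symmetric]) measurable
  also have "\<dots> = (\<integral>\<^sup>+k. f (madj (mmult (madj l) k)) \<partial>haarK)"
    unfolding madj_mmult by (simp add: madj_def) (simp add: madj_def mmult_def)
  also have "\<dots> = (\<integral>\<^sup>+k. f (madj k) \<partial>haarK)"
    by (rule nn_integral_haarK_left[OF _ madj_in_SU2[OF l]]) measurable
  also have "\<dots> = (\<integral>\<^sup>+k. f k \<partial>haarK)"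
    by (rule nn_integral_haarK_inv[OF f])
  finally show ?thesis .
qed

lemma psi_right_AN:
  assumes "v \<noteq> 0" "p > 0"
  shows "mmult (psi (v, z)) (mk (of_real p) q 0 (1 / of_real p))
       = psi (p *\<^sub>R v, q / of_real p + (1 / p\<^sup>2) *\<^sub>R z)"
proof -
  have pv: "p *\<^sub>R v \<noteq> 0" using assms by simp
  have "norm v \<noteq> 0" using assms by simp
  then show ?thesis
    unfolding psi_eq[OF assms(1)] psi_eq[OF pv] using assms(2)
    by (simp add: scaleR_conv_of_real power2_eq_square field_simps)
qed

text \<open>Right multiplication scales v by p in real dimension 4 and z by p^{-2} in real dimension
  2, besides a translation of z. The two Jacobians p^4 and p^{-4} cancel.\<close>

lemma nn_integral_haarG_right_AN:
  assumes f[measurable]: "f \<in> borel_measurable haarG" and p: "p > 0"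
  shows "(\<integral>\<^sup>+x. f (mmult x (mk (of_real p) q 0 (1 / of_real p))) \<partial>haarG) = (\<integral>\<^sup>+x. f x \<partial>haarG)"
proof -
  let ?b = "mk (of_real p) q 0 (1 / of_real p)"
  have [measurable]: "(\<lambda>x. ?b) \<in> measurable haarG haarG" using p by simp
  note fpsi = measurable_compose_psi[OF f]
  have "(\<integral>\<^sup>+x. f (mmult x ?b) \<partial>haarG) = (\<integral>\<^sup>+v. \<integral>\<^sup>+z. f (mmult (psi (v, z)) ?b) \<partial>lborel \<partial>lborel)"
    by (rule nn_integral_haarG_iterated) measurable
  also have "\<dots> = (\<integral>\<^sup>+v. ennreal (p ^ 4) * (\<integral>\<^sup>+z. f (psi (p *\<^sub>R v, z)) \<partial>lborel) \<partial>lborel)"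
  proof (rule nn_integral_cong_AE, rule eventually_mono[OF AE_nonzero])
    fix v :: "complex \<times> complex" assume v: "v \<noteq> 0"
    have "(\<integral>\<^sup>+z. f (psi (p *\<^sub>R v, z)) \<partial>lborel) =
        ennreal ((1 / p\<^sup>2) ^ DIM(complex)) * (\<integral>\<^sup>+z. f (psi (p *\<^sub>R v, q / of_real p + (1 / p\<^sup>2) *\<^sub>R z)) \<partial>lborel)"
      by (rule nn_integral_scale[OF borel_section(1)[OF fpsi]]) (use p in simp)
    then have "ennreal (p ^ 4) * (\<integral>\<^sup>+z. f (psi (p *\<^sub>R v, z)) \<partial>lborel) =
        (ennreal (p ^ 4) * ennreal ((1 / p\<^sup>2) ^ 2)) * (\<integral>\<^sup>+z. f (psi (p *\<^sub>R v, q / of_real p + (1 / p\<^sup>2) *\<^sub>R z)) \<partial>lborel)"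
      by (simp add: mult.assoc)
    also have "ennreal (p ^ 4) * ennreal ((1 / p\<^sup>2) ^ 2) = 1"
      using p by (simp add: ennreal_mult[symmetric] field_simps flip: power_mult ennreal_1)
    finally show "(\<integral>\<^sup>+z. f (mmult (psi (v, z)) ?b) \<partial>lborel) = ennreal (p ^ 4) * (\<integral>\<^sup>+z. f (psi (p *\<^sub>R v, z)) \<partial>lborel)"
      unfolding psi_right_AN[OF v p] by simp
  qed
  also have "\<dots> = ennreal (p ^ 4) * (\<integral>\<^sup>+v. (\<integral>\<^sup>+z. f (psi (p *\<^sub>R v, z)) \<partial>lborel) \<partial>lborel)"
  proof (rule nn_integral_cmult)
    have "(\<lambda>v :: complex \<times> complex. p *\<^sub>R v) \<in> borel_measurable borel"
      by (intro cts_borel continuous_on_scaleR continuous_on_const continuous_on_id)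
    from measurable_compose[OF this borel_section(2)[OF fpsi]]
    show "(\<lambda>v. \<integral>\<^sup>+z. f (psi (p *\<^sub>R v, z)) \<partial>lborel) \<in> borel_measurable lborel" by simp
  qed
  also have "\<dots> = (\<integral>\<^sup>+v. (\<integral>\<^sup>+z. f (psi (v, z)) \<partial>lborel) \<partial>lborel)"
    using nn_integral_scale[OF borel_section(2)[OF fpsi] p, of 0] by simp
  also have "\<dots> = (\<integral>\<^sup>+x. f x \<partial>haarG)"
    by (rule nn_integral_haarG_iterated[OF f, symmetric])
  finally show ?thesis .
qed

lemma hsn_psi:
  assumes "v \<noteq> 0"
  shows "hsn (psi (v, z)) = (norm v)\<^sup>2 + 1 / (norm v)\<^sup>2 + (cmod z)\<^sup>2 * (norm v)\<^sup>2"
proof -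
  have n: "norm v > 0" using assms by simp
  have e: "exp (2 * ln (norm v) / 2) = norm v" "exp (- (2 * ln (norm v)) / 2) = inverse (norm v)"
    using exp_ln[OF n] exp_minus[of "ln (norm v)"] by simp_all
  have "hsn (psi (v, z)) = hsn (mmult (a_elt S0 (2 * ln (norm v))) (mk 1 z 0 1))"
    unfolding psi_Iwasawa[OF assms] mmult_assoc by (rule hsn_mult_left[OF ku_in_SU2])
  also have "\<dots> = (norm v)\<^sup>2 + 1 / (norm v)\<^sup>2 + (cmod z)\<^sup>2 * (norm v)\<^sup>2"
    unfolding a_elt_S0 e by (simp add: hsn_def norm_mult power_mult_distrib norm_inverse power_inverse divide_inverse)
  finally show ?thesis .
qed

lemma hsn_measurable [measurable]: "hsn \<in> borel_measurable haarG"
proof -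
  have "continuous_on SL2 hsn"
    unfolding hsn_def
    by (intro continuous_on_add continuous_on_power continuous_on_norm continuous_on_entries continuous_on_id)
  then have "hsn \<in> borel_measurable (restrict_space borel SL2)"
    by (rule borel_measurable_continuous_on_restrict)
  then show ?thesis by (simp cong: measurable_cong_sets)
qed

text \<open>\<open>hsn\<close> dominates |v|^2, |v|^{-2} and |z|^2 |v|^2. The product of the last
  two bounds |z| by N, so the set lies over a compact box of coordinates.\<close>

lemma hsn_sublevel_finite: "emeasure haarG {x \<in> SL2. hsn x \<le> N} < \<infinity>"
proof -
  let ?B = "cball (0 :: complex \<times> complex) (sqrt N) \<times> cball (0 :: complex) N"
  have cpt: "compact ?B" by (intro compact_Times) auto
  have "{x \<in> space haarG. hsn x \<le> N} \<in> sets haarG" by measurable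
  then have meas: "{x \<in> SL2. hsn x \<le> N} \<in> sets haarG" by simp
  have "emeasure haarG {x \<in> SL2. hsn x \<le> N} \<le> emeasure lborel ?B"
  proof (rule emeasure_haarG_le[OF meas])
    show "?B \<in> sets borel" using cpt by (rule borel_compact)
    show "cmap ` {x \<in> SL2. hsn x \<le> N} \<subseteq> ?B"
    proof (rule image_subsetI)
      fix x assume "x \<in> {x \<in> SL2. hsn x \<le> N}"
      then have x: "x \<in> SL2" "hsn x \<le> N" by auto
      define v where "v = (ea x, ec x)"
      define z where "z = zc x"
      have v0: "v \<noteq> 0" using SL2_column_nonzero[OF x(1)] by (simp add: v_def)
      have "hsn x = (norm v)\<^sup>2 + 1 / (norm v)\<^sup>2 + (cmod z)\<^sup>2 * (norm v)\<^sup>2"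
        using psi_zc[OF x(1)] hsn_psi[OF v0, of z] by (simp add: v_def z_def)
      then have le: "(norm v)\<^sup>2 + 1 / (norm v)\<^sup>2 + (cmod z)\<^sup>2 * (norm v)\<^sup>2 \<le> N" using x(2) by simp
      have v2: "(norm v)\<^sup>2 > 0" using v0 by simp
      have nn: "0 \<le> 1 / (norm v)\<^sup>2" "0 \<le> (cmod z)\<^sup>2 * (norm v)\<^sup>2" by simp_all
      have a: "(norm v)\<^sup>2 \<le> N" "1 / (norm v)\<^sup>2 \<le> N" "(cmod z)\<^sup>2 * (norm v)\<^sup>2 \<le> N"
        using le nn v2 by linarith+
      then have N0: "N \<ge> 0" using v2 by linarith
      have "norm v \<le> sqrt N" using a(1) by (simp add: real_le_rsqrt)
      moreover have "cmod z \<le> N"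
      proof (rule power2_le_imp_le[OF _ N0])
        have "(cmod z)\<^sup>2 = ((cmod z)\<^sup>2 * (norm v)\<^sup>2) * (1 / (norm v)\<^sup>2)"
          using v2 by simp
        also have "\<dots> \<le> N * N"
          by (rule mult_mono[OF a(3) a(2) N0]) (use nn in simp)
        finally show "(cmod z)\<^sup>2 \<le> N\<^sup>2" by (simp add: power2_eq_square)
      qed
      ultimately show "cmap x \<in> ?B"
        by (simp add: cmap_def v_def z_def)
    qed
  qed
  also have "\<dots> < \<infinity>" by (rule emeasure_compact_finite[OF cpt])
  finally show ?thesis .
qed

text \<open>Both $\int f(x^{-1})\,dx$ and $\int f(x)\,dx$ times the volume of a set $\{\|x\| \le N\}$ are
  the value of $\int\int \varphi(x) f(y^{-1}x)\,dx\,dy$, where $\varphi$ is the indicator function of this set: as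
  $\varphi$ is right $K$-invariant, right translation by \<open>b k\<close>, with \<open>b \<in> AN\<close>, does not change its integral.\<close>

lemma nn_integral_haarG_inv:
  assumes f[measurable]: "f \<in> borel_measurable haarG"
  shows "(\<integral>\<^sup>+x. f (madj x) \<partial>haarG) = (\<integral>\<^sup>+x. f x \<partial>haarG)"
proof -
  have meas: "{x \<in> SL2. hsn x \<le> N} \<in> sets haarG" for N
  proof -
    have "{x \<in> space haarG. hsn x \<le> N} \<in> sets haarG" by measurable
    then show ?thesis by simp
  qed
  obtain n :: nat where n: "emeasure haarG {x \<in> SL2. hsn x \<le> real n} \<noteq> 0"
  proof (rule ccontr)
    assume "\<not> thesis"
    then have "emeasure haarG (\<Union>n::nat. {x \<in> SL2. hsn x \<le> real n}) = 0"
      using that meas by (intro emeasure_UN_eq_0) auto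
    moreover have "(\<Union>n::nat. {x \<in> SL2. hsn x \<le> real n}) = SL2"
      using real_arch_simple by auto
    ultimately show False using emeasure_haarG_space by simp
  qed
  define A where "A = {x \<in> SL2. hsn x \<le> real n}"
  define \<phi> :: "coords \<Rightarrow> ennreal" where "\<phi> = indicator A"
  define e where "e = emeasure haarG A"
  have e: "e \<noteq> 0" "e \<noteq> \<infinity>"
    using n hsn_sublevel_finite[of "real n"] by (auto simp: e_def A_def)
  have [measurable]: "\<phi> \<in> borel_measurable haarG"
    using meas by (simp add: \<phi>_def A_def)
  have e_eq: "(\<integral>\<^sup>+x. \<phi> x \<partial>haarG) = e"
    using meas by (simp add: \<phi>_def e_def A_def)
  have right: "(\<integral>\<^sup>+y. \<phi> (mmult y x) \<partial>haarG) = e" if x: "x \<in> SL2" for x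
  proof -
    \<comment> \<open>The Iwasawa decomposition is applied to the inverse of \<open>x\<close>;
      inverting it again yields \<open>x\<close> as an element of AN followed by an element of K,
      the order that the right invariance of \<phi> calls for.\<close>
    define t where "t = 2 * ln (norm (ea (madj x), ec (madj x)))"
    define k where "k = ku (ea (madj x), ec (madj x))"
    define z where "z = zc (madj x)"
    define p where "p = exp (- t / 2)"
    let ?b = "mk (of_real p) (- z / of_real p) 0 (1 / of_real p)"
    have k: "k \<in> SU2" by (simp add: k_def ku_in_SU2)
    have "x = madj (madj x)" using SL2_eta[OF x] by (simp add: madj_def)
    also have "madj x = mmult (mmult k (a_elt S0 t)) (mk 1 z 0 1)"
      unfolding k_def t_def z_def by (rule Iwasawa_exists[OF madj_in_SL2[OF x]])
    also have "madj \<dots> = mmult (mmult (madj (mk 1 z 0 1)) (madj (a_elt S0 t))) (madj k)"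
      by (simp only: madj_mmult mmult_assoc)
    also have "mmult (madj (mk 1 z 0 1)) (madj (a_elt S0 t)) = ?b"
      by (simp add: a_elt_S0 p_def exp_minus field_simps)
    finally have xb: "x = mmult ?b (madj k)" .
    have "\<phi> (mmult y x) = \<phi> (mmult y ?b)" if y: "y \<in> SL2" for y
    proof -
      have "?b \<in> SL2" by (simp add: p_def)
      then have "mmult y x \<in> SL2" "mmult y ?b \<in> SL2" using x y by (auto intro: mmult_in_SL2)
      moreover have "hsn (mmult y x) = hsn (mmult y ?b)"
        unfolding xb mmult_assoc[symmetric] by (rule hsn_mult_right[OF madj_in_SU2[OF k]])
      ultimately show ?thesis by (simp add: \<phi>_def A_def indicator_def)
    qed
    then have "(\<integral>\<^sup>+y. \<phi> (mmult y x) \<partial>haarG) = (\<integral>\<^sup>+y. \<phi> (mmult y ?b) \<partial>haarG)"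
      by (intro nn_integral_cong) simp
    also have "\<dots> = (\<integral>\<^sup>+y. \<phi> y \<partial>haarG)"
      by (rule nn_integral_haarG_right_AN) (simp_all add: p_def)
    finally show ?thesis by (simp add: e_eq)
  qed
  have 1: "(\<integral>\<^sup>+y. f (mmult (madj y) x) \<partial>haarG) = (\<integral>\<^sup>+y. f (madj y) \<partial>haarG)" if x: "x \<in> SL2" for x
  proof -
    have [measurable]: "(\<lambda>y. x) \<in> measurable haarG haarG" using x by simp
    have "(\<integral>\<^sup>+y. f (mmult (madj (mmult x y)) x) \<partial>haarG) = (\<integral>\<^sup>+y. f (mmult (madj y) x) \<partial>haarG)"
      by (rule nn_integral_haarG_left[OF _ x]) measurable
    moreover have "(\<integral>\<^sup>+y. f (mmult (madj (mmult x y)) x) \<partial>haarG) = (\<integral>\<^sup>+y. f (madj y) \<partial>haarG)"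
      by (rule nn_integral_cong) (simp add: madj_mmult mmult_assoc mmult_madj x mmult_1 madj_in_SL2)
    ultimately show ?thesis by simp
  qed
  have 2: "(\<integral>\<^sup>+x. \<phi> x * f (mmult (madj y) x) \<partial>haarG) = (\<integral>\<^sup>+x. \<phi> (mmult y x) * f x \<partial>haarG)" if y: "y \<in> SL2" for y
  proof -
    have [measurable]: "(\<lambda>x. y) \<in> measurable haarG haarG" using y by simp
    have "(\<integral>\<^sup>+x. \<phi> (mmult y x) * f (mmult (madj y) (mmult y x)) \<partial>haarG) = (\<integral>\<^sup>+x. \<phi> x * f (mmult (madj y) x) \<partial>haarG)"
      by (rule nn_integral_haarG_left[OF _ y]) measurable
    moreover have "(\<integral>\<^sup>+x. \<phi> (mmult y x) * f (mmult (madj y) (mmult y x)) \<partial>haarG) = (\<integral>\<^sup>+x. \<phi> (mmult y x) * f x \<partial>haarG)"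
      by (rule nn_integral_cong) (simp add: mmult_assoc[symmetric] mmult_madj y mmult_1)
    ultimately show ?thesis by simp
  qed
  have "e * (\<integral>\<^sup>+x. f (madj x) \<partial>haarG) = (\<integral>\<^sup>+x. \<phi> x * (\<integral>\<^sup>+y. f (madj y) \<partial>haarG) \<partial>haarG)"
    by (simp add: nn_integral_multc e_eq)
  also have "\<dots> = (\<integral>\<^sup>+x. \<phi> x * (\<integral>\<^sup>+y. f (mmult (madj y) x) \<partial>haarG) \<partial>haarG)"
    by (rule nn_integral_cong) (simp add: 1)
  also have "\<dots> = (\<integral>\<^sup>+x. (\<integral>\<^sup>+y. \<phi> x * f (mmult (madj y) x) \<partial>haarG) \<partial>haarG)"
  proof (rule nn_integral_cong)
    fix x assume "x \<in> space haarG"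
    then have [measurable]: "(\<lambda>y. x) \<in> measurable haarG haarG" by simp
    show "\<phi> x * (\<integral>\<^sup>+y. f (mmult (madj y) x) \<partial>haarG) = (\<integral>\<^sup>+y. \<phi> x * f (mmult (madj y) x) \<partial>haarG)"
      by (rule nn_integral_cmult[symmetric]) measurable
  qed
  also have "\<dots> = (\<integral>\<^sup>+y. (\<integral>\<^sup>+x. \<phi> x * f (mmult (madj y) x) \<partial>haarG) \<partial>haarG)"
    by (rule haarGG.Fubini'[symmetric]) measurable
  also have "\<dots> = (\<integral>\<^sup>+y. (\<integral>\<^sup>+x. \<phi> (mmult y x) * f x \<partial>haarG) \<partial>haarG)"
    by (rule nn_integral_cong) (simp add: 2)
  also have "\<dots> = (\<integral>\<^sup>+x. (\<integral>\<^sup>+y. \<phi> (mmult y x) * f x \<partial>haarG) \<partial>haarG)"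
    by (rule haarGG.Fubini') measurable
  also have "\<dots> = (\<integral>\<^sup>+x. e * f x \<partial>haarG)"
  proof (rule nn_integral_cong)
    fix x assume x: "x \<in> space haarG"
    then have [measurable]: "(\<lambda>y. x) \<in> measurable haarG haarG" by simp
    have "(\<integral>\<^sup>+y. \<phi> (mmult y x) * f x \<partial>haarG) = (\<integral>\<^sup>+y. \<phi> (mmult y x) \<partial>haarG) * f x"
      by (rule nn_integral_multc) measurable
    then show "(\<integral>\<^sup>+y. \<phi> (mmult y x) * f x \<partial>haarG) = e * f x"
      using right x by simp
  qed
  also have "\<dots> = e * (\<integral>\<^sup>+x. f x \<partial>haarG)"
    by (rule nn_integral_cmult[OF f])
  finally show ?thesis
    using e by (simp add: ennreal_mult_cancel_left)
qed

lemma distr_haarG_madj: "distr haarG haarG madj = haarG"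
proof (rule measure_eq_distrI)
  show "madj \<in> measurable haarG haarG"
    using measurable_haar_group(2)[OF measurable_ident_sets[OF refl]] by simp
qed (rule nn_integral_haarG_inv)

subsection \<open>Integration in Iwasawa coordinates\<close>

interpretation haarK_lborel: pair_sigma_finite haarK "lborel :: (complex \<times> complex) measure" ..

text \<open>K preserves norms and Lebesgue measure on C^2, so f may be evaluated at k
  \<open>ku v\<close> instead of \<open>ku v\<close>. Averaging over k and exchanging the integrals,
  right invariance makes the inner integral independent of v.\<close>

lemma nn_integral_polar:
  assumes \<Theta>[measurable]: "\<Theta> \<in> borel_measurable borel" and f[measurable]: "f \<in> borel_measurable haarK"
  shows "(\<integral>\<^sup>+v. \<Theta> (norm v) * f (ku v) \<partial>lborel) =
    (\<integral>\<^sup>+v. \<Theta> (norm (v :: complex \<times> complex)) \<partial>lborel) * (\<integral>\<^sup>+k. f k \<partial>haarK)"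
proof -
  have ku'[measurable]: "ku \<in> measurable lborel haarK" by simp
  have nm[measurable]: "(\<lambda>v :: complex \<times> complex. \<Theta> (norm v)) \<in> borel_measurable borel"
    by measurable
  have rot: "(\<integral>\<^sup>+v. \<Theta> (norm v) * f (mmult k (ku v)) \<partial>lborel) = (\<integral>\<^sup>+v. \<Theta> (norm v) * f (ku v) \<partial>lborel)"
    if k: "k \<in> SU2" for k
  proof -
    have "(\<integral>\<^sup>+v. \<Theta> (norm v) * f (mmult k (ku v)) \<partial>lborel)
        = (\<integral>\<^sup>+v. \<Theta> (norm (mact k v)) * f (ku (mact k v)) \<partial>lborel)"
      by (rule nn_integral_cong_AE, rule eventually_mono[OF AE_nonzero])
        (simp add: ku_mact[OF k] norm_mact_SU2[OF k])
    also have "\<dots> = (\<integral>\<^sup>+v. \<Theta> (norm v) * f (ku v) \<partial>lborel)"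
    proof (rule nn_integral_mact)
      show "(\<lambda>v. \<Theta> (norm v) * f (ku v)) \<in> borel_measurable borel" by measurable
    qed (use k SU2_subset in auto)
    finally show ?thesis .
  qed
  have "(\<integral>\<^sup>+v. \<Theta> (norm v) * f (ku v) \<partial>lborel)
      = (\<integral>\<^sup>+k. (\<integral>\<^sup>+v. \<Theta> (norm v) * f (ku v) \<partial>lborel) \<partial>haarK)"
    by (simp add: haarK.emeasure_space_1[simplified])
  also have "\<dots> = (\<integral>\<^sup>+k. (\<integral>\<^sup>+v. \<Theta> (norm v) * f (mmult k (ku v)) \<partial>lborel) \<partial>haarK)"
    by (rule nn_integral_cong) (simp add: rot)
  also have "\<dots> = (\<integral>\<^sup>+v. (\<integral>\<^sup>+k. \<Theta> (norm v) * f (mmult k (ku v)) \<partial>haarK) \<partial>lborel)"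
    by (rule haarK_lborel.Fubini'[symmetric]) measurable
  also have "\<dots> = (\<integral>\<^sup>+v. \<Theta> (norm (v :: complex \<times> complex)) * (\<integral>\<^sup>+k. f k \<partial>haarK) \<partial>lborel)"
  proof (rule nn_integral_cong)
    fix v :: "complex \<times> complex"
    have [measurable]: "(\<lambda>k. ku v) \<in> measurable haarK haarK" using ku_in_SU2 by simp
    have "(\<integral>\<^sup>+k. \<Theta> (norm v) * f (mmult k (ku v)) \<partial>haarK) = \<Theta> (norm v) * (\<integral>\<^sup>+k. f (mmult k (ku v)) \<partial>haarK)"
      by (rule nn_integral_cmult) measurable
    then show "(\<integral>\<^sup>+k. \<Theta> (norm v) * f (mmult k (ku v)) \<partial>haarK) = \<Theta> (norm v) * (\<integral>\<^sup>+k. f k \<partial>haarK)"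
      by (simp add: nn_integral_haarK_right ku_in_SU2)
  qed
  also have "\<dots> = (\<integral>\<^sup>+v. \<Theta> (norm (v :: complex \<times> complex)) \<partial>lborel) * (\<integral>\<^sup>+k. f k \<partial>haarK)"
    by (rule nn_integral_multc) simp
  finally show ?thesis .
qed

text \<open>Two alternatives are provided because \<open>lawY\<close> is finite on the half-lines
  bounded above and \<open>lawT\<close> on those bounded below.\<close>

lemma measure_eqI_halfline:
  fixes M N :: "real measure"
  assumes "sets M = sets borel" "sets N = sets borel"
    and "(\<forall>a. emeasure M {..a} = emeasure N {..a} \<and> emeasure N {..a} \<noteq> \<infinity>) \<or>
         (\<forall>a. emeasure M {a..} = emeasure N {a..} \<and> emeasure N {a..} \<noteq> \<infinity>)"
  shows "M = N"
  using assms(3)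
proof
  assume *: "\<forall>a. emeasure M {..a} = emeasure N {..a} \<and> emeasure N {..a} \<noteq> \<infinity>"
  show ?thesis
  proof (rule measure_eqI_generator_eq[where E = "range atMost" and \<Omega> = UNIV and A = "\<lambda>n. {..real n}"])
    show "Int_stable (range (atMost :: real \<Rightarrow> _))"
      unfolding Int_stable_def by (auto intro: range_eqI[of _ _ "min _ _"])
    show "(\<Union>n. {..real n}) = UNIV" using real_arch_simple by auto
  qed (use * assms(1,2) in \<open>auto simp: borel_eq_atMost\<close>)
next
  assume *: "\<forall>a. emeasure M {a..} = emeasure N {a..} \<and> emeasure N {a..} \<noteq> \<infinity>"
  show ?thesis
  proof (rule measure_eqI_generator_eq[where E = "range atLeast" and \<Omega> = UNIV and A = "\<lambda>n. {- real n..}"])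
    show "Int_stable (range (atLeast :: real \<Rightarrow> _))"
      unfolding Int_stable_def by (auto intro: range_eqI[of _ _ "max _ _"])
    show "(\<Union>n. {- real n..}) = UNIV"
    proof safe
      fix x :: real
      obtain n where "- x \<le> real n" using real_arch_simple by blast
      then show "x \<in> (\<Union>n. {- real n..})" by (intro UN_I[of n]) auto
    qed simp
  qed (use * assms(1,2) in \<open>auto simp: borel_Ici\<close>)
qed

text \<open>Image of Lebesgue measure on C^2 under v -> -2 ln |v|. The half-line from a corresponds
  to the ball of radius e^{-a/2}, whose volume is (pi^2/2) e^{-2a}.\<close>

definition lawT :: "real measure" where
  "lawT = density lborel (\<lambda>s. ennreal (pi\<^sup>2 * exp (- 2 * s)))"

text \<open>Image of Lebesgue measure on C under z -> |z|^2, since the disc |z|^2 <= a has area pi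
  a.\<close>

definition lawY :: "real measure" where
  "lawY = density lborel (\<lambda>u. ennreal pi * indicator {0..} u)"

lemma sets_laws [simp, measurable_cong]: "sets lawT = sets borel" "sets lawY = sets borel"
  and space_laws [simp]: "space lawT = UNIV" "space lawY = UNIV"
  by (simp_all add: lawT_def lawY_def)

lemma sigma_finite_lawT: "sigma_finite_measure lawT"
  unfolding lawT_def by (subst sigma_finite_measure.sigma_finite_iff_density_finite[OF sigma_finite_lborel]) auto

lemma sigma_finite_lawY: "sigma_finite_measure lawY"
  unfolding lawY_def by (subst sigma_finite_measure.sigma_finite_iff_density_finite[OF sigma_finite_lborel]) (auto simp: indicator_def)

lemma distr_lawY: "distr lborel borel (\<lambda>z::complex. (cmod z)\<^sup>2) = lawY"
proof (rule measure_eqI_halfline, simp, simp, intro disjI1 allI conjI)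
  fix a :: real
  have Y: "emeasure lawY {..a} = ennreal (if a \<ge> 0 then pi * a else 0)"
  proof -
    have "emeasure lawY {..a} = (\<integral>\<^sup>+u. ennreal pi * indicator {0..a} u \<partial>lborel)"
      unfolding lawY_def by (subst emeasure_density) (auto intro!: nn_integral_cong simp: indicator_def)
    also have "\<dots> = ennreal pi * emeasure lborel {0..a}"
      by (rule nn_integral_cmult_indicator) simp
    finally show ?thesis by (simp add: ennreal_mult)
  qed
  then show "emeasure lawY {..a} \<noteq> \<infinity>" by simp
  have "emeasure (distr lborel borel (\<lambda>z::complex. (cmod z)\<^sup>2)) {..a} = emeasure lborel {z::complex. (cmod z)\<^sup>2 \<le> a}"
    by (subst emeasure_distr) (auto intro!: arg_cong[where f = "emeasure lborel"])
  also have "\<dots> = ennreal (if a \<ge> 0 then pi * a else 0)"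
  proof (cases "a \<ge> 0")
    case True
    have "{z::complex. (cmod z)\<^sup>2 \<le> a} = cball 0 (sqrt a)"
      using True by (auto simp: real_le_rsqrt sqrt_ge_absD dist_norm intro: real_sqrt_le_iff[THEN iffD1])
    then show ?thesis
      using True by (simp add: emeasure_cball unit_ball_vol_2)
  next
    case False
    then have "{z::complex. (cmod z)\<^sup>2 \<le> a} = {}"
      by (auto simp: not_le intro: less_le_trans)
    then show ?thesis using False by simp
  qed
  finally show "emeasure (distr lborel borel (\<lambda>z::complex. (cmod z)\<^sup>2)) {..a} = emeasure lawY {..a}"
    by (simp add: Y)
qed

lemma distr_lawT: "distr lborel borel (\<lambda>v::complex \<times> complex. - 2 * ln (norm v)) = lawT"
proof (rule measure_eqI_halfline, simp, simp, intro disjI2 allI conjI)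
  fix a :: real
  have T: "emeasure lawT {a..} = ennreal (pi\<^sup>2 / 2 * exp (- 2 * a))"
  proof -
    have "emeasure lawT {a..} = (\<integral>\<^sup>+s. ennreal (pi\<^sup>2 * exp (- 2 * s)) * indicator {a..} s \<partial>lborel)"
      unfolding lawT_def by (subst emeasure_density) auto
    also have "\<dots> = ennreal (0 - (- (pi\<^sup>2 / 2) * exp (- 2 * a)))"
    proof (rule nn_integral_FTC_atLeast)
      show "((\<lambda>s. - (pi\<^sup>2 / 2) * exp (- 2 * s)) has_real_derivative pi\<^sup>2 * exp (- 2 * x)) (at x)" for x
        by (auto intro!: derivative_eq_intros)
      show "((\<lambda>s. - (pi\<^sup>2 / 2) * exp (- 2 * s)) \<longlongrightarrow> 0) at_top"
        by real_asymp
    qed auto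
    finally show ?thesis by simp
  qed
  then show "emeasure lawT {a..} \<noteq> \<infinity>" by simp
  have "emeasure (distr lborel borel (\<lambda>v::complex \<times> complex. - 2 * ln (norm v))) {a..}
      = emeasure lborel {v::complex \<times> complex. a \<le> - 2 * ln (norm v)}"
    by (subst emeasure_distr) (auto intro!: arg_cong[where f = "emeasure lborel"])
  also have "\<dots> = emeasure lborel (cball (0 :: complex \<times> complex) (exp (- a / 2)))"
  proof (rule emeasure_eq_AE)
    have "(a \<le> - 2 * ln (norm v)) = (norm v \<le> exp (- a / 2))" if "v \<noteq> 0" for v :: "complex \<times> complex"
      using ln_le_cancel_iff[of "norm v" "exp (- a / 2)"] that by auto
    then show "AE v in lborel. (v \<in> {v::complex \<times> complex. a \<le> - 2 * ln (norm v)}) = (v \<in> cball 0 (exp (- a / 2)))"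
      by (intro eventually_mono[OF AE_nonzero]) auto
  qed auto
  also have "\<dots> = ennreal (pi\<^sup>2 / 2 * exp (- 2 * a))"
    by (simp add: emeasure_cball unit_ball_vol_4 exp_of_nat_mult[symmetric])
  finally show "emeasure (distr lborel borel (\<lambda>v::complex \<times> complex. - 2 * ln (norm v))) {a..} = emeasure lawT {a..}"
    by (simp add: T)
qed

text \<open>Minus the Iwasawa projection, so that A(x,k) becomes \<open>AA\<close> at
  x^{-1}k.\<close>

definition AA :: "coords \<Rightarrow> real" where
  "AA x = - 2 * ln (norm (ea x, ec x))"

definition kap :: "coords \<Rightarrow> coords" where
  "kap x = ku (ea x, ec x)"

lemma column_measurable: "(\<lambda>x. (ea x, ec x)) \<in> borel_measurable haarG"
proof -
  have "(\<lambda>x. x) \<in> borel_measurable haarG"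
    using measurable_into_haar(1)[of "\<lambda>x. x" haarG] by simp
  then show ?thesis by (intro borel_measurable_Pair borel_measurable_entries)
qed

lemma AA_measurable [measurable]: "AA \<in> borel_measurable haarG"
  unfolding AA_def using column_measurable by measurable

lemma kap_measurable [measurable]: "kap \<in> measurable haarG haarK"
  unfolding kap_def by (rule measurable_compose[OF column_measurable ku_measurable])

lemma kap_in_SU2 [simp]: "kap x \<in> SU2"
  by (simp add: kap_def ku_in_SU2)

interpretation lawT: sigma_finite_measure lawT
  by (rule sigma_finite_lawT)

interpretation lawY: sigma_finite_measure lawY
  by (rule sigma_finite_lawY)

text \<open>With |v|^2 = e^{-s} and |z|^2 = y, \<open>hsn_psi\<close> reads e^{-s} + e^s + y e^{-s}.
  So \<open>hsn\<close> and \<open>AA\<close> only depend on |v| and |z|, while \<open>kap\<close>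
  is the direction of v, which splits off by \<open>nn_integral_polar\<close>.\<close>

lemma nn_integral_radial:
  assumes B[measurable]: "B \<in> borel_measurable borel" and \<theta>[measurable]: "\<theta> \<in> borel_measurable borel"
    and g[measurable]: "g \<in> borel_measurable haarK"
  shows "(\<integral>\<^sup>+x. B (hsn x) * \<theta> (AA x) * g (kap x) \<partial>haarG) =
    (\<integral>\<^sup>+s. \<theta> s * (\<integral>\<^sup>+y. B (exp (- s) + exp s + y * exp (- s)) \<partial>lawY) \<partial>lawT) * (\<integral>\<^sup>+k. g k \<partial>haarK)"
proof -
  define W where "W = (\<lambda>s. \<integral>\<^sup>+y. B (exp (- s) + exp s + y * exp (- s)) \<partial>lawY)"
  have W[measurable]: "W \<in> borel_measurable borel"
    unfolding W_def by (rule lawY.borel_measurable_nn_integral) measurable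
  define s where "s = (\<lambda>v :: complex \<times> complex. - 2 * ln (norm v))"
  have "(\<integral>\<^sup>+x. B (hsn x) * \<theta> (AA x) * g (kap x) \<partial>haarG)
      = (\<integral>\<^sup>+v. \<integral>\<^sup>+z. B (hsn (psi (v, z))) * \<theta> (AA (psi (v, z))) * g (kap (psi (v, z))) \<partial>lborel \<partial>lborel)"
    by (rule nn_integral_haarG_iterated) measurable
  also have "\<dots> = (\<integral>\<^sup>+v. (\<theta> (s v) * W (s v)) * g (ku v) \<partial>lborel)"
  proof (rule nn_integral_cong_AE, rule eventually_mono[OF AE_nonzero])
    fix v :: "complex \<times> complex" assume v: "v \<noteq> 0"
    have col: "(ea (psi (v, z)), ec (psi (v, z))) = v" for z
      using psi_entries[OF v] by simp
    have n: "norm v > 0" using v by simp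
    have "exp (- s v) = exp (ln (norm v) + ln (norm v))" by (simp add: s_def)
    also have "\<dots> = (norm v)\<^sup>2" using n by (simp only: exp_add exp_ln power2_eq_square)
    finally have e: "exp (- s v) = (norm v)\<^sup>2" .
    have e': "exp (s v) = 1 / (norm v)\<^sup>2"
      using exp_minus[of "- s v"] e by (simp add: inverse_eq_divide)
    have "B (hsn (psi (v, z))) * \<theta> (AA (psi (v, z))) * g (kap (psi (v, z)))
        = (\<theta> (s v) * g (ku v)) * B (exp (- s v) + exp (s v) + (cmod z)\<^sup>2 * exp (- s v))" for z
      unfolding e e' hsn_psi[OF v] AA_def kap_def col by (simp add: s_def mult_ac)
    then have "(\<integral>\<^sup>+z. B (hsn (psi (v, z))) * \<theta> (AA (psi (v, z))) * g (kap (psi (v, z))) \<partial>lborel)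
        = (\<integral>\<^sup>+z. (\<theta> (s v) * g (ku v)) * B (exp (- s v) + exp (s v) + (cmod z)\<^sup>2 * exp (- s v)) \<partial>lborel)"
      by simp
    also have "\<dots> = (\<theta> (s v) * g (ku v)) * (\<integral>\<^sup>+z. B (exp (- s v) + exp (s v) + (cmod z)\<^sup>2 * exp (- s v)) \<partial>lborel)"
      by (rule nn_integral_cmult) measurable
    also have "(\<integral>\<^sup>+z. B (exp (- s v) + exp (s v) + (cmod z)\<^sup>2 * exp (- s v)) \<partial>lborel) = W (s v)"
      unfolding W_def distr_lawY[symmetric] by (rule nn_integral_distr[symmetric]) measurable
    finally show "(\<integral>\<^sup>+z. B (hsn (psi (v, z))) * \<theta> (AA (psi (v, z))) * g (kap (psi (v, z))) \<partial>lborel)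
        = (\<theta> (s v) * W (s v)) * g (ku v)"
      by (simp add: mult_ac)
  qed
  also have "\<dots> = (\<integral>\<^sup>+v. \<theta> (s v) * W (s v) \<partial>lborel) * (\<integral>\<^sup>+k. g k \<partial>haarK)"
    unfolding s_def
    by (rule nn_integral_polar[of "\<lambda>n. \<theta> (- 2 * ln n) * W (- 2 * ln n)"]) measurable
  also have "(\<integral>\<^sup>+v. \<theta> (s v) * W (s v) \<partial>lborel) = (\<integral>\<^sup>+s. \<theta> s * W s \<partial>lawT)"
    unfolding s_def distr_lawT[symmetric] by (rule nn_integral_distr[symmetric]) measurable
  finally show ?thesis unfolding W_def .
qed

lemma nn_integral_lawY:
  assumes B[measurable]: "B \<in> borel_measurable borel" and d: "d > 0"
  shows "(\<integral>\<^sup>+y. B (c + y * d) \<partial>lawY) = ennreal (pi / d) * (\<integral>\<^sup>+u. B u * indicator {c..} u \<partial>lborel)"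
proof -
  have "(\<integral>\<^sup>+u. B u * indicator {c..} u \<partial>lborel)
      = ennreal d * (\<integral>\<^sup>+y. B (c + d * y) * indicator {c..} (c + d * y) \<partial>lborel)"
    using nn_integral_real_affine[of "\<lambda>u. B u * indicator {c..} u" d c] d by simp
  also have "(\<integral>\<^sup>+y. B (c + d * y) * indicator {c..} (c + d * y) \<partial>lborel)
      = (\<integral>\<^sup>+y. B (c + y * d) * indicator {0..} y \<partial>lborel)"
    by (rule nn_integral_cong) (use d in \<open>auto simp: indicator_def mult.commute zero_le_mult_iff\<close>)
  finally have "ennreal (pi / d) * (\<integral>\<^sup>+u. B u * indicator {c..} u \<partial>lborel)
      = (ennreal (pi / d) * ennreal d) * (\<integral>\<^sup>+y. B (c + y * d) * indicator {0..} y \<partial>lborel)"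
    by (simp add: mult.assoc)
  also have "ennreal (pi / d) * ennreal d = ennreal pi"
    using d by (simp add: ennreal_mult[symmetric])
  also have "ennreal pi * (\<integral>\<^sup>+y. B (c + y * d) * indicator {0..} y \<partial>lborel)
      = (\<integral>\<^sup>+y. ennreal pi * (B (c + y * d) * indicator {0..} y) \<partial>lborel)"
    by (rule nn_integral_cmult[symmetric]) measurable
  also have "\<dots> = (\<integral>\<^sup>+y. B (c + y * d) \<partial>lawY)"
    unfolding lawY_def by (subst nn_integral_density) (auto intro!: nn_integral_cong simp: mult_ac)
  finally show ?thesis by simp
qed

section \<open>The functions\<close>

text \<open>The function $f_s$ is $K$-biinvariant with Abel transform \<open>Eg s\<close>, i.e.
  $f_s(a_r) = -E_s'(r) / (2 \sinh r)$ up to a constant; \<open>Gp s\<close> expresses it in terms of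
  $\|x\|^2 = 2 \cosh r$.\<close>

definition Eg :: "real \<Rightarrow> real \<Rightarrow> real" where
  "Eg s t = exp (- (t - s)\<^sup>2 / 2) + exp (- (t + s)\<^sup>2 / 2)"

definition mfun :: "real \<Rightarrow> real \<Rightarrow> real" where
  "mfun s r = (r - s) * exp (- (r - s)\<^sup>2 / 2) + (r + s) * exp (- (r + s)\<^sup>2 / 2)"

definition Gp :: "real \<Rightarrow> real \<Rightarrow> real" where
  "Gp s u = (if u > 2 then mfun s (arcosh (u / 2)) / (2 * sinh (arcosh (u / 2))) else 0)"

lemma Eg_even: "Eg s (- t) = Eg s t"
proof -
  have "(- t - s)\<^sup>2 = (t + s)\<^sup>2" "(- t + s)\<^sup>2 = (t - s)\<^sup>2"
    by (simp_all add: power2_eq_square algebra_simps)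
  then show ?thesis by (simp add: Eg_def)
qed

lemma Eg_pos: "Eg s t \<ge> 0"
  by (simp add: Eg_def)

lemma gauss_deriv:
  "((\<lambda>t. exp (- (t - c)\<^sup>2 / 2)) has_real_derivative - (t - c) * exp (- (t - c)\<^sup>2 / 2)) (at t)" for t c :: real
proof -
  have "((\<lambda>t. - (t - c)\<^sup>2 / 2) has_real_derivative - (t - c)) (at t)"
    by (auto intro!: derivative_eq_intros simp: field_simps)
  from DERIV_fun_exp[OF this] show ?thesis by (simp add: mult.commute)
qed

lemma Eg_deriv: "(Eg s has_real_derivative - mfun s t) (at t)"
  using DERIV_add[OF gauss_deriv[of s t] gauss_deriv[of "- s" t]]
  unfolding Eg_def[abs_def] mfun_def by (simp add: algebra_simps)

lemma mfun_factor:
  "mfun s r = exp (- (r\<^sup>2 + s\<^sup>2) / 2) * ((r - s) * exp (r * s) + (r + s) * exp (- (r * s)))"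
proof -
  have "exp (- (r - s)\<^sup>2 / 2) = exp (- (r\<^sup>2 + s\<^sup>2) / 2) * exp (r * s)"
    "exp (- (r + s)\<^sup>2 / 2) = exp (- (r\<^sup>2 + s\<^sup>2) / 2) * exp (- (r * s))"
    unfolding exp_add[symmetric] by (simp_all add: power2_eq_square field_simps)
  then show ?thesis unfolding mfun_def by (simp add: algebra_simps)
qed

text \<open>The bracket in \<open>mfun_factor\<close> vanishes at r = 0, and for s <= 1 it is
  nondecreasing. This is where the restriction of s comes from; it makes f_s the density of a
  measure.\<close>

lemma mfun_nonneg:
  assumes "0 \<le> s" "s \<le> 1" "0 \<le> r" shows "0 \<le> mfun s r"
proof -
  let ?m = "\<lambda>r. (r - s) * exp (r * s) + (r + s) * exp (- (r * s))"
  have "?m 0 \<le> ?m r"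
  proof (rule DERIV_nonneg_imp_nondecreasing[OF assms(3)])
    fix x assume x: "0 \<le> x" "x \<le> r"
    have "(?m has_real_derivative (1 - s\<^sup>2) * (exp (x * s) + exp (- (x * s))) + x * s * (exp (x * s) - exp (- (x * s)))) (at x)"
      by (auto intro!: derivative_eq_intros simp: algebra_simps power2_eq_square)
    moreover have "0 \<le> (1 - s\<^sup>2) * (exp (x * s) + exp (- (x * s))) + x * s * (exp (x * s) - exp (- (x * s)))"
      using assms x by (intro add_nonneg_nonneg mult_nonneg_nonneg) (auto simp: power_le_one)
    ultimately show "\<exists>y. (?m has_real_derivative y) (at x) \<and> 0 \<le> y" by blast
  qed
  then show ?thesis unfolding mfun_factor by (simp add: mult_nonneg_nonneg)
qed

lemma mfun_le:
  assumes "0 \<le> s" "0 \<le> r" shows "mfun s r \<le> 2 * r * exp (s * r - r\<^sup>2 / 2)"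
proof -
  have "exp (- (r * s)) \<le> exp (r * s)" using assms by simp
  then have "(r - s) * exp (r * s) + (r + s) * exp (- (r * s)) \<le> (r - s) * exp (r * s) + (r + s) * exp (r * s)"
    using assms by (intro add_left_mono mult_left_mono) auto
  also have "\<dots> = 2 * r * exp (r * s)" by (simp add: algebra_simps)
  finally have "mfun s r \<le> exp (- (r\<^sup>2 + s\<^sup>2) / 2) * (2 * r * exp (r * s))"
    unfolding mfun_factor by (rule mult_left_mono) simp
  also have "\<dots> \<le> exp (- r\<^sup>2 / 2) * (2 * r * exp (r * s))"
    using assms by (intro mult_right_mono) auto
  also have "\<dots> = 2 * r * (exp (- r\<^sup>2 / 2) * exp (r * s))" by simp
  also have "exp (- r\<^sup>2 / 2) * exp (r * s) = exp (s * r - r\<^sup>2 / 2)"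
    unfolding exp_add[symmetric] by (simp add: mult.commute)
  finally show ?thesis .
qed

lemma arcosh_half: "u > 2 \<Longrightarrow> arcosh (u / 2) > 0" "u > 2 \<Longrightarrow> sinh (arcosh (u / 2)) > (0::real)"
proof -
  assume u: "u > (2::real)"
  show 1: "arcosh (u / 2) > 0" using u by (subst arcosh_real_gt_1_iff) auto
  show "sinh (arcosh (u / 2)) > 0" using 1 by simp
qed

lemma Gp_nonneg: "0 \<le> s \<Longrightarrow> s \<le> 1 \<Longrightarrow> 0 \<le> Gp s u"
  unfolding Gp_def using arcosh_half[of u] mfun_nonneg[of s "arcosh (u / 2)"] by auto

text \<open>Multiplied out, this is 1 + 2r <= e^{2r}. The same ratio r / sinh r is the value of
  \<Xi> at a_r, so one bound serves for f_s and for \<Xi>.\<close>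

lemma sinh_ratio_le:
  assumes "(r::real) > 0" shows "r / sinh r \<le> (1 + 2 * r) * exp (- r)"
proof -
  have "1 + 2 * r \<le> exp (2 * r)" by (rule exp_ge_add_one_self)
  then have "(1 + 2 * r) * exp (- r) \<le> exp (2 * r) * exp (- r)" by (rule mult_right_mono) simp
  also have "\<dots> = exp r" unfolding exp_add[symmetric] by simp
  finally have "2 * r * exp r \<le> (1 + 2 * r) * (exp r - exp (- r))" by (simp add: algebra_simps)
  moreover have "2 * sinh r = exp r - exp (- r)" by (simp add: sinh_def)
  ultimately have "2 * r * exp r \<le> (1 + 2 * r) * (2 * sinh r)" by simp
  then have le: "r * exp r \<le> (1 + 2 * r) * sinh r" by (simp add: algebra_simps)
  have "r = r * exp r * exp (- r)" by (simp add: exp_minus_inverse mult.assoc)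
  also have "\<dots> \<le> (1 + 2 * r) * sinh r * exp (- r)" by (rule mult_right_mono[OF le]) simp
  also have "\<dots> = (1 + 2 * r) * exp (- r) * sinh r" by (simp only: mult_ac)
  finally have "r \<le> (1 + 2 * r) * exp (- r) * sinh r" .
  moreover have "sinh r > 0" using assms by simp
  ultimately show ?thesis by (simp add: pos_divide_le_eq)
qed

lemma Gp_le:
  assumes "0 \<le> s" "u \<ge> 2"
  defines "r \<equiv> arcosh (u / 2)"
  shows "Gp s u \<le> (1 + 2 * r) * exp (- r) * exp (s * r - r\<^sup>2 / 2)"
proof (cases "u > 2")
  case True
  have r: "r > 0" "sinh r > 0" using arcosh_half[OF True] by (simp_all add: r_def)
  have "Gp s u = mfun s r / (2 * sinh r)" using True by (simp add: Gp_def r_def)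
  also have "\<dots> \<le> 2 * r * exp (s * r - r\<^sup>2 / 2) / (2 * sinh r)"
    using mfun_le[OF assms(1), of r] r by (intro divide_right_mono) auto
  also have "\<dots> = (r / sinh r) * exp (s * r - r\<^sup>2 / 2)" by simp
  also have "\<dots> \<le> ((1 + 2 * r) * exp (- r)) * exp (s * r - r\<^sup>2 / 2)"
    by (rule mult_right_mono[OF sinh_ratio_le[OF r(1)]]) simp
  finally show ?thesis .
next
  case False
  then have "r = 0" using assms by (simp add: r_def)
  then show ?thesis using False by (simp add: Gp_def)
qed

lemma arcosh_measurable: "(\<lambda>u::real. arcosh (u / 2)) \<in> borel_measurable borel"
  unfolding arcosh_def by measurable

lemma Gp_measurable [measurable]: "Gp s \<in> borel_measurable borel"
proof -
  note [measurable] = arcosh_measurable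
  have "continuous_on UNIV (mfun s)"
    unfolding mfun_def[abs_def] by (intro continuous_intros) auto
  then have m: "mfun s \<in> borel_measurable borel" by (rule cts_borel)
  have "continuous_on UNIV (sinh :: real \<Rightarrow> real)" by (intro continuous_intros)
  then have sh: "(sinh :: real \<Rightarrow> real) \<in> borel_measurable borel" by (rule cts_borel)
  have [measurable]: "(\<lambda>u. mfun s (arcosh (u / 2))) \<in> borel_measurable borel"
    "(\<lambda>u::real. sinh (arcosh (u / 2))) \<in> borel_measurable borel"
    by (rule measurable_compose[OF arcosh_measurable m] measurable_compose[OF arcosh_measurable sh])+
  show ?thesis unfolding Gp_def[abs_def] by measurable
qed

text \<open>The substitution u = 2 cosh r turns \<open>Gp s u\<close> du into -E_s'(r) dr, whose
  integral up to infinity is the value of E_s at the lower end.\<close>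

lemma nn_integral_Gp:
  assumes s: "0 \<le> s" "s \<le> 1" and c: "c > 2"
  shows "(\<integral>\<^sup>+u. ennreal (Gp s u) * indicator {c..} u \<partial>lborel) = ennreal (Eg s (arcosh (c / 2)))"
proof -
  have "(\<integral>\<^sup>+u. ennreal (Gp s u) * indicator {c..} u \<partial>lborel) = ennreal (0 - (- Eg s (arcosh (c / 2))))"
  proof (rule nn_integral_FTC_atLeast)
    fix u assume "c \<le> u"
    then have u: "u > 2" using c by simp
    have "((\<lambda>u. arcosh (u / 2)) has_real_derivative (1 / sqrt ((u / 2)\<^sup>2 - 1)) * (1 / 2)) (at u)"
      by (rule DERIV_chain2[OF arcosh_real_has_field_derivative]) (use u in \<open>auto intro!: derivative_eq_intros\<close>)
    then have "((\<lambda>u. Eg s (arcosh (u / 2))) has_real_derivative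
        - mfun s (arcosh (u / 2)) * ((1 / sqrt ((u / 2)\<^sup>2 - 1)) * (1 / 2))) (at u)"
      by (rule DERIV_chain2[OF Eg_deriv])
    then have "((\<lambda>u. - Eg s (arcosh (u / 2))) has_real_derivative
        - (- mfun s (arcosh (u / 2)) * ((1 / sqrt ((u / 2)\<^sup>2 - 1)) * (1 / 2)))) (at u)"
      by (rule DERIV_minus)
    also have "- (- mfun s (arcosh (u / 2)) * ((1 / sqrt ((u / 2)\<^sup>2 - 1)) * (1 / 2))) = Gp s u"
      using u sinh_arcosh_real[of "u / 2"] by (simp add: Gp_def)
    finally show "((\<lambda>u. - Eg s (arcosh (u / 2))) has_real_derivative Gp s u) (at u)" .
  next
    have "filterlim (\<lambda>u::real. u / 2) at_top at_top" by real_asymp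
    then have "filterlim (\<lambda>u::real. arcosh (u / 2)) at_top at_top"
      by (rule filterlim_compose[OF arcosh_real_at_top])
    moreover have "((\<lambda>t. - Eg s t) \<longlongrightarrow> 0) at_top"
    proof -
      have g: "((\<lambda>t::real. exp (- (t - c)\<^sup>2 / 2)) \<longlongrightarrow> 0) at_top" for c :: real
        by real_asymp
      from tendsto_minus[OF tendsto_add[OF g[of s] g[of "- s"]]] show ?thesis
        by (simp add: Eg_def)
    qed
    ultimately show "((\<lambda>u. - Eg s (arcosh (u / 2))) \<longlongrightarrow> 0) at_top"
      by (rule filterlim_compose[rotated])
  qed (use Gp_nonneg[OF s] in auto)
  then show ?thesis by simp
qed

text \<open>The Abel transform of f_s, an integral over N written in y = |z|^2. For t = 0 the lower
  limit would be u = 2, where arcosh is not differentiable; a single t does not matter for integrals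
  over t.\<close>

lemma Gp_abel:
  assumes s: "0 \<le> s" "s \<le> 1" and t: "t \<noteq> 0"
  shows "(\<integral>\<^sup>+y. ennreal (Gp s (exp (- t) + exp t + y * exp (- t))) \<partial>lawY) = ennreal (pi * exp t * Eg s t)"
proof -
  have c: "exp (- t) + exp t = 2 * cosh t" by (simp add: cosh_def)
  have ne: "cosh t \<noteq> 1" using t by (simp add: cosh_real_one_iff)
  then have c2: "2 * cosh t > 2" using cosh_real_ge_1[of t] by linarith
  have ar: "arcosh (2 * cosh t / 2) = \<bar>t\<bar>"
    using arcosh_cosh_real[of "\<bar>t\<bar>"] by simp
  have "(\<integral>\<^sup>+y. ennreal (Gp s (exp (- t) + exp t + y * exp (- t))) \<partial>lawY)
      = ennreal (pi / exp (- t)) * ennreal (Eg s (arcosh (2 * cosh t / 2)))"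
    unfolding c by (subst nn_integral_lawY[of "\<lambda>u. ennreal (Gp s u)"]) (simp_all add: nn_integral_Gp[OF s c2])
  also have "Eg s (arcosh (2 * cosh t / 2)) = Eg s t"
    unfolding ar using Eg_even[of s t] by (simp add: abs_if)
  also have "ennreal (pi / exp (- t)) * ennreal (Eg s t) = ennreal (pi * exp t * Eg s t)"
    by (simp add: ennreal_mult[symmetric] Eg_pos exp_minus divide_inverse)
  finally show ?thesis .
qed

text \<open>Law of \<open>AA\<close> under f_s dx: the density pi^2 e^{-2t} of \<open>lawT\<close>
  times the Abel transform pi e^t E_s(t).\<close>

definition lawE :: "real \<Rightarrow> real measure" where
  "lawE s = density lborel (\<lambda>t. ennreal (pi ^ 3 * exp (- t) * Eg s t))"

lemma sets_lawE [simp, measurable_cong]: "sets (lawE s) = sets borel"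
  and space_lawE [simp]: "space (lawE s) = UNIV"
  by (simp_all add: lawE_def)

lemma Eg_measurable [measurable]: "Eg s \<in> borel_measurable borel"
  unfolding Eg_def[abs_def] by (rule cts_borel) (intro continuous_intros, auto)

lemma sigma_finite_lawE: "sigma_finite_measure (lawE s)"
  unfolding lawE_def by (subst sigma_finite_measure.sigma_finite_iff_density_finite[OF sigma_finite_lborel]) auto

lemma nn_integral_weighted:
  assumes s: "0 \<le> s" "s \<le> 1" and \<theta>[measurable]: "\<theta> \<in> borel_measurable borel"
    and g[measurable]: "g \<in> borel_measurable haarK"
  shows "(\<integral>\<^sup>+x. ennreal (Gp s (hsn x)) * \<theta> (AA x) * g (kap x) \<partial>haarG) =
    (\<integral>\<^sup>+t. \<theta> t \<partial>lawE s) * (\<integral>\<^sup>+k. g k \<partial>haarK)"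
proof -
  have "(\<integral>\<^sup>+t. \<theta> t * (\<integral>\<^sup>+y. ennreal (Gp s (exp (- t) + exp t + y * exp (- t))) \<partial>lawY) \<partial>lawT)
      = (\<integral>\<^sup>+t. ennreal (pi\<^sup>2 * exp (- 2 * t)) * (\<theta> t * (\<integral>\<^sup>+y. ennreal (Gp s (exp (- t) + exp t + y * exp (- t))) \<partial>lawY)) \<partial>lborel)"
    unfolding lawT_def
  proof (rule nn_integral_density)
    have "(\<lambda>t. \<integral>\<^sup>+y. ennreal (Gp s (exp (- t) + exp t + y * exp (- t))) \<partial>lawY) \<in> borel_measurable borel"
      by (rule lawY.borel_measurable_nn_integral) measurable
    then show "(\<lambda>t. \<theta> t * (\<integral>\<^sup>+y. ennreal (Gp s (exp (- t) + exp t + y * exp (- t))) \<partial>lawY)) \<in> borel_measurable lborel"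
      by simp
  qed simp
  also have "\<dots> = (\<integral>\<^sup>+t. ennreal (pi ^ 3 * exp (- t) * Eg s t) * \<theta> t \<partial>lborel)"
  proof (rule nn_integral_cong_AE, rule eventually_mono[OF AE_nonzero])
    fix t :: real assume t: "t \<noteq> 0"
    have "ennreal (pi\<^sup>2 * exp (- 2 * t)) * ennreal (pi * exp t * Eg s t) = ennreal (pi ^ 3 * exp (- t) * Eg s t)"
      using exp_add[of "- 2 * t" t]
      by (simp add: ennreal_mult[symmetric] Eg_pos power3_eq_cube power2_eq_square mult_ac)
    then show "ennreal (pi\<^sup>2 * exp (- 2 * t)) * (\<theta> t * (\<integral>\<^sup>+y. ennreal (Gp s (exp (- t) + exp t + y * exp (- t))) \<partial>lawY))
        = ennreal (pi ^ 3 * exp (- t) * Eg s t) * \<theta> t"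
      unfolding Gp_abel[OF s t] by (simp add: mult_ac)
  qed
  also have "\<dots> = (\<integral>\<^sup>+t. \<theta> t \<partial>lawE s)"
    unfolding lawE_def by (rule nn_integral_density[symmetric]) auto
  finally have E: "(\<integral>\<^sup>+t. \<theta> t * (\<integral>\<^sup>+y. ennreal (Gp s (exp (- t) + exp t + y * exp (- t))) \<partial>lawY) \<partial>lawT)
      = (\<integral>\<^sup>+t. \<theta> t \<partial>lawE s)" .
  have "(\<lambda>u. ennreal (Gp s u)) \<in> borel_measurable borel" by measurable
  then show ?thesis
    unfolding E[symmetric] by (rule nn_integral_radial[OF _ \<theta> g])
qed

text \<open>Under f_s dx the A-part and the K-part are independent. Stating
  \<open>nn_integral_weighted\<close> as an equality of measures makes it available for
  complex-valued, oscillating integrands.\<close>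

lemma distr_weighted:
  assumes s: "0 \<le> s" "s \<le> 1"
  shows "distr (density haarG (\<lambda>x. ennreal (Gp s (hsn x)))) (borel \<Otimes>\<^sub>M haarK) (\<lambda>x. (AA x, kap x))
    = lawE s \<Otimes>\<^sub>M haarK"
proof (rule pair_measure_eqI[symmetric, OF sigma_finite_lawE haarK.sigma_finite_measure_axioms])
  show "sets (lawE s \<Otimes>\<^sub>M haarK) = sets (distr (density haarG (\<lambda>x. ennreal (Gp s (hsn x)))) (borel \<Otimes>\<^sub>M haarK) (\<lambda>x. (AA x, kap x)))"
    unfolding sets_distr by (rule sets_pair_measure_cong[OF sets_lawE refl])
  fix A B assume A: "A \<in> sets (lawE s)" and B: "B \<in> sets haarK"
  then have AB: "A \<times> B \<in> sets (borel \<Otimes>\<^sub>M haarK)" by simp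
  have meas: "(\<lambda>x. (AA x, kap x)) \<in> measurable haarG (borel \<Otimes>\<^sub>M haarK)" by measurable
  have [measurable]: "A \<in> sets borel" "B \<in> sets haarK" using A B by simp_all
  have "emeasure (distr (density haarG (\<lambda>x. ennreal (Gp s (hsn x)))) (borel \<Otimes>\<^sub>M haarK) (\<lambda>x. (AA x, kap x))) (A \<times> B)
      = emeasure (density haarG (\<lambda>x. ennreal (Gp s (hsn x)))) ((\<lambda>x. (AA x, kap x)) -` (A \<times> B) \<inter> SL2)"
    using meas AB by (subst emeasure_distr) simp_all
  also have "\<dots> = (\<integral>\<^sup>+x. ennreal (Gp s (hsn x)) * indicator ((\<lambda>x. (AA x, kap x)) -` (A \<times> B) \<inter> SL2) x \<partial>haarG)"
    using measurable_sets[OF meas AB] by (subst emeasure_density) simp_all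
  also have "\<dots> = (\<integral>\<^sup>+x. ennreal (Gp s (hsn x)) * indicator A (AA x) * indicator B (kap x) \<partial>haarG)"
    by (rule nn_integral_cong) (simp add: indicator_def)
  also have "\<dots> = (\<integral>\<^sup>+t. indicator A t \<partial>lawE s) * (\<integral>\<^sup>+k. indicator B k \<partial>haarK)"
    by (rule nn_integral_weighted[OF s]) measurable
  also have "\<dots> = emeasure (lawE s) A * emeasure haarK B"
    using A B by simp
  finally show "emeasure (lawE s) A * emeasure haarK B = emeasure (distr (density haarG (\<lambda>x. ennreal (Gp s (hsn x)))) (borel \<Otimes>\<^sub>M haarK) (\<lambda>x. (AA x, kap x))) (A \<times> B)"
    by simp
qed

text \<open>The spherical transform of $f_s$.\<close>

definition hhat :: "real \<Rightarrow> real \<Rightarrow> real" where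
  "hhat s l = 2 * pi ^ 3 * sqrt (2 * pi) * exp (- l\<^sup>2 / 2) * cos (s * l)"

text \<open>For a = 0 this is the characteristic function of the standard normal distribution; a
  translation of t contributes the phase.\<close>

lemma gaussian_fourier:
  "integrable lborel (\<lambda>t. exp (- (\<i> * of_real l * of_real t)) * of_real (exp (- (t - a)\<^sup>2 / 2)))"
  "(LINT t|lborel. exp (- (\<i> * of_real l * of_real t)) * of_real (exp (- (t - a)\<^sup>2 / 2)))
    = exp (- (\<i> * of_real l * of_real a)) * of_real (sqrt (2 * pi) * exp (- l\<^sup>2 / 2))"
proof -
  let ?g = "\<lambda>t. iexp (- l * t) * of_real (exp (- t\<^sup>2 / 2))"
  have int_real: "integrable lborel (\<lambda>t::real. exp (- t\<^sup>2 / 2))"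
  proof -
    have "integrable lborel (\<lambda>t. sqrt (2 * pi) * std_normal_density t)"
      by (intro integrable_mult_right integrable_normal_density) simp
    moreover have "(\<lambda>t. sqrt (2 * pi) * std_normal_density t) = (\<lambda>t::real. exp (- t\<^sup>2 / 2))"
      by (simp add: std_normal_density_def fun_eq_iff)
    ultimately show ?thesis by (simp only:)
  qed
  have int: "integrable lborel ?g"
  proof (rule Bochner_Integration.integrable_bound[OF int_real])
    have "continuous_on UNIV ?g" by (intro continuous_intros) auto
    then show "?g \<in> borel_measurable lborel" using cts_borel by simp
  qed (simp add: norm_mult)
  have "char std_normal_distribution (- l) = (LINT t|lborel. std_normal_density t *\<^sub>R iexp (- l * t))"
    unfolding char_def by (subst integral_density) auto
  also have "\<dots> = (LINT t|lborel. of_real (1 / sqrt (2 * pi)) * ?g t)"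
    by (rule Bochner_Integration.integral_cong) (simp_all add: std_normal_density_def scaleR_conv_of_real mult_ac)
  also have "\<dots> = of_real (1 / sqrt (2 * pi)) * (LINT t|lborel. ?g t)"
    by (rule integral_mult_right_zero)
  finally have "of_real (1 / sqrt (2 * pi)) * (LINT t|lborel. ?g t) = complex_of_real (exp (- l\<^sup>2 / 2))"
    unfolding char_std_normal_distribution by simp
  then have J: "(LINT t|lborel. ?g t) = of_real (sqrt (2 * pi) * exp (- l\<^sup>2 / 2))"
    by (simp add: field_simps)
  let ?h = "\<lambda>t. exp (- (\<i> * of_real l * of_real t)) * complex_of_real (exp (- (t - a)\<^sup>2 / 2))"
  have sh: "?h (a + 1 * t) = exp (- (\<i> * of_real l * of_real a)) * ?g t" for t
    by (simp add: exp_add[symmetric] distrib_left mult_ac)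
  have "integrable lborel (\<lambda>t. ?h (a + 1 * t))"
    unfolding sh by (rule integrable_mult_right[OF int])
  then show "integrable lborel ?h"
    by (rule iffD1[OF lborel_integrable_real_affine_iff[where c = 1 and t = a and f = ?h, OF one_neq_zero]])
  have "(LINT t|lborel. ?h t) = (LINT t|lborel. ?h (a + 1 * t))"
    using lborel_integral_real_affine[of 1 ?h a] by simp
  also have "\<dots> = exp (- (\<i> * of_real l * of_real a)) * (LINT t|lborel. ?g t)"
    unfolding sh by (rule integral_mult_right_zero)
  finally show "(LINT t|lborel. ?h t) = exp (- (\<i> * of_real l * of_real a)) * of_real (sqrt (2 * pi) * exp (- l\<^sup>2 / 2))"
    by (simp only: J)
qed

lemma Eg_fourier:
  "integrable lborel (\<lambda>t. exp (- (\<i> * of_real l * of_real t)) * of_real (Eg s t))"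
  "of_real (pi ^ 3) * (LINT t|lborel. exp (- (\<i> * of_real l * of_real t)) * of_real (Eg s t)) = complex_of_real (hhat s l)"
proof -
  have e: "exp (- (\<i> * of_real l * of_real t)) * complex_of_real (Eg s t)
     = exp (- (\<i> * of_real l * of_real t)) * of_real (exp (- (t - s)\<^sup>2 / 2))
       + exp (- (\<i> * of_real l * of_real t)) * of_real (exp (- (t - (- s))\<^sup>2 / 2))" for t
    by (simp add: Eg_def distrib_left)
  show "integrable lborel (\<lambda>t. exp (- (\<i> * of_real l * of_real t)) * complex_of_real (Eg s t))"
    unfolding e by (intro Bochner_Integration.integrable_add gaussian_fourier)
  have "(LINT t|lborel. exp (- (\<i> * of_real l * of_real t)) * complex_of_real (Eg s t)) =
      (exp (- (\<i> * of_real l * of_real s)) + exp (- (\<i> * of_real l * of_real (- s)))) * of_real (sqrt (2 * pi) * exp (- l\<^sup>2 / 2))"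
    unfolding e by (subst Bochner_Integration.integral_add[OF gaussian_fourier(1) gaussian_fourier(1)])
      (simp only: gaussian_fourier(2) distrib_right)
  also have "exp (- (\<i> * of_real l * of_real s)) + exp (- (\<i> * of_real l * of_real (- s))) = 2 * complex_of_real (cos (s * l))"
    by (simp add: cos_of_real[symmetric] cos_exp_eq mult_ac)
  finally show "of_real (pi ^ 3) * (LINT t|lborel. exp (- (\<i> * of_real l * of_real t)) * of_real (Eg s t)) = complex_of_real (hhat s l)"
    by (simp add: hhat_def mult_ac)
qed

text \<open>By \<open>distr_weighted\<close> the integral factors. The e^t in \<psi> cancels the
  e^{-t} in the density of \<open>lawE\<close>, leaving the Euclidean Fourier transform of E_s, and
  the K-factor is the mean of g.\<close>

lemma fourier_master:
  fixes g :: "coords \<Rightarrow> complex" and l :: real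
  assumes s: "0 \<le> s" "s \<le> 1" and g: "integrable haarK g"
  defines "\<psi> \<equiv> \<lambda>x. exp ((1 - \<i> * of_real l) * of_real (AA x)) * g (kap x)"
  shows "integrable haarG (\<lambda>x. of_real (Gp s (hsn x)) * \<psi> x)"
    "(LINT x|haarG. of_real (Gp s (hsn x)) * \<psi> x) = of_real (hhat s l) * (LINT k|haarK. g k)"
proof -
  have gm[measurable]: "g \<in> borel_measurable haarK" using g by auto
  let ?\<Psi> = "\<lambda>p. exp ((1 - \<i> * of_real l) * of_real (fst p)) * g (snd p)"
  have em: "(\<lambda>t. exp ((1 - \<i> * of_real l) * complex_of_real t)) \<in> borel_measurable borel"
    by (rule cts_borel) (intro continuous_intros)
  have \<Psi>: "?\<Psi> \<in> borel_measurable (borel \<Otimes>\<^sub>M haarK)"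
    by (intro borel_measurable_times measurable_compose[OF measurable_fst em] measurable_compose[OF measurable_snd gm])
  have pm: "(\<lambda>x. (AA x, kap x)) \<in> measurable haarG (borel \<Otimes>\<^sub>M haarK)" by measurable
  have \<psi>m: "\<psi> \<in> borel_measurable haarG"
    using measurable_compose[OF pm \<Psi>] by (simp add: \<psi>_def)
  interpret E: sigma_finite_measure "lawE s" by (rule sigma_finite_lawE)
  interpret EK: pair_sigma_finite "lawE s" haarK ..
  have \<Psi>': "?\<Psi> \<in> borel_measurable (lawE s \<Otimes>\<^sub>M haarK)"
    using \<Psi> by (subst measurable_cong_sets[OF sets_pair_measure_cong[OF sets_lawE refl] refl])
  have expint: "integrable (lawE s) (\<lambda>t. exp ((1 - \<i> * of_real l) * complex_of_real t))"
  and expval: "(LINT t|lawE s. exp ((1 - \<i> * of_real l) * complex_of_real t)) = of_real (hhat s l)"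
  proof -
    have e: "(pi ^ 3 * exp (- t) * Eg s t) *\<^sub>R exp ((1 - \<i> * of_real l) * complex_of_real t)
        = of_real (pi ^ 3) * (exp (- (\<i> * of_real l * of_real t)) * of_real (Eg s t))" for t
    proof -
      have "exp (complex_of_real (- t)) * exp ((1 - \<i> * of_real l) * complex_of_real t) = exp (- (\<i> * of_real l * of_real t))"
        unfolding exp_add[symmetric] by (simp add: algebra_simps)
      then have "complex_of_real (exp (- t)) * exp ((1 - \<i> * of_real l) * complex_of_real t) = exp (- (\<i> * of_real l * of_real t))"
        by (simp only: exp_of_real)
      then show ?thesis by (simp add: scaleR_conv_of_real mult_ac)
    qed
    have "integrable lborel (\<lambda>t. (pi ^ 3 * exp (- t) * Eg s t) *\<^sub>R exp ((1 - \<i> * of_real l) * complex_of_real t))"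
      unfolding e by (intro integrable_mult_right Eg_fourier)
    then show "integrable (lawE s) (\<lambda>t. exp ((1 - \<i> * of_real l) * complex_of_real t))"
      unfolding lawE_def using em by (subst integrable_density) (auto simp: Eg_pos)
    have "(LINT t|lawE s. exp ((1 - \<i> * of_real l) * complex_of_real t))
        = (LINT t|lborel. (pi ^ 3 * exp (- t) * Eg s t) *\<^sub>R exp ((1 - \<i> * of_real l) * complex_of_real t))"
      unfolding lawE_def using em by (intro integral_density) (auto simp: Eg_pos)
    also have "\<dots> = of_real (hhat s l)"
      unfolding e Eg_fourier(2)[symmetric] by (rule integral_mult_right_zero)
    finally show "(LINT t|lawE s. exp ((1 - \<i> * of_real l) * complex_of_real t)) = of_real (hhat s l)" .
  qed
  have int\<Psi>: "integrable (lawE s \<Otimes>\<^sub>M haarK) ?\<Psi>"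
  proof (rule EK.Fubini_integrable[OF \<Psi>'])
    have "integrable (lawE s) (\<lambda>t. norm (exp ((1 - \<i> * of_real l) * complex_of_real t)) * (LINT k|haarK. norm (g k)))"
      by (intro integrable_mult_left integrable_norm expint)
    then show "integrable (lawE s) (\<lambda>t. LINT k|haarK. norm (?\<Psi> (t, k)))"
      by (simp add: norm_mult)
    show "AE t in lawE s. integrable haarK (\<lambda>k. ?\<Psi> (t, k))"
      using g by simp
  qed
  have val\<Psi>: "(LINT p|(lawE s \<Otimes>\<^sub>M haarK). ?\<Psi> p) = of_real (hhat s l) * (LINT k|haarK. g k)"
  proof -
    have "(LINT p|(lawE s \<Otimes>\<^sub>M haarK). ?\<Psi> p) = (LINT t|lawE s. LINT k|haarK. ?\<Psi> (t, k))"
      by (rule EK.integral_fst'[symmetric, OF int\<Psi>])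
    also have "\<dots> = (LINT t|lawE s. exp ((1 - \<i> * of_real l) * complex_of_real t)) * (LINT k|haarK. g k)"
      by simp
    finally show ?thesis unfolding expval .
  qed
  let ?D = "density haarG (\<lambda>x. ennreal (Gp s (hsn x)))"
  have pm': "(\<lambda>x. (AA x, kap x)) \<in> measurable ?D (borel \<Otimes>\<^sub>M haarK)" using pm by simp
  have "integrable ?D (\<lambda>x. ?\<Psi> (AA x, kap x))"
    using int\<Psi> unfolding distr_weighted[OF s, symmetric] by (subst (asm) integrable_distr_eq[OF pm' \<Psi>])
  then show "integrable haarG (\<lambda>x. of_real (Gp s (hsn x)) * \<psi> x)"
    using \<psi>m Gp_nonneg[OF s] by (subst (asm) integrable_density) (auto simp: \<psi>_def scaleR_conv_of_real)
  have "(LINT x|haarG. of_real (Gp s (hsn x)) * \<psi> x) = (LINT x|?D. \<psi> x)"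
    using \<psi>m Gp_nonneg[OF s] by (subst integral_density) (auto simp: scaleR_conv_of_real)
  also have "\<dots> = (LINT p|(lawE s \<Otimes>\<^sub>M haarK). ?\<Psi> p)"
    unfolding distr_weighted[OF s, symmetric] by (subst integral_distr[OF pm' \<Psi>]) (simp add: \<psi>_def)
  finally show "(LINT x|haarG. of_real (Gp s (hsn x)) * \<psi> x) = of_real (hhat s l) * (LINT k|haarK. g k)"
    unfolding val\<Psi> .
qed

subsection \<open>Spherical functions\<close>

lemma nn_integral_squares:
  assumes H[measurable]: "case_prod H \<in> borel_measurable (borel \<Otimes>\<^sub>M borel)"
  shows "(\<integral>\<^sup>+v. H ((cmod (fst v))\<^sup>2) ((cmod (snd v))\<^sup>2) \<partial>lborel) = (\<integral>\<^sup>+a. \<integral>\<^sup>+b. H a b \<partial>lawY \<partial>lawY)"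
proof -
  have m: "(\<lambda>v :: complex \<times> complex. H ((cmod (fst v))\<^sup>2) ((cmod (snd v))\<^sup>2)) \<in> borel_measurable borel"
  proof -
    have "(\<lambda>v :: complex \<times> complex. (cmod (fst v))\<^sup>2) \<in> borel_measurable borel"
      "(\<lambda>v :: complex \<times> complex. (cmod (snd v))\<^sup>2) \<in> borel_measurable borel"
      by (intro cts_borel continuous_on_power continuous_on_norm continuous_on_fst continuous_on_snd continuous_on_id)+
    then show ?thesis by measurable
  qed
  have "(\<integral>\<^sup>+v. H ((cmod (fst v))\<^sup>2) ((cmod (snd v))\<^sup>2) \<partial>lborel)
      = (\<integral>\<^sup>+x. \<integral>\<^sup>+y. H ((cmod x)\<^sup>2) ((cmod y)\<^sup>2) \<partial>lborel \<partial>lborel)"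
    using nn_integral_lborel_pair(1)[OF m] by simp
  also have "\<dots> = (\<integral>\<^sup>+x. \<integral>\<^sup>+b. H ((cmod x)\<^sup>2) b \<partial>lawY \<partial>lborel)"
  proof (rule nn_integral_cong)
    fix x :: complex
    show "(\<integral>\<^sup>+y. H ((cmod x)\<^sup>2) ((cmod y)\<^sup>2) \<partial>lborel) = (\<integral>\<^sup>+b. H ((cmod x)\<^sup>2) b \<partial>lawY)"
      unfolding distr_lawY[symmetric] by (rule nn_integral_distr[symmetric]) measurable
  qed
  also have "\<dots> = (\<integral>\<^sup>+a. \<integral>\<^sup>+b. H a b \<partial>lawY \<partial>distr lborel borel (\<lambda>z::complex. (cmod z)\<^sup>2))"
  proof -
    have "case_prod H \<in> borel_measurable (borel \<Otimes>\<^sub>M lawY)"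
      using H by (subst measurable_cong_sets[OF sets_pair_measure_cong[OF refl sets_laws(2)] refl])
    from lawY.borel_measurable_nn_integral[OF this]
    have m2: "(\<lambda>a. \<integral>\<^sup>+b. H a b \<partial>lawY) \<in> borel_measurable borel" .
    have Tm: "(\<lambda>z::complex. (cmod z)\<^sup>2) \<in> measurable lborel borel" by measurable
    show ?thesis
      by (rule nn_integral_distr[symmetric, OF Tm]) (simp add: m2)
  qed
  finally show ?thesis unfolding distr_lawY .
qed

text \<open>On the unit sphere of C^2 the squared modulus of a coordinate is uniform on [0, 1].
  Indeed (|v_1|^2, |v_2|^2) has constant density on the quadrant, so for a given sum S the quotient
  |v_1|^2 / S is uniform.\<close>

lemma nn_integral_haarK_entry:
  assumes \<Theta>[measurable]: "\<Theta> \<in> borel_measurable borel"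
  shows "(\<integral>\<^sup>+k. \<Theta> ((cmod (ea k))\<^sup>2) \<partial>haarK) = (\<integral>\<^sup>+u. \<Theta> u * indicator {0..1} u \<partial>lborel)"
proof -
  define D where "D = ennreal pi * (ennreal pi * (\<integral>\<^sup>+S. ennreal S * indicator {0<..<1} S \<partial>lborel))"
  let ?vol = "emeasure lborel (ball (0 :: complex \<times> complex) 1)"
  have main: "(\<integral>\<^sup>+k. \<Theta> ((cmod (ea k))\<^sup>2) \<partial>haarK) = D * (\<integral>\<^sup>+u. \<Theta> u * indicator {0..1} u \<partial>lborel) / ?vol"
    if \<Theta>[measurable]: "\<Theta> \<in> borel_measurable borel" for \<Theta> :: "real \<Rightarrow> ennreal"
  proof -
    define U where "U = (\<integral>\<^sup>+u. \<Theta> u * indicator {0..1} u \<partial>lborel)"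
    have "(\<lambda>k. k) \<in> borel_measurable haarK"
      using measurable_into_haar(2)[of "\<lambda>x. x" haarK] by simp
    from borel_measurable_entries(1)[OF this] have ea_m[measurable]: "ea \<in> borel_measurable haarK" .
    have "(\<integral>\<^sup>+k. \<Theta> ((cmod (ea k))\<^sup>2) \<partial>haarK)
        = (\<integral>\<^sup>+v. \<Theta> ((cmod (ea (ku v)))\<^sup>2) * indicator (ball 0 1) v \<partial>lborel) / ?vol"
      by (rule nn_integral_haarK) measurable
    also have "(\<integral>\<^sup>+v. \<Theta> ((cmod (ea (ku v)))\<^sup>2) * indicator (ball 0 1) v \<partial>lborel)
        = (\<integral>\<^sup>+v. \<Theta> ((cmod (fst v))\<^sup>2 / ((cmod (fst v))\<^sup>2 + (cmod (snd v))\<^sup>2)) *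
            indicator {..<1} ((cmod (fst v))\<^sup>2 + (cmod (snd v))\<^sup>2) \<partial>lborel)"
    proof (rule nn_integral_cong_AE, rule eventually_mono[OF AE_nonzero])
      fix v :: "complex \<times> complex" assume v: "v \<noteq> 0"
      have "(cmod (ea (ku v)))\<^sup>2 = (cmod (fst v))\<^sup>2 / (norm v)\<^sup>2"
        using ku_eq[OF v] by (simp add: norm_divide power_divide)
      moreover have "v \<in> ball 0 1 \<longleftrightarrow> (norm v)\<^sup>2 < 1"
        using abs_square_less_1[of "norm v"] by simp
      ultimately show "\<Theta> ((cmod (ea (ku v)))\<^sup>2) * indicator (ball 0 1) v
          = \<Theta> ((cmod (fst v))\<^sup>2 / ((cmod (fst v))\<^sup>2 + (cmod (snd v))\<^sup>2)) *
            indicator {..<1} ((cmod (fst v))\<^sup>2 + (cmod (snd v))\<^sup>2)"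
        unfolding norm_pair_sq by (simp add: indicator_def)
    qed
    also have "\<dots> = (\<integral>\<^sup>+a. \<integral>\<^sup>+b. \<Theta> (a / (a + b)) * indicator {..<1} (a + b) \<partial>lawY \<partial>lawY)"
      by (rule nn_integral_squares[of "\<lambda>a b. \<Theta> (a / (a + b)) * indicator {..<1} (a + b)"]) measurable
    also have "\<dots> = (\<integral>\<^sup>+a. ennreal pi * (\<integral>\<^sup>+S. \<Theta> (a / S) * indicator {..<1} S * indicator {a..} S \<partial>lborel) \<partial>lawY)"
    proof (rule nn_integral_cong)
      fix a :: real
      have "(\<lambda>S. \<Theta> (a / S) * indicator {..<1} S) \<in> borel_measurable borel" by measurable
      with nn_integral_lawY[of "\<lambda>S. \<Theta> (a / S) * indicator {..<1} S" 1 a]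
      show "(\<integral>\<^sup>+b. \<Theta> (a / (a + b)) * indicator {..<1} (a + b) \<partial>lawY)
          = ennreal pi * (\<integral>\<^sup>+S. \<Theta> (a / S) * indicator {..<1} S * indicator {a..} S \<partial>lborel)"
        by simp
    qed
    also have "\<dots> = (\<integral>\<^sup>+a. (ennreal pi * indicator {0..} a) *
        (ennreal pi * (\<integral>\<^sup>+S. \<Theta> (a / S) * indicator {..<1} S * indicator {a..} S \<partial>lborel)) \<partial>lborel)"
      unfolding lawY_def
    proof (rule nn_integral_density)
      have "(\<lambda>p :: real \<times> real. \<Theta> (fst p / snd p) * indicator {..<1} (snd p) * indicator {q. fst q \<le> snd q} p)
          \<in> borel_measurable (borel \<Otimes>\<^sub>M lborel)" by measurable
      then have "(\<lambda>(a, S). \<Theta> (a / S) * indicator {..<1} S * indicator {a..} S) \<in> borel_measurable (borel \<Otimes>\<^sub>M lborel)"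
        by (rule measurable_cong[THEN iffD1, rotated]) (auto simp: indicator_def)
      from lborel.borel_measurable_nn_integral[OF this]
      show "(\<lambda>a. ennreal pi * (\<integral>\<^sup>+S. \<Theta> (a / S) * indicator {..<1} S * indicator {a..} S \<partial>lborel)) \<in> borel_measurable lborel"
        by simp
    qed measurable
    also have "\<dots> = (\<integral>\<^sup>+a. \<integral>\<^sup>+S. ennreal pi * (ennreal pi * (\<Theta> (a / S) * indicator {..<1} S * indicator {0..S} a)) \<partial>lborel \<partial>lborel)"
    proof (rule nn_integral_cong)
      fix a :: real
      have "(\<integral>\<^sup>+S. ennreal pi * (ennreal pi * (\<Theta> (a / S) * indicator {..<1} S * indicator {0..S} a)) \<partial>lborel)
          = (\<integral>\<^sup>+S. (ennreal pi * indicator {0..} a * ennreal pi) * (\<Theta> (a / S) * indicator {..<1} S * indicator {a..} S) \<partial>lborel)"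
        by (rule nn_integral_cong) (auto simp: indicator_def mult.assoc)
      also have "\<dots> = (ennreal pi * indicator {0..} a * ennreal pi) * (\<integral>\<^sup>+S. \<Theta> (a / S) * indicator {..<1} S * indicator {a..} S \<partial>lborel)"
        by (rule nn_integral_cmult) measurable
      finally show "(ennreal pi * indicator {0..} a) *
          (ennreal pi * (\<integral>\<^sup>+S. \<Theta> (a / S) * indicator {..<1} S * indicator {a..} S \<partial>lborel))
        = (\<integral>\<^sup>+S. ennreal pi * (ennreal pi * (\<Theta> (a / S) * indicator {..<1} S * indicator {0..S} a)) \<partial>lborel)"
        by (simp add: mult.assoc)
    qed
    also have "\<dots> = (\<integral>\<^sup>+S. \<integral>\<^sup>+a. ennreal pi * (ennreal pi * (\<Theta> (a / S) * indicator {..<1} S * indicator {0..S} a)) \<partial>lborel \<partial>lborel)"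
    proof (rule lborel_pair.Fubini'[symmetric])
      have "(\<lambda>p :: real \<times> real. ennreal pi * (ennreal pi * (\<Theta> (fst p / snd p) * indicator {..<1} (snd p) * indicator {q. 0 \<le> fst q \<and> fst q \<le> snd q} p)))
          \<in> borel_measurable (lborel \<Otimes>\<^sub>M lborel)" by measurable
      then show "(\<lambda>(a, S). ennreal pi * (ennreal pi * (\<Theta> (a / S) * indicator {..<1} S * indicator {0..S} a))) \<in> borel_measurable (lborel \<Otimes>\<^sub>M lborel)"
        by (rule measurable_cong[THEN iffD1, rotated]) (auto simp: indicator_def)
    qed
    also have "\<dots> = (\<integral>\<^sup>+S. (ennreal pi * (ennreal pi * (ennreal S * indicator {0<..<1} S))) * U \<partial>lborel)"
    proof (rule nn_integral_cong_AE, rule eventually_mono[OF AE_nonzero])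
      fix S :: real assume S: "S \<noteq> 0"
      show "(\<integral>\<^sup>+a. ennreal pi * (ennreal pi * (\<Theta> (a / S) * indicator {..<1} S * indicator {0..S} a)) \<partial>lborel)
          = (ennreal pi * (ennreal pi * (ennreal S * indicator {0<..<1} S))) * U"
      proof (cases "S > 0")
        case True
        have "(\<integral>\<^sup>+a. \<Theta> (a / S) * indicator {0..S} a \<partial>lborel)
            = ennreal S * (\<integral>\<^sup>+w. \<Theta> ((0 + S * w) / S) * indicator {0..S} (0 + S * w) \<partial>lborel)"
          using nn_integral_real_affine[of "\<lambda>a. \<Theta> (a / S) * indicator {0..S} a" S 0] True by simp
        also have "(\<integral>\<^sup>+w. \<Theta> ((0 + S * w) / S) * indicator {0..S} (0 + S * w) \<partial>lborel) = U"
          unfolding U_def by (rule nn_integral_cong) (use True in \<open>auto simp: indicator_def zero_le_mult_iff\<close>)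
        finally have e: "(\<integral>\<^sup>+a. \<Theta> (a / S) * indicator {0..S} a \<partial>lborel) = ennreal S * U" .
        have "(\<integral>\<^sup>+a. ennreal pi * (ennreal pi * (\<Theta> (a / S) * indicator {..<1} S * indicator {0..S} a)) \<partial>lborel)
            = (\<integral>\<^sup>+a. (ennreal pi * ennreal pi * indicator {..<1} S) * (\<Theta> (a / S) * indicator {0..S} a) \<partial>lborel)"
          by (rule nn_integral_cong) (simp add: mult_ac)
        also have "\<dots> = (ennreal pi * ennreal pi * indicator {..<1} S) * (ennreal S * U)"
          unfolding e[symmetric] by (rule nn_integral_cmult) measurable
        finally show ?thesis using True by (simp add: indicator_def mult_ac)
      next
        case False
        then have "indicator {0..S} a = (0 :: ennreal)" "indicator {0<..<1} S = (0 :: ennreal)" for a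
          using S by (auto simp: indicator_def)
        then show ?thesis by simp
      qed
    qed
    also have "\<dots> = D * U"
      unfolding D_def by (subst nn_integral_multc) (simp_all add: nn_integral_cmult)
    finally show ?thesis unfolding U_def .
  qed
  \<comment> \<open>The quotient of \<open>D\<close> by the volume of the ball is found from the
    total mass of \<open>haarK\<close>, with \<Theta> = 1.\<close>
  have "1 = D * 1 / ?vol"
    using main[of "\<lambda>u. 1"] haarK.emeasure_space_1[simplified] by simp
  then show ?thesis
    unfolding main[OF \<Theta>] by (metis ennreal_times_divide mult.commute mult.right_neutral)
qed

lemma distr_haarK_entry:
  "distr haarK borel (\<lambda>k. (cmod (ea k))\<^sup>2) = density lborel (indicator {0..1})"
proof (rule measure_eqI)
  have "(\<lambda>k. k) \<in> borel_measurable haarK"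
    using measurable_into_haar(2)[of "\<lambda>x. x" haarK] by simp
  from borel_measurable_entries(1)[OF this] have [measurable]: "ea \<in> borel_measurable haarK" .
  fix A assume "A \<in> sets (distr haarK borel (\<lambda>k. (cmod (ea k))\<^sup>2))"
  then have A[measurable]: "A \<in> sets borel" by simp
  have "emeasure (distr haarK borel (\<lambda>k. (cmod (ea k))\<^sup>2)) A = (\<integral>\<^sup>+u. indicator A u \<partial>distr haarK borel (\<lambda>k. (cmod (ea k))\<^sup>2))"
    by simp
  also have "\<dots> = (\<integral>\<^sup>+k. indicator A ((cmod (ea k))\<^sup>2) \<partial>haarK)"
    by (rule nn_integral_distr) measurable
  also have "\<dots> = (\<integral>\<^sup>+u. indicator A u * indicator {0..1} u \<partial>lborel)"
    by (rule nn_integral_haarK_entry) measurable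
  also have "\<dots> = emeasure (density lborel (indicator {0..1})) A"
    by (subst emeasure_density) (auto intro!: nn_integral_cong simp: mult.commute)
  finally show "emeasure (distr haarK borel (\<lambda>k. (cmod (ea k))\<^sup>2)) A = emeasure (density lborel (indicator {0..1})) A" .
qed simp

lemma Afun_S0: "x \<in> SL2 \<Longrightarrow> k \<in> SU2 \<Longrightarrow> Afun S0 x k = AA (mmult (madj x) k)"
  using SU2_subset by (auto simp: Afun_def iwasawa_H_S0 AA_def mmult_in_SL2 madj_in_SL2)

lemma AA_mult_left: "k \<in> SU2 \<Longrightarrow> AA (mmult k g) = AA g"
  using norm_mact_SU2[of k "(ea g, ec g)"] by (simp add: AA_def mact_def mmult_def)

text \<open>Squared norm of the first column of a_{-r} k when |\<open>ea k\<close>|^2 = u. Being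
  affine in u, it makes the integrals for spherical functions elementary.\<close>

definition qfun :: "real \<Rightarrow> real \<Rightarrow> real" where
  "qfun r u = exp (- r) * u + exp r * (1 - u)"

lemma qfun_pos: "0 \<le> u \<Longrightarrow> u \<le> 1 \<Longrightarrow> qfun r u > 0"
  unfolding qfun_def by (cases "u = 0") (auto intro: add_pos_nonneg)

lemma AA_diag:
  assumes "k \<in> SU2" shows "AA (mmult (a_elt S0 (- r)) k) = - ln (qfun r ((cmod (ea k))\<^sup>2))"
    "(cmod (ea k))\<^sup>2 \<le> 1"
proof -
  obtain p q where k: "k = mk p q (- cnj q) (cnj p)" and pq: "p * cnj p + q * cnj q = 1"
    using assms by (rule SU2_cases)
  have "complex_of_real ((cmod p)\<^sup>2 + (cmod q)\<^sup>2) = 1"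
    using pq by (simp only: of_real_add complex_norm_square)
  then have pq': "(cmod q)\<^sup>2 = 1 - (cmod p)\<^sup>2" by (simp only: of_real_eq_1_iff)
  show le: "(cmod (ea k))\<^sup>2 \<le> 1" using pq' zero_le_power2[of "cmod q"] by (simp add: k)
  let ?w = "(ea (mmult (a_elt S0 (- r)) k), ec (mmult (a_elt S0 (- r)) k))"
  have e: "(exp (- r / 2))\<^sup>2 = exp (- r)" "(exp (r / 2))\<^sup>2 = exp r"
    by (simp_all add: power2_eq_square exp_add[symmetric])
  have "(norm ?w)\<^sup>2 = qfun r ((cmod (ea k))\<^sup>2)"
    using e by (simp add: norm_pair_sq k a_elt_S0 norm_mult power_mult_distrib pq' qfun_def)
  moreover have "qfun r ((cmod (ea k))\<^sup>2) > 0" using le by (intro qfun_pos) auto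
  ultimately have "norm ?w > 0" by (metis norm_ge_zero order_le_less power_zero_numeral less_irrefl)
  then have "2 * ln (norm ?w) = ln ((norm ?w)\<^sup>2)" by (simp add: ln_realpow)
  then show "AA (mmult (a_elt S0 (- r)) k) = - ln (qfun r ((cmod (ea k))\<^sup>2))"
    using \<open>(norm ?w)\<^sup>2 = _\<close> by (simp add: AA_def)
qed

text \<open>Write x = k a_r m. In x^{-1}c the factor m^{-1} on the left does not change
  \<open>AA\<close>, and the factor k^{-1} next to c is absorbed by the invariance of Haar measure.
  What remains depends on one entry of c, whose law is uniform.\<close>

lemma spherical_S0:
  assumes x: "x \<in> SL2"
  shows "spherical S0 l x = (LINT u|lborel. indicator {0..1} u *\<^sub>R
    exp (- (\<i> * l + 1) * of_real (ln (qfun (rad x) u))))"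
proof -
  obtain k m where k: "k \<in> SU2" and m: "m \<in> SU2" and xe: "x = mmult (mmult k (a_elt S0 (rad x))) m"
    using Cartan[OF x] .
  define r where "r = rad x"
  have xr: "x = mmult (mmult k (a_elt S0 r)) m" using xe by (simp add: r_def)
  let ?e = "\<lambda>u. exp (- (\<i> * l + 1) * of_real (ln (qfun r u)))"
  have idm: "(\<lambda>k. k) \<in> borel_measurable haarK"
    using measurable_into_haar(2)[of "\<lambda>x. x" haarK] by simp
  from borel_measurable_entries(1)[OF idm] have [measurable]: "ea \<in> borel_measurable haarK" .
  have em[measurable]: "?e \<in> borel_measurable borel"
  proof -
    have "(\<lambda>u. ln (qfun r u)) \<in> borel_measurable borel" unfolding qfun_def by measurable
    moreover have "continuous_on UNIV (\<lambda>y. exp (- (\<i> * l + 1) * complex_of_real y))" by (intro continuous_intros)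
    ultimately show ?thesis by (rule borel_measurable_continuous_on[rotated])
  qed
  have A: "AA (mmult (madj x) c) = - ln (qfun r ((cmod (ea (mmult (madj k) c)))\<^sup>2))" if c: "c \<in> SU2" for c
  proof -
    have "madj x = madj (mmult (mmult k (a_elt S0 r)) m)" using xr by (rule arg_cong)
    then have "mmult (madj x) c = mmult (madj m) (mmult (a_elt S0 (- r)) (mmult (madj k) c))"
      by (simp only: madj_mmult madj_a_elt mmult_assoc)
    then show ?thesis
      using AA_mult_left[OF madj_in_SU2[OF m]] AA_diag(1)[OF mmult_in_SU2[OF madj_in_SU2[OF k] c]] by simp
  qed
  have "spherical S0 l x = (LINT c|haarK. ?e ((cmod (ea (mmult (madj k) c)))\<^sup>2))"
    unfolding spherical_def S0_sel rho_S0
  proof (rule Bochner_Integration.integral_cong[OF refl])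
    fix c assume "c \<in> space haarK"
    then have c: "c \<in> SU2" by simp
    show "exp ((\<i> * l + of_real 1) * of_real (Afun S0 x c)) = ?e ((cmod (ea (mmult (madj k) c)))\<^sup>2)"
      unfolding Afun_S0[OF x c] A[OF c] by (simp add: algebra_simps)
  qed
  also have "\<dots> = (LINT c|distr haarK haarK (mmult (madj k)). ?e ((cmod (ea c))\<^sup>2))"
  proof (rule integral_distr[symmetric])
    have "(\<lambda>c. madj k) \<in> measurable haarK haarK" using madj_in_SU2[OF k] by simp
    from measurable_haar_group(3)[OF this measurable_ident_sets[OF refl]]
    show "mmult (madj k) \<in> measurable haarK haarK" by simp
  qed measurable
  also have "\<dots> = (LINT c|haarK. ?e ((cmod (ea c))\<^sup>2))"
    by (simp only: distr_haarK_left[OF madj_in_SU2[OF k]])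
  also have "\<dots> = (LINT u|distr haarK borel (\<lambda>k. (cmod (ea k))\<^sup>2). ?e u)"
    by (rule integral_distr[symmetric]) measurable
  also have "\<dots> = (LINT u|density lborel (\<lambda>u. ennreal (indicator {0..1} u)). ?e u)"
    unfolding distr_haarK_entry by (simp add: ennreal_indicator)
  also have "\<dots> = (LINT u|lborel. indicator {0..1} u *\<^sub>R ?e u)"
    using em by (intro integral_density) simp_all
  finally show ?thesis by (simp add: r_def)
qed

lemma qfun_deriv: "(qfun r has_real_derivative - (2 * sinh r)) (at u within S)"
  unfolding qfun_def[abs_def] by (auto intro!: derivative_eq_intros simp: sinh_def field_simps)

lemma qfun_exp_deriv:
  fixes c :: complex
  assumes u: "u \<in> {0..1}"
  shows "((\<lambda>u. exp (c * of_real (ln (qfun r u)))) has_vector_derivative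
    (c * of_real (- (2 * sinh r) / qfun r u)) * exp (c * of_real (ln (qfun r u)))) (at u within {0..1})"
proof -
  have q: "qfun r u > 0" using u by (intro qfun_pos) auto
  have "((\<lambda>u. ln (qfun r u)) has_real_derivative - (2 * sinh r) / qfun r u) (at u within {0..1})"
    using q by (auto intro!: derivative_eq_intros qfun_deriv)
  then have "((\<lambda>u. c * of_real (ln (qfun r u))) has_vector_derivative c * of_real (- (2 * sinh r) / qfun r u)) (at u within {0..1})"
    by (intro has_vector_derivative_mult_right has_vector_derivative_of_real)
  from field_vector_diff_chain_within[OF this has_field_derivative_at_within[OF DERIV_exp]]
  show ?thesis by (simp add: o_def)
qed

lemma continuous_on_qfun_exp: "continuous_on {0..1} (\<lambda>u. exp (c * complex_of_real (ln (qfun r u))))"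
  using qfun_exp_deriv has_vector_derivative_continuous
  unfolding continuous_on_eq_continuous_within by blast

lemma qfun_ends [simp]: "ln (qfun r 0) = r" "ln (qfun r 1) = - r"
  by (simp_all add: qfun_def)

text \<open>The integrand is the power -1 - il of an affine function with slope -2 sinh r, so it has
  an explicit primitive. The value is sin(lr) / (l sinh r).\<close>

lemma spherical_formula:
  assumes x: "x \<in> SL2" and l: "l \<noteq> 0" and r: "rad x > 0"
  shows "spherical S0 l x = (exp (\<i> * l * of_real (rad x)) - exp (- (\<i> * l * of_real (rad x)))) / (2 * \<i> * l * of_real (sinh (rad x)))"
proof -
  let ?r = "rad x"
  have sh: "sinh ?r > 0" using r by simp
  then have shc: "complex_of_real (sinh ?r) \<noteq> 0" by simp
  let ?F = "\<lambda>u. exp (- (\<i> * l) * of_real (ln (qfun ?r u))) / (2 * \<i> * l * of_real (sinh ?r))"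
  have "spherical S0 l x = ?F 1 - ?F 0"
    unfolding spherical_S0[OF x]
  proof (rule integral_FTC_atLeastAtMost)
    fix u :: real assume u: "0 \<le> u" "u \<le> 1"
    have q: "qfun ?r u > 0" using u by (rule qfun_pos)
    have "exp (complex_of_real (- ln (qfun ?r u))) = complex_of_real (exp (- ln (qfun ?r u)))"
      by (rule exp_of_real)
    also have "exp (- ln (qfun ?r u)) = 1 / qfun ?r u"
      using q by (simp add: exp_minus inverse_eq_divide)
    finally have e1: "exp (- complex_of_real (ln (qfun ?r u))) = complex_of_real (1 / qfun ?r u)" by simp
    have "- (\<i> * l + 1) * of_real (ln (qfun ?r u)) = - (\<i> * l) * of_real (ln (qfun ?r u)) + - complex_of_real (ln (qfun ?r u))"
      by (simp add: algebra_simps)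
    then have ex: "exp (- (\<i> * l + 1) * of_real (ln (qfun ?r u))) = exp (- (\<i> * l) * of_real (ln (qfun ?r u))) * complex_of_real (1 / qfun ?r u)"
      by (simp only: exp_add e1)
    have "(?F has_vector_derivative ((- (\<i> * l)) * of_real (- (2 * sinh ?r) / qfun ?r u)) * exp (- (\<i> * l) * of_real (ln (qfun ?r u)))
        / (2 * \<i> * l * of_real (sinh ?r))) (at u within {0..1})"
      by (rule has_vector_derivative_divide[OF qfun_exp_deriv]) (use u in simp)
    also have "((- (\<i> * l)) * of_real (- (2 * sinh ?r) / qfun ?r u)) * exp (- (\<i> * l) * of_real (ln (qfun ?r u)))
        / (2 * \<i> * l * of_real (sinh ?r)) = exp (- (\<i> * l + 1) * of_real (ln (qfun ?r u)))"
      unfolding ex using l shc q by (simp add: field_simps)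
    finally show "(?F has_vector_derivative exp (- (\<i> * l + 1) * of_real (ln (qfun ?r u)))) (at u within {0..1})" .
  qed (use continuous_on_qfun_exp[of "- (\<i> * l + 1)" ?r] in simp_all)
  then show ?thesis by (simp add: diff_divide_distrib)
qed

lemma rad_a_elt: "t \<ge> 0 \<Longrightarrow> rad (a_elt S0 t) = t"
proof -
  assume t: "t \<ge> 0"
  have "(exp (t / 2))\<^sup>2 = exp t" "(exp (- t / 2))\<^sup>2 = exp (- t)"
    by (simp_all add: power2_eq_square exp_add[symmetric])
  then have "hsn (a_elt S0 t) = 2 * cosh t"
    by (simp add: hsn_def a_elt_S0 cosh_def)
  then show ?thesis using t by (simp add: rad_def arcosh_cosh_real)
qed

lemma Xi_formula:
  assumes x: "x \<in> SL2" and r: "rad x > 0"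
  shows "Xi S0 x = rad x / sinh (rad x)" "spherical S0 0 x = of_real (Xi S0 x)"
proof -
  let ?r = "rad x"
  have sh: "sinh ?r > 0" using r by simp
  \<comment> \<open>At parameter 0 the integrand is the reciprocal of the affine function, and its
    primitive is a logarithm instead of a power.\<close>
  let ?F = "\<lambda>u. complex_of_real (- ln (qfun ?r u) / (2 * sinh ?r))"
  have "spherical S0 0 x = ?F 1 - ?F 0"
    unfolding spherical_S0[OF x]
  proof (rule integral_FTC_atLeastAtMost)
    fix u :: real assume u: "0 \<le> u" "u \<le> 1"
    have q: "qfun ?r u > 0" using u by (rule qfun_pos)
    have "((\<lambda>u. - ln (qfun ?r u) / (2 * sinh ?r)) has_real_derivative 1 / qfun ?r u) (at u within {0..1})"
      using q sh by (auto intro!: derivative_eq_intros qfun_deriv simp: field_simps)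
    then have F: "(?F has_vector_derivative of_real (1 / qfun ?r u)) (at u within {0..1})"
      by (rule has_vector_derivative_of_real)
    have "exp (complex_of_real (- ln (qfun ?r u))) = complex_of_real (exp (- ln (qfun ?r u)))"
      by (rule exp_of_real)
    also have "exp (- ln (qfun ?r u)) = 1 / qfun ?r u"
      using q by (simp add: exp_minus inverse_eq_divide)
    finally have e: "exp (- (\<i> * 0 + 1) * of_real (ln (qfun ?r u))) = complex_of_real (1 / qfun ?r u)"
      by simp
    show "(?F has_vector_derivative exp (- (\<i> * 0 + 1) * of_real (ln (qfun ?r u)))) (at u within {0..1})"
      unfolding e by (rule F)
  qed (use continuous_on_qfun_exp[of "- (\<i> * 0 + 1)" ?r] in simp_all)
  also have "\<dots> = of_real (?r / sinh ?r)"
    using sh by (simp add: field_simps)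
  finally have "spherical S0 0 x = of_real (?r / sinh ?r)" .
  then show "Xi S0 x = rad x / sinh (rad x)" "spherical S0 0 x = of_real (Xi S0 x)"
    by (simp_all add: Xi_def)
qed

lemma Xi_formula_0:
  assumes x: "x \<in> SL2" and r: "rad x = 0"
  shows "Xi S0 x = 1" "spherical S0 0 x = of_real (Xi S0 x)"
proof -
  have "spherical S0 0 x = (LINT u|lborel. indicator {0..1} (u::real) *\<^sub>R (1 :: complex))"
    unfolding spherical_S0[OF x] r by (simp add: qfun_def)
  also have "\<dots> = (LINT u|lborel. indicator {0..1} (u::real)) *\<^sub>R 1"
    by (rule integral_scaleR_left) simp
  also have "\<dots> = 1" by simp
  finally have "spherical S0 0 x = 1" .
  then show "Xi S0 x = 1" "spherical S0 0 x = of_real (Xi S0 x)"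
    by (simp_all add: Xi_def)
qed

lemma Xi_bounds:
  assumes "x \<in> SL2"
  shows "0 \<le> Xi S0 x" "Xi S0 x \<le> (1 + 2 * rad x) * exp (- rad x)" "spherical S0 0 x = of_real (Xi S0 x)"
proof -
  have "0 \<le> Xi S0 x \<and> Xi S0 x \<le> (1 + 2 * rad x) * exp (- rad x) \<and> spherical S0 0 x = of_real (Xi S0 x)"
  proof (cases "rad x = 0")
    case True
    then show ?thesis using Xi_formula_0[OF assms] by simp
  next
    case False
    then have r: "rad x > 0" using rad_nonneg[OF assms] by simp
    then show ?thesis using Xi_formula[OF assms r] sinh_ratio_le[OF r] by simp
  qed
  then show "0 \<le> Xi S0 x" "Xi S0 x \<le> (1 + 2 * rad x) * exp (- rad x)" "spherical S0 0 x = of_real (Xi S0 x)"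
    by auto
qed

subsection \<open>The Plancherel measure\<close>

text \<open>Of the two exponentials in \<open>spherical_formula\<close>, the one that leads to
  exp(-2ilt) dies out because its modulus is e^{2t Im l} and Im l < 0; the prefactor e^t / (2 sinh
  t) tends to 1.\<close>

lemma c_lower_S0:
  assumes l: "Im l < 0" shows "c_lower S0 l = 1 / (\<i> * l)"
proof -
  have l0: "l \<noteq> 0" using l by auto
  let ?f = "\<lambda>t::real. exp ((of_real (rho S0) - \<i> * l) * of_real t) * spherical S0 l (a_elt S0 t)"
  let ?g = "\<lambda>t::real. complex_of_real (exp t / (2 * sinh t)) * ((1 - exp (- (2 * \<i> * l * of_real t))) / (\<i> * l))"
  have eq: "?f t = ?g t" if t: "t > 0" for t
  proof -
    have sh: "complex_of_real (sinh t) \<noteq> 0" using t by simp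
    have "spherical S0 l (a_elt S0 t) = (exp (\<i> * l * of_real t) - exp (- (\<i> * l * of_real t))) / (2 * \<i> * l * of_real (sinh t))"
      using spherical_formula[of "a_elt S0 t" l] rad_a_elt[of t] t l0 by simp
    moreover have "exp ((1 - \<i> * l) * of_real t) * exp (\<i> * l * of_real t) = of_real (exp t)"
      unfolding exp_add[symmetric] exp_of_real[symmetric] by (simp add: algebra_simps)
    moreover have "exp ((1 - \<i> * l) * of_real t) * exp (- (\<i> * l * of_real t)) = of_real (exp t) * exp (- (2 * \<i> * l * of_real t))"
      unfolding exp_add[symmetric] exp_of_real[symmetric] by (simp add: algebra_simps)
    ultimately have "?f t = (of_real (exp t) - of_real (exp t) * exp (- (2 * \<i> * l * of_real t))) / (2 * \<i> * l * of_real (sinh t))"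
      by (simp add: rho_S0 right_diff_distrib)
    also have "\<dots> = ?g t" using sh l0 by (simp add: field_simps)
    finally show ?thesis .
  qed
  have "((\<lambda>t. exp t / (2 * sinh t)) \<longlongrightarrow> (1::real)) at_top"
    unfolding sinh_field_def by real_asymp
  then have 1: "((\<lambda>t. complex_of_real (exp t / (2 * sinh t))) \<longlongrightarrow> of_real 1) at_top"
    by (rule tendsto_of_real)
  define a where "a = - 2 * Im l"
  have "a > 0" using l by (simp add: a_def)
  then have "((\<lambda>t::real. exp (- (a * t))) \<longlongrightarrow> 0) at_top"
    by real_asymp
  then have "((\<lambda>t::real. norm (exp (- (2 * \<i> * l * of_real t)))) \<longlongrightarrow> 0) at_top"
    by (simp add: a_def)
  then have 2: "((\<lambda>t::real. exp (- (2 * \<i> * l * of_real t))) \<longlongrightarrow> 0) at_top"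
    by (rule tendsto_norm_zero_cancel)
  have "(?g \<longlongrightarrow> of_real 1 * ((1 - 0) / (\<i> * l))) at_top"
    by (intro tendsto_mult tendsto_divide tendsto_diff tendsto_const 1 2) (use l0 in simp)
  then have gl: "(?g \<longlongrightarrow> 1 / (\<i> * l)) at_top" by simp
  have "\<forall>\<^sub>F t in at_top. ?g t = ?f t"
    by (rule eventually_mono[OF eventually_gt_at_top[of "0::real"]]) (rule eq[symmetric])
  from Lim_transform_eventually[OF gl this] have "(?f \<longlongrightarrow> 1 / (\<i> * l)) at_top" .
  then show ?thesis
    unfolding c_lower_def by (intro tendsto_Lim) auto
qed

lemma c_fun_S0: assumes "l \<noteq> 0" shows "c_fun S0 l = 1 / (\<i> * of_real l)"
proof -
  have "((\<lambda>\<eta>::real. 1 / (\<i> * (of_real l - \<i> * of_real \<eta>))) \<longlongrightarrow> 1 / (\<i> * (of_real l - \<i> * of_real 0))) (at_right 0)"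
    using assms by (intro tendsto_intros) auto
  then have gl: "((\<lambda>\<eta>::real. 1 / (\<i> * (of_real l - \<i> * of_real \<eta>))) \<longlongrightarrow> 1 / (\<i> * of_real l)) (at_right 0)"
    by simp
  have "\<forall>\<^sub>F \<eta> in at_right 0. 1 / (\<i> * (of_real l - \<i> * of_real \<eta>)) = c_lower S0 (of_real l - \<i> * of_real \<eta>)"
    using eventually_at_right_less[of "0::real"]
  proof eventually_elim
    case (elim \<eta>)
    then have "Im (of_real l - \<i> * of_real \<eta>) < 0" by simp
    from c_lower_S0[OF this] show ?case by (rule sym)
  qed
  from Lim_transform_eventually[OF gl this]
  have "((\<lambda>\<eta>. c_lower S0 (of_real l - \<i> * of_real \<eta>)) \<longlongrightarrow> 1 / (\<i> * of_real l)) (at_right 0)" .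
  then show ?thesis
    unfolding c_fun_def by (intro tendsto_Lim) auto
qed

lemma plancherel_S0: "plancherel S0 = density lborel (\<lambda>l. ennreal (l\<^sup>2))"
proof -
  define g where "g l = ennreal (1 / (cmod (c_fun S0 l))\<^sup>2)" for l
  have g: "g l = ennreal (l\<^sup>2)" if "l \<noteq> 0" for l
    unfolding g_def c_fun_S0[OF that] by (simp add: norm_divide norm_mult power_divide)
  \<comment> \<open>At 0 the c-function has a pole, and \<open>c_fun\<close> there is a limit that
    does not exist. Its unknown value is kept as a constant; it only matters on a null set.\<close>
  have m: "(\<lambda>l. if l = 0 then g 0 else ennreal (l\<^sup>2)) \<in> borel_measurable lborel"
    by measurable
  have "g \<in> borel_measurable lborel"
    by (rule measurable_cong[THEN iffD2, OF _ m]) (simp add: g)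
  moreover have "(\<lambda>l::real. ennreal (l\<^sup>2)) \<in> borel_measurable lborel"
    by measurable
  moreover have "AE l in lborel. g l = ennreal (l\<^sup>2)"
    by (rule eventually_mono[OF AE_nonzero]) (rule g)
  ultimately have "density lborel g = density lborel (\<lambda>l. ennreal (l\<^sup>2))"
    by (rule density_cong)
  then show ?thesis
    unfolding plancherel_def g_def .
qed

subsection \<open>Decay at infinity\<close>

lemma nn_integral_exp_abs:
  assumes a: "(a::real) > 0"
  shows "(\<integral>\<^sup>+s. ennreal (exp (- (a * \<bar>s\<bar>))) \<partial>lborel) < \<infinity>"
proof -
  let ?h = "\<lambda>s::real. ennreal (exp (- (a * s))) * indicator {0..} s"
  have h: "(\<integral>\<^sup>+s. ?h s \<partial>lborel) = ennreal (0 - (- exp (- (a * 0)) / a))"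
  proof (rule nn_integral_FTC_atLeast)
    show "((\<lambda>s. - exp (- (a * s)) / a) \<longlongrightarrow> 0) at_top" using a by real_asymp
    show "((\<lambda>s. - exp (- (a * s)) / a) has_real_derivative exp (- (a * s))) (at s)" for s
      using a by (auto intro!: derivative_eq_intros)
  qed auto
  have "(\<integral>\<^sup>+s. ?h s \<partial>lborel) = ennreal \<bar>- 1\<bar> * (\<integral>\<^sup>+s. ?h (0 + (- 1) * s) \<partial>lborel)"
    by (rule nn_integral_real_affine) auto
  then have h': "(\<integral>\<^sup>+s. ?h (- s) \<partial>lborel) = (\<integral>\<^sup>+s. ?h s \<partial>lborel)" by simp
  have "(\<integral>\<^sup>+s. ennreal (exp (- (a * \<bar>s\<bar>))) \<partial>lborel) \<le> (\<integral>\<^sup>+s. ?h s + ?h (- s) \<partial>lborel)"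
    by (rule nn_integral_mono) (auto simp: indicator_def)
  also have "\<dots> = (\<integral>\<^sup>+s. ?h s \<partial>lborel) + (\<integral>\<^sup>+s. ?h (- s) \<partial>lborel)"
    by (rule nn_integral_add) auto
  also have "\<dots> < \<infinity>" unfolding h' h by (simp add: ennreal_plus[symmetric] del: ennreal_plus)
  finally show ?thesis .
qed

lemma nn_integral_powr_tail:
  assumes q: "(q::real) > 1" and c: "c > 0"
  shows "(\<integral>\<^sup>+u. ennreal ((u / 2) powr (- q)) * indicator {c..} u \<partial>lborel)
    = ennreal (2 / (q - 1) * (c / 2) powr (1 - q))"
proof -
  have "(\<integral>\<^sup>+u. ennreal ((u / 2) powr (- q)) * indicator {c..} u \<partial>lborel)
    = ennreal (0 - (- (2 / (q - 1)) * (c / 2) powr (1 - q)))"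
  proof (rule nn_integral_FTC_atLeast)
    show "((\<lambda>u. - (2 / (q - 1)) * (u / 2) powr (1 - q)) \<longlongrightarrow> 0) at_top"
    proof -
      have "filterlim (\<lambda>u::real. u / 2) at_top at_top" by real_asymp
      then have "((\<lambda>u. (u / 2) powr (1 - q)) \<longlongrightarrow> 0) at_top"
        using q by (intro tendsto_neg_powr) auto
      from tendsto_mult[OF tendsto_const this, of "- (2 / (q - 1))"] show ?thesis by simp
    qed
    fix u assume u: "c \<le> u"
    have "((\<lambda>u. (u / 2) powr (1 - q)) has_real_derivative (1 - q) * (u / 2) powr (1 - q - 1) * (1 / 2)) (at u)"
      using u c by (auto intro!: derivative_eq_intros simp: field_simps)
    note D = DERIV_cmult[OF this, of "- (2 / (q - 1))"]
    have "- (2 / (q - 1)) * ((1 - q) * P * (1 / 2)) = P" for P :: real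
    proof -
      have "- (2 / t) * (- t * P * (1 / 2)) = P" if "t \<noteq> 0" for t :: real
        using that by simp
      from this[of "q - 1"] have "- (2 / (q - 1)) * ((1 - q) * P * (1 / 2)) = P" using q by simp
      then show ?thesis using q by simp
    qed
    from D[unfolded this]
    show "((\<lambda>u. - (2 / (q - 1)) * (u / 2) powr (1 - q)) has_real_derivative (u / 2) powr (- q)) (at u)"
      by simp
  qed auto
  then show ?thesis by simp
qed

text \<open>The volume grows like e^{2r}, hence the threshold 2. Replacing e^r by the smaller cosh
  r, which is half of \<open>hsn\<close>, gives a power of \<open>hsn\<close>; its integral over z
  is elementary, and what is left decays exponentially in s.\<close>

lemma nn_integral_exp_rad:
  assumes q: "(q::real) > 2"
  shows "(\<integral>\<^sup>+x. ennreal (exp (- (q * rad x))) \<partial>haarG) < \<infinity>"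
proof -
  define B where "B = (\<lambda>u::real. ennreal ((u / 2) powr (- q)))"
  have [measurable]: "B \<in> borel_measurable borel" unfolding B_def by measurable
  let ?C = "pi ^ 3 * (2 / (q - 1) * 2 powr (q - 1))"
  have C: "?C \<ge> 0" using q by simp
  have "(\<integral>\<^sup>+x. ennreal (exp (- (q * rad x))) \<partial>haarG) \<le> (\<integral>\<^sup>+x. B (hsn x) * 1 * 1 \<partial>haarG)"
  proof (rule nn_integral_mono)
    fix x assume "x \<in> space haarG"
    then have x: "x \<in> SL2" by simp
    have r: "rad x \<ge> 0" and h: "hsn x / 2 = cosh (rad x)"
      using rad_nonneg[OF x] cosh_rad[OF x] by auto
    have "(exp (rad x)) powr (- q) \<le> (cosh (rad x)) powr (- q)"
      using q r by (intro powr_mono2') (auto simp: cosh_field_def add_pos_pos)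
    then show "ennreal (exp (- (q * rad x))) \<le> B (hsn x) * 1 * 1"
      unfolding B_def h by (simp add: powr_def)
  qed
  also have "\<dots> = (\<integral>\<^sup>+s. 1 * (\<integral>\<^sup>+y. B (exp (- s) + exp s + y * exp (- s)) \<partial>lawY) \<partial>lawT) * (\<integral>\<^sup>+k. 1 \<partial>haarK)"
    by (rule nn_integral_radial) auto
  also have "(\<integral>\<^sup>+k. 1 \<partial>haarK) = 1" using haarK.emeasure_space_1 by simp
  also have "(\<integral>\<^sup>+s. 1 * (\<integral>\<^sup>+y. B (exp (- s) + exp s + y * exp (- s)) \<partial>lawY) \<partial>lawT)
    = (\<integral>\<^sup>+s. ennreal (pi * exp s * (2 / (q - 1) * (cosh s) powr (1 - q))) \<partial>lawT)"
  proof (rule nn_integral_cong)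
    fix s :: real
    let ?c = "exp (- s) + exp s"
    have c: "?c > 0" "?c / 2 = cosh s" by (simp_all add: cosh_field_def add_pos_pos)
    have "(\<integral>\<^sup>+y. B (?c + y * exp (- s)) \<partial>lawY) = ennreal (pi / exp (- s)) * (\<integral>\<^sup>+u. B u * indicator {?c..} u \<partial>lborel)"
      by (rule nn_integral_lawY) auto
    also have "(\<integral>\<^sup>+u. B u * indicator {?c..} u \<partial>lborel) = ennreal (2 / (q - 1) * (cosh s) powr (1 - q))"
      unfolding B_def using nn_integral_powr_tail[of q ?c] q c by simp
    also have "ennreal (pi / exp (- s)) * \<dots> = ennreal (pi * exp s * (2 / (q - 1) * (cosh s) powr (1 - q)))"
      using q by (subst ennreal_mult[symmetric]) (auto simp: exp_minus field_simps)
    finally show "1 * (\<integral>\<^sup>+y. B (?c + y * exp (- s)) \<partial>lawY) = \<dots>" by simp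
  qed
  also have "\<dots> = (\<integral>\<^sup>+s. ennreal (pi\<^sup>2 * exp (- 2 * s)) * ennreal (pi * exp s * (2 / (q - 1) * (cosh s) powr (1 - q))) \<partial>lborel)"
    unfolding lawT_def cosh_field_def[abs_def] by (subst nn_integral_density) auto
  also have "\<dots> \<le> (\<integral>\<^sup>+s. ennreal ?C * ennreal (exp (- ((q - 2) * \<bar>s\<bar>))) \<partial>lborel)"
  proof (rule nn_integral_mono)
    fix s :: real
    have "exp \<bar>s\<bar> / 2 \<le> cosh s" by (cases "s \<ge> 0") (auto simp: cosh_field_def)
    then have "(cosh s) powr (1 - q) \<le> (exp \<bar>s\<bar> / 2) powr (1 - q)"
      using q by (intro powr_mono2') auto
    also have "\<dots> = 2 powr (q - 1) * exp (- ((q - 1) * \<bar>s\<bar>))"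
    proof -
      have "2 powr (1 - q) = inverse (2 powr (q - 1) :: real)" using powr_minus[of 2 "q - 1"] by simp
      moreover have "(exp \<bar>s\<bar>) powr (1 - q) = exp (- ((q - 1) * \<bar>s\<bar>))"
        by (simp add: powr_def algebra_simps)
      moreover have "(exp \<bar>s\<bar> / 2) powr (1 - q) = (exp \<bar>s\<bar>) powr (1 - q) / 2 powr (1 - q)"
        by (rule powr_divide)
      ultimately show ?thesis by (simp only: divide_inverse inverse_inverse_eq mult.commute)
    qed
    finally have le: "(cosh s) powr (1 - q) \<le> 2 powr (q - 1) * exp (- ((q - 1) * \<bar>s\<bar>))" .
    have "exp (- 2 * s) * exp s = exp (- s)" unfolding exp_add[symmetric] by simp
    then have "exp (- 2 * s) * exp s * (cosh s) powr (1 - q) \<le> exp (- s) * (2 powr (q - 1) * exp (- ((q - 1) * \<bar>s\<bar>)))"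
      using mult_left_mono[OF le, of "exp (- s)"] by simp
    also have "\<dots> = 2 powr (q - 1) * exp (- s - (q - 1) * \<bar>s\<bar>)"
      using exp_add[of "- s" "- ((q - 1) * \<bar>s\<bar>)"] by simp
    \<comment> \<open>For negative s the factor e^{-s} uses up one unit of the decay rate q -
      1.\<close>
    also have "\<dots> \<le> 2 powr (q - 1) * exp (- ((q - 2) * \<bar>s\<bar>))"
      by (intro mult_left_mono) (auto simp: algebra_simps abs_if)
    finally have 1: "exp (- 2 * s) * exp s * (cosh s) powr (1 - q) \<le> \<dots>" .
    have "pi\<^sup>2 * exp (- 2 * s) * (pi * exp s * (2 / (q - 1) * (cosh s) powr (1 - q)))
      = pi ^ 3 * (2 / (q - 1)) * (exp (- 2 * s) * exp s * (cosh s) powr (1 - q))"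
      by (simp add: power2_eq_square power3_eq_cube)
    also have "\<dots> \<le> pi ^ 3 * (2 / (q - 1)) * (2 powr (q - 1) * exp (- ((q - 2) * \<bar>s\<bar>)))"
      using q by (intro mult_left_mono[OF 1]) auto
    finally have "pi\<^sup>2 * exp (- 2 * s) * (pi * exp s * (2 / (q - 1) * (cosh s) powr (1 - q)))
      \<le> ?C * exp (- ((q - 2) * \<bar>s\<bar>))" by (simp add: mult.assoc)
    then have "ennreal (pi\<^sup>2 * exp (- 2 * s) * (pi * exp s * (2 / (q - 1) * (cosh s) powr (1 - q))))
      \<le> ennreal (?C * exp (- ((q - 2) * \<bar>s\<bar>)))" by (rule ennreal_leI)
    moreover have "ennreal (pi\<^sup>2 * exp (- 2 * s) * (pi * exp s * (2 / (q - 1) * (cosh s) powr (1 - q))))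
      = ennreal (pi\<^sup>2 * exp (- 2 * s)) * ennreal (pi * exp s * (2 / (q - 1) * (cosh s) powr (1 - q)))"
      using q by (intro ennreal_mult mult_nonneg_nonneg) auto
    moreover have "ennreal (?C * exp (- ((q - 2) * \<bar>s\<bar>))) = ennreal ?C * ennreal (exp (- ((q - 2) * \<bar>s\<bar>)))"
      using C by (intro ennreal_mult) auto
    ultimately show "ennreal (pi\<^sup>2 * exp (- 2 * s)) * ennreal (pi * exp s * (2 / (q - 1) * (cosh s) powr (1 - q)))
      \<le> ennreal ?C * ennreal (exp (- ((q - 2) * \<bar>s\<bar>)))" by (simp only:)
  qed
  also have "\<dots> = ennreal ?C * (\<integral>\<^sup>+s. ennreal (exp (- ((q - 2) * \<bar>s\<bar>))) \<partial>lborel)"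
    by (rule nn_integral_cmult) auto
  also have "\<dots> < \<infinity>"
    using nn_integral_exp_abs[of "q - 2"] q by (simp add: ennreal_mult_less_top)
  finally show ?thesis by (simp add: less_top)
qed

lemma rad_measurable [measurable]: "rad \<in> borel_measurable haarG"
  unfolding rad_def[abs_def] using measurable_compose[OF hsn_measurable arcosh_measurable] by simp

definition fs :: "real \<Rightarrow> coords \<Rightarrow> complex" where
  "fs s x = complex_of_real (Gp s (hsn x))"

lemma Gp_rad:
  assumes "x \<in> SL2" "0 \<le> s"
  shows "Gp s (hsn x) \<le> (1 + 2 * rad x) * exp (- rad x) * exp (s * rad x - (rad x)\<^sup>2 / 2)"
  using Gp_le[of s "hsn x"] hsn_ge_2[OF assms(1)] assms(2) by (simp add: rad_def)

text \<open>Any rate above 2 makes the bound integrable by \<open>nn_integral_exp_rad\<close>. The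
  exponent is at most 2r - r^2/2, and 5r - r^2/2 = 25/2 - (r - 5)^2/2 is below 13.\<close>

lemma Gp_decay:
  assumes x: "x \<in> SL2" and s: "0 \<le> s" "s \<le> 1"
  shows "Gp s (hsn x) \<le> exp 13 * exp (- (3 * rad x))"
proof -
  let ?r = "rad x"
  have r: "?r \<ge> 0" using x by (rule rad_nonneg)
  have "Gp s (hsn x) \<le> (1 + 2 * ?r) * exp (- ?r) * exp (s * ?r - ?r\<^sup>2 / 2)" by (rule Gp_rad[OF x s(1)])
  also have "\<dots> \<le> exp (2 * ?r) * exp (- ?r) * exp (s * ?r - ?r\<^sup>2 / 2)"
    by (intro mult_right_mono exp_ge_add_one_self) auto
  also have "\<dots> = exp (2 * ?r - ?r + (s * ?r - ?r\<^sup>2 / 2))"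
    unfolding exp_add[symmetric] by simp
  also have "\<dots> \<le> exp (13 - 3 * ?r)"
  proof -
    have "s * ?r \<le> ?r" using s r by (simp add: mult_left_le_one_le)
    moreover have "0 \<le> (?r - 5)\<^sup>2 / 2" by simp
    then have "5 * ?r - ?r\<^sup>2 / 2 \<le> 13" by (simp add: power2_eq_square algebra_simps)
    ultimately show ?thesis by simp
  qed
  finally show ?thesis by (simp add: exp_diff exp_minus field_simps)
qed

lemma fs_measurable [measurable]: "fs s \<in> borel_measurable haarG"
  unfolding fs_def[abs_def] by measurable

lemma fs_L1_L2:
  assumes s: "0 \<le> s" "s \<le> 1" shows "fs s \<in> L1_X S0 \<inter> L2_X S0"
proof -
  have fx: "fun_on_X S0 (fs s)"
    unfolding fun_on_X_def by (auto simp: fs_def hsn_mult_right)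
  have fin: "(\<integral>\<^sup>+x. ennreal (c * exp (- (3 * rad x))) \<partial>haarG) < \<infinity>" if "c \<ge> 0" for c
  proof -
    have "(\<integral>\<^sup>+x. ennreal (c * exp (- (3 * rad x))) \<partial>haarG) = (\<integral>\<^sup>+x. ennreal c * ennreal (exp (- (3 * rad x))) \<partial>haarG)"
      using that by (simp add: ennreal_mult)
    also have "\<dots> = ennreal c * (\<integral>\<^sup>+x. ennreal (exp (- (3 * rad x))) \<partial>haarG)"
      by (rule nn_integral_cmult) auto
    also have "\<dots> < \<infinity>" using nn_integral_exp_rad[of 3] by (simp add: ennreal_mult_less_top)
    finally show ?thesis .
  qed
  have b: "cmod (fs s x) \<le> exp 13 * exp (- (3 * rad x))" if "x \<in> SL2" for x
    using Gp_decay[OF that s] Gp_nonneg[OF s, of "hsn x"] by (simp add: fs_def)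
  have "integrable haarG (fs s)"
  proof (rule integrableI_bounded)
    have "(\<integral>\<^sup>+x. ennreal (cmod (fs s x)) \<partial>haarG) \<le> (\<integral>\<^sup>+x. ennreal (exp 13 * exp (- (3 * rad x))) \<partial>haarG)"
      by (intro nn_integral_mono ennreal_leI b) simp
    also have "\<dots> < \<infinity>" by (rule fin) simp
    finally show "(\<integral>\<^sup>+x. ennreal (cmod (fs s x)) \<partial>haarG) < \<infinity>" .
  qed simp
  moreover have "integrable haarG (\<lambda>x. (cmod (fs s x))\<^sup>2)"
  proof (rule integrableI_bounded)
    have "(\<integral>\<^sup>+x. ennreal (norm ((cmod (fs s x))\<^sup>2)) \<partial>haarG) \<le> (\<integral>\<^sup>+x. ennreal (exp 13 ^ 2 * exp (- (3 * rad x))) \<partial>haarG)"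
    proof (intro nn_integral_mono ennreal_leI)
      fix x assume "x \<in> space haarG"
      then have x: "x \<in> SL2" by simp
      have "(cmod (fs s x))\<^sup>2 \<le> (exp 13 * exp (- (3 * rad x)))\<^sup>2"
        by (intro power_mono b x) simp
      also have "\<dots> = exp 13 ^ 2 * (exp (- (3 * rad x)) * exp (- (3 * rad x)))"
        by (simp add: power2_eq_square)
      also have "\<dots> \<le> exp 13 ^ 2 * (exp (- (3 * rad x)) * 1)"
        using rad_nonneg[OF x] by (intro mult_left_mono) auto
      finally show "norm ((cmod (fs s x))\<^sup>2) \<le> exp 13 ^ 2 * exp (- (3 * rad x))" by simp
    qed
    also have "\<dots> < \<infinity>" by (rule fin) simp
    finally show "(\<integral>\<^sup>+x. ennreal (norm ((cmod (fs s x))\<^sup>2)) \<partial>haarG) < \<infinity>" .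
  qed simp
  ultimately show ?thesis using fx by (simp add: L1_X_def L2_X_def)
qed

lemma fs_integrable: "0 \<le> s \<Longrightarrow> s \<le> 1 \<Longrightarrow> integrable haarG (fs s)"
  using fs_L1_L2[of s] by (simp add: L1_X_def)

subsection \<open>The operator Fourier transform\<close>

text \<open>The substitution y = x^{-1}k preserves \<open>haarG\<close>, by left invariance and
  unimodularity, and does not change \<open>hsn\<close>. It turns A(x,k) and the K-part of x^{-1}k
  into \<open>AA y\<close> and \<open>kap y\<close>, the situation of \<open>fourier_master\<close>.
  The operator is thus a scalar times the projection to the constants.\<close>

lemma fourier_fs:
  assumes s: "0 \<le> s" "s \<le> 1" and g: "integrable haarK g" and k: "k \<in> SU2"
  shows "integrable haarG (\<lambda>x. fs s x * principal_series S0 (- l) x g k)"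
    "fourier S0 (fs s) l g k = of_real (hhat s l) * (LINT m|haarK. g m)"
proof -
  define \<Psi> where "\<Psi> = (\<lambda>y. of_real (Gp s (hsn y)) * (exp ((1 - \<i> * of_real l) * of_real (AA y)) * g (kap y)))"
  have int: "(LINT y|haarG. \<Psi> y) = of_real (hhat s l) * (LINT m|haarK. g m)"
    and i\<Psi>: "integrable haarG \<Psi>"
    using fourier_master[OF s g, of l] by (auto simp: \<Psi>_def)
  have m\<Psi> [measurable]: "\<Psi> \<in> borel_measurable haarG" using i\<Psi> by simp
  have kG: "madj k \<in> SL2" using k SU2_subset madj_in_SU2 by blast
  have [measurable]: "madj \<in> measurable haarG haarG"
    using measurable_haar_group(2)[OF measurable_ident_sets[OF refl]] by simp
  have mk: "mmult (madj k) \<in> measurable haarG haarG"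
    using kG by (intro measurable_haar_group(1)[of "\<lambda>_. madj k" _ "\<lambda>x. x"]) auto
  have eq: "fs s x * principal_series S0 (- l) x g k = \<Psi> (madj (mmult (madj k) x))" if x: "x \<in> SL2" for x
  proof -
    have kk: "k \<in> SL2" using k SU2_subset by blast
    have mm: "madj (madj k) = k" using kk by (simp add: madj_def mk_eta SL2_def)
    have e: "madj (mmult (madj k) x) = mmult (madj x) k" by (simp add: madj_mmult mm)
    show ?thesis
      unfolding e \<Psi>_def principal_series_def S0_sel rho_S0 Afun_S0[OF x k] inv_S0[OF x]
      using iwasawa_K_S0[OF mmult_in_SL2[OF madj_in_SL2[OF x] kk]]
      by (simp add: fs_def kap_def hsn_mult_right[OF k] hsn_madj add.commute)
  qed
  have i1: "integrable haarG (\<lambda>x. \<Psi> (madj x))"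
    by (rule integrable_distr[of madj haarG haarG]) (simp_all add: distr_haarG_madj i\<Psi>)
  have "integrable haarG (\<lambda>x. \<Psi> (madj (mmult (madj k) x)))"
    by (rule integrable_distr[OF mk]) (simp add: distr_haarG_left[OF kG] i1)
  then show "integrable haarG (\<lambda>x. fs s x * principal_series S0 (- l) x g k)"
    by (subst Bochner_Integration.integrable_cong[OF refl, of _ _ "\<lambda>x. \<Psi> (madj (mmult (madj k) x))"]) (auto simp: eq)
  have "fourier S0 (fs s) l g k = (LINT x|haarG. \<Psi> (madj (mmult (madj k) x)))"
    unfolding fourier_def S0_sel by (intro Bochner_Integration.integral_cong) (auto simp: eq)
  also have "\<dots> = (LINT x|distr haarG haarG (mmult (madj k)). \<Psi> (madj x))"
    using i1 mk by (intro integral_distr[symmetric]) auto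
  also have "\<dots> = (LINT x|distr haarG haarG madj. \<Psi> x)"
    unfolding distr_haarG_left[OF kG] by (rule integral_distr[symmetric]) measurable
  finally show "fourier S0 (fs s) l g k = of_real (hhat s l) * (LINT m|haarK. g m)"
    unfolding distr_haarG_madj int .
qed

section \<open>Hilbert-Schmidt norm of the Fourier transform\<close>

lemma L2_KM_integrable:
  assumes "g \<in> L2_KM S0" shows "integrable haarK g"
proof (rule Bochner_Integration.integrable_bound)
  show "integrable haarK (\<lambda>k. 1 + (cmod (g k))\<^sup>2)"
    using assms by (auto simp: L2_KM_def)
  show "AE k in haarK. norm (g k) \<le> norm (1 + (cmod (g k))\<^sup>2)"
  proof (rule AE_I2)
    fix k
    have "0 \<le> (cmod (g k) - 1)\<^sup>2" by simp
    then have "2 * cmod (g k) \<le> 1 + (cmod (g k))\<^sup>2"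
      unfolding power2_diff by simp
    then have "cmod (g k) \<le> 1 + (cmod (g k))\<^sup>2"
      using norm_ge_zero[of "g k"] by linarith
    then show "norm (g k) \<le> norm (1 + (cmod (g k))\<^sup>2)" by simp
  qed
qed (use assms in \<open>simp add: L2_KM_def\<close>)

lemma L2_KM_integrable_mult:
  assumes "g \<in> L2_KM S0" "h \<in> L2_KM S0" shows "integrable haarK (\<lambda>k. g k * cnj (h k))"
proof (rule Bochner_Integration.integrable_bound)
  show "integrable haarK (\<lambda>k. (cmod (g k))\<^sup>2 + (cmod (h k))\<^sup>2)"
    using assms by (auto simp: L2_KM_def)
  show "AE k in haarK. norm (g k * cnj (h k)) \<le> norm ((cmod (g k))\<^sup>2 + (cmod (h k))\<^sup>2)"
  proof (rule AE_I2)
    fix k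
    have "0 \<le> (cmod (g k) - cmod (h k))\<^sup>2" by simp
    moreover have "0 \<le> cmod (g k) * cmod (h k)" by simp
    ultimately have "cmod (g k) * cmod (h k) \<le> (cmod (g k))\<^sup>2 + (cmod (h k))\<^sup>2"
      unfolding power2_diff by linarith
    then show "norm (g k * cnj (h k)) \<le> norm ((cmod (g k))\<^sup>2 + (cmod (h k))\<^sup>2)"
      by (simp add: norm_mult)
  qed
  have "g \<in> borel_measurable haarK" "h \<in> borel_measurable haarK"
    using assms by (auto simp: L2_KM_def)
  then show "(\<lambda>k. g k * cnj (h k)) \<in> borel_measurable haarK"
    by (intro borel_measurable_times measurable_compose[of h haarK borel cnj] borel_measurable_continuous_onI)
      (auto intro: continuous_intros)
qed

text \<open>Bessel's inequality for the constant function 1, which has norm one: \<open>v\<close> is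
  its projection to the span of the family, and the integral of |1 - v|^2 is one minus the
  sum.\<close>

lemma bessel_constant:
  assumes e: "orthonormal_family S0 n e"
  shows "(\<Sum>i<n. (cmod (LINT k|haarK. e i k))\<^sup>2) \<le> 1"
proof -
  define c where "c i = (LINT k|haarK. e i k)" for i
  define v where "v k = (\<Sum>i<n. cnj (c i) * e i k)" for k
  have L2: "e i \<in> L2_KM S0" if "i < n" for i using e that by (simp add: orthonormal_family_def)
  have on: "(LINT k|haarK. e i k * cnj (e j k)) = (if i = j then 1 else 0)" if "i < n" "j < n" for i j
    using e that by (simp add: orthonormal_family_def)
  have i1: "integrable haarK (e i)" if "i < n" for i by (rule L2_KM_integrable[OF L2[OF that]])
  have i2: "integrable haarK (\<lambda>k. e i k * cnj (e j k))" if "i < n" "j < n" for i j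
    by (rule L2_KM_integrable_mult[OF L2[OF that(1)] L2[OF that(2)]])
  let ?N = "\<Sum>i<n. (cmod (c i))\<^sup>2"
  have N: "(\<Sum>i<n. cnj (c i) * c i) = of_real ?N"
    by (simp only: of_real_sum complex_norm_square mult.commute)
  have iv: "integrable haarK v"
    unfolding v_def[abs_def] using i1 by (intro Bochner_Integration.integrable_sum integrable_mult_right) auto
  have Iv: "(LINT k|haarK. v k) = of_real ?N"
  proof -
    have "(LINT k|haarK. v k) = (\<Sum>i<n. cnj (c i) * c i)"
      unfolding v_def c_def using i1 by (subst Bochner_Integration.integral_sum) auto
    then show ?thesis unfolding N .
  qed
  have vv: "v k * cnj (v k) = (\<Sum>i<n. \<Sum>j<n. (cnj (c i) * c j) * (e i k * cnj (e j k)))" for k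
    unfolding v_def cnj_sum sum_product by (intro sum.cong refl) (simp add: mult_ac)
  have ivv: "integrable haarK (\<lambda>k. v k * cnj (v k))"
    unfolding vv using i2 by (intro Bochner_Integration.integrable_sum integrable_mult_right) auto
  have Ivv: "(LINT k|haarK. v k * cnj (v k)) = of_real ?N"
  proof -
    have "(LINT k|haarK. v k * cnj (v k)) = (\<Sum>i<n. LINT k|haarK. (\<Sum>j<n. (cnj (c i) * c j) * (e i k * cnj (e j k))))"
      unfolding vv using i2
      by (intro Bochner_Integration.integral_sum Bochner_Integration.integrable_sum integrable_mult_right) auto
    also have "\<dots> = (\<Sum>i<n. \<Sum>j<n. LINT k|haarK. (cnj (c i) * c j) * (e i k * cnj (e j k)))"
      using i2 by (intro sum.cong refl Bochner_Integration.integral_sum integrable_mult_right) auto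
    also have "\<dots> = (\<Sum>i<n. \<Sum>j<n. (cnj (c i) * c j) * (if i = j then 1 else 0))"
      by (intro sum.cong refl) (simp add: on)
    also have "\<dots> = (\<Sum>i<n. cnj (c i) * c i)"
      by (simp add: if_distrib cong: if_cong)
    finally show ?thesis unfolding N .
  qed
  have d: "complex_of_real ((cmod (1 - v k))\<^sup>2) = 1 - v k - cnj (v k) + v k * cnj (v k)" for k
    unfolding complex_norm_square by (simp add: algebra_simps)
  have "complex_of_real (LINT k|haarK. (cmod (1 - v k))\<^sup>2) = (LINT k|haarK. 1 - v k - cnj (v k) + v k * cnj (v k))"
    unfolding integral_complex_of_real[symmetric] d ..
  also have "\<dots> = 1 - (LINT k|haarK. v k) - cnj (LINT k|haarK. v k) + (LINT k|haarK. v k * cnj (v k))"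
    using iv ivv haarK.prob_space by simp
  also have "\<dots> = complex_of_real (1 - ?N)"
    unfolding Iv Ivv complex_cnj_complex_of_real by simp
  finally have "(LINT k|haarK. (cmod (1 - v k))\<^sup>2) = 1 - ?N"
    unfolding of_real_eq_iff .
  moreover have "(LINT k|haarK. (cmod (1 - v k))\<^sup>2) \<ge> 0" by simp
  ultimately show ?thesis by (simp add: c_def)
qed

text \<open>The transform maps \<open>e i\<close> to the constant \<open>hhat s l\<close> times the
  mean of \<open>e i\<close>; by Bessel's inequality the squared means sum up to at most
  one.\<close>

lemma HS_norm_fs:
  assumes s: "0 \<le> s" "s \<le> 1"
  shows "HS_norm S0 (fourier S0 (fs s) l) \<le> ennreal \<bar>hhat s l\<bar>"
  unfolding HS_norm_def
proof (rule Inf_lower, rule CollectI, intro allI impI)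
  fix n e assume e: "orthonormal_family S0 n e"
  define c where "c i = (LINT k|haarK. e i k)" for i
  have 1: "(\<Sum>i<n. \<integral>\<^sup>+k. ennreal ((cmod (fourier S0 (fs s) l (e i) k))\<^sup>2) \<partial>dk S0)
    = (\<Sum>i<n. ennreal ((hhat s l)\<^sup>2 * (cmod (c i))\<^sup>2))"
  proof (rule sum.cong[OF refl])
    fix i assume "i \<in> {..<n}"
    then have g: "integrable haarK (e i)"
      using e by (auto intro: L2_KM_integrable simp: orthonormal_family_def)
    have "(\<integral>\<^sup>+k. ennreal ((cmod (fourier S0 (fs s) l (e i) k))\<^sup>2) \<partial>haarK)
      = (\<integral>\<^sup>+k. ennreal ((hhat s l)\<^sup>2 * (cmod (c i))\<^sup>2) \<partial>haarK)"
      by (intro nn_integral_cong) (simp add: fourier_fs(2)[OF s g] norm_mult power_mult_distrib c_def)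
    also have "\<dots> = ennreal ((hhat s l)\<^sup>2 * (cmod (c i))\<^sup>2)"
      using haarK.emeasure_space_1 by simp
    finally show "(\<integral>\<^sup>+k. ennreal ((cmod (fourier S0 (fs s) l (e i) k))\<^sup>2) \<partial>dk S0)
      = ennreal ((hhat s l)\<^sup>2 * (cmod (c i))\<^sup>2)" by simp
  qed
  have 2: "(\<Sum>i<n. ennreal ((hhat s l)\<^sup>2 * (cmod (c i))\<^sup>2)) = ennreal ((hhat s l)\<^sup>2 * (\<Sum>i<n. (cmod (c i))\<^sup>2))"
    unfolding sum_distrib_left by (rule sum_ennreal) simp
  have 3: "(hhat s l)\<^sup>2 * (\<Sum>i<n. (cmod (c i))\<^sup>2) \<le> (hhat s l)\<^sup>2 * 1"
    using bessel_constant[OF e] unfolding c_def by (rule mult_left_mono) simp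
  have 4: "(ennreal \<bar>hhat s l\<bar>)\<^sup>2 = ennreal ((hhat s l)\<^sup>2 * 1)"
    using ennreal_power[of "\<bar>hhat s l\<bar>" 2] by simp
  show "(\<Sum>i<n. \<integral>\<^sup>+k. ennreal ((cmod (fourier S0 (fs s) l (e i) k))\<^sup>2) \<partial>dk S0) \<le> (ennreal \<bar>hhat s l\<bar>)\<^sup>2"
    unfolding 1 2 4 by (rule ennreal_leI[OF 3])
qed

subsection \<open>The Beurling integral\<close>

text \<open>Half of the Gaussian absorbs the polynomial; the other half is compared with e^{-|y|} by
  completing the square (\<kappa>|y| - 2)^2.\<close>

lemma exp_quadratic_decay:
  fixes \<kappa> y :: real
  assumes \<kappa>: "\<kappa> > 0"
  shows "(1 + y\<^sup>2) * exp (- (\<kappa> * y\<^sup>2 / 2)) \<le> (1 + 4 / \<kappa>) * exp (1 / \<kappa>) * exp (- \<bar>y\<bar>)"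
proof -
  define w where "w = \<kappa> * y\<^sup>2 / 4"
  have w: "w \<ge> 0" using \<kappa> by (simp add: w_def)
  have "1 + y\<^sup>2 = 1 + (4 / \<kappa>) * w" using \<kappa> by (simp add: w_def)
  also have "\<dots> \<le> (1 + 4 / \<kappa>) * (1 + w)"
  proof -
    have "1 + b * w \<le> (1 + b) * (1 + w)" if "b \<ge> 0" for b using that w by (simp add: algebra_simps)
    from this[of "4 / \<kappa>"] show ?thesis using \<kappa> by simp
  qed
  also have "\<dots> \<le> (1 + 4 / \<kappa>) * exp w" using \<kappa> exp_ge_add_one_self[of w] by (intro mult_left_mono) auto
  finally have "(1 + y\<^sup>2) * exp (- (2 * w)) \<le> (1 + 4 / \<kappa>) * exp w * exp (- (2 * w))"
    by (rule mult_right_mono) simp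
  also have "\<dots> = (1 + 4 / \<kappa>) * exp (- w)" by (simp add: exp_add[symmetric])
  also have "\<dots> \<le> (1 + 4 / \<kappa>) * exp (1 / \<kappa> + - \<bar>y\<bar>)"
  proof -
    have "0 \<le> (\<kappa> * \<bar>y\<bar> - 2)\<^sup>2 / (4 * \<kappa>)" using \<kappa> by simp
    also have "\<dots> = w - \<bar>y\<bar> + 1 / \<kappa>"
      using \<kappa> by (simp add: w_def power2_eq_square field_simps)
    finally show ?thesis using \<kappa> by (intro mult_left_mono) auto
  qed
  finally show ?thesis unfolding exp_add by (simp add: w_def mult.assoc)
qed

lemma affine_powr_le_exp:
  fixes a \<eta> :: real
  assumes a: "a > 0" and \<eta>: "\<eta> > 0"
  obtains C where "C > 0" "\<And>r. r \<ge> 0 \<Longrightarrow> (1 + 2 * r) powr a \<le> C * exp (\<eta> * r)"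
proof
  \<comment> \<open>Chosen so that the a-th power of e^{\<delta> r} is e^{\<eta> r}.\<close>
  define \<delta> where "\<delta> = \<eta> / a"
  have \<delta>: "\<delta> > 0" using a \<eta> by (simp add: \<delta>_def)
  have p: "1 + 2 / \<delta> > 0" using \<delta> by (simp add: add_pos_pos)
  then show "(1 + 2 / \<delta>) powr a > 0" by simp
  fix r :: real assume r: "r \<ge> 0"
  have "1 + 2 * r \<le> (1 + 2 / \<delta>) * (1 + \<delta> * r)" using \<delta> r by (simp add: field_simps)
  also have "\<dots> \<le> (1 + 2 / \<delta>) * exp (\<delta> * r)" using p by (intro mult_left_mono exp_ge_add_one_self) auto
  finally have "(1 + 2 * r) powr a \<le> ((1 + 2 / \<delta>) * exp (\<delta> * r)) powr a"
    using a r by (intro powr_mono2) auto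
  also have "\<dots> = (1 + 2 / \<delta>) powr a * exp (\<delta> * r) powr a"
    by (rule powr_mult)
  also have "exp (\<delta> * r) powr a = exp (\<eta> * r)" using a by (simp add: powr_def \<delta>_def)
  finally show "(1 + 2 * r) powr a \<le> (1 + 2 / \<delta>) powr a * exp (\<eta> * r)" .
qed

text \<open>Upper bound of the integrand at radius r and |\<lambda>| = m, up to a constant: the
  Plancherel density, the Gaussian of the transform, and the bounds for f_s, \<Xi> and the
  exponential. As f_s contributes one factor (1 + 2r) e^{-r} and \<Xi> its power 1 - \<epsilon>, the
  exponent \<open>a\<close> will be 2 - \<epsilon>.\<close>

definition weight :: "real \<Rightarrow> real \<Rightarrow> real \<Rightarrow> real \<Rightarrow> real \<Rightarrow> real" where
  "weight c a s r m = m\<^sup>2 * exp (- m\<^sup>2 / 2) * (((1 + 2 * r) * exp (- r)) powr a * exp (s * r - r\<^sup>2 / 2) * exp (c * r * m))"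

text \<open>Completes the square: -m^2/2 - r^2/2 + crm is the sum of -(1-c)m^2/2, -(1-c)r^2/2 and
  -c(m-r)^2/2.\<close>

lemma weight_eq:
  assumes "r \<ge> 0"
  shows "weight c a s r m = (m\<^sup>2 * exp (- ((1 - c) * m\<^sup>2 / 2))) * exp (- ((1 - c) * r\<^sup>2 / 2)) *
    exp (- (c * (m - r)\<^sup>2 / 2)) * ((1 + 2 * r) powr a * exp ((s - a) * r))"
proof -
  have 1: "((1 + 2 * r) * exp (- r)) powr a = (1 + 2 * r) powr a * exp (- (a * r))"
    using assms by (simp add: powr_mult) (simp add: powr_def)
  have 2: "exp (- m\<^sup>2 / 2) * (exp (- (a * r)) * (exp (s * r - r\<^sup>2 / 2) * exp (c * r * m)))
    = exp (- ((1 - c) * m\<^sup>2 / 2)) * (exp (- ((1 - c) * r\<^sup>2 / 2)) * (exp (- (c * (m - r)\<^sup>2 / 2)) * exp ((s - a) * r)))"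
    unfolding exp_add[symmetric]
    by (rule arg_cong[of _ _ exp]) (simp add: power2_eq_square field_simps)
  have "weight c a s r m = m\<^sup>2 * (1 + 2 * r) powr a *
    (exp (- m\<^sup>2 / 2) * (exp (- (a * r)) * (exp (s * r - r\<^sup>2 / 2) * exp (c * r * m))))"
    unfolding weight_def 1 by (simp only: mult_ac)
  then show ?thesis unfolding 2 by (simp only: mult_ac)
qed

text \<open>The weight increases with c, so c = 1 is the worst case, where only the Gaussian in m -
  r is left. The factor m^2 is distributed over (1 + 2r)^2, which raises the exponent to a + 2, and
  1 + (m - r)^2, which the Gaussian absorbs.\<close>

lemma weight_bound_critical:
  assumes a: "a > 2" and s: "s \<le> (a - 2) / 2" and c: "0 \<le> c" "c \<le> 1"
  obtains C q where "q > 2" "C \<ge> 0"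
    "\<And>r m. r \<ge> 0 \<Longrightarrow> m \<ge> 0 \<Longrightarrow> weight c a s r m \<le> C * exp (- (q * r)) * exp (- \<bar>m - r\<bar>)"
proof -
  \<comment> \<open>The bound on s gives a - s >= (a + 2)/2 = 2 + 2\<eta>. One \<eta> pays for the
    power of 1 + 2r; the remaining rate 2 + \<eta> still exceeds the volume growth.\<close>
  define \<eta> where "\<eta> = (a - 2) / 4"
  have \<eta>: "\<eta> > 0" using a by (simp add: \<eta>_def)
  obtain C where C: "C > 0" "\<And>r. r \<ge> 0 \<Longrightarrow> (1 + 2 * r) powr (a + 2) \<le> C * exp (\<eta> * r)"
    using affine_powr_le_exp[of "a + 2" \<eta>] a \<eta> by auto
  define D where "D = (1 + 4 / (1::real)) * exp (1 / 1)"
  show ?thesis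
  proof (rule that[of "2 + \<eta>" "2 * C * D"])
    fix r m :: real assume r: "r \<ge> 0" and m: "m \<ge> 0"
    have mono: "weight c a s r m \<le> weight 1 a s r m"
      unfolding weight_def using c r m mult_left_le_one_le[of r c] by (intro mult_left_mono) (auto intro!: mult_right_mono mult_nonneg_nonneg)
    have "m\<^sup>2 \<le> 2 * (r\<^sup>2 + (m - r)\<^sup>2)"
    proof -
      have "0 \<le> (m - 2 * r)\<^sup>2" by simp
      then show ?thesis by (simp add: power2_eq_square algebra_simps)
    qed
    also have "\<dots> \<le> 2 * ((1 + 2 * r)\<^sup>2 * (1 + (m - r)\<^sup>2))"
    proof -
      have "r\<^sup>2 + u \<le> (1 + r\<^sup>2) * (1 + u)" if "u \<ge> 0" for u
        using that by (simp add: algebra_simps)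
      then have "r\<^sup>2 + (m - r)\<^sup>2 \<le> (1 + r\<^sup>2) * (1 + (m - r)\<^sup>2)" by simp
      also have "\<dots> \<le> (1 + 2 * r)\<^sup>2 * (1 + (m - r)\<^sup>2)"
      proof (rule mult_right_mono)
        show "1 + r\<^sup>2 \<le> (1 + 2 * r)\<^sup>2" using r by (simp add: power2_eq_square algebra_simps)
      qed simp
      finally show ?thesis by simp
    qed
    finally have 1: "m\<^sup>2 \<le> 2 * ((1 + 2 * r)\<^sup>2 * (1 + (m - r)\<^sup>2))" .
    have "weight 1 a s r m = m\<^sup>2 * (exp (- (1 * (m - r)\<^sup>2 / 2)) * ((1 + 2 * r) powr a * exp ((s - a) * r)))"
      using weight_eq[OF r, of 1 a s m] by simp
    also have "\<dots> \<le> 2 * ((1 + 2 * r)\<^sup>2 * (1 + (m - r)\<^sup>2)) * (exp (- (1 * (m - r)\<^sup>2 / 2)) * ((1 + 2 * r) powr a * exp ((s - a) * r)))"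
      by (intro mult_right_mono 1) auto
    also have "\<dots> = 2 * ((1 + (m - r)\<^sup>2) * exp (- (1 * (m - r)\<^sup>2 / 2))) * ((1 + 2 * r) powr (a + 2) * exp ((s - a) * r))"
      using r by (simp add: powr_add powr_numeral mult_ac)
    also have "\<dots> \<le> 2 * (D * exp (- \<bar>m - r\<bar>)) * (C * exp (\<eta> * r) * exp ((s - a) * r))"
      unfolding D_def
      by (intro mult_mono mult_nonneg_nonneg exp_quadratic_decay C r mult_left_mono) (auto intro: less_imp_le[OF C(1)])
    also have "C * exp (\<eta> * r) * exp ((s - a) * r) \<le> C * exp (- ((2 + \<eta>) * r))"
    proof -
      have "(\<eta> + (s - a)) * r \<le> - (2 + \<eta>) * r"
        using s r by (intro mult_right_mono) (auto simp: \<eta>_def field_simps)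
      then have "\<eta> * r + (s - a) * r \<le> - ((2 + \<eta>) * r)" by (simp add: algebra_simps)
      then show ?thesis using C(1) by (simp add: mult.assoc exp_add[symmetric])
    qed
    finally show "weight c a s r m \<le> 2 * C * D * exp (- ((2 + \<eta>) * r)) * exp (- \<bar>m - r\<bar>)"
      using mono by (simp add: D_def mult_left_mono mult_ac)
  qed (use \<eta> C in \<open>auto simp: D_def\<close>)
qed

text \<open>Gaussians of parameter 1 - c are left over in both variables. The one in m absorbs m^2
  and yields e^{-m}; the one in r provides any exponential rate, so s <= 1 and a >= 2 are
  enough.\<close>

lemma weight_bound_subcritical:
  assumes a: "a \<ge> 2" and s: "s \<le> 1" and c: "0 \<le> c" "c < 1"
  obtains C q where "q > 2" "C \<ge> 0"
    "\<And>r m. r \<ge> 0 \<Longrightarrow> m \<ge> 0 \<Longrightarrow> weight c a s r m \<le> C * exp (- (q * r)) * exp (- \<bar>m - r\<bar>)"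
proof -
  define \<kappa> where "\<kappa> = 1 - c"
  have \<kappa>: "\<kappa> > 0" using c by (simp add: \<kappa>_def)
  obtain C where C: "C > 0" "\<And>r. r \<ge> 0 \<Longrightarrow> (1 + 2 * r) powr a \<le> C * exp (1 * r)"
    using affine_powr_le_exp[of a 1] a by auto
  define D where "D = (1 + 4 / \<kappa>) * exp (1 / \<kappa>)"
  have D: "D > 0" using \<kappa> by (simp add: D_def add_pos_pos)
  \<comment> \<open>From (\<kappa> r - 4)^2 >= 0: the Gaussian in r is at most \<open>E\<close>
    e^{-4r}. Three units of this rate are the decay in r, the fourth turns e^{-m} into e^{-|m -
    r|}.\<close>
  define E where "E = exp (16 / (2 * \<kappa>))"
  show ?thesis
  proof (rule that[of 3 "D * C * E"])
    fix r m :: real assume r: "r \<ge> 0" and m: "m \<ge> 0"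
    have "weight c a s r m = (m\<^sup>2 * exp (- (\<kappa> * m\<^sup>2 / 2))) * exp (- (\<kappa> * r\<^sup>2 / 2)) *
      exp (- (c * (m - r)\<^sup>2 / 2)) * ((1 + 2 * r) powr a * exp ((s - a) * r))"
      unfolding \<kappa>_def by (rule weight_eq[OF r])
    also have "\<dots> \<le> (D * exp (- \<bar>m\<bar>)) * exp (- (\<kappa> * r\<^sup>2 / 2)) * 1 * (C * exp (1 * r) * exp (- r))"
    proof -
      have "m\<^sup>2 * exp (- (\<kappa> * m\<^sup>2 / 2)) \<le> (1 + m\<^sup>2) * exp (- (\<kappa> * m\<^sup>2 / 2))"
        by (intro mult_right_mono) auto
      also have "\<dots> \<le> D * exp (- \<bar>m\<bar>)" unfolding D_def by (rule exp_quadratic_decay[OF \<kappa>])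
      finally have 1: "m\<^sup>2 * exp (- (\<kappa> * m\<^sup>2 / 2)) \<le> D * exp (- \<bar>m\<bar>)" .
      have 2: "exp (- (c * (m - r)\<^sup>2 / 2)) \<le> 1" using c by simp
      have "(s - a) * r \<le> - 1 * r" using s a r by (intro mult_right_mono) auto
      then have 3: "exp ((s - a) * r) \<le> exp (- r)" by simp
      have 4: "(1 + 2 * r) powr a * exp ((s - a) * r) \<le> C * exp (1 * r) * exp (- r)"
        using C(1) by (intro mult_mono C(2)[OF r] 3) auto
      show ?thesis
        by (rule mult_mono[OF mult_mono[OF mult_right_mono[OF 1] 2] 4]) (use D C in auto)
    qed
    also have "\<dots> = D * C * (exp (- \<bar>m\<bar>) * exp (- (\<kappa> * r\<^sup>2 / 2)))"
      by (simp add: exp_minus field_simps)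
    also have "\<dots> \<le> D * C * (E * (exp (- (3 * r)) * exp (- \<bar>m - r\<bar>)))"
    proof (intro mult_left_mono)
      have "0 \<le> (\<kappa> * r - 4)\<^sup>2 / (2 * \<kappa>)" using \<kappa> by simp
      also have "\<dots> = \<kappa> * r\<^sup>2 / 2 - 4 * r + 16 / (2 * \<kappa>)"
        using \<kappa> by (simp add: power2_eq_square field_simps)
      finally have "- \<bar>m\<bar> + - (\<kappa> * r\<^sup>2 / 2) \<le> 16 / (2 * \<kappa>) + (- (3 * r) + - \<bar>m - r\<bar>)"
        using r m by simp
      then show "exp (- \<bar>m\<bar>) * exp (- (\<kappa> * r\<^sup>2 / 2)) \<le> E * (exp (- (3 * r)) * exp (- \<bar>m - r\<bar>))"
        unfolding E_def exp_add[symmetric] exp_le_cancel_iff .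
    qed (use C D in auto)
    finally show "weight c a s r m \<le> D * C * E * exp (- (3 * r)) * exp (- \<bar>m - r\<bar>)"
      by (simp only: mult.assoc)
  qed (use C D in \<open>auto simp: E_def\<close>)
qed

lemma beurling_integral_fs:
  fixes c \<epsilon> s :: real
  assumes s: "0 \<le> s" "s \<le> 1" and e: "\<epsilon> \<le> 0" and q: "q > 2" and C: "C \<ge> 0"
    and W: "\<And>r m. r \<ge> 0 \<Longrightarrow> m \<ge> 0 \<Longrightarrow>
      weight (max c 0) (2 - \<epsilon>) s r m \<le> C * exp (- (q * r)) * exp (- \<bar>m - r\<bar>)"
  shows "beurling_integral S0 c \<epsilon> 0 (fs s) < \<infinity>"
proof -
  define H where "H = 2 * pi ^ 3 * sqrt (2 * pi)"
  have H: "H \<ge> 0" by (simp add: H_def)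
  have hh: "\<bar>hhat s l\<bar> \<le> H * exp (- l\<^sup>2 / 2)" for l
  proof -
    have "\<bar>hhat s l\<bar> = H * exp (- l\<^sup>2 / 2) * \<bar>cos (s * l)\<bar>"
      using H by (simp add: hhat_def H_def abs_mult)
    also have "\<dots> \<le> H * exp (- l\<^sup>2 / 2) * 1" using H by (intro mult_left_mono) auto
    finally show ?thesis by simp
  qed
  define E1 where "E1 = (\<integral>\<^sup>+l. ennreal (exp (- (1 * \<bar>l\<bar>))) \<partial>lborel)"
  have E1: "E1 < \<infinity>" unfolding E1_def by (rule nn_integral_exp_abs) simp
  let ?F = "\<lambda>x l. cmod (fs s x) * exp (c * sigma S0 x * \<bar>l\<bar>) * Xi S0 x powr (1 - \<epsilon>) / (1 + sigma S0 x + \<bar>l\<bar>) ^ 0"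
  let ?B = "\<lambda>x. ennreal (H * C * exp (- (q * rad x)))"
  have inner: "(\<integral>\<^sup>+l. HS_norm S0 (fourier S0 (fs s) l) * ennreal (?F x l) \<partial>plancherel S0) \<le> ?B x * (2 * E1)"
    if x: "x \<in> SL2" for x
  proof -
    let ?r = "rad x"
    have r: "?r \<ge> 0" by (rule rad_nonneg[OF x])
    have F: "l\<^sup>2 * exp (- l\<^sup>2 / 2) * ?F x l \<le> C * exp (- (q * ?r)) * exp (- \<bar>\<bar>l\<bar> - ?r\<bar>)" for l
    proof -
      have b: "0 \<le> (1 + 2 * ?r) * exp (- ?r)" using r by simp
      have 1: "cmod (fs s x) \<le> (1 + 2 * ?r) * exp (- ?r) * exp (s * ?r - ?r\<^sup>2 / 2)"
        using Gp_rad[OF x s(1)] Gp_nonneg[OF s, of "hsn x"] by (simp add: fs_def)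
      \<comment> \<open>The distance is only bounded from above by r, so c is replaced by its
        positive part before the bound is used.\<close>
      have "c * sigma S0 x * \<bar>l\<bar> \<le> max c 0 * ?r * \<bar>l\<bar>"
        using sigma_bounds[OF x] r by (intro mult_right_mono mult_mono) auto
      then have 2: "exp (c * sigma S0 x * \<bar>l\<bar>) \<le> exp (max c 0 * ?r * \<bar>l\<bar>)" by simp
      have 3: "Xi S0 x powr (1 - \<epsilon>) \<le> ((1 + 2 * ?r) * exp (- ?r)) powr (1 - \<epsilon>)"
        using e Xi_bounds[OF x] by (intro powr_mono2) auto
      have 4: "((1 + 2 * ?r) * exp (- ?r)) powr (2 - \<epsilon>) = (1 + 2 * ?r) * exp (- ?r) * ((1 + 2 * ?r) * exp (- ?r)) powr (1 - \<epsilon>)"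
      proof -
        have "0 < (1 + 2 * ?r) * exp (- ?r)" using r by (simp add: add_pos_nonneg)
        then show ?thesis using powr_add[of "(1 + 2 * ?r) * exp (- ?r)" 1 "1 - \<epsilon>"] by simp
      qed
      have "?F x l \<le> (1 + 2 * ?r) * exp (- ?r) * exp (s * ?r - ?r\<^sup>2 / 2) * exp (max c 0 * ?r * \<bar>l\<bar>) * ((1 + 2 * ?r) * exp (- ?r)) powr (1 - \<epsilon>)"
        unfolding power_0 div_by_1 using b r by (intro mult_mono 1 2 3 mult_nonneg_nonneg) auto
      then have "l\<^sup>2 * exp (- l\<^sup>2 / 2) * ?F x l \<le> l\<^sup>2 * exp (- l\<^sup>2 / 2) * ((1 + 2 * ?r) * exp (- ?r) * exp (s * ?r - ?r\<^sup>2 / 2) * exp (max c 0 * ?r * \<bar>l\<bar>) * ((1 + 2 * ?r) * exp (- ?r)) powr (1 - \<epsilon>))"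
        by (rule mult_left_mono) simp
      also have "\<dots> = weight (max c 0) (2 - \<epsilon>) s ?r \<bar>l\<bar>"
        unfolding weight_def 4 power2_abs by (simp only: mult_ac)
      also have "\<dots> \<le> C * exp (- (q * ?r)) * exp (- \<bar>\<bar>l\<bar> - ?r\<bar>)" by (rule W[OF r]) simp
      finally show ?thesis .
    qed
    have F0: "0 \<le> ?F x l" for l by simp
    have "(\<integral>\<^sup>+l. HS_norm S0 (fourier S0 (fs s) l) * ennreal (?F x l) \<partial>plancherel S0)
      \<le> (\<integral>\<^sup>+l. ennreal (H * exp (- l\<^sup>2 / 2)) * ennreal (?F x l) \<partial>plancherel S0)"
      by (intro nn_integral_mono mult_right_mono order_trans[OF HS_norm_fs[OF s]] ennreal_leI hh) auto
    also have "\<dots> = (\<integral>\<^sup>+l. ennreal (l\<^sup>2) * (ennreal (H * exp (- l\<^sup>2 / 2)) * ennreal (?F x l)) \<partial>lborel)"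
      unfolding plancherel_S0 by (rule nn_integral_density) measurable
    \<comment> \<open>The bound peaks at the two points l = r and l = -r. Estimating it by the sum
      of both bumps makes the integral over l independent of r, by translation.\<close>
    also have "\<dots> \<le> (\<integral>\<^sup>+l. ?B x * (ennreal (exp (- (1 * \<bar>l - ?r\<bar>))) + ennreal (exp (- (1 * \<bar>l + ?r\<bar>)))) \<partial>lborel)"
    proof (rule nn_integral_mono)
      fix l :: real
      have "l\<^sup>2 * (H * exp (- l\<^sup>2 / 2) * ?F x l) = H * (l\<^sup>2 * exp (- l\<^sup>2 / 2) * ?F x l)" by (simp only: mult_ac)
      also have "\<dots> \<le> H * (C * exp (- (q * ?r)) * exp (- \<bar>\<bar>l\<bar> - ?r\<bar>))" by (rule mult_left_mono[OF F H])
      also have "\<dots> \<le> H * (C * exp (- (q * ?r)) * (exp (- (1 * \<bar>l - ?r\<bar>)) + exp (- (1 * \<bar>l + ?r\<bar>))))"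
      proof (intro mult_left_mono H mult_nonneg_nonneg C)
        show "exp (- \<bar>\<bar>l\<bar> - ?r\<bar>) \<le> exp (- (1 * \<bar>l - ?r\<bar>)) + exp (- (1 * \<bar>l + ?r\<bar>))"
        proof (cases "l \<ge> 0")
          case False
          then have "\<bar>\<bar>l\<bar> - ?r\<bar> = \<bar>l + ?r\<bar>" by simp
          then show ?thesis by simp
        qed simp
      qed simp
      finally have "l\<^sup>2 * (H * exp (- l\<^sup>2 / 2) * ?F x l) \<le> H * C * exp (- (q * ?r)) * (exp (- (1 * \<bar>l - ?r\<bar>)) + exp (- (1 * \<bar>l + ?r\<bar>)))"
        by (simp only: mult.assoc)
      then have "ennreal (l\<^sup>2 * (H * exp (- l\<^sup>2 / 2) * ?F x l)) \<le> ennreal (H * C * exp (- (q * ?r)) * (exp (- (1 * \<bar>l - ?r\<bar>)) + exp (- (1 * \<bar>l + ?r\<bar>))))"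
        by (rule ennreal_leI)
      moreover have "ennreal (l\<^sup>2 * (H * exp (- l\<^sup>2 / 2) * ?F x l)) = ennreal (l\<^sup>2) * (ennreal (H * exp (- l\<^sup>2 / 2)) * ennreal (?F x l))"
        using H by (simp add: ennreal_mult[symmetric] del: ennreal_mult')
      moreover have "ennreal (H * C * exp (- (q * ?r)) * (exp (- (1 * \<bar>l - ?r\<bar>)) + exp (- (1 * \<bar>l + ?r\<bar>))))
        = ?B x * (ennreal (exp (- (1 * \<bar>l - ?r\<bar>))) + ennreal (exp (- (1 * \<bar>l + ?r\<bar>))))"
        using H C by (subst ennreal_mult) (auto simp: ennreal_plus)
      ultimately show "ennreal (l\<^sup>2) * (ennreal (H * exp (- l\<^sup>2 / 2)) * ennreal (?F x l))
        \<le> ?B x * (ennreal (exp (- (1 * \<bar>l - ?r\<bar>))) + ennreal (exp (- (1 * \<bar>l + ?r\<bar>))))" by simp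
    qed
    also have "\<dots> = ?B x * (\<integral>\<^sup>+l. ennreal (exp (- (1 * \<bar>l - ?r\<bar>))) + ennreal (exp (- (1 * \<bar>l + ?r\<bar>))) \<partial>lborel)"
      by (rule nn_integral_cmult) measurable
    also have "(\<integral>\<^sup>+l. ennreal (exp (- (1 * \<bar>l - ?r\<bar>))) + ennreal (exp (- (1 * \<bar>l + ?r\<bar>))) \<partial>lborel)
      = (\<integral>\<^sup>+l. ennreal (exp (- (1 * \<bar>l - ?r\<bar>))) \<partial>lborel) + (\<integral>\<^sup>+l. ennreal (exp (- (1 * \<bar>l + ?r\<bar>))) \<partial>lborel)"
      by (rule nn_integral_add) measurable
    also have "\<dots> = 2 * E1"
      using nn_integral_real_affine[of "\<lambda>l. ennreal (exp (- (1 * \<bar>l\<bar>)))" 1 "?r"]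
        nn_integral_real_affine[of "\<lambda>l. ennreal (exp (- (1 * \<bar>l\<bar>)))" 1 "- ?r"]
      unfolding E1_def by (simp add: add.commute mult_2)
    finally show ?thesis .
  qed
  have "beurling_integral S0 c \<epsilon> 0 (fs s) \<le> (\<integral>\<^sup>+x. ?B x * (2 * E1) \<partial>haarG)"
    unfolding beurling_integral_def S0_sel by (intro nn_integral_mono inner) simp
  also have "\<dots> = (\<integral>\<^sup>+x. ennreal (H * C) * ennreal (exp (- (q * rad x))) * (2 * E1) \<partial>haarG)"
    using H C by (simp add: ennreal_mult)
  also have "\<dots> = ennreal (H * C) * (\<integral>\<^sup>+x. ennreal (exp (- (q * rad x))) \<partial>haarG) * (2 * E1)"
    by (simp add: nn_integral_multc nn_integral_cmult)
  also have "\<dots> < \<infinity>"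
    using nn_integral_exp_rad[OF q] E1 by (simp add: ennreal_mult_less_top)
  finally show ?thesis .
qed

text \<open>For a = 2 - \<epsilon> the requirement s <= (a - 2)/2 of the critical bound becomes s <=
  -\<epsilon>/2.\<close>

lemma beurling_integral_fs_finite:
  fixes c \<epsilon> s :: real
  assumes s: "0 \<le> s" "s \<le> 1" and ce: "(c < 1 \<and> \<epsilon> \<le> 0) \<or> (c \<le> 1 \<and> \<epsilon> < 0 \<and> s \<le> - \<epsilon> / 2)"
  shows "beurling_integral S0 c \<epsilon> 0 (fs s) < \<infinity>"
proof (cases "c < 1 \<and> \<epsilon> \<le> 0")
  case True
  show ?thesis
  proof (rule weight_bound_subcritical[of "2 - \<epsilon>" s "max c 0"])
    fix C q assume "q > 2" "C \<ge> 0" "\<And>r m. r \<ge> 0 \<Longrightarrow> m \<ge> 0 \<Longrightarrow>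
      weight (max c 0) (2 - \<epsilon>) s r m \<le> C * exp (- (q * r)) * exp (- \<bar>m - r\<bar>)"
    then show ?thesis using True by (intro beurling_integral_fs[OF s, of \<epsilon> q C c]) blast+
  qed (use True s in auto)
next
  case False
  then have *: "c \<le> 1" "\<epsilon> < 0" "s \<le> - \<epsilon> / 2" using ce by auto
  show ?thesis
  proof (rule weight_bound_critical[of "2 - \<epsilon>" s "max c 0"])
    fix C q assume "q > 2" "C \<ge> 0" "\<And>r m. r \<ge> 0 \<Longrightarrow> m \<ge> 0 \<Longrightarrow>
      weight (max c 0) (2 - \<epsilon>) s r m \<le> C * exp (- (q * r)) * exp (- \<bar>m - r\<bar>)"
    then show ?thesis using less_imp_le[OF *(2)] by (intro beurling_integral_fs[OF s, of \<epsilon> q C c]) blast+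
  qed (use * s in auto)
qed

subsection \<open>Pairing with the spherical functions\<close>

text \<open>The sign agrees with the parameter -\<lambda> in \<open>fourier_coeff\<close>, so that
  for a trivial type the Fourier coefficient is the integral against this function.\<close>

definition phi :: "real \<Rightarrow> coords \<Rightarrow> complex" where
  "phi l x = spherical S0 (- of_real l) x"

lemma phi_eq:
  "x \<in> SL2 \<Longrightarrow> phi l x = (LINT k|haarK. exp ((1 - \<i> * of_real l) * of_real (AA (mmult (madj x) k))))"
  unfolding phi_def spherical_def S0_sel rho_S0
  by (intro Bochner_Integration.integral_cong) (auto simp: Afun_S0 algebra_simps)

lemma phi_left: "k \<in> SU2 \<Longrightarrow> x \<in> SL2 \<Longrightarrow> phi l (mmult k x) = phi l x"
  using SU2_subset unfolding phi_def
  by (subst (1 2) spherical_S0) (auto simp: mmult_in_SL2 rad_def hsn_mult_left)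

lemma exp_AA_measurable [measurable]:
  "(\<lambda>p. exp ((1 - \<i> * of_real l) * complex_of_real (AA (mmult (madj (snd p)) (fst p))))) \<in> borel_measurable (haarK \<Otimes>\<^sub>M haarG)"
proof -
  have "(\<lambda>p. mmult (madj (snd p)) (fst p)) \<in> measurable (haarK \<Otimes>\<^sub>M haarG) haarG"
    by (intro measurable_haar_group(1) measurable_haar_group(2) measurable_haarK_haarG measurable_fst measurable_snd)
  from measurable_compose[OF this AA_measurable]
  have "(\<lambda>p. AA (mmult (madj (snd p)) (fst p))) \<in> borel_measurable (haarK \<Otimes>\<^sub>M haarG)" .
  moreover have "continuous_on UNIV (\<lambda>y. exp ((1 - \<i> * of_real l) * complex_of_real y))"
    by (intro continuous_intros)
  ultimately show ?thesis by (rule borel_measurable_continuous_on[rotated])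
qed

lemma phi_measurable [measurable]: "phi l \<in> borel_measurable haarG"
proof -
  have "(\<lambda>x. LINT k|haarK. exp ((1 - \<i> * of_real l) * of_real (AA (mmult (madj x) k)))) \<in> borel_measurable haarG"
  proof (rule haarK.borel_measurable_lebesgue_integral)
    have "(\<lambda>p. (snd p, fst p)) \<in> measurable (haarG \<Otimes>\<^sub>M haarK) (haarK \<Otimes>\<^sub>M haarG)" by measurable
    from measurable_compose[OF this exp_AA_measurable[of l]]
    show "(\<lambda>(x, k). exp ((1 - \<i> * of_real l) * of_real (AA (mmult (madj x) k)))) \<in> borel_measurable (haarG \<Otimes>\<^sub>M haarK)"
      by (simp add: split_beta)
  qed
  then show ?thesis
    by (rule measurable_cong[THEN iffD2, rotated]) (simp add: phi_eq)
qed

text \<open>For real parameter the modulus of the integrand is the integrand of \<Xi>, and \<Xi> <=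
  (1 + 2r) e^{-r} <= 2.\<close>

lemma phi_bounded: assumes x: "x \<in> SL2" shows "cmod (phi l x) \<le> 2"
proof -
  let ?q = "\<lambda>u. ln (qfun (rad x) u)"
  have "cmod (phi l x) \<le> (LINT u|lborel. cmod (indicator {0..1} u *\<^sub>R exp (- (\<i> * (- of_real l) + 1) * of_real (?q u))))"
    unfolding phi_def spherical_S0[OF x] by (rule integral_norm_bound)
  also have "\<dots> = (LINT u|lborel. indicator {0..1} u *\<^sub>R exp (- ?q u))"
    by (intro Bochner_Integration.integral_cong) (auto simp: norm_exp_eq_Re)
  also have "complex_of_real \<dots> = spherical S0 0 x"
    unfolding spherical_S0[OF x] integral_complex_of_real[symmetric]
    by (intro Bochner_Integration.integral_cong) (auto simp: exp_of_real scaleR_conv_of_real simp flip: of_real_minus)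
  then have "(LINT u|lborel. indicator {0..1} u *\<^sub>R exp (- ?q u)) = Xi S0 x"
    using Xi_bounds(3)[OF x] of_real_eq_iff by metis
  also have "\<dots> \<le> (1 + 2 * rad x) * exp (- rad x)" by (rule Xi_bounds(2)[OF x])
  also have "\<dots> \<le> (2 * exp (rad x)) * exp (- rad x)"
  proof (rule mult_right_mono)
    show "1 + 2 * rad x \<le> 2 * exp (rad x)" using exp_ge_add_one_self[of "rad x"] by linarith
  qed simp
  also have "\<dots> = 2" by (simp add: exp_minus)
  finally show ?thesis .
qed

lemma integrable_mult_phi:
  assumes h: "integrable haarG h" shows "integrable haarG (\<lambda>x. h x * phi l x)"
proof (rule Bochner_Integration.integrable_bound)
  show "integrable haarG (\<lambda>x. 2 * h x)" using h by simp
  show "(\<lambda>x. h x * phi l x) \<in> borel_measurable haarG" using h by measurable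
  show "AE x in haarG. norm (h x * phi l x) \<le> norm (2 * h x)"
  proof (rule AE_I2)
    fix x assume "x \<in> space haarG"
    then have "cmod (h x) * cmod (phi l x) \<le> cmod (h x) * 2" by (intro mult_left_mono phi_bounded) auto
    then show "norm (h x * phi l x) \<le> norm (2 * h x)" by (simp add: norm_mult)
  qed
qed

text \<open>For each k the integral over x is the Fourier transform applied to the constant function
  1 and does not depend on k. As f_s is nonnegative, taking absolute values amounts to setting l =
  0, which yields the integrability for Fubini.\<close>

lemma fs_phi:
  assumes s: "0 \<le> s" "s \<le> 1" shows "(LINT x|haarG. fs s x * phi l x) = of_real (hhat s l)"
proof -
  define E where "E l k x = exp ((1 - \<i> * of_real l) * complex_of_real (AA (mmult (madj x) k)))" for l k x
  have E_ps: "fs s x * E l k x = fs s x * principal_series S0 (- l) x (\<lambda>_. 1) k" if "x \<in> SL2" "k \<in> SU2" for x k l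
    using that by (simp add: E_def principal_series_def rho_S0 Afun_S0 add.commute)
  have int: "integrable haarG (\<lambda>x. fs s x * E l k x)" if k: "k \<in> SU2" for k l
  proof -
    have "integrable haarG (\<lambda>x. fs s x * E l k x) \<longleftrightarrow> integrable haarG (\<lambda>x. fs s x * principal_series S0 (- l) x (\<lambda>_. 1) k)"
      by (intro Bochner_Integration.integrable_cong refl E_ps k) simp
    then show ?thesis using fourier_fs(1)[OF s _ k, of "\<lambda>_. 1" l] by simp
  qed
  have val: "(LINT x|haarG. fs s x * E l k x) = of_real (hhat s l)" if k: "k \<in> SU2" for k l
  proof -
    have "(LINT x|haarG. fs s x * E l k x) = fourier S0 (fs s) l (\<lambda>_. 1) k"
      unfolding fourier_def by (intro Bochner_Integration.integral_cong) (auto simp: E_ps k)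
    also have "\<dots> = of_real (hhat s l)"
      using fourier_fs(2)[OF s _ k, of "\<lambda>_. 1" l] haarK.prob_space by simp
    finally show ?thesis .
  qed
  have nE: "complex_of_real (norm (fs s x * E l k x)) = fs s x * E 0 k x" for x k l
    using Gp_nonneg[OF s, of "hsn x"] by (simp add: fs_def E_def norm_mult norm_exp_eq_Re exp_of_real)
  have meas: "case_prod (\<lambda>k x. fs s x * E l k x) \<in> borel_measurable (haarK \<Otimes>\<^sub>M haarG)"
    unfolding E_def split_beta
    by (intro borel_measurable_times exp_AA_measurable measurable_compose[OF measurable_snd fs_measurable])
  have I: "integrable (haarK \<Otimes>\<^sub>M haarG) (case_prod (\<lambda>k x. fs s x * E l k x))"
  proof (rule haarKG.Fubini_integrable[OF meas])
    have "(LINT x|haarG. norm (fs s x * E l k x)) = hhat s 0" if "k \<in> SU2" for k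
    proof -
      have "complex_of_real (LINT x|haarG. norm (fs s x * E l k x)) = of_real (hhat s 0)"
        unfolding integral_complex_of_real[symmetric] nE by (rule val[OF that])
      then show ?thesis unfolding of_real_eq_iff .
    qed
    then have "integrable haarK (\<lambda>k. LINT x|haarG. norm (fs s x * E l k x)) \<longleftrightarrow> integrable haarK (\<lambda>k. hhat s 0)"
      by (intro Bochner_Integration.integrable_cong) auto
    then show "integrable haarK (\<lambda>k. LINT x|haarG. norm (case_prod (\<lambda>k x. fs s x * E l k x) (k, x)))" by simp
    show "AE k in haarK. integrable haarG (\<lambda>x. case_prod (\<lambda>k x. fs s x * E l k x) (k, x))"
      by (rule AE_I2) (simp add: int)
  qed
  have "(LINT x|haarG. fs s x * phi l x) = (LINT x|haarG. LINT k|haarK. fs s x * E l k x)"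
    by (intro Bochner_Integration.integral_cong) (auto simp: phi_eq E_def)
  also have "\<dots> = (LINT k|haarK. LINT x|haarG. fs s x * E l k x)"
    by (rule haarKG.Fubini_integral[OF I])
  also have "\<dots> = (LINT k|haarK. of_real (hhat s l))"
    by (intro Bochner_Integration.integral_cong) (auto simp: val)
  also have "\<dots> = of_real (hhat s l)" using haarK.prob_space by simp
  finally show ?thesis .
qed

subsection \<open>Functions of a \<open>K\<close>-type\<close>

lemma integrable_haarK_continuous:
  fixes u :: "coords \<Rightarrow> complex"
  assumes "continuous_on SU2 u" shows "integrable haarK u"
proof -
  have "bounded (u ` SU2)"
    by (intro compact_imp_bounded compact_continuous_image assms compact_SU2)
  then obtain B where B: "\<And>k. k \<in> SU2 \<Longrightarrow> cmod (u k) \<le> B" by (auto simp: bounded_iff)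
  have "u \<in> borel_measurable (restrict_space borel SU2)"
    using assms by (rule borel_measurable_continuous_on_restrict)
  then have "u \<in> borel_measurable haarK" by (simp cong: measurable_cong_sets)
  then show ?thesis
    by (intro haarK.integrable_const_bound[of _ B]) (auto simp: B)
qed

lemma integral_haarK_left:
  fixes u :: "coords \<Rightarrow> complex"
  assumes "integrable haarK u" "k \<in> SU2" shows "(LINT l|haarK. u (mmult k l)) = (LINT l|haarK. u l)"
proof -
  have "mmult k \<in> measurable haarK haarK"
    using assms(2) by (intro measurable_haar_group(3)[of "\<lambda>_. k" _ "\<lambda>l. l"]) auto
  then have "(LINT l|haarK. u (mmult k l)) = (LINT l|distr haarK haarK (mmult k). u l)"
    using assms(1) by (intro integral_distr[symmetric]) auto
  then show ?thesis unfolding distr_haarK_left[OF assms(2)] .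
qed

text \<open>The spherical function is left $K$-invariant, so the average over $K$ in the definition of
  type $\delta$ falls on the character alone.\<close>

lemma of_type_phi:
  assumes h: "h \<in> L1_X S0" and t: "of_type S0 \<delta> h" and c: "continuous_on SU2 (rep_char S0 \<delta>)"
  shows "(LINT x|haarG. h x * phi l x) =
    of_nat (rep_deg S0 \<delta>) * (LINT k|haarK. cnj (rep_char S0 \<delta> k)) * (LINT x|haarG. h x * phi l x)"
proof -
  define ch where "ch k = cnj (rep_char S0 \<delta> k)" for k
  have hi: "integrable haarG h" and [measurable]: "h \<in> borel_measurable haarG" using h by (auto simp: L1_X_def)
  have ci: "integrable haarK ch"
    unfolding ch_def[abs_def] by (intro integrable_haarK_continuous continuous_on_cnj c)
  then have [measurable]: "ch \<in> borel_measurable haarK" by simp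
  define J where "J = (LINT x|haarG. h x * phi l x)"
  have left: "integrable haarG (\<lambda>x. u (mmult k x))" "(LINT x|haarG. u (mmult k x)) = (LINT x|haarG. u x)"
    if k: "k \<in> SU2" and u: "integrable haarG u" for k and u :: "coords \<Rightarrow> 'c :: {banach, second_countable_topology}"
  proof -
    have kG: "k \<in> SL2" using k SU2_subset by blast
    have m: "mmult k \<in> measurable haarG haarG"
      using kG by (intro measurable_haar_group(1)[of "\<lambda>_. k" _ "\<lambda>l. l"]) auto
    show "integrable haarG (\<lambda>x. u (mmult k x))"
      by (rule integrable_distr[OF m]) (simp add: distr_haarG_left[OF kG] u)
    have "(LINT x|haarG. u (mmult k x)) = (LINT x|distr haarG haarG (mmult k). u x)"
      using m u by (intro integral_distr[symmetric]) auto
    then show "(LINT x|haarG. u (mmult k x)) = (LINT x|haarG. u x)" unfolding distr_haarG_left[OF kG] .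
  qed
  define f where "f k x = h (mmult k x) * ch k * phi l x" for k x
  have f_eq: "f k x = ch k * (h (mmult k x) * phi l (mmult k x))" if "k \<in> SU2" "x \<in> SL2" for k x
    using phi_left[OF that] by (simp add: f_def mult_ac)
  have hp: "integrable haarG (\<lambda>x. h x * phi l x)" by (rule integrable_mult_phi[OF hi])
  have fi: "integrable haarG (f k)" if k: "k \<in> SU2" for k
    by (subst Bochner_Integration.integrable_cong[OF refl, of _ _ "\<lambda>x. ch k * (h (mmult k x) * phi l (mmult k x))"])
      (auto simp: f_eq k left(1)[OF k hp])
  have fv: "(LINT x|haarG. f k x) = ch k * J" if k: "k \<in> SU2" for k
  proof -
    have "(LINT x|haarG. f k x) = (LINT x|haarG. ch k * (h (mmult k x) * phi l (mmult k x)))"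
      by (intro Bochner_Integration.integral_cong) (auto simp: f_eq k)
    then show ?thesis using left(2)[OF k hp] by (simp add: J_def)
  qed
  have fn: "(LINT x|haarG. norm (f k x)) = norm (ch k) * (LINT x|haarG. norm (h x * phi l x))" if k: "k \<in> SU2" for k
  proof -
    have "(LINT x|haarG. norm (f k x)) = (LINT x|haarG. norm (ch k) * norm (h (mmult k x) * phi l (mmult k x)))"
      by (intro Bochner_Integration.integral_cong) (auto simp: f_eq k norm_mult)
    then show ?thesis using left(2)[OF k integrable_norm[OF hp]] by simp
  qed
  have mm: "(\<lambda>p. mmult (fst p) (snd p)) \<in> measurable (haarK \<Otimes>\<^sub>M haarG) haarG"
    by (intro measurable_haar_group(1) measurable_haarK_haarG measurable_fst measurable_snd)
  have meas: "case_prod f \<in> borel_measurable (haarK \<Otimes>\<^sub>M haarG)"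
    unfolding f_def split_beta
    by (intro borel_measurable_times measurable_compose[OF mm] measurable_compose[OF measurable_fst]
        measurable_compose[OF measurable_snd]) measurable
  have I: "integrable (haarK \<Otimes>\<^sub>M haarG) (case_prod f)"
  proof (rule haarKG.Fubini_integrable[OF meas])
    have "integrable haarK (\<lambda>k. norm (ch k) * (LINT x|haarG. norm (h x * phi l x)))" using ci by simp
    then have "integrable haarK (\<lambda>k. LINT x|haarG. norm (f k x))"
      by (subst Bochner_Integration.integrable_cong[OF refl, of _ _ "\<lambda>k. norm (ch k) * (LINT x|haarG. norm (h x * phi l x))"])
        (auto simp: fn)
    then show "integrable haarK (\<lambda>k. LINT x|haarG. norm (case_prod f (k, x)))" by simp
    show "AE k in haarK. integrable haarG (\<lambda>x. case_prod f (k, x))"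
      by (rule AE_I2) (simp add: fi)
  qed
  have "J = (LINT x|haarG. of_nat (rep_deg S0 \<delta>) * (LINT k|haarK. f k x))"
    unfolding J_def
  proof (rule integral_cong_AE)
    show "(\<lambda>x. of_nat (rep_deg S0 \<delta>) * (LINT k|haarK. f k x)) \<in> borel_measurable haarG"
    proof (intro borel_measurable_times borel_measurable_const haarK.borel_measurable_lebesgue_integral)
      have "(\<lambda>p. (snd p, fst p)) \<in> measurable (haarG \<Otimes>\<^sub>M haarK) (haarK \<Otimes>\<^sub>M haarG)" by measurable
      from measurable_compose[OF this meas]
      show "(\<lambda>(x, k). f k x) \<in> borel_measurable (haarG \<Otimes>\<^sub>M haarK)" by (simp add: split_beta)
    qed
    show "AE x in haarG. h x * phi l x = of_nat (rep_deg S0 \<delta>) * (LINT k|haarK. f k x)"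
      using t unfolding of_type_def S0_sel
      by eventually_elim (simp add: f_def ch_def)
  qed measurable
  also have "\<dots> = of_nat (rep_deg S0 \<delta>) * (LINT x|haarG. LINT k|haarK. f k x)" by simp
  also have "(LINT x|haarG. LINT k|haarK. f k x) = (LINT k|haarK. LINT x|haarG. f k x)"
    by (rule haarKG.Fubini_integral[OF I])
  also have "\<dots> = (LINT k|haarK. ch k * J)"
    by (intro Bochner_Integration.integral_cong) (auto simp: fv)
  finally show ?thesis by (simp add: J_def ch_def)
qed

text \<open>If the character has nonzero mean, then some column of the mean of $\delta$ over $K$ is a nonzero
  fixed vector; by irreducibility all vectors are fixed.\<close>

lemma K_type_trivial:
  assumes \<delta>: "K_type S0 \<delta>" and c: "(LINT k|haarK. cnj (rep_char S0 \<delta> k)) \<noteq> 0" and k: "k \<in> SU2"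
  shows "Yfun \<delta> 0 k = 1"
proof -
  define d where "d = rep_deg S0 \<delta>"
  have U: "unitary_rep S0 \<delta>" and irr: "irreducible_rep S0 \<delta>" using \<delta> by (auto simp: K_type_def)
  have d0: "d > 0" using irr by (simp add: irreducible_rep_def d_def Let_def)
  have car: "\<delta> k \<in> carrier_mat d d" if "k \<in> SU2" for k
    using U that by (simp add: unitary_rep_def d_def Let_def)
  have mult: "\<delta> (mmult k l) = \<delta> k * \<delta> l" if "k \<in> SU2" "l \<in> SU2" for k l
    using U that by (simp add: unitary_rep_def d_def Let_def)
  have cont: "continuous_on SU2 (\<lambda>k. \<delta> k $$ (i, j))" if "i < d" "j < d" for i j
    using U that by (simp add: unitary_rep_def d_def Let_def)
  have int: "integrable haarK (\<lambda>k. \<delta> k $$ (i, j))" if "i < d" "j < d" for i j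
    by (intro integrable_haarK_continuous cont that)
  have "(LINT k|haarK. cnj (rep_char S0 \<delta> k)) = cnj (\<Sum>i<d. LINT k|haarK. \<delta> k $$ (i, i))"
    unfolding rep_char_def d_def[symmetric] Bochner_Integration.integral_cnj
    by (subst Bochner_Integration.integral_sum) (auto intro: int)
  with c obtain i where i: "i < d" "(LINT k|haarK. \<delta> k $$ (i, i)) \<noteq> 0"
    by (metis (mono_tags, lifting) complex_cnj_zero lessThan_iff sum.neutral)
  define w where "w = vec d (\<lambda>j. LINT k|haarK. \<delta> k $$ (j, i))"
  define W where "W = {v \<in> carrier_vec d. \<forall>k\<in>SU2. \<delta> k *\<^sub>v v = v}"
  have "\<delta> l *\<^sub>v w = w" if l: "l \<in> SU2" for l
  proof (rule eq_vecI)
    show "dim_vec (\<delta> l *\<^sub>v w) = dim_vec w" using car[OF l] by (auto simp: w_def)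
    fix a assume "a < dim_vec w"
    then have a: "a < d" by (simp add: w_def)
    have "(\<delta> l *\<^sub>v w) $ a = (\<Sum>j<d. \<delta> l $$ (a, j) * (LINT k|haarK. \<delta> k $$ (j, i)))"
      using car[OF l] a by (auto simp: w_def scalar_prod_def atLeast0LessThan intro!: sum.cong)
    also have "\<dots> = (LINT k|haarK. (\<Sum>j<d. \<delta> l $$ (a, j) * \<delta> k $$ (j, i)))"
      using int i by (subst Bochner_Integration.integral_sum) auto
    also have "\<dots> = (LINT k|haarK. \<delta> (mmult l k) $$ (a, i))"
    proof (rule Bochner_Integration.integral_cong[OF refl])
      fix k assume "k \<in> space haarK"
      then have k: "k \<in> SU2" by simp
      show "(\<Sum>j<d. \<delta> l $$ (a, j) * \<delta> k $$ (j, i)) = \<delta> (mmult l k) $$ (a, i)"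
        unfolding mult[OF l k] using car[OF l] car[OF k] a i(1)
        by (auto simp: scalar_prod_def atLeast0LessThan intro!: sum.cong)
    qed
    also have "\<dots> = (LINT k|haarK. \<delta> k $$ (a, i))"
      by (rule integral_haarK_left[OF int[OF a i(1)] l])
    also have "\<dots> = w $ a" using a by (simp add: w_def)
    finally show "(\<delta> l *\<^sub>v w) $ a = w $ a" .
  qed
  then have wW: "w \<in> W" by (simp add: W_def w_def)
  have "w $ i \<noteq> 0" using i by (simp add: w_def)
  then have "w \<noteq> 0\<^sub>v d" using i(1) by auto
  then have W0: "W \<noteq> {0\<^sub>v d}" using wW by auto
  have z: "A *\<^sub>v 0\<^sub>v d = 0\<^sub>v d" if "A \<in> carrier_mat d d" for A :: "complex mat"
    using that by (intro eq_vecI) auto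
  have sub: "vec_subspace d W"
    unfolding vec_subspace_def
  proof (intro conjI ballI allI)
    show "W \<subseteq> carrier_vec d" by (auto simp: W_def)
    show "0\<^sub>v d \<in> W" using car z by (auto simp: W_def)
    show "v + v' \<in> W" if "v \<in> W" "v' \<in> W" for v v'
      using that car by (auto simp: W_def mult_add_distrib_mat_vec[where nr = d and nc = d])
    show "a \<cdot>\<^sub>v v \<in> W" if "v \<in> W" for a v
      using that car by (auto simp: W_def mult_mat_vec[where nr = d and nc = d])
  qed
  have "\<forall>k\<in>Kgp S0. \<forall>v\<in>W. \<delta> k *\<^sub>v v \<in> W" by (auto simp: W_def)
  then have "W = carrier_vec d"
    using irr sub W0 unfolding irreducible_rep_def d_def[symmetric] Let_def by blast
  then have "unit_vec d 0 \<in> W" by simp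
  then have "(\<delta> k *\<^sub>v unit_vec d 0) $ 0 = unit_vec d 0 $ 0" using k by (simp add: W_def)
  then have "\<delta> k $$ (0, 0) = 1" using car[OF k] d0 by auto
  then show ?thesis by (simp add: Yfun_def)
qed

section \<open>Spherical pairing of functions of the excluded form\<close>

lemma pochhammer_poly: "\<exists>R :: complex poly. \<forall>z. pochhammer ((u + \<i> * z) / 2) n = poly R z"
proof (induction n)
  case 0
  show ?case by (rule exI[of _ 1]) simp
next
  case (Suc n)
  then obtain R where R: "\<And>z. pochhammer ((u + \<i> * z) / 2) n = poly R z" by blast
  have "pochhammer ((u + \<i> * z) / 2) (Suc n) = poly (R * [:u / 2 + of_nat n, \<i> / 2:]) z" for z
    unfolding pochhammer_Suc R poly_mult by (simp add: add_divide_distrib)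
  then show ?case by blast
qed

lemma kostant_poly_poly: "\<exists>R. \<forall>z. kostant_poly S p q z = poly R z"
proof -
  obtain R1 where "\<And>z. pochhammer (((of_nat (m1 S) + of_nat (m2 S) - 1) / 2 + (of_nat (m2 S) - 1) / 2 + 1 + \<i> * z) / 2)
      (nat ((p + q) div 2)) = poly R1 z"
    using pochhammer_poly by metis
  moreover obtain R2 where "\<And>z. pochhammer (((of_nat (m1 S) + of_nat (m2 S) - 1) / 2 - (of_nat (m2 S) - 1) / 2 + 1 + \<i> * z) / 2)
      (nat ((p - q) div 2)) = poly R2 z"
    using pochhammer_poly by metis
  ultimately have "kostant_poly S p q z = poly (R1 * R2) z" for z
    by (simp only: kostant_poly_def Let_def poly_mult)
  then show ?thesis by blast
qed

text \<open>If the character of a summand's type has mean 0, its pairing vanishes by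
  \<open>of_type_phi\<close>. Otherwise the type is trivial by \<open>K_type_trivial\<close>, and
  the pairing is its Fourier coefficient of index 0, polynomial times Gaussian. All summands share
  the same \<alpha>, so the sum keeps this form.\<close>

lemma gaussian_form_phi:
  assumes g: "gaussian_form S0 f" and m: "f \<in> borel_measurable haarG"
  obtains \<alpha> R where "\<And>l::real. (LINT x|haarG. f x * phi l x) = poly R (of_real l) * of_real (exp (- \<alpha> * l\<^sup>2))"
proof -
  from g[unfolded gaussian_form_def] obtain F :: "coords rep set" and h \<alpha> and P :: "coords rep \<Rightarrow> nat \<Rightarrow> complex poly"
    where G: "finite F \<and> (\<forall>\<delta>\<in>F. K_type S0 \<delta>) \<and>
        (\<forall>\<delta>\<in>F. \<forall>\<delta>'\<in>F. equivalent_reps S0 \<delta> \<delta>' \<longrightarrow> \<delta> = \<delta>') \<and> \<alpha> > 0 \<and>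
        (\<forall>\<delta>\<in>F. h \<delta> \<in> L1_X S0 \<and> of_type S0 \<delta> (h \<delta>) \<and>
           (\<exists>Q. is_kostant_poly S0 \<delta> Q \<and>
              (\<forall>j<rep_deg S0 \<delta>. \<forall>l::real. fourier_coeff S0 \<delta> j (h \<delta>) l =
                 poly (P \<delta> j) ((of_real l)\<^sup>2) * Q (- of_real l) * of_real (exp (- \<alpha> * l\<^sup>2))))) \<and>
        (AE x in dx S0. f x = (\<Sum>\<delta>\<in>F. h \<delta> x))"
    by (elim exE)
  note G' = G[THEN conjunct2, THEN conjunct2, THEN conjunct2, THEN conjunct2]
  have K: "K_type S0 \<delta>" if "\<delta> \<in> F" for \<delta>
    by (rule bspec[OF G[THEN conjunct2, THEN conjunct1] that])
  have h: "h \<delta> \<in> L1_X S0" "of_type S0 \<delta> (h \<delta>)"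
    and Q: "\<exists>Q. is_kostant_poly S0 \<delta> Q \<and>
              (\<forall>j<rep_deg S0 \<delta>. \<forall>l::real. fourier_coeff S0 \<delta> j (h \<delta>) l =
                 poly (P \<delta> j) ((of_real l)\<^sup>2) * Q (- of_real l) * of_real (exp (- \<alpha> * l\<^sup>2)))"
    if "\<delta> \<in> F" for \<delta>
    using bspec[OF G'[THEN conjunct1] that] by simp_all
  have f: "AE x in dx S0. f x = (\<Sum>\<delta>\<in>F. h \<delta> x)" by (rule G'[THEN conjunct2])
  have "\<exists>R. \<forall>l::real. (LINT x|haarG. h \<delta> x * phi l x) = poly R (of_real l) * of_real (exp (- \<alpha> * l\<^sup>2))"
    if \<delta>: "\<delta> \<in> F" for \<delta>
  proof (cases "(LINT k|haarK. cnj (rep_char S0 \<delta> k)) = 0")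
    case True
    have "continuous_on SU2 (rep_char S0 \<delta>)"
      using K[OF \<delta>] unfolding rep_char_def[abs_def]
      by (intro continuous_on_sum) (simp add: K_type_def unitary_rep_def Let_def)
    from of_type_phi[OF h[OF \<delta>] this] True have "(LINT x|haarG. h \<delta> x * phi l x) = 0" for l by simp
    then show ?thesis by (intro exI[of _ 0]) simp
  next
    case False
    have Y: "Yfun \<delta> 0 k = 1" if "k \<in> SU2" for k by (rule K_type_trivial[OF K[OF \<delta>] False that])
    have "gen_spherical S0 \<delta> 0 z x = spherical S0 z x" for z x
      unfolding gen_spherical_def spherical_def S0_sel
      by (intro Bochner_Integration.integral_cong) (auto simp: Y)
    then have fc: "fourier_coeff S0 \<delta> 0 (h \<delta>) l = (LINT x|haarG. h \<delta> x * phi l x)" for l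
      by (simp add: fourier_coeff_def phi_def)
    have d0: "0 < rep_deg S0 \<delta>"
      using K[OF \<delta>] by (simp add: K_type_def irreducible_rep_def Let_def)
    obtain q where q: "is_kostant_poly S0 \<delta> q" "\<And>l::real. fourier_coeff S0 \<delta> 0 (h \<delta>) l =
        poly (P \<delta> 0) ((of_real l)\<^sup>2) * q (- of_real l) * of_real (exp (- \<alpha> * l\<^sup>2))"
      using Q[OF \<delta>] d0 by blast
    from q(1) obtain p1 p2 where "q = kostant_poly S0 p1 p2" unfolding is_kostant_poly_def by blast
    then obtain R where R: "\<And>z. q z = poly R z" using kostant_poly_poly[of S0 p1 p2] by auto
    show ?thesis
    proof (intro exI allI)
      fix l :: real
      \<comment> \<open>The inner polynomials substitute the square of \<lambda> into
        \<open>P\<close> and -\<lambda> into the Kostant polynomial.\<close>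
      show "(LINT x|haarG. h \<delta> x * phi l x) =
        poly (pcompose (P \<delta> 0) [:0, 0, 1:] * pcompose R [:0, - 1:]) (of_real l) * of_real (exp (- \<alpha> * l\<^sup>2))"
        unfolding fc[symmetric] q(2) R by (simp add: poly_pcompose power2_eq_square)
    qed
  qed
  then have "\<forall>\<delta>\<in>F. \<exists>R. \<forall>l::real. (LINT x|haarG. h \<delta> x * phi l x) = poly R (of_real l) * of_real (exp (- \<alpha> * l\<^sup>2))"
    by (rule ballI)
  from bchoice[OF this] obtain R where
    "\<forall>\<delta>\<in>F. \<forall>l::real. (LINT x|haarG. h \<delta> x * phi l x) = poly (R \<delta>) (of_real l) * of_real (exp (- \<alpha> * l\<^sup>2))"
    by (elim exE)
  then have R: "(LINT x|haarG. h \<delta> x * phi l x) = poly (R \<delta>) (of_real l) * of_real (exp (- \<alpha> * l\<^sup>2))"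
    if "\<delta> \<in> F" for \<delta> and l :: real
    using that by simp
  have hi: "integrable haarG (\<lambda>x. h \<delta> x * phi l x)" if "\<delta> \<in> F" for \<delta> l
    using h(1)[OF that] by (intro integrable_mult_phi) (simp add: L1_X_def)
  show ?thesis
  proof (rule that[of "\<Sum>\<delta>\<in>F. R \<delta>" \<alpha>])
    fix l :: real
    have "(LINT x|haarG. f x * phi l x) = (LINT x|haarG. (\<Sum>\<delta>\<in>F. h \<delta> x * phi l x))"
    proof (rule integral_cong_AE)
      show "(\<lambda>x. \<Sum>\<delta>\<in>F. h \<delta> x * phi l x) \<in> borel_measurable haarG"
        using hi by (intro borel_measurable_sum) auto
      show "AE x in haarG. f x * phi l x = (\<Sum>\<delta>\<in>F. h \<delta> x * phi l x)"
        using f unfolding S0_sel by eventually_elim (simp add: sum_distrib_right)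
    qed (use m in measurable)
    also have "\<dots> = (\<Sum>\<delta>\<in>F. LINT x|haarG. h \<delta> x * phi l x)"
      by (intro Bochner_Integration.integral_sum hi)
    also have "\<dots> = poly (\<Sum>\<delta>\<in>F. R \<delta>) (of_real l) * of_real (exp (- \<alpha> * l\<^sup>2))"
      by (simp add: R poly_sum sum_distrib_right)
    finally show "(LINT x|haarG. f x * phi l x) = poly (\<Sum>\<delta>\<in>F. R \<delta>) (of_real l) * of_real (exp (- \<alpha> * l\<^sup>2))" .
  qed
qed

lemma not_gaussian_form_fs:
  assumes s: "0 < s" "s \<le> 1" shows "\<not> gaussian_form S0 (fs s)"
proof
  assume "gaussian_form S0 (fs s)"
  then obtain \<alpha> R where "\<And>l::real. (LINT x|haarG. fs s x * phi l x) = poly R (of_real l) * of_real (exp (- \<alpha> * l\<^sup>2))"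
    using gaussian_form_phi[OF _ fs_measurable] by blast
  then have R: "complex_of_real (hhat s l) = poly R (of_real l) * of_real (exp (- \<alpha> * l\<^sup>2))" for l
    using fs_phi[of s l] s by simp
  let ?z = "\<lambda>n::nat. complex_of_real ((of_int (2 * int n + 1) * (pi / 2)) / s)"
  have "poly R (?z n) = 0" for n
  proof -
    have "cos (of_int (2 * int n + 1) * (pi / 2)) = 0" unfolding cos_zero_iff_int by (intro exI[of _ "2 * int n + 1"]) simp
    then have "hhat s ((of_int (2 * int n + 1) * (pi / 2)) / s) = 0" using s by (simp add: hhat_def)
    then show ?thesis using R[of "(of_int (2 * int n + 1) * (pi / 2)) / s"] by (simp del: of_real_divide of_real_mult of_real_of_int_eq)
  qed
  then have "range ?z \<subseteq> {x. poly R x = 0}" by blast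
  moreover have "infinite (range ?z)"
    using s by (intro range_inj_infinite injI) (simp del: of_real_divide of_real_mult of_real_of_int_eq add: of_real_eq_iff)
  ultimately have "R = 0" using poly_roots_finite finite_subset by blast
  \<comment> \<open>At 0 the Gaussian and the cosine are both 1, so the transform cannot vanish
    there.\<close>
  then have "hhat s 0 = 0" using R[of 0] by simp
  then show False by (simp add: hhat_def)
qed

subsection \<open>Linear independence\<close>

lemma cos_pow3_independent:
  fixes a :: "nat \<Rightarrow> complex" and s0 :: real
  assumes s0: "s0 > 0" and sum: "\<And>l::real. (\<Sum>i<n. a i * of_real (cos (s0 / 3 ^ i * l))) = 0"
  shows "\<forall>i<n. a i = 0"
  using sum
proof (induction n)
  case (Suc n)
  \<comment> \<open>The argument of the i-th cosine is then 3^{n-i} pi/6. For i < n this is an odd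
    multiple of pi/2, while the last cosine is cos(pi/6), which is nonzero.\<close>
  define l where "l = pi / 6 * 3 ^ n / s0"
  have z: "cos (s0 / 3 ^ i * l) = 0" if "i < n" for i
  proof -
    obtain m where n: "n = i + Suc m" using \<open>i < n\<close> less_iff_Suc_add by auto
    have "s0 / 3 ^ i * l = of_int (3 ^ m) * (pi / 2)" using s0 by (simp add: l_def n power_add field_simps)
    then show ?thesis unfolding cos_zero_iff_int by (intro exI[of _ "3 ^ m"]) simp
  qed
  have e: "s0 / 3 ^ n * l = pi / 6" using s0 by (simp add: l_def)
  have "(\<Sum>i<n. a i * of_real (cos (s0 / 3 ^ i * l))) = 0"
    by (intro sum.neutral ballI) (simp only: z lessThan_iff of_real_0 mult_zero_right)
  then have "a n * complex_of_real (cos (pi / 6)) = 0"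
    using Suc.prems[of l] unfolding sum.lessThan_Suc e by (simp only: add_0)
  then have an: "a n = 0" by (simp add: cos_30)
  have "(\<Sum>i<n. a i * of_real (cos (s0 / 3 ^ i * l))) = 0" for l
    using Suc.prems[of l] unfolding sum.lessThan_Suc an by (simp only: mult_zero_left add_0_right)
  then have "\<forall>i<n. a i = 0" by (rule Suc.IH)
  with an show ?case by (simp add: less_Suc_eq)
qed simp

text \<open>Pairing with \<open>phi l\<close> turns a relation between the functions into one
  between their transforms; the common Gaussian factor cancels, and only the cosines remain.\<close>

lemma lin_indep_fs:
  assumes s0: "0 < s0" "s0 \<le> 1" shows "lin_indep_seq S0 (\<lambda>n. fs (s0 / 3 ^ n))"
  unfolding lin_indep_seq_def S0_sel
proof (intro allI impI)
  fix n and a :: "nat \<Rightarrow> complex"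
  assume ae: "AE x in haarG. (\<Sum>i<n. a i * fs (s0 / 3 ^ i) x) = 0"
  fix i assume "i < n"
  have s: "0 \<le> s0 / 3 ^ i" "s0 / 3 ^ i \<le> 1" for i
    using s0 order_trans[OF s0(2), of "3 ^ i"] by (auto simp: divide_le_eq)
  have "(\<Sum>i<n. a i * of_real (cos (s0 / 3 ^ i * l))) = 0" for l :: real
  proof -
    have int: "integrable haarG (\<lambda>x. fs (s0 / 3 ^ i) x * phi l x)" for i
      by (intro integrable_mult_phi fs_integrable s)
    have 1: "(LINT x|haarG. (\<Sum>i<n. a i * (fs (s0 / 3 ^ i) x * phi l x))) = (LINT x|haarG. 0)"
    proof (rule integral_cong_AE)
      show "AE x in haarG. (\<Sum>i<n. a i * (fs (s0 / 3 ^ i) x * phi l x)) = 0"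
        using ae
      proof eventually_elim
        case (elim x)
        have "(\<Sum>i<n. a i * (fs (s0 / 3 ^ i) x * phi l x)) = (\<Sum>i<n. a i * fs (s0 / 3 ^ i) x) * phi l x"
          by (simp add: sum_distrib_right mult.assoc)
        then show ?case using elim by simp
      qed
    qed measurable
    have 2: "(LINT x|haarG. (\<Sum>i<n. a i * (fs (s0 / 3 ^ i) x * phi l x))) = (\<Sum>i<n. a i * of_real (hhat (s0 / 3 ^ i) l))"
      using int by (subst Bochner_Integration.integral_sum) (auto simp: fs_phi[OF s])
    have "(\<Sum>i<n. a i * of_real (hhat (s0 / 3 ^ i) l)) = of_real (2 * pi ^ 3 * sqrt (2 * pi) * exp (- l\<^sup>2 / 2)) * (\<Sum>i<n. a i * of_real (cos (s0 / 3 ^ i * l)))"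
      unfolding hhat_def sum_distrib_left by (intro sum.cong) (simp_all add: mult_ac)
    then show ?thesis using 1 unfolding 2 by simp
  qed
  then have "\<forall>i<n. a i = 0" by (rule cos_pow3_independent[OF s0(1)])
  then show "a i = 0" using \<open>i < n\<close> by blast
qed

theorem mainTheorem3:
  shows "\<exists>S :: (nat \<Rightarrow> real) symmetric_data. rank_one_symmetric_space S \<and>
    (\<forall>c \<epsilon> :: real. (c < 1 \<and> \<epsilon> \<le> 0) \<or> (c \<le> 1 \<and> \<epsilon> < 0) \<longrightarrow>
      (\<exists>(d :: nat) (f :: nat \<Rightarrow> (nat \<Rightarrow> real) \<Rightarrow> complex).
         lin_indep_seq S f \<and>
         (\<forall>n. f n \<in> L1_X S \<inter> L2_X S \<and> beurling_integral S c \<epsilon> d (f n) < \<infinity> \<and>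
              \<not> gaussian_form S (f n))))"
proof (rule exI[of _ S0], intro conjI allI impI rank_one_S0)
  fix c \<epsilon> :: real
  assume ce: "(c < 1 \<and> \<epsilon> \<le> 0) \<or> (c \<le> 1 \<and> \<epsilon> < 0)"
  \<comment> \<open>The bound -\<epsilon>/2 is the one of the critical case, and 1 is the limit for
    nonnegativity of f_s. The parameters s0/3^n of the sequence stay below both.\<close>
  define s0 where "s0 = (if c < 1 \<and> \<epsilon> \<le> 0 then 1 else min 1 (- \<epsilon> / 2))"
  have s0: "0 < s0" "s0 \<le> 1" using ce by (auto simp: s0_def)
  have le: "s0 / 3 ^ n \<le> s0" and pos: "0 < s0 / 3 ^ n" for n
    using s0 by (simp_all add: divide_le_eq mult_le_cancel_left1)
  have cond: "(c < 1 \<and> \<epsilon> \<le> 0) \<or> (c \<le> 1 \<and> \<epsilon> < 0 \<and> s0 / 3 ^ n \<le> - \<epsilon> / 2)" for n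
    using ce le[of n] by (auto simp: s0_def split: if_splits)
  show "\<exists>(d :: nat) (f :: nat \<Rightarrow> (nat \<Rightarrow> real) \<Rightarrow> complex). lin_indep_seq S0 f \<and>
      (\<forall>n. f n \<in> L1_X S0 \<inter> L2_X S0 \<and> beurling_integral S0 c \<epsilon> d (f n) < \<infinity> \<and> \<not> gaussian_form S0 (f n))"
  proof (intro exI[of _ "0 :: nat"] exI[of _ "\<lambda>n. fs (s0 / 3 ^ n)"] conjI allI)
    show "lin_indep_seq S0 (\<lambda>n. fs (s0 / 3 ^ n))" by (rule lin_indep_fs[OF s0])
    fix n
    have s: "0 \<le> s0 / 3 ^ n" "s0 / 3 ^ n \<le> 1" using le[of n] pos[of n] s0 by linarith+
    show "fs (s0 / 3 ^ n) \<in> L1_X S0 \<inter> L2_X S0" by (rule fs_L1_L2[OF s])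
    show "beurling_integral S0 c \<epsilon> 0 (fs (s0 / 3 ^ n)) < \<infinity>" by (rule beurling_integral_fs_finite[OF s cond])
    show "\<not> gaussian_form S0 (fs (s0 / 3 ^ n))" by (rule not_gaussian_form_fs[OF pos s(2)])
  qed
qed

end
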